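(* Let $d\geq 3$ and $$G_d=\sum_{i=0}^{d-1}v_iu_0^iu_1^{d-1-i},$$ a form of degree $d$ in the $d+2$ variables $v_0,\dots,v_{d-1},u_0,u_1$. Then the projective variety $\underline{\mathrm{VSP}}(G_d,d+2)$ is isomorphic to the projective space $\mathbb P^{d+2}\cong\mathbb P(S^{d+2}\mathbb C^2)\cong S^{d+2}\mathbb P^1$, where $S^{d+2}\mathbb P^1$ is the $(d+2)$-fold symmetric product of $\mathbb P^1$.
   Context: Work over $\mathbb C$. Let $n=d+1$ and let $T=\mathbb C[x_0,\dots,x_{d-1},y_0,y_1]$ act by differentiation on $\mathbb C[v_0,\dots,v_{d-1},u_0,u_1]$, with $x_i=\partial/\partial v_i$, $y_j=\partial/\partial u_j$; $\mathrm{Ann}(F)=\{h\in T:h\circ F=0\}$. For $r\in\mathbb N$ let $h_r(e)=\min\{r,\dim T_e\}$ for $e\ge 0$ (the generic Hilbert function of $r$ points in $\mathbb P^n$). The multigraded Hilbert scheme (Haiman–Sturmfels) $\mathrm{Hilb}_T^{h_r}$ parametrizes homogeneous ideals $\mathcal J\subset T$ with $\dim(T/\mathcal J)_e=h_r(e)$ for all $e$. $\mathrm{Slip}_{r,\mathbb P^n}$ is its irreducible component containing the radical ideals of $r$ distinct points in $\mathbb P^n$ having Hilbert function $h_r$ (the closure of the set of such ideals). The border variety of sums of powers of $F$ is $\underline{\mathrm{VSP}}(F,r)=\{\mathcal J\in\mathrm{Slip}_{r,\mathbb P^n}:\mathcal J\subset\mathrm{Ann}(F)\}$, regarded as a projective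 variety (closed subset with reduced structure). *)

theory Defs
  imports
    "HOL-Library.Poly_Mapping"
    "HOL-Library.Multiset"
    "HOL-Algebra.Ideal"
    "HOL-Analysis.Abstract_Topology"
begin

section \<open>Polynomial rings\<close>

text \<open>
  A polynomial over the complex numbers is a finitely supported function from monomials
  (exponent vectors) to coefficients. The variables are numbered, and the polynomial ring in the
  \<open>n + 1\<close> variables \<open>0, \<dots>, n\<close> is the subring \<open>polys n\<close>.
\<close>

type_synonym monom = "nat \<Rightarrow>\<^sub>0 nat"
type_synonym cpoly = "monom \<Rightarrow>\<^sub>0 complex"

abbreviation lookup :: "('i \<Rightarrow>\<^sub>0 'b::zero) \<Rightarrow> 'i \<Rightarrow> 'b"
  where "lookup \<equiv> Poly_Mapping.lookup"

abbreviation keys :: "('i \<Rightarrow>\<^sub>0 'b::zero) \<Rightarrow> 'i set"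
  where "keys \<equiv> Poly_Mapping.keys"

abbreviation single :: "'i \<Rightarrow> 'b \<Rightarrow> 'i \<Rightarrow>\<^sub>0 'b::zero"
  where "single \<equiv> Poly_Mapping.single"

definition cscale :: "complex \<Rightarrow> ('i \<Rightarrow>\<^sub>0 complex) \<Rightarrow> 'i \<Rightarrow>\<^sub>0 complex"
  where "cscale c f = Poly_Mapping.map ((*) c) f"

lemma lookup_cscale [simp]: "lookup (cscale c f) i = c * lookup f i"
  by (simp add: cscale_def Poly_Mapping.map.rep_eq when_def)

global_interpretation cvec: vector_space "cscale :: complex \<Rightarrow> ('i \<Rightarrow>\<^sub>0 complex) \<Rightarrow> _"
  by unfold_locales
     (auto intro!: poly_mapping_eqI simp: lookup_add algebra_simps)

definition Var :: "nat \<Rightarrow> cpoly"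
  where "Var i = single (single i 1) 1"

definition mdeg :: "monom \<Rightarrow> nat"
  where "mdeg m = (\<Sum>i\<in>keys m. lookup m i)"

definition monoms :: "nat \<Rightarrow> nat \<Rightarrow> monom set"
  where "monoms n e = {m. keys m \<subseteq> {..n} \<and> mdeg m = e}"

definition forms :: "nat \<Rightarrow> nat \<Rightarrow> cpoly set"
  where "forms n e = {f. keys f \<subseteq> monoms n e}"

definition polys :: "nat \<Rightarrow> cpoly set"
  where "polys n = {f. \<forall>m\<in>keys f. keys m \<subseteq> {..n}}"

definition poly_ring :: "nat \<Rightarrow> cpoly ring"
  where "poly_ring n = \<lparr>carrier = polys n, monoid.mult = (*), one = 1, zero = 0, add = (+)\<rparr>"

definition hcomp :: "nat \<Rightarrow> cpoly \<Rightarrow> cpoly"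
  where "hcomp e f = (\<Sum>m | m \<in> keys f \<and> mdeg m = e. single m (lookup f m))"

definition peval :: "cpoly \<Rightarrow> (nat \<Rightarrow>\<^sub>0 complex) \<Rightarrow> complex"
  where "peval f v = (\<Sum>m\<in>keys f. lookup f m * (\<Prod>i\<in>keys m. lookup v i ^ lookup m i))"

lemma polys_0: "0 \<in> polys n" and polys_1: "1 \<in> polys n"
  by (auto simp: polys_def)

lemma polys_add: "f \<in> polys n \<Longrightarrow> g \<in> polys n \<Longrightarrow> f + g \<in> polys n"
  using Poly_Mapping.keys_add[of f g] by (fastforce simp: polys_def)

lemma polys_uminus: "f \<in> polys n \<Longrightarrow> - f \<in> polys n"
  by (auto simp: polys_def in_keys_iff)

lemma polys_mult:
  assumes "f \<in> polys n" "g \<in> polys n"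
  shows "f * g \<in> polys n"
  unfolding polys_def
proof safe
  fix m i assume "m \<in> keys (f * g)" and i: "i \<in> keys m"
  then obtain a b where "a \<in> keys f" "b \<in> keys g" "m = a + b"
    using Poly_Mapping.keys_mult[of f g] by blast
  with i assms show "i \<le> n"
    using Poly_Mapping.keys_add[of a b] unfolding polys_def by blast
qed

lemma cring_poly_ring: "cring (poly_ring n)"
proof (rule cringI)
  show "abelian_group (poly_ring n)"
  proof (rule abelian_groupI)
    fix x assume "x \<in> carrier (poly_ring n)"
    then show "\<exists>y\<in>carrier (poly_ring n). y \<oplus>\<^bsub>poly_ring n\<^esub> x = \<zero>\<^bsub>poly_ring n\<^esub>"
      by (intro bexI[of _ "- x"]) (auto simp: poly_ring_def polys_uminus)
  qed (auto simp: poly_ring_def polys_0 polys_add algebra_simps)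
  show "comm_monoid (poly_ring n)"
    by (rule comm_monoidI) (auto simp: poly_ring_def polys_1 polys_mult algebra_simps)
qed (auto simp: poly_ring_def algebra_simps)

section \<open>Action by differentiation and annihilators\<close>

definition pd :: "nat \<Rightarrow> cpoly \<Rightarrow> cpoly"
  where "pd i F = (\<Sum>m\<in>keys F. single (m - single i 1) (of_nat (lookup m i) * lookup F m))"

text \<open>The operators \<open>pd i\<close> commute; the sorted list only fixes an order of composition.\<close>

definition pd_monom :: "monom \<Rightarrow> cpoly \<Rightarrow> cpoly"
  where "pd_monom a F = fold (\<lambda>i. pd i ^^ lookup a i) (sorted_list_of_set (keys a)) F"

definition diff_act :: "cpoly \<Rightarrow> cpoly \<Rightarrow> cpoly"
  where "diff_act h F = (\<Sum>a\<in>keys h. cscale (lookup h a) (pd_monom a F))"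

definition Ann :: "nat \<Rightarrow> cpoly \<Rightarrow> cpoly set"
  where "Ann n F = {h \<in> polys n. diff_act h F = 0}"

section \<open>Varieties as spaces with functions\<close>

text \<open>
  A (classical, reduced) variety over the complex numbers is determined by its Zariski topology
  and the complex-valued functions that are regular on each open set \<open>U\<close>. In \<open>regular X U\<close>
  only the values of a function on \<open>U\<close> matter.
\<close>

record 'a space_fun =
  zariski :: "'a topology"
  regular :: "'a set \<Rightarrow> ('a \<Rightarrow> complex) set"

definition iso_space_fun :: "'a space_fun \<Rightarrow> 'b space_fun \<Rightarrow> bool"
  where "iso_space_fun X Y \<longleftrightarrow>
    (\<exists>\<phi>. homeomorphic_map (zariski X) (zariski Y) \<phi> \<and>
      (\<forall>U f. openin (zariski Y) U \<longrightarrow>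
        (f \<in> regular Y U \<longleftrightarrow> f \<circ> \<phi> \<in> regular X {x \<in> topspace (zariski X). \<phi> x \<in> U})))"

inductive_set poly_funs :: "('a \<Rightarrow> complex) set \<Rightarrow> ('a \<Rightarrow> complex) set"
  for A :: "('a \<Rightarrow> complex) set"
  where
    const: "(\<lambda>_. c) \<in> poly_funs A"
  | coord: "a \<in> A \<Longrightarrow> a \<in> poly_funs A"
  | add: "p \<in> poly_funs A \<Longrightarrow> q \<in> poly_funs A \<Longrightarrow> (\<lambda>x. p x + q x) \<in> poly_funs A"
  | mult: "p \<in> poly_funs A \<Longrightarrow> q \<in> poly_funs A \<Longrightarrow> (\<lambda>x. p x * q x) \<in> poly_funs A"

text \<open>
  An atlas is a set of charts \<open>(D, A)\<close>: a domain \<open>D\<close> together with the affine coordinate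
  functions \<open>A\<close> on it (values outside \<open>D\<close> are irrelevant). The Zariski topology is generated by
  the loci in \<open>D\<close> where a polynomial in the coordinates does not vanish, and the regular functions
  are those that are locally quotients of polynomials in the coordinates of some chart.
\<close>

type_synonym 'a atlas = "('a set \<times> ('a \<Rightarrow> complex) set) set"

definition zariski_of :: "'a atlas \<Rightarrow> 'a topology"
  where "zariski_of At =
    topology_generated_by {{x \<in> D. q x \<noteq> 0} | D A q. (D, A) \<in> At \<and> q \<in> poly_funs A}"

definition variety_of :: "'a atlas \<Rightarrow> 'a space_fun"
  where "variety_of At =
    \<lparr>zariski = zariski_of At,
     regular = (\<lambda>U. {f. \<forall>x\<in>U. \<exists>W D A p q.
        openin (zariski_of At) W \<and> x \<in> W \<and> (D, A) \<in> At \<and> W \<subseteq> U \<inter> D \<and>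
        p \<in> poly_funs A \<and> q \<in> poly_funs A \<and>
        (\<forall>y\<in>W. q y \<noteq> 0 \<and> f y = p y / q y)})\<rparr>"

text \<open>The reduced structure induced on a closed subset.\<close>

definition restrict_atlas :: "'a atlas \<Rightarrow> 'a set \<Rightarrow> 'a atlas"
  where "restrict_atlas At S = {(D \<inter> S, A) | D A. (D, A) \<in> At}"

text \<open>The \<open>m\<close>-fold product; its points are the lists of length \<open>m\<close>.\<close>

definition power_atlas :: "nat \<Rightarrow> 'a atlas \<Rightarrow> 'a list atlas"
  where "power_atlas m At =
    {({xs. length xs = m \<and> (\<forall>i<m. xs ! i \<in> fst (cs ! i))},
      {\<lambda>xs. a (xs ! i) | a i. i < m \<and> a \<in> snd (cs ! i)}) | cs. length cs = m \<and> set cs \<subseteq> At}"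

definition quotient_space :: "('a \<Rightarrow> 'b) \<Rightarrow> 'a space_fun \<Rightarrow> 'b space_fun"
  where "quotient_space \<pi> X =
    \<lparr>zariski = topology (\<lambda>U. U \<subseteq> \<pi> ` topspace (zariski X) \<and>
        openin (zariski X) {x \<in> topspace (zariski X). \<pi> x \<in> U}),
     regular = (\<lambda>U. {f. f \<circ> \<pi> \<in> regular X {x \<in> topspace (zariski X). \<pi> x \<in> U}})\<rparr>"

lemma openin_quotient_space:
  "openin (zariski (quotient_space \<pi> X)) U \<longleftrightarrow>
    U \<subseteq> \<pi> ` topspace (zariski X) \<and> openin (zariski X) {x \<in> topspace (zariski X). \<pi> x \<in> U}"
proof -
  let ?X = "topspace (zariski X)"
  let ?L = "\<lambda>U. U \<subseteq> \<pi> ` ?X \<and> openin (zariski X) {x \<in> ?X. \<pi> x \<in> U}"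
  have "istopology ?L"
    unfolding istopology_def
  proof (intro conjI allI impI)
    fix S T assume S: "?L S" and T: "?L T"
    have "{x \<in> ?X. \<pi> x \<in> S \<inter> T} = {x \<in> ?X. \<pi> x \<in> S} \<inter> {x \<in> ?X. \<pi> x \<in> T}" by blast
    with S T show "openin (zariski X) {x \<in> ?X. \<pi> x \<in> S \<inter> T}" by (simp only: openin_Int)
    from S show "S \<inter> T \<subseteq> \<pi> ` ?X" by blast
  next
    fix \<K> assume K: "\<forall>K\<in>\<K>. ?L K"
    have "{x \<in> ?X. \<pi> x \<in> \<Union>\<K>} = (\<Union>K\<in>\<K>. {x \<in> ?X. \<pi> x \<in> K})" by blast
    with K show "openin (zariski X) {x \<in> ?X. \<pi> x \<in> \<Union>\<K>}" by (simp only:) blast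
    from K show "\<Union>\<K> \<subseteq> \<pi> ` ?X" by blast
  qed
  then show ?thesis
    by (simp add: quotient_space_def)
qed

text \<open>The symmetric product: the unordered list underlying \<open>xs\<close> is \<open>mset xs\<close>.\<close>

definition sym_product :: "nat \<Rightarrow> 'a atlas \<Rightarrow> 'a multiset space_fun"
  where "sym_product m At = quotient_space mset (variety_of (power_atlas m At))"

section \<open>Projective spaces\<close>

definition cline :: "('i \<Rightarrow>\<^sub>0 complex) \<Rightarrow> ('i \<Rightarrow>\<^sub>0 complex) set"
  where "cline v = {cscale c v | c. c \<noteq> 0}"

definition proj_points :: "('i \<Rightarrow>\<^sub>0 complex) set \<Rightarrow> ('i \<Rightarrow>\<^sub>0 complex) set set"
  where "proj_points V = {cline v | v. v \<in> V \<and> v \<noteq> 0}"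

definition hratio :: "'i \<Rightarrow> 'i \<Rightarrow> ('i \<Rightarrow>\<^sub>0 complex) set \<Rightarrow> complex"
  where "hratio j i L = (THE c. \<exists>v\<in>L. c = lookup v j / lookup v i)"

text \<open>The projective space of lines in a linear subspace \<open>V\<close>, with its standard charts.\<close>

definition proj_atlas :: "('i \<Rightarrow>\<^sub>0 complex) set \<Rightarrow> ('i \<Rightarrow>\<^sub>0 complex) set atlas"
  where "proj_atlas V =
    {({L \<in> proj_points V. \<forall>v\<in>L. lookup v i \<noteq> 0}, {hratio j i | j. True}) | i. True}"

text \<open>\<open>coord_space n\<close> is the vector space of \<open>(n + 1)\<close>-tuples.\<close>

definition coord_space :: "nat \<Rightarrow> (nat \<Rightarrow>\<^sub>0 complex) set"
  where "coord_space n = {v. keys v \<subseteq> {..n}}"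

definition PP :: "nat \<Rightarrow> (nat \<Rightarrow>\<^sub>0 complex) set space_fun"
  where "PP n = variety_of (proj_atlas (coord_space n))"

text \<open>The symmetric power \<open>S\<^sup>m \<complex>\<^sup>2\<close> is the space of binary forms of degree \<open>m\<close>.\<close>

definition PP_binary_forms :: "nat \<Rightarrow> cpoly set space_fun"
  where "PP_binary_forms m = variety_of (proj_atlas (forms 1 m))"

definition sym_P1 :: "nat \<Rightarrow> (nat \<Rightarrow>\<^sub>0 complex) set multiset space_fun"
  where "sym_P1 m = sym_product m (proj_atlas (coord_space 1))"

section \<open>The multigraded Hilbert scheme, Slip and border VSP\<close>

definition homogeneous_ideal :: "nat \<Rightarrow> cpoly set \<Rightarrow> bool"
  where "homogeneous_ideal n J \<longleftrightarrow> ideal J (poly_ring n) \<and> (\<forall>f\<in>J. \<forall>e. hcomp e f \<in> J)"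

text \<open>\<open>dim (T/J)\<^sub>e\<close>, for a homogeneous ideal \<open>J\<close>.\<close>

definition hilbert_fun :: "nat \<Rightarrow> cpoly set \<Rightarrow> nat \<Rightarrow> nat"
  where "hilbert_fun n J e = cvec.dim (forms n e) - cvec.dim (J \<inter> forms n e)"

definition h_gen :: "nat \<Rightarrow> nat \<Rightarrow> nat \<Rightarrow> nat"
  where "h_gen n r e = min r (cvec.dim (forms n e))"

definition Hilb :: "nat \<Rightarrow> (nat \<Rightarrow> nat) \<Rightarrow> cpoly set set"
  where "Hilb n h = {J. homogeneous_ideal n J \<and> (\<forall>e. hilbert_fun n J e = h e)}"

text \<open>
  Closed points of the Hilbert scheme are viewed in the product of the Grassmannians of the
  \<open>T\<^sub>e\<close>, on which we use the standard affine charts. A set \<open>B\<close> of monomials of degree \<open>e\<close> is a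
  basis of \<open>T\<^sub>e/J\<^sub>e\<close> iff every form of degree \<open>e\<close> has a unique normal form, supported on
  \<open>B\<close>, modulo \<open>J\<close>; the local coordinates are the coefficients of the normal forms of the
  monomials of degree \<open>e\<close>.

  A chart prescribes such bases in a finite set \<open>E\<close> of degrees. All finite \<open>E\<close> are allowed:
  by Haiman and Sturmfels, finitely many degrees suffice to embed the Hilbert scheme as a closed
  subscheme of a product of Grassmannians, and the coordinates in the remaining degrees are regular
  there, so this gives the reduced structure of the Hilbert scheme without choosing degrees.
\<close>

definition quot_basis :: "nat \<Rightarrow> cpoly set \<Rightarrow> nat \<Rightarrow> monom set \<Rightarrow> bool"
  where "quot_basis n J e B \<longleftrightarrow>
    B \<subseteq> monoms n e \<and> (\<forall>f\<in>forms n e. \<exists>!p. keys p \<subseteq> B \<and> f - p \<in> J)"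

definition nf_coeff :: "monom set \<Rightarrow> monom \<Rightarrow> monom \<Rightarrow> cpoly set \<Rightarrow> complex"
  where "nf_coeff B m b J = lookup (THE p. keys p \<subseteq> B \<and> single m 1 - p \<in> J) b"

definition Hilb_atlas :: "nat \<Rightarrow> (nat \<Rightarrow> nat) \<Rightarrow> cpoly set atlas"
  where "Hilb_atlas n h =
    {({J \<in> Hilb n h. \<forall>e\<in>E. quot_basis n J e (B e)},
      {nf_coeff (B e) m b | e m b. e \<in> E \<and> m \<in> monoms n e \<and> b \<in> B e}) | E B. finite E}"

definition vanishing_ideal :: "nat \<Rightarrow> (nat \<Rightarrow>\<^sub>0 complex) set set \<Rightarrow> cpoly set"
  where "vanishing_ideal n Z = {f \<in> polys n. \<forall>L\<in>Z. \<forall>v\<in>L. peval f v = 0}"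

definition Slip :: "nat \<Rightarrow> nat \<Rightarrow> cpoly set set"
  where "Slip n r = zariski_of (Hilb_atlas n (h_gen n r)) closure_of
    {J \<in> Hilb n (h_gen n r).
      \<exists>Z. Z \<subseteq> proj_points (coord_space n) \<and> finite Z \<and> card Z = r \<and> J = vanishing_ideal n Z}"

definition border_VSP :: "nat \<Rightarrow> cpoly \<Rightarrow> nat \<Rightarrow> cpoly set space_fun"
  where "border_VSP n F r =
    variety_of (restrict_atlas (Hilb_atlas n (h_gen n r)) {J \<in> Slip n r. J \<subseteq> Ann n F})"

text \<open>The variables \<open>v\<^sub>0, \<dots>, v\<^sub>d\<^sub>-\<^sub>1, u\<^sub>0, u\<^sub>1\<close> are numbered \<open>0, \<dots>, d - 1, d, d + 1\<close>.\<close>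

definition form_G :: "nat \<Rightarrow> cpoly"
  where "form_G d = (\<Sum>i<d. Var i * Var d ^ i * Var (d + 1) ^ (d - 1 - i))"

end

theory Submission
  imports Defs "HOL-Computational_Algebra.Computational_Algebra" "Jordan_Normal_Form.Determinant"
begin

text \<open>
  If a homogeneous ideal \<open>J\<close> is contained in \<open>Ann(G)\<close> and \<open>T/J\<close> has Hilbert function
  \<open>min (d + 2) (dim T\<^sub>e)\<close>, then \<open>J\<close> agrees in degree \<open>2\<close> with \<open>Ann(G)\<close>, for dimension reasons. The quadrics of
  \<open>Ann(G)\<close> generate an ideal \<open>I\<close> such that \<open>J\<close> is \<open>I + (q)\<close> for a binary form \<open>q\<close> of degree
  \<open>d + 2\<close> in \<open>y\<^sub>0, y\<^sub>1\<close>, unique up to scaling, and all these \<open>I + (q)\<close> have this Hilbert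
  function. Each of them is a limit of ideals of \<open>d + 2\<close> points: if \<open>q\<close> has simple roots, the points
  lie over the roots and tend to the line \<open>x = 0\<close>, and the other \<open>q\<close> are limits of such forms.
  In the standard charts the ratios of coefficients of \<open>q\<close> and the coefficients of normal forms
  modulo \<open>I + (q)\<close> are rational functions of each other. A form is determined up to
  scaling by its roots, and regular functions descend to the symmetric product because symmetric
  polynomials are polynomials in the elementary symmetric ones.
\<close>

section \<open>Germs of rational functions and morphisms\<close>

text \<open>Modulo the quadrics, degree e >= 1 has the e + 1 binary monomials and max(0, d + 1 - e)
  classes of monomials X_i y_0^a y_1^b. For 1 <= e <= d + 1 this is exactly d + 2, so nothing can be
  added there; in degree d + 2 it is one too many, which forces one binary form of that degree, and
  its d + 3 coefficients up to scaling give P^(d+2). The hypothesis d >= 3 keeps binary quadrics out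
  of Ann(G), so that degree 2 already has dimension d + 2. To keep this computable, I + (q) is
  defined by linear membership conditions; the generators serve to show that I + (q) lies inside a
  given ideal, after which Hilbert functions decide equality. The delicate point is membership in
  Slip, a Zariski closure with respect to infinitely many charts. It is reached by Euclidean
  sequences: normal form coefficients converge along them, hence so does every polynomial in such
  coefficients, and a Zariski neighbourhood of the limit contains almost all terms.\<close>

lemma poly_funs_sum:
  "(\<And>i. i \<in> I \<Longrightarrow> f i \<in> poly_funs A) \<Longrightarrow> (\<lambda>x. \<Sum>i\<in>I. f i x) \<in> poly_funs A"
  by (induction I rule: infinite_finite_induct) (auto intro: poly_funs.intros)

lemma poly_funs_prod:
  "(\<And>i. i \<in> I \<Longrightarrow> f i \<in> poly_funs A) \<Longrightarrow> (\<lambda>x. \<Prod>i\<in>I. f i x) \<in> poly_funs A"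
  by (induction I rule: infinite_finite_induct) (auto intro: poly_funs.intros)

lemma poly_funs_power: "f \<in> poly_funs A \<Longrightarrow> (\<lambda>x. f x ^ k) \<in> poly_funs A"
  by (induction k) (auto intro: poly_funs.intros)

lemma poly_funs_cmult: "f \<in> poly_funs A \<Longrightarrow> (\<lambda>x. c * f x) \<in> poly_funs A"
  using poly_funs.mult[OF poly_funs.const[of c]] .

lemma poly_funs_uminus: "f \<in> poly_funs A \<Longrightarrow> (\<lambda>x. - f x) \<in> poly_funs A"
  using poly_funs_cmult[of f A "-1"] by simp

lemma poly_funs_diff:
  "f \<in> poly_funs A \<Longrightarrow> g \<in> poly_funs A \<Longrightarrow> (\<lambda>x. f x - g x) \<in> poly_funs A"
  using poly_funs.add[OF _ poly_funs_uminus, of f A g] by simp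

lemma openin_zariski_basic:
  "(D, A) \<in> At \<Longrightarrow> q \<in> poly_funs A \<Longrightarrow> openin (zariski_of At) {x \<in> D. q x \<noteq> 0}"
  unfolding zariski_of_def by (rule topology_generated_by_Basis) blast

lemma openin_zariski_chart: "(D, A) \<in> At \<Longrightarrow> openin (zariski_of At) D"
  using openin_zariski_basic[of D A At "\<lambda>_. 1"] by (simp add: poly_funs.const)

lemma topspace_zariski_of: "topspace (zariski_of At) = (\<Union>(D, A)\<in>At. D)"
proof
  show "topspace (zariski_of At) \<subseteq> (\<Union>(D, A)\<in>At. D)"
    unfolding zariski_of_def topology_generated_by_topspace by blast
  show "(\<Union>(D, A)\<in>At. D) \<subseteq> topspace (zariski_of At)"
    using openin_subset[OF openin_zariski_chart] by (auto split: prod.splits)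
qed

lemma zariski_variety_of [simp]: "zariski (variety_of At) = zariski_of At"
  by (simp add: variety_of_def)

text \<open>\<open>regular\<close> lets the chart vary with the point; here it is fixed, so that
  sums and products of such germs need no change of chart.\<close>

definition rat :: "'a atlas \<Rightarrow> 'a set \<Rightarrow> ('a \<Rightarrow> complex) set \<Rightarrow> 'a \<Rightarrow> ('a \<Rightarrow> complex) \<Rightarrow> bool"
  where "rat At D A x f \<longleftrightarrow>
    (\<exists>W p q. openin (zariski_of At) W \<and> x \<in> W \<and> W \<subseteq> D \<and> p \<in> poly_funs A \<and> q \<in> poly_funs A \<and>
      (\<forall>y\<in>W. q y \<noteq> 0 \<and> f y = p y / q y))"

lemma ratI:
  assumes "openin (zariski_of At) W" "x \<in> W" "W \<subseteq> D" "p \<in> poly_funs A" "q \<in> poly_funs A"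
    "\<And>y. y \<in> W \<Longrightarrow> q y \<noteq> 0" "\<And>y. y \<in> W \<Longrightarrow> f y = p y / q y"
  shows "rat At D A x f"
  using assms unfolding rat_def by blast

lemma ratE:
  assumes "rat At D A x f"
  obtains W p q where "openin (zariski_of At) W" "x \<in> W" "W \<subseteq> D" "p \<in> poly_funs A"
    "q \<in> poly_funs A" "\<And>y. y \<in> W \<Longrightarrow> q y \<noteq> 0" "\<And>y. y \<in> W \<Longrightarrow> f y = p y / q y"
  using assms unfolding rat_def by blast

lemma rat_poly: "(D, A) \<in> At \<Longrightarrow> x \<in> D \<Longrightarrow> p \<in> poly_funs A \<Longrightarrow> rat At D A x p"
  by (rule ratI[of At D x D p A "\<lambda>_. 1"]) (auto intro: openin_zariski_chart poly_funs.const)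

lemma rat_cong:
  assumes "rat At D A x f" "openin (zariski_of At) V" "x \<in> V" "\<And>y. y \<in> V \<Longrightarrow> f y = g y"
  shows "rat At D A x g"
proof -
  obtain W p q where W: "openin (zariski_of At) W" "x \<in> W" "W \<subseteq> D" "p \<in> poly_funs A"
    "q \<in> poly_funs A" "\<And>y. y \<in> W \<Longrightarrow> q y \<noteq> 0" "\<And>y. y \<in> W \<Longrightarrow> f y = p y / q y"
    using ratE[OF assms(1)] by metis
  show ?thesis
    by (rule ratI[of At "W \<inter> V" x D p A q]) (use W assms(2,3) assms(4)[symmetric] in auto)
qed

lemma rat_add:
  assumes "rat At D A x f" "rat At D A x g"
  shows "rat At D A x (\<lambda>y. f y + g y)"
proof -
  obtain W p q where W: "openin (zariski_of At) W" "x \<in> W" "W \<subseteq> D" "p \<in> poly_funs A"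
    "q \<in> poly_funs A" "\<And>y. y \<in> W \<Longrightarrow> q y \<noteq> 0" "\<And>y. y \<in> W \<Longrightarrow> f y = p y / q y"
    using ratE[OF assms(1)] by metis
  obtain W' p' q' where W': "openin (zariski_of At) W'" "x \<in> W'" "W' \<subseteq> D" "p' \<in> poly_funs A"
    "q' \<in> poly_funs A" "\<And>y. y \<in> W' \<Longrightarrow> q' y \<noteq> 0" "\<And>y. y \<in> W' \<Longrightarrow> g y = p' y / q' y"
    using ratE[OF assms(2)] by metis
  show ?thesis
    by (rule ratI[of At "W \<inter> W'" x D "\<lambda>y. p y * q' y + p' y * q y" A "\<lambda>y. q y * q' y"])
      (use W W' in \<open>auto simp: field_simps intro: poly_funs.intros\<close>)
qed

lemma rat_mult:
  assumes "rat At D A x f" "rat At D A x g"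
  shows "rat At D A x (\<lambda>y. f y * g y)"
proof -
  obtain W p q where W: "openin (zariski_of At) W" "x \<in> W" "W \<subseteq> D" "p \<in> poly_funs A"
    "q \<in> poly_funs A" "\<And>y. y \<in> W \<Longrightarrow> q y \<noteq> 0" "\<And>y. y \<in> W \<Longrightarrow> f y = p y / q y"
    using ratE[OF assms(1)] by metis
  obtain W' p' q' where W': "openin (zariski_of At) W'" "x \<in> W'" "W' \<subseteq> D" "p' \<in> poly_funs A"
    "q' \<in> poly_funs A" "\<And>y. y \<in> W' \<Longrightarrow> q' y \<noteq> 0" "\<And>y. y \<in> W' \<Longrightarrow> g y = p' y / q' y"
    using ratE[OF assms(2)] by metis
  show ?thesis
    by (rule ratI[of At "W \<inter> W'" x D "\<lambda>y. p y * p' y" A "\<lambda>y. q y * q' y"])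
      (use W W' in \<open>auto intro: poly_funs.intros\<close>)
qed

lemma rat_nonzero:
  assumes "(D, A) \<in> At" "rat At D A x f" "f x \<noteq> 0"
  obtains W where "openin (zariski_of At) W" "x \<in> W" "W \<subseteq> D" "\<And>y. y \<in> W \<Longrightarrow> f y \<noteq> 0"
proof -
  obtain W p q where W: "openin (zariski_of At) W" "x \<in> W" "W \<subseteq> D" "p \<in> poly_funs A"
    "q \<in> poly_funs A" "\<And>y. y \<in> W \<Longrightarrow> q y \<noteq> 0" "\<And>y. y \<in> W \<Longrightarrow> f y = p y / q y"
    using ratE[OF assms(2)] by metis
  show thesis
    by (rule that[of "W \<inter> {x \<in> D. p x \<noteq> 0}"])
      (use W assms openin_zariski_basic[OF assms(1) W(4)] in auto)
qed

lemma rat_inverse: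
  assumes "(D, A) \<in> At" "rat At D A x f" "f x \<noteq> 0"
  shows "rat At D A x (\<lambda>y. inverse (f y))"
proof -
  obtain W p q where W: "openin (zariski_of At) W" "x \<in> W" "W \<subseteq> D" "p \<in> poly_funs A"
    "q \<in> poly_funs A" "\<And>y. y \<in> W \<Longrightarrow> q y \<noteq> 0" "\<And>y. y \<in> W \<Longrightarrow> f y = p y / q y"
    using ratE[OF assms(2)] by metis
  show ?thesis
    by (rule ratI[of At "W \<inter> {x \<in> D. p x \<noteq> 0}" x D q A p])
      (use W assms openin_zariski_basic[OF assms(1) W(4)] in auto)
qed

lemma rat_divide:
  assumes "(D, A) \<in> At" "rat At D A x f" "rat At D A x g" "g x \<noteq> 0"
  shows "rat At D A x (\<lambda>y. f y / g y)"
  using rat_mult[OF assms(2) rat_inverse[OF assms(1,3,4)]] by (simp add: divide_inverse)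

lemma rat_poly_funs:
  assumes "(D, A) \<in> At" "x \<in> D" "p \<in> poly_funs B" "\<And>b. b \<in> B \<Longrightarrow> rat At D A x (\<lambda>y. b (\<phi> y))"
  shows "rat At D A x (\<lambda>y. p (\<phi> y))"
  using assms(3)
  by (induction p rule: poly_funs.induct)
    (auto intro: rat_poly[OF assms(1,2) poly_funs.const] assms(4) rat_add rat_mult)

lemma regular_variety_of_iff:
  assumes "openin (zariski_of At) U"
  shows "f \<in> regular (variety_of At) U \<longleftrightarrow> (\<forall>x\<in>U. \<exists>D A. (D, A) \<in> At \<and> rat At D A x f)"
proof
  assume "f \<in> regular (variety_of At) U"
  then have f: "\<exists>W D A p q. openin (zariski_of At) W \<and> x \<in> W \<and> (D, A) \<in> At \<and> W \<subseteq> U \<inter> D \<and>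
      p \<in> poly_funs A \<and> q \<in> poly_funs A \<and> (\<forall>y\<in>W. q y \<noteq> 0 \<and> f y = p y / q y)" if "x \<in> U" for x
    using that unfolding variety_of_def by simp
  show "\<forall>x\<in>U. \<exists>D A. (D, A) \<in> At \<and> rat At D A x f"
  proof
    fix x assume "x \<in> U"
    from f[OF this] obtain W D A p q where W: "openin (zariski_of At) W" "x \<in> W" "(D, A) \<in> At"
      "W \<subseteq> U \<inter> D" "p \<in> poly_funs A" "q \<in> poly_funs A" "\<forall>y\<in>W. q y \<noteq> 0 \<and> f y = p y / q y"
      by (elim exE conjE) rule
    have "rat At D A x f" by (rule ratI[of At W x D p A q]) (use W in auto)
    with W(3) show "\<exists>D A. (D, A) \<in> At \<and> rat At D A x f" by blast
  qed
next
  assume R: "\<forall>x\<in>U. \<exists>D A. (D, A) \<in> At \<and> rat At D A x f"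
  show "f \<in> regular (variety_of At) U"
    unfolding variety_of_def space_fun.select_convs mem_Collect_eq
  proof
    fix x assume x: "x \<in> U"
    then obtain D A where DA: "(D, A) \<in> At" "rat At D A x f" using R by blast
    obtain W p q where W: "openin (zariski_of At) W" "x \<in> W" "W \<subseteq> D" "p \<in> poly_funs A"
      "q \<in> poly_funs A" "\<And>y. y \<in> W \<Longrightarrow> q y \<noteq> 0" "\<And>y. y \<in> W \<Longrightarrow> f y = p y / q y"
      using ratE[OF DA(2)] by metis
    have "openin (zariski_of At) (W \<inter> U)" using W(1) assms by (rule openin_Int)
    moreover have "x \<in> W \<inter> U" "W \<inter> U \<subseteq> U \<inter> D" "\<forall>y\<in>W \<inter> U. q y \<noteq> 0 \<and> f y = p y / q y"
      using W(2,3,6,7) x by auto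
    ultimately show "\<exists>W D A p q. openin (zariski_of At) W \<and> x \<in> W \<and> (D, A) \<in> At \<and> W \<subseteq> U \<inter> D \<and>
        p \<in> poly_funs A \<and> q \<in> poly_funs A \<and> (\<forall>y\<in>W. q y \<noteq> 0 \<and> f y = p y / q y)"
      using DA(1) W(4,5) by meson
  qed
qed

lemma regular_variety_of_cong:
  assumes "openin (zariski_of At) U" "\<And>x. x \<in> U \<Longrightarrow> f x = g x"
  shows "f \<in> regular (variety_of At) U \<longleftrightarrow> g \<in> regular (variety_of At) U"
  unfolding regular_variety_of_iff[OF assms(1)]
  using rat_cong[OF _ assms(1)] assms(2) by metis

definition morphism :: "'a atlas \<Rightarrow> 'b atlas \<Rightarrow> ('a \<Rightarrow> 'b) \<Rightarrow> bool"
  where "morphism At At' \<phi> \<longleftrightarrow>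
    (\<forall>x\<in>topspace (zariski_of At). \<phi> x \<in> topspace (zariski_of At')) \<and>
    (\<forall>x\<in>topspace (zariski_of At). \<forall>D' A'. (D', A') \<in> At' \<longrightarrow> \<phi> x \<in> D' \<longrightarrow>
      (\<exists>D A W. (D, A) \<in> At \<and> x \<in> D \<and> openin (zariski_of At) W \<and> x \<in> W \<and> \<phi> ` W \<subseteq> D' \<and>
        (\<forall>a\<in>A'. rat At D A x (\<lambda>y. a (\<phi> y)))))"

lemma morphismE:
  assumes "morphism At At' \<phi>" "x \<in> topspace (zariski_of At)" "(D', A') \<in> At'" "\<phi> x \<in> D'"
  obtains D A W where "(D, A) \<in> At" "x \<in> D" "openin (zariski_of At) W" "x \<in> W" "\<phi> ` W \<subseteq> D'"
    "\<And>p. p \<in> poly_funs A' \<Longrightarrow> rat At D A x (\<lambda>y. p (\<phi> y))"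
proof -
  obtain D A W where *: "(D, A) \<in> At" "x \<in> D" "openin (zariski_of At) W" "x \<in> W" "\<phi> ` W \<subseteq> D'"
    "\<forall>a\<in>A'. rat At D A x (\<lambda>y. a (\<phi> y))"
    using assms unfolding morphism_def by metis
  show thesis
    using that[OF *(1-5)] rat_poly_funs[OF *(1,2), of _ A' \<phi>] *(6) by blast
qed

text \<open>It suffices to treat the generating open sets, and these pull back to nonvanishing loci
  of fractions.\<close>

lemma morphism_continuous:
  assumes "morphism At At' \<phi>"
  shows "continuous_map (zariski_of At) (zariski_of At') \<phi>"
  unfolding zariski_of_def[of At']
proof (rule continuous_on_generated_topo)
  show "\<phi> ` topspace (zariski_of At) \<subseteq> \<Union> {{x \<in> D. q x \<noteq> 0} |D A q. (D, A) \<in> At' \<and> q \<in> poly_funs A}"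
    using assms unfolding morphism_def zariski_of_def[of At'] topology_generated_by_topspace by blast
next
  fix U assume "U \<in> {{x \<in> D. q x \<noteq> 0} |D A q. (D, A) \<in> At' \<and> q \<in> poly_funs A}"
  then obtain D' A' q where U: "U = {x \<in> D'. q x \<noteq> 0}" "(D', A') \<in> At'" "q \<in> poly_funs A'"
    by blast
  show "openin (zariski_of At) (\<phi> -` U \<inter> topspace (zariski_of At))"
  proof (subst openin_subopen, intro ballI)
    fix x assume x: "x \<in> \<phi> -` U \<inter> topspace (zariski_of At)"
    then obtain D A W where W: "(D, A) \<in> At" "x \<in> D" "openin (zariski_of At) W" "x \<in> W" "\<phi> ` W \<subseteq> D'"
      "\<And>p. p \<in> poly_funs A' \<Longrightarrow> rat At D A x (\<lambda>y. p (\<phi> y))"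
      using morphismE[OF assms _ U(2), of x] U(1) by blast
    obtain V where V: "openin (zariski_of At) V" "x \<in> V" "\<And>y. y \<in> V \<Longrightarrow> q (\<phi> y) \<noteq> 0"
    proof (rule rat_nonzero[OF W(1) W(6)[OF U(3)]])
      show "q (\<phi> x) \<noteq> 0" using x U(1) by simp
    qed blast
    show "\<exists>T. openin (zariski_of At) T \<and> x \<in> T \<and> T \<subseteq> \<phi> -` U \<inter> topspace (zariski_of At)"
      by (rule exI[of _ "W \<inter> V"]) (use W V U(1) openin_subset[OF W(3)] in auto)
  qed
qed

lemma morphism_regular:
  assumes "morphism At At' \<phi>" "openin (zariski_of At') U" "f \<in> regular (variety_of At') U"
  shows "f \<circ> \<phi> \<in> regular (variety_of At) {x \<in> topspace (zariski_of At). \<phi> x \<in> U}"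
proof -
  have cont: "openin (zariski_of At) {x \<in> topspace (zariski_of At). \<phi> x \<in> V}"
    if "openin (zariski_of At') V" for V
    using that openin_continuous_map_preimage[OF morphism_continuous[OF assms(1)]] by blast
  show ?thesis
    unfolding regular_variety_of_iff[OF cont[OF assms(2)]]
  proof
    fix x assume x: "x \<in> {x \<in> topspace (zariski_of At). \<phi> x \<in> U}"
    then obtain D' A' where DA': "(D', A') \<in> At'" "rat At' D' A' (\<phi> x) f"
      using assms(3) unfolding regular_variety_of_iff[OF assms(2)] by blast
    obtain W' p q where W': "openin (zariski_of At') W'" "\<phi> x \<in> W'" "W' \<subseteq> D'" "p \<in> poly_funs A'"
      "q \<in> poly_funs A'" "\<And>y. y \<in> W' \<Longrightarrow> q y \<noteq> 0" "\<And>y. y \<in> W' \<Longrightarrow> f y = p y / q y"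
      using ratE[OF DA'(2)] by metis
    obtain D A W where W: "(D, A) \<in> At" "x \<in> D"
      "\<And>p. p \<in> poly_funs A' \<Longrightarrow> rat At D A x (\<lambda>y. p (\<phi> y))"
    proof (rule morphismE[OF assms(1) _ DA'(1)])
      show "x \<in> topspace (zariski_of At)" "\<phi> x \<in> D'" using x W'(2,3) by auto
    qed blast
    have "rat At D A x (\<lambda>y. p (\<phi> y) / q (\<phi> y))"
      using W' by (intro rat_divide W) auto
    then have "rat At D A x (f \<circ> \<phi>)"
      by (rule rat_cong[OF _ cont[OF W'(1)]]) (use x W' in auto)
    with W(1) show "\<exists>D A. (D, A) \<in> At \<and> rat At D A x (f \<circ> \<phi>)" by blast
  qed
qed

text \<open>Regularity passes back along the inverse: \<open>f\<close> agrees on \<open>U\<close>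
  with the pullback of \<open>f \<circ> \<phi>\<close> along \<open>\<psi>\<close>.\<close>

lemma iso_space_fun_variety:
  assumes "morphism At At' \<phi>" "morphism At' At \<psi>"
    "\<And>x. x \<in> topspace (zariski_of At) \<Longrightarrow> \<psi> (\<phi> x) = x"
    "\<And>y. y \<in> topspace (zariski_of At') \<Longrightarrow> \<phi> (\<psi> y) = y"
  shows "iso_space_fun (variety_of At) (variety_of At')"
proof -
  let ?X = "topspace (zariski_of At)" and ?Y = "topspace (zariski_of At')"
  have "homeomorphic_maps (zariski_of At) (zariski_of At') \<phi> \<psi>"
    unfolding homeomorphic_maps_def
    using assms(3,4) morphism_continuous[OF assms(1)] morphism_continuous[OF assms(2)] by blast
  then have "homeomorphic_map (zariski_of At) (zariski_of At') \<phi>"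
    using homeomorphic_map_maps by blast
  moreover have "f \<in> regular (variety_of At') U"
    if U: "openin (zariski_of At') U"
      and f: "f \<circ> \<phi> \<in> regular (variety_of At) {x \<in> ?X. \<phi> x \<in> U}" for U f
  proof -
    have "openin (zariski_of At) {x \<in> ?X. \<phi> x \<in> U}"
      using openin_continuous_map_preimage[OF morphism_continuous[OF assms(1)] U] .
    from morphism_regular[OF assms(2) this f]
    have "f \<circ> \<phi> \<circ> \<psi> \<in> regular (variety_of At') {y \<in> ?Y. \<psi> y \<in> {x \<in> ?X. \<phi> x \<in> U}}" .
    also have "{y \<in> ?Y. \<psi> y \<in> {x \<in> ?X. \<phi> x \<in> U}} = U"
      using assms(2,4) openin_subset[OF U] unfolding morphism_def by auto
    finally have "f \<circ> \<phi> \<circ> \<psi> \<in> regular (variety_of At') U" .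
    moreover have "(f \<circ> \<phi> \<circ> \<psi>) y = f y" if "y \<in> U" for y
      using assms(4) openin_subset[OF U] that by auto
    ultimately show ?thesis
      using regular_variety_of_cong[OF U] by blast
  qed
  ultimately show ?thesis
    unfolding iso_space_fun_def using morphism_regular[OF assms(1)] by (intro exI[of _ \<phi>]) auto
qed

lemma iso_space_fun_trans:
  assumes "iso_space_fun X Y" "iso_space_fun Y Z"
  shows "iso_space_fun X Z"
proof -
  obtain \<phi> where \<phi>: "homeomorphic_map (zariski X) (zariski Y) \<phi>"
    "\<And>U f. openin (zariski Y) U \<Longrightarrow>
      f \<in> regular Y U \<longleftrightarrow> f \<circ> \<phi> \<in> regular X {x \<in> topspace (zariski X). \<phi> x \<in> U}"
    using assms(1) unfolding iso_space_fun_def by (elim exE conjE) blast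
  obtain \<psi> where \<psi>: "homeomorphic_map (zariski Y) (zariski Z) \<psi>"
    "\<And>U f. openin (zariski Z) U \<Longrightarrow>
      f \<in> regular Z U \<longleftrightarrow> f \<circ> \<psi> \<in> regular Y {y \<in> topspace (zariski Y). \<psi> y \<in> U}"
    using assms(2) unfolding iso_space_fun_def by (elim exE conjE) blast
  have "f \<in> regular Z U \<longleftrightarrow> f \<circ> (\<psi> \<circ> \<phi>) \<in> regular X {x \<in> topspace (zariski X). (\<psi> \<circ> \<phi>) x \<in> U}"
    if U: "openin (zariski Z) U" for U f
  proof -
    have "openin (zariski Y) {y \<in> topspace (zariski Y). \<psi> y \<in> U}"
      using openin_continuous_map_preimage[OF homeomorphic_imp_continuous_map[OF \<psi>(1)] U] .
    from \<phi>(2)[OF this]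
    have "f \<in> regular Z U \<longleftrightarrow> f \<circ> \<psi> \<circ> \<phi> \<in> regular X
      {x \<in> topspace (zariski X). \<phi> x \<in> {y \<in> topspace (zariski Y). \<psi> y \<in> U}}"
      using \<psi>(2)[OF U] by blast
    moreover have "{x \<in> topspace (zariski X). \<phi> x \<in> {y \<in> topspace (zariski Y). \<psi> y \<in> U}} =
      {x \<in> topspace (zariski X). (\<psi> \<circ> \<phi>) x \<in> U}"
      using homeomorphic_imp_surjective_map[OF \<phi>(1)] by auto
    ultimately show ?thesis by (simp add: o_assoc)
  qed
  then show ?thesis
    unfolding iso_space_fun_def
    using homeomorphic_map_compose[OF \<phi>(1) \<psi>(1)] by (intro exI[of _ "\<psi> \<circ> \<phi>"]) auto
qed

section \<open>Projective spaces\<close>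

lemma cscale_0_right [simp]: "cscale c 0 = 0"
  and cscale_1_left [simp]: "cscale 1 v = v"
  and cscale_cscale [simp]: "cscale a (cscale b v) = cscale (a * b) v"
  by (auto intro!: poly_mapping_eqI)

lemma keys_cscale: "keys (cscale c v) = (if c = 0 then {} else keys v)"
  by (auto simp: in_keys_iff)

lemma cline_self [simp]: "v \<in> cline v"
  unfolding cline_def by (auto intro: exI[of _ 1])

lemma cline_cscale: "c \<noteq> 0 \<Longrightarrow> cline (cscale c v) = cline v"
proof -
  assume c: "c \<noteq> 0"
  have "\<exists>b. cscale a v = cscale (b * c) v \<and> b \<noteq> 0" if "a \<noteq> 0" for a
    using that c by (intro exI[of _ "a / c"]) auto
  then show ?thesis unfolding cline_def using c by fastforce
qed

lemma cline_eqE: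
  assumes "cline v = cline w"
  obtains c where "c \<noteq> 0" "w = cscale c v"
  using assms cline_self[of w] unfolding cline_def by blast

text \<open>A nonzero common factor cancels from the quotient; where the denominator is 0, all
  representatives give the value 0.\<close>

lemma hratio_cline: "hratio j i (cline v) = lookup v j / lookup v i"
  unfolding hratio_def
proof (rule the_equality)
  show "\<exists>w\<in>cline v. lookup v j / lookup v i = lookup w j / lookup w i"
    by (rule bexI[of _ v]) auto
qed (auto simp: cline_def)

lemma proj_chart_cline:
  "cline v \<in> {L \<in> proj_points V. \<forall>v\<in>L. lookup v i \<noteq> 0} \<longleftrightarrow> cline v \<in> proj_points V \<and> lookup v i \<noteq> 0"
  using cline_self[of v] by (auto simp: cline_def)

lemma topspace_proj: "topspace (zariski_of (proj_atlas V)) = proj_points V"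
proof
  show "topspace (zariski_of (proj_atlas V)) \<subseteq> proj_points V"
    unfolding topspace_zariski_of proj_atlas_def by auto
  show "proj_points V \<subseteq> topspace (zariski_of (proj_atlas V))"
  proof
    fix L assume "L \<in> proj_points V"
    then obtain v where v: "L = cline v" "v \<noteq> 0" and L: "cline v \<in> proj_points V"
      unfolding proj_points_def by blast
    from v(2) obtain i where "lookup v i \<noteq> 0" by (metis poly_mapping_eqI lookup_zero)
    then have "L \<in> {L \<in> proj_points V. \<forall>v\<in>L. lookup v i \<noteq> 0}"
      using proj_chart_cline[of v V i] L v by blast
    then show "L \<in> topspace (zariski_of (proj_atlas V))"
      unfolding topspace_zariski_of proj_atlas_def by blast
  qed
qed

abbreviation proj_chart :: "('i \<Rightarrow>\<^sub>0 complex) set \<Rightarrow> 'i \<Rightarrow> ('i \<Rightarrow>\<^sub>0 complex) set set"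
  where "proj_chart V i \<equiv> {L \<in> proj_points V. \<forall>v\<in>L. lookup v i \<noteq> 0}"

abbreviation proj_coords :: "'i \<Rightarrow> (('i \<Rightarrow>\<^sub>0 complex) set \<Rightarrow> complex) set"
  where "proj_coords i \<equiv> {hratio j i | j. True}"

lemma proj_chart_in_atlas: "(proj_chart V i, proj_coords i) \<in> proj_atlas V"
  unfolding proj_atlas_def by blast

lemma proj_pointsE:
  assumes "L \<in> proj_points V"
  obtains v where "L = cline v" "v \<in> V" "v \<noteq> 0"
  using assms unfolding proj_points_def by blast

lemma proj_points_chart:
  assumes "L \<in> proj_points V"
  obtains i where "L \<in> proj_chart V i"
  using assms topspace_proj[of V] unfolding topspace_zariski_of proj_atlas_def by blast

text \<open>Change of chart: x_j / x_k = (x_j / x_i) / (x_k / x_i).\<close>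

lemma rat_hratio:
  assumes "L \<in> proj_chart V i" "L \<in> proj_chart V k"
  shows "rat (proj_atlas V) (proj_chart V i) (proj_coords i) L (hratio j k)"
proof -
  have r: "rat (proj_atlas V) (proj_chart V i) (proj_coords i) L (hratio j' i)" for j'
    by (rule rat_poly[OF proj_chart_in_atlas assms(1)]) (auto intro: poly_funs.coord)
  obtain v where v: "L = cline v" using assms by (auto elim: proj_pointsE)
  have "rat (proj_atlas V) (proj_chart V i) (proj_coords i) L (\<lambda>L. hratio j i L / hratio k i L)"
    using assms v by (intro rat_divide r proj_chart_in_atlas) (auto simp: hratio_cline)
  then show ?thesis
    by (rule rat_cong[OF _ openin_zariski_chart[OF proj_chart_in_atlas] assms(1)])
      (auto simp: hratio_cline elim!: proj_pointsE)
qed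

text \<open>Renaming of coordinates along \<open>\<sigma>\<close>, used to number the monomials of
  binary forms.\<close>

definition recoord :: "'i set \<Rightarrow> ('i \<Rightarrow> 'j) \<Rightarrow> ('i \<Rightarrow>\<^sub>0 complex) \<Rightarrow> 'j \<Rightarrow>\<^sub>0 complex"
  where "recoord K \<sigma> v = (\<Sum>k\<in>K. single (\<sigma> k) (lookup v k))"

lemma lookup_recoord:
  assumes "finite K" "inj_on \<sigma> K" "k \<in> K"
  shows "lookup (recoord K \<sigma> v) (\<sigma> k) = lookup v k"
proof -
  have "lookup (recoord K \<sigma> v) (\<sigma> k) = (\<Sum>k'\<in>K. if k' = k then lookup v k else 0)"
    unfolding recoord_def lookup_sum lookup_single
    by (rule sum.cong) (use assms in \<open>auto simp: when_def inj_on_def\<close>)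
  then show ?thesis using assms by simp
qed

lemma lookup_recoord_outside: "finite K \<Longrightarrow> k \<notin> \<sigma> ` K \<Longrightarrow> lookup (recoord K \<sigma> v) k = 0"
  unfolding recoord_def lookup_sum lookup_single by (auto simp: when_def intro!: sum.neutral)

lemma recoord_cscale: "recoord K \<sigma> (cscale c v) = cscale c (recoord K \<sigma> v)"
  unfolding recoord_def
  by (auto intro!: poly_mapping_eqI sum.cong simp: lookup_sum lookup_single when_def sum_distrib_left)

lemma recoord_cline: "recoord K \<sigma> ` cline v = cline (recoord K \<sigma> v)"
  unfolding cline_def by (force simp: recoord_cscale)

lemma recoord_inv:
  assumes "finite K" "bij_betw \<sigma> K K'" "keys v \<subseteq> K"
  shows "recoord K' (inv_into K \<sigma>) (recoord K \<sigma> v) = v"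
proof (rule poly_mapping_eqI)
  fix k
  note b = bij_betw_inv_into[OF assms(2)]
  have K': "finite K'" using assms bij_betw_finite by blast
  show "lookup (recoord K' (inv_into K \<sigma>) (recoord K \<sigma> v)) k = lookup v k"
  proof (cases "k \<in> K")
    case True
    then have "\<sigma> k \<in> K'" "inv_into K \<sigma> (\<sigma> k) = k"
      using assms(2) by (auto simp: bij_betw_def)
    then show ?thesis
      using lookup_recoord[OF K' bij_betw_imp_inj_on[OF b], of "\<sigma> k" "recoord K \<sigma> v"]
        lookup_recoord[OF assms(1) bij_betw_imp_inj_on[OF assms(2)] True, of v] by simp
  next
    case False
    then have "k \<notin> inv_into K \<sigma> ` K'" using b by (auto simp: bij_betw_def)
    from lookup_recoord_outside[OF K' this] show ?thesis
      using False assms(3) by (metis in_keys_iff subsetD)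
  qed
qed

lemma morphism_recoord:
  assumes "finite K" "bij_betw \<sigma> K K'"
  shows "morphism (proj_atlas {v. keys v \<subseteq> K}) (proj_atlas {v. keys v \<subseteq> K'}) ((`) (recoord K \<sigma>))"
  unfolding morphism_def topspace_proj
proof (intro conjI ballI allI impI)
  let ?V = "{v::'a \<Rightarrow>\<^sub>0 complex. keys v \<subseteq> K}" and ?V' = "{v::'b \<Rightarrow>\<^sub>0 complex. keys v \<subseteq> K'}"
  have K': "\<sigma> ` K = K'" and inj: "inj_on \<sigma> K" using assms(2) by (auto simp: bij_betw_def)
  have keys: "keys (recoord K \<sigma> v) \<subseteq> K'" for v
    using lookup_recoord_outside[OF assms(1), of _ \<sigma> v] K' by (auto simp: in_keys_iff)
  show img: "recoord K \<sigma> ` L \<in> proj_points ?V'" if L: "L \<in> proj_points ?V" for L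
  proof -
    obtain v where v: "L = cline v" "keys v \<subseteq> K" "v \<noteq> 0" using L by (auto elim: proj_pointsE)
    have "recoord K \<sigma> v \<noteq> 0"
      using recoord_inv[OF assms v(2)] v(3) recoord_cscale[of K' "inv_into K \<sigma>" 0 0] by auto
    then show ?thesis
      unfolding v recoord_cline proj_points_def using keys by blast
  qed
  fix L D' A'
  assume L: "L \<in> proj_points ?V" and DA': "(D', A') \<in> proj_atlas ?V'" "recoord K \<sigma> ` L \<in> D'"
  obtain i' where i': "D' = proj_chart ?V' i'" "A' = proj_coords i'"
    using DA'(1) unfolding proj_atlas_def by blast
  obtain v where v: "L = cline v" "keys v \<subseteq> K" "v \<noteq> 0" using L by (auto elim: proj_pointsE)
  have "lookup (recoord K \<sigma> v) i' \<noteq> 0"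
    using DA'(2) unfolding v i' recoord_cline by simp
  then have "i' \<in> \<sigma> ` K" using lookup_recoord_outside[OF assms(1)] by metis
  then obtain i where i: "i' = \<sigma> i" "i \<in> K" by blast
  have lk: "lookup (recoord K \<sigma> w) i' = lookup w i" for w
    unfolding i(1) by (rule lookup_recoord[OF assms(1) inj i(2)])
  have LD: "L \<in> proj_chart ?V i"
    using L DA'(2) unfolding i' v recoord_cline proj_chart_cline lk by simp
  show "\<exists>D A W. (D, A) \<in> proj_atlas ?V \<and> L \<in> D \<and> openin (zariski_of (proj_atlas ?V)) W \<and> L \<in> W \<and>
     (`) (recoord K \<sigma>) ` W \<subseteq> D' \<and> (\<forall>a\<in>A'. rat (proj_atlas ?V) D A L (\<lambda>y. a (recoord K \<sigma> ` y)))"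
  proof (rule exI[of _ "proj_chart ?V i"], rule exI[of _ "proj_coords i"],
      rule exI[of _ "proj_chart ?V i"], intro conjI ballI)
    show "(`) (recoord K \<sigma>) ` proj_chart ?V i \<subseteq> D'"
      unfolding i' using img lk by auto
    fix a assume "a \<in> A'"
    then obtain j' where j': "a = hratio j' i'" unfolding i' by blast
    have val: "hratio j' i' (recoord K \<sigma> ` cline w) = lookup (recoord K \<sigma> w) j' / lookup w i" for w
      unfolding recoord_cline hratio_cline lk ..
    show "rat (proj_atlas ?V) (proj_chart ?V i) (proj_coords i) L (\<lambda>y. a (recoord K \<sigma> ` y))"
    proof (cases "j' \<in> K'")
      case True
      then obtain j where j: "j' = \<sigma> j" "j \<in> K" using K' by blast
      have "a (recoord K \<sigma> ` y) = hratio j i y" if "y \<in> proj_points ?V" for y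
        using that unfolding j'
        by (elim proj_pointsE) (simp add: val[unfolded j(1)] hratio_cline j lookup_recoord[OF assms(1) inj])
      then show ?thesis
        by (intro rat_cong[OF rat_hratio[OF LD LD, of j] _ LD])
          (auto intro: openin_zariski_chart[OF proj_chart_in_atlas])
    next
      \<comment> \<open>The chart has a ratio for every index; those outside \<open>K'\<close>
        vanish on the image.\<close>
      case False
      have "a (recoord K \<sigma> ` y) = 0" if "y \<in> proj_points ?V" for y
        using that False unfolding j' K'[symmetric]
        by (elim proj_pointsE) (simp add: val lookup_recoord_outside[OF assms(1)])
      then show ?thesis
        by (intro rat_cong[OF rat_poly[OF proj_chart_in_atlas LD poly_funs.const[of 0]] _ LD])
          (auto intro: openin_zariski_chart[OF proj_chart_in_atlas])
    qed
  qed (use LD proj_chart_in_atlas openin_zariski_chart[OF proj_chart_in_atlas[of ?V i]] in auto)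
qed

lemma iso_space_fun_recoord:
  assumes "finite K" "bij_betw \<sigma> K K'"
  shows "iso_space_fun (variety_of (proj_atlas {v. keys v \<subseteq> K})) (variety_of (proj_atlas {v. keys v \<subseteq> K'}))"
proof (rule iso_space_fun_variety[OF morphism_recoord[OF assms]
      morphism_recoord[OF _ bij_betw_inv_into[OF assms(2)]]])
  note b = bij_betw_inv_into[OF assms(2)]
  show K': "finite K'" using assms bij_betw_finite by blast
  show "recoord K' (inv_into K \<sigma>) ` recoord K \<sigma> ` L = L"
    if "L \<in> topspace (zariski_of (proj_atlas {v. keys v \<subseteq> K}))" for L
    using that unfolding topspace_proj
    by (elim proj_pointsE) (simp add: recoord_cline recoord_inv[OF assms])
  \<comment> \<open>The iterated inverse agrees with \<open>\<sigma>\<close> only on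
    \<open>K\<close>, where \<open>recoord\<close> evaluates it.\<close>
  have eq: "recoord K (inv_into K' (inv_into K \<sigma>)) = recoord K \<sigma>"
    unfolding recoord_def
    using inv_into_inv_into_eq[OF assms(2)] by (auto intro!: ext sum.cong)
  show "recoord K \<sigma> ` recoord K' (inv_into K \<sigma>) ` L = L"
    if "L \<in> topspace (zariski_of (proj_atlas {v. keys v \<subseteq> K'}))" for L
    using that recoord_inv[OF K' b] unfolding topspace_proj eq
    by (elim proj_pointsE) (simp add: recoord_cline)
qed

section \<open>Degrees of monomials, and binary forms as a projective space\<close>

lemma mdeg_single [simp]: "mdeg (single i k) = k"
  by (simp add: mdeg_def)

lemma mdeg_superset: "finite S \<Longrightarrow> keys m \<subseteq> S \<Longrightarrow> mdeg m = (\<Sum>i\<in>S. lookup m i)"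
  unfolding mdeg_def by (rule sum.mono_neutral_left) (auto simp: in_keys_iff)

lemma mdeg_add [simp]: "mdeg (a + b) = mdeg a + mdeg b"
proof -
  have "mdeg (a + b) = (\<Sum>i\<in>keys a \<union> keys b. lookup (a + b) i)"
    by (rule mdeg_superset) (use Poly_Mapping.keys_add[of a b] in auto)
  moreover have "mdeg a = (\<Sum>i\<in>keys a \<union> keys b. lookup a i)"
    by (rule mdeg_superset) auto
  moreover have "mdeg b = (\<Sum>i\<in>keys a \<union> keys b. lookup b i)"
    by (rule mdeg_superset) auto
  ultimately show ?thesis by (simp add: lookup_add sum.distrib)
qed

lemma mdeg_zero [simp]: "mdeg 0 = 0"
  by (simp add: mdeg_def)

theorem iso_PP_binary_forms: "iso_space_fun (PP m) (PP_binary_forms m)"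
  and iso_binary_forms_PP: "iso_space_fun (PP_binary_forms m) (PP m)"
proof -
  \<comment> \<open>Binary monomials are numbered by the exponent of the second variable.\<close>
  let ?\<sigma> = "\<lambda>j::nat. single 0 (m - j) + single 1 j :: monom"
  have bij: "bij_betw ?\<sigma> {..m} (monoms 1 m)"
  proof (rule bij_betwI)
    show "?\<sigma> \<in> {..m} \<rightarrow> monoms 1 m"
      by (auto simp: monoms_def in_keys_iff lookup_add lookup_single when_def split: if_splits)
    show "(\<lambda>a. lookup a 1) \<in> monoms 1 m \<rightarrow> {..m}"
      by (auto simp: monoms_def mdeg_superset[of "{..1}"])
    show "lookup (?\<sigma> x) 1 = x" for x by (simp add: lookup_add lookup_single)
    show "?\<sigma> (lookup a 1) = a" if a: "a \<in> monoms 1 m" for a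
    proof (rule poly_mapping_eqI)
      fix k
      have "k \<le> 1 \<or> lookup a k = 0" using a subsetD[of "keys a" "{..1}" k] by (auto simp: monoms_def in_keys_iff)
      moreover have "lookup a 0 + lookup a 1 = m"
        using a by (auto simp: monoms_def mdeg_superset[of "{..1}"])
      ultimately show "lookup (?\<sigma> (lookup a 1)) k = lookup a k"
        by (cases "k = 0"; cases "k = 1") (auto simp: lookup_add lookup_single when_def)
    qed
  qed
  have fin: "finite (monoms 1 m)" using bij_betw_finite[OF bij] by simp
  show "iso_space_fun (PP m) (PP_binary_forms m)"
    unfolding PP_def PP_binary_forms_def coord_space_def forms_def
    by (rule iso_space_fun_recoord[OF _ bij]) simp
  show "iso_space_fun (PP_binary_forms m) (PP m)"
    unfolding PP_def PP_binary_forms_def coord_space_def forms_def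
    by (rule iso_space_fun_recoord[OF fin bij_betw_inv_into[OF bij]])
qed

section \<open>Symmetric polynomials are polynomials in the elementary symmetric ones\<close>

text \<open>The coefficient of X^j in the product of the 1 + x X is the elementary symmetric
  function e_j of the list.\<close>

definition elem_poly :: "complex list \<Rightarrow> complex poly"
  where "elem_poly ts = (\<Prod>x\<leftarrow>ts. [:1, x:])"

definition power_sum :: "nat \<Rightarrow> complex list \<Rightarrow> complex"
  where "power_sum c ts = (\<Sum>x\<leftarrow>ts. x ^ c)"

definition elem_funs :: "(complex list \<Rightarrow> complex) set"
  where "elem_funs = {\<lambda>ts. coeff (elem_poly ts) j | j. True}"

text \<open>Newton's identities, read off from \<open>E'(X) = E(X) \<cdot> (\<Sum>x. x / (1 + x X))\<close>.\<close>

lemma fps_deriv_elem_poly: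
  "fps_deriv (fps_of_poly (elem_poly ts)) =
    fps_of_poly (elem_poly ts) * Abs_fps (\<lambda>c. (- 1) ^ c * power_sum (Suc c) ts)"
proof (induction ts)
  case Nil
  have "Abs_fps (\<lambda>c. (- 1) ^ c * power_sum (Suc c) []) = 0"
    by (rule fps_ext) (simp add: power_sum_def)
  then show ?case by (simp add: elem_poly_def)
next
  case (Cons x ts)
  let ?l = "1 + fps_const x * fps_X"
  let ?S = "\<lambda>ts. Abs_fps (\<lambda>c. (- 1) ^ c * power_sum (Suc c) ts)"
  \<comment> \<open>The power series of x / (1 + x X).\<close>
  define G where "G = Abs_fps (\<lambda>c. (- 1) ^ c * x ^ Suc c)"
  have l: "fps_of_poly (elem_poly (x # ts)) = ?l * fps_of_poly (elem_poly ts)"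
    by (simp add: elem_poly_def fps_of_poly_mult fps_of_poly_pCons algebra_simps)
  have S: "?S (x # ts) = G + ?S ts"
    by (rule fps_ext) (simp add: G_def power_sum_def algebra_simps)
  have G: "?l * G = fps_const x"
  proof (rule fps_ext)
    show "fps_nth (?l * G) n = fps_nth (fps_const x) n" for n
      by (cases n) (simp_all add: G_def distrib_right mult.assoc)
  qed
  have "fps_deriv (fps_of_poly (elem_poly (x # ts))) =
      fps_const x * fps_of_poly (elem_poly ts) + ?l * (fps_of_poly (elem_poly ts) * ?S ts)"
    unfolding l Cons.IH[symmetric] by (simp add: algebra_simps)
  also have "\<dots> = ?l * G * fps_of_poly (elem_poly ts) + ?l * (fps_of_poly (elem_poly ts) * ?S ts)"
    by (simp only: G)
  also have "\<dots> = ?l * fps_of_poly (elem_poly ts) * (G + ?S ts)"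
    by (simp add: algebra_simps)
  finally show ?case unfolding l S .
qed

lemma coeff_elem_poly_0 [simp]: "coeff (elem_poly ts) 0 = 1"
  by (induction ts) (simp_all add: elem_poly_def)

text \<open>The coefficient of X^k in the identity for the derivative. As e_0 = 1, the highest power
  sum can be solved for.\<close>

lemma newton_identity:
  "power_sum (Suc k) ts = (- 1) ^ k * (of_nat (Suc k) * coeff (elem_poly ts) (Suc k) -
    (\<Sum>i\<in>{1..k}. coeff (elem_poly ts) i * ((- 1) ^ (k - i) * power_sum (Suc (k - i)) ts)))"
proof -
  have "of_nat (Suc k) * coeff (elem_poly ts) (Suc k) =
      (\<Sum>i=0..k. coeff (elem_poly ts) i * ((- 1) ^ (k - i) * power_sum (Suc (k - i)) ts))"
    using arg_cong[OF fps_deriv_elem_poly[of ts], of "\<lambda>F. fps_nth F k"]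
    by (simp add: fps_mult_nth)
  also have "\<dots> = (- 1) ^ k * power_sum (Suc k) ts +
      (\<Sum>i\<in>{1..k}. coeff (elem_poly ts) i * ((- 1) ^ (k - i) * power_sum (Suc (k - i)) ts))"
    by (simp add: sum.atLeast_Suc_atMost)
  finally have "of_nat (Suc k) * coeff (elem_poly ts) (Suc k) -
      (\<Sum>i\<in>{1..k}. coeff (elem_poly ts) i * ((- 1) ^ (k - i) * power_sum (Suc (k - i)) ts)) =
      (- 1) ^ k * power_sum (Suc k) ts" by simp
  then have "(- 1) ^ k * (of_nat (Suc k) * coeff (elem_poly ts) (Suc k) -
    (\<Sum>i\<in>{1..k}. coeff (elem_poly ts) i * ((- 1) ^ (k - i) * power_sum (Suc (k - i)) ts))) =
    ((- 1) ^ k * (- 1) ^ k) * power_sum (Suc k) ts" by (simp only: mult.assoc)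
  then show ?thesis unfolding minus_one_mult_self mult_1_left by (rule sym)
qed

lemma power_sum_elem: "(\<lambda>ts. power_sum (Suc k) ts) \<in> poly_funs elem_funs"
proof (induction k rule: less_induct)
  case (less k)
  have e: "(\<lambda>ts. coeff (elem_poly ts) j) \<in> poly_funs elem_funs" for j
    by (rule poly_funs.coord) (auto simp: elem_funs_def)
  show ?case
    unfolding newton_identity[of k]
    by (intro poly_funs_cmult poly_funs_diff poly_funs_sum poly_funs.mult e less.IH) auto
qed

text \<open>The length is fixed because some symmetric functions depend on it: the zeroth power sum
  is the constant \<open>m\<close>, and no polynomial in the e_j gives the length of all lists,
  since appending 0 changes no e_j.\<close>

definition elem_rep :: "nat \<Rightarrow> (complex list \<Rightarrow> complex) \<Rightarrow> bool"
  where "elem_rep m g \<longleftrightarrow> (\<exists>R\<in>poly_funs elem_funs. \<forall>ts. length ts = m \<longrightarrow> g ts = R ts)"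

lemma elem_rep_poly: "R \<in> poly_funs elem_funs \<Longrightarrow> elem_rep m R"
  unfolding elem_rep_def by blast

lemma elem_rep_cong: "elem_rep m g \<Longrightarrow> (\<And>ts. length ts = m \<Longrightarrow> h ts = g ts) \<Longrightarrow> elem_rep m h"
  unfolding elem_rep_def by metis

lemma elem_rep_add: "elem_rep m g \<Longrightarrow> elem_rep m h \<Longrightarrow> elem_rep m (\<lambda>ts. g ts + h ts)"
  unfolding elem_rep_def using poly_funs.add by (smt (verit, best))

lemma elem_rep_mult: "elem_rep m g \<Longrightarrow> elem_rep m h \<Longrightarrow> elem_rep m (\<lambda>ts. g ts * h ts)"
  unfolding elem_rep_def using poly_funs.mult by (smt (verit, best))

lemma elem_rep_const: "elem_rep m (\<lambda>_. c)"
  by (rule elem_rep_poly poly_funs.const)+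

lemma elem_rep_cmult: "elem_rep m g \<Longrightarrow> elem_rep m (\<lambda>ts. c * g ts)"
  by (intro elem_rep_mult elem_rep_const)

lemma elem_rep_diff:
  assumes "elem_rep m g" "elem_rep m h"
  shows "elem_rep m (\<lambda>ts. g ts - h ts)"
  using elem_rep_add[OF assms(1) elem_rep_cmult[OF assms(2), of "-1"]] by simp

lemma elem_rep_sum:
  "(\<And>i. i \<in> I \<Longrightarrow> elem_rep m (f i)) \<Longrightarrow> elem_rep m (\<lambda>ts. \<Sum>i\<in>I. f i ts)"
  by (induction I rule: infinite_finite_induct) (auto intro: elem_rep_const elem_rep_add)

lemma elem_rep_power_sum: "elem_rep m (\<lambda>ts. \<Sum>i<m. ts ! i ^ c)"
proof (cases c)
  case 0
  then show ?thesis using elem_rep_const[of m "of_nat m"] by simp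
next
  case (Suc k)
  show ?thesis
    by (rule elem_rep_cong[OF elem_rep_poly[OF power_sum_elem[of k]]])
      (simp add: power_sum_def Suc sum_list_sum_nth atLeast0LessThan)
qed

text \<open>Injective tuples of indices; for \<open>r = m\<close> they are the permutations.\<close>

definition dlists :: "nat \<Rightarrow> nat \<Rightarrow> nat list set"
  where "dlists m r = {is. length is = r \<and> distinct is \<and> set is \<subseteq> {..<m}}"

lemma finite_dlists [simp]: "finite (dlists m r)"
  by (rule finite_subset[OF _ finite_lists_length_eq[of "{..<m}" r]]) (auto simp: dlists_def)

lemma dlists_0 [simp]: "dlists m 0 = {[]}"
  by (auto simp: dlists_def)

lemma sum_dlists_Suc:
  "(\<Sum>is\<in>dlists m (Suc r). f is) = (\<Sum>is\<in>dlists m r. \<Sum>i\<in>{..<m} - set is. f (i # is))"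
proof -
  have "(\<Sum>is\<in>dlists m r. \<Sum>i\<in>{..<m} - set is. f (i # is)) =
      (\<Sum>(is, i)\<in>Sigma (dlists m r) (\<lambda>is. {..<m} - set is). f (i # is))"
    by (subst sum.Sigma) auto
  also have "\<dots> = (\<Sum>is\<in>dlists m (Suc r). f is)"
    by (rule sum.reindex_bij_witness[of _ "\<lambda>is. (tl is, hd is)" "\<lambda>(is, i). i # is"])
      (auto simp: dlists_def length_Suc_conv)
  finally show ?thesis ..
qed

text \<open>The augmented monomial symmetric function: equal exponents cause repeated terms, which
  is harmless and avoids dividing by multiplicities.\<close>

definition monomial_sum :: "nat \<Rightarrow> nat list \<Rightarrow> complex list \<Rightarrow> complex"
  where "monomial_sum m cs ts = (\<Sum>is\<in>dlists m (length cs). \<Prod>l<length cs. ts ! (is ! l) ^ (cs ! l))"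

text \<open>Let the index attached to \<open>c\<close> run freely and remove the collisions: where
  it equals the l-th index, \<open>c\<close> is added to the l-th exponent. All monomial sums on the
  right have one exponent less, which drives the induction below.\<close>

lemma monomial_sum_Cons:
  "monomial_sum m (c # cs) ts =
    (\<Sum>i<m. ts ! i ^ c) * monomial_sum m cs ts - (\<Sum>l<length cs. monomial_sum m (cs[l := cs ! l + c]) ts)"
proof -
  let ?r = "length cs"
  let ?P = "\<lambda>is. \<Prod>l<?r. ts ! (is ! l) ^ (cs ! l)"
  have "monomial_sum m (c # cs) ts = (\<Sum>is\<in>dlists m ?r. \<Sum>i\<in>{..<m} - set is. ts ! i ^ c * ?P is)"
    unfolding monomial_sum_def
    by (simp add: sum_dlists_Suc prod.lessThan_Suc_shift del: prod.lessThan_Suc)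
  also have "\<dots> = (\<Sum>is\<in>dlists m ?r. (\<Sum>i<m. ts ! i ^ c) * ?P is -
      (\<Sum>l<?r. \<Prod>l'<?r. ts ! (is ! l') ^ (cs[l := cs ! l + c] ! l')))"
  proof (rule sum.cong[OF refl])
    fix "is" assume "is": "is \<in> dlists m ?r"
    have "(\<Sum>i\<in>{..<m} - set is. ts ! i ^ c) = (\<Sum>i<m. ts ! i ^ c) - (\<Sum>i\<in>set is. ts ! i ^ c)"
      using "is" by (intro sum_diff) (auto simp: dlists_def)
    moreover have "(\<Sum>i\<in>set is. ts ! i ^ c) = (\<Sum>l<?r. ts ! (is ! l) ^ c)"
      using "is" unfolding dlists_def
      by (auto simp: sum_code distinct_remdups_id sum_list_sum_nth atLeast0LessThan)
    moreover have "(\<Prod>l'<?r. ts ! (is ! l') ^ (cs[l := cs ! l + c] ! l')) = ts ! (is ! l) ^ c * ?P is"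
      if "l < ?r" for l
    proof -
      have "(\<Prod>l'<?r. ts ! (is ! l') ^ (cs[l := cs ! l + c] ! l')) =
          ts ! (is ! l) ^ (cs ! l + c) * (\<Prod>l'\<in>{..<?r} - {l}. ts ! (is ! l') ^ (cs[l := cs ! l + c] ! l'))"
        using that by (subst prod.remove[of _ l]) auto
      also have "(\<Prod>l'\<in>{..<?r} - {l}. ts ! (is ! l') ^ (cs[l := cs ! l + c] ! l')) =
          (\<Prod>l'\<in>{..<?r} - {l}. ts ! (is ! l') ^ (cs ! l'))"
        by (rule prod.cong) auto
      also have "ts ! (is ! l) ^ (cs ! l + c) * \<dots> = ts ! (is ! l) ^ c * ?P is"
        using that by (subst prod.remove[of "{..<?r}" l]) (auto simp: power_add)
      finally show ?thesis .
    qed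
    ultimately show "(\<Sum>i\<in>{..<m} - set is. ts ! i ^ c * ?P is) = (\<Sum>i<m. ts ! i ^ c) * ?P is -
      (\<Sum>l<?r. \<Prod>l'<?r. ts ! (is ! l') ^ (cs[l := cs ! l + c] ! l'))"
      by (simp add: left_diff_distrib flip: sum_distrib_right)
  qed
  also have "\<dots> = (\<Sum>i<m. ts ! i ^ c) * monomial_sum m cs ts -
      (\<Sum>l<?r. monomial_sum m (cs[l := cs ! l + c]) ts)"
    unfolding sum_subtractf monomial_sum_def length_list_update
    by (subst sum.swap) (simp add: sum_distrib_left)
  finally show ?thesis .
qed

text \<open>The induction is on the number of exponents, with arbitrary values, since merging two
  indices changes the values.\<close>

lemma elem_rep_monomial_sum: "elem_rep m (monomial_sum m cs)"
proof (induction "length cs" arbitrary: cs)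
  case 0
  then show ?case by (auto simp: monomial_sum_def[abs_def] intro: elem_rep_const)
next
  case (Suc r)
  then obtain c cs' where cs: "cs = c # cs'" "length cs' = r" by (cases cs) auto
  have "elem_rep m (\<lambda>ts. monomial_sum m cs ts)"
    unfolding cs monomial_sum_Cons
    by (intro elem_rep_diff elem_rep_mult elem_rep_sum elem_rep_power_sum Suc.hyps(1)) (simp_all add: cs)
  then show ?case .
qed

definition coord_funs :: "nat \<Rightarrow> (complex list \<Rightarrow> complex) set"
  where "coord_funs m = {\<lambda>ts. ts ! k | k. k < m}"

text \<open>The induction also multiplies by an arbitrary monomial; this takes care of products.\<close>

lemma elem_rep_symmetrization:
  assumes "g \<in> poly_funs (coord_funs m)"
  shows "elem_rep m (\<lambda>ts. \<Sum>is\<in>dlists m m. g (map ((!) ts) is))"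
proof -
  define good where "good h \<longleftrightarrow> (\<forall>ex. elem_rep m
      (\<lambda>ts. \<Sum>is\<in>dlists m m. h (map ((!) ts) is) * (\<Prod>k<m. ts ! (is ! k) ^ ex k)))"
    for h :: "complex list \<Rightarrow> complex"
  have nth: "map ((!) ts) is ! k = ts ! (is ! k)" if "is \<in> dlists m m" "k < m"
    for ts :: "complex list" and "is" k
    using that by (simp add: dlists_def)
  have "good (\<lambda>_. 1)"
    unfolding good_def
  proof
    fix ex
    show "elem_rep m (\<lambda>ts. \<Sum>is\<in>dlists m m. 1 * (\<Prod>k<m. ts ! (is ! k) ^ ex k))"
      using elem_rep_monomial_sum[of m "map ex [0..<m]"]
      by (rule elem_rep_cong) (simp add: monomial_sum_def)
  qed
  moreover have "good h \<Longrightarrow> good (\<lambda>ts. g ts * h ts)" for h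
    using assms
  proof (induction g arbitrary: h rule: poly_funs.induct)
    case (const c)
    show ?case
      unfolding good_def
    proof
      fix ex
      show "elem_rep m (\<lambda>ts. \<Sum>is\<in>dlists m m. c * h (map ((!) ts) is) * (\<Prod>k<m. ts ! (is ! k) ^ ex k))"
        using elem_rep_cmult[of m _ c, OF const[unfolded good_def, rule_format, of ex]]
        by (simp add: sum_distrib_left mult.assoc)
    qed
  next
    case (coord a)
    then obtain l where l: "a = (\<lambda>ts. ts ! l)" "l < m" by (auto simp: coord_funs_def)
    show ?case
      unfolding good_def
    proof
      fix ex
      have "(\<Prod>k<m. ts ! (is ! k) ^ (ex(l := Suc (ex l))) k) =
          ts ! (is ! l) * (\<Prod>k<m. ts ! (is ! k) ^ ex k)" for ts :: "complex list" and "is"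
        using l(2) by (subst (1 2) prod.remove[of _ l]) auto
      then show "elem_rep m (\<lambda>ts. \<Sum>is\<in>dlists m m. a (map ((!) ts) is) * h (map ((!) ts) is) *
          (\<Prod>k<m. ts ! (is ! k) ^ ex k))"
        using coord(2)[unfolded good_def, rule_format, of "ex(l := Suc (ex l))"]
        by (elim elem_rep_cong) (auto intro!: sum.cong simp: l nth)
    qed
  next
    case (add p q)
    show ?case
      unfolding good_def
    proof
      fix ex
      show "elem_rep m (\<lambda>ts. \<Sum>is\<in>dlists m m. (p (map ((!) ts) is) + q (map ((!) ts) is)) *
          h (map ((!) ts) is) * (\<Prod>k<m. ts ! (is ! k) ^ ex k))"
        using elem_rep_add[OF add.IH(1)[OF add.prems, unfolded good_def, rule_format, of ex]
            add.IH(2)[OF add.prems, unfolded good_def, rule_format, of ex]]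
        by (simp add: sum.distrib distrib_right)
    qed
  next
    case (mult p q)
    show ?case
      using mult.IH(1)[OF mult.IH(2)[OF mult.prems]] by (simp add: mult.assoc)
  qed
  ultimately have "good (\<lambda>ts. g ts * 1)" by blast
  from this[unfolded good_def, rule_format, of "\<lambda>_. 0"] show ?thesis by simp
qed

text \<open>If all positive power sums vanished, so would the sum of the values at the
  \<open>g s\<close> of every polynomial without constant term. The lemma provides a symmetrized
  power of a denominator that is nonzero at a given point.\<close>

lemma power_sums_separate:
  fixes g :: "'a \<Rightarrow> complex"
  assumes "finite S" "s \<in> S" "g s \<noteq> 0"
  obtains k where "(\<Sum>s\<in>S. g s ^ Suc k) \<noteq> 0"
proof (rule ccontr)
  assume "\<not> thesis"
  then have z: "(\<Sum>s\<in>S. g s ^ Suc k) = 0" for k using that by blast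
  \<comment> \<open>\<open>Q\<close> kills 0 and all values other than \<open>g s\<close>, so that
    only the indices with value \<open>g s\<close> contribute.\<close>
  define Q where "Q = [:0, 1:] * (\<Prod>v\<in>g ` S - {g s}. [:- v, 1:])"
  have Q0: "coeff Q 0 = 0" unfolding Q_def by simp
  have "(\<Sum>s\<in>S. poly Q (g s)) = (\<Sum>k\<le>degree Q. coeff Q k * (\<Sum>s\<in>S. g s ^ k))"
    unfolding poly_altdef sum_distrib_left by (rule sum.swap)
  also have "\<dots> = 0"
  proof (rule sum.neutral, intro ballI)
    show "coeff Q k * (\<Sum>s\<in>S. g s ^ k) = 0" for k
      using Q0 z by (cases k) auto
  qed
  finally have "(\<Sum>s\<in>S. poly Q (g s)) = 0" .
  moreover have "poly Q (g t) = (if g t = g s then poly Q (g s) else 0)" if "t \<in> S" for t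
    using that assms(1) unfolding Q_def by (auto simp: poly_prod prod_zero_iff)
  then have "(\<Sum>s\<in>S. poly Q (g s)) = of_nat (card {t \<in> S. g t = g s}) * poly Q (g s)"
    using assms(1) by (simp add: sum.If_cases Int_def)
  moreover have "card {t \<in> S. g t = g s} \<noteq> 0" using assms by auto
  moreover have "poly Q (g s) \<noteq> 0"
    using assms unfolding Q_def by (auto simp: poly_prod prod_zero_iff)
  ultimately show False by simp
qed

section \<open>Symmetric products of the projective line\<close>

definition vpoly :: "(nat \<Rightarrow>\<^sub>0 complex) \<Rightarrow> complex poly"
  where "vpoly v = (\<Sum>j\<in>keys v. Polynomial.monom (lookup v j) j)"

definition pvec :: "complex poly \<Rightarrow> nat \<Rightarrow>\<^sub>0 complex"
  where "pvec p = (\<Sum>j\<le>degree p. single j (coeff p j))"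

lemma coeff_vpoly [simp]: "coeff (vpoly v) j = lookup v j"
  by (auto simp: vpoly_def coeff_sum in_keys_iff if_distrib sum.delta' cong: if_cong)

lemma lookup_pvec [simp]: "lookup (pvec p) j = coeff p j"
  by (auto simp: pvec_def lookup_sum lookup_single when_def coeff_eq_0)

lemma vpoly_pvec [simp]: "vpoly (pvec p) = p"
  by (rule poly_eqI) simp

lemma pvec_vpoly [simp]: "pvec (vpoly v) = v"
  by (rule poly_mapping_eqI) simp

lemma vpoly_cscale: "vpoly (cscale c v) = Polynomial.smult c (vpoly v)"
  by (rule poly_eqI) simp

lemma vpoly_eq_0_iff [simp]: "vpoly v = 0 \<longleftrightarrow> v = 0"
  using pvec_vpoly vpoly_pvec by (metis coeff_vpoly lookup_zero poly_eqI coeff_0)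

lemma coord_space_iff: "v \<in> coord_space m \<longleftrightarrow> degree (vpoly v) \<le> m"
proof
  show "v \<in> coord_space m \<Longrightarrow> degree (vpoly v) \<le> m"
    by (rule degree_le) (auto simp: coord_space_def in_keys_iff)
  show "degree (vpoly v) \<le> m \<Longrightarrow> v \<in> coord_space m"
    using le_degree[of "vpoly v"] by (fastforce simp: coord_space_def in_keys_iff)
qed

text \<open>A point of \<open>\<P>\<^sup>m\<close> is viewed as a nonzero polynomial of degree at most \<open>m\<close> up to scaling;
  roots at infinity account for the missing degree.\<close>

definition line_poly :: "(nat \<Rightarrow>\<^sub>0 complex) set \<Rightarrow> complex poly"
  where "line_poly L = vpoly (SOME v. v \<in> L)"

definition poly_line :: "complex poly \<Rightarrow> (nat \<Rightarrow>\<^sub>0 complex) set"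
  where "poly_line p = cline (pvec p)"

abbreviation "proj_space m \<equiv> proj_points (coord_space m)"

lemma poly_line_smult: "c \<noteq> 0 \<Longrightarrow> poly_line (Polynomial.smult c p) = poly_line p"
proof -
  assume "c \<noteq> 0"
  moreover have "pvec (Polynomial.smult c p) = cscale c (pvec p)" by (rule poly_mapping_eqI) simp
  ultimately show ?thesis by (simp add: poly_line_def cline_cscale)
qed

lemma poly_line_eqE:
  assumes "poly_line p = poly_line q"
  obtains c where "c \<noteq> 0" "q = Polynomial.smult c p"
proof -
  obtain c where c: "c \<noteq> 0" "pvec q = cscale c (pvec p)"
    using assms cline_eqE unfolding poly_line_def by metis
  have "q = Polynomial.smult c p"
    by (rule poly_eqI) (use arg_cong[OF c(2), of "\<lambda>v. lookup v _"] in auto)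
  with c(1) show thesis by (rule that)
qed

lemma line_poly_poly_line:
  obtains c where "c \<noteq> 0" "line_poly (poly_line p) = Polynomial.smult c p"
proof -
  have "(SOME v. v \<in> cline (pvec p)) \<in> cline (pvec p)" by (rule someI) (rule cline_self)
  then obtain c where "c \<noteq> 0" "(SOME v. v \<in> cline (pvec p)) = cscale c (pvec p)"
    unfolding cline_def by blast
  with that show thesis by (simp add: line_poly_def poly_line_def vpoly_cscale)
qed

lemma poly_line_in_proj: "p \<noteq> 0 \<Longrightarrow> degree p \<le> m \<Longrightarrow> poly_line p \<in> proj_space m"
  unfolding poly_line_def proj_points_def
  by (auto simp: coord_space_iff intro!: exI[of _ "pvec p"]) (metis vpoly_eq_0_iff vpoly_pvec)

lemma line_poly:
  assumes "L \<in> proj_space m"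
  shows "line_poly L \<noteq> 0" "degree (line_poly L) \<le> m" "poly_line (line_poly L) = L"
proof -
  obtain v where v: "L = cline v" "v \<in> coord_space m" "v \<noteq> 0" using assms by (elim proj_pointsE)
  then have L: "L = poly_line (vpoly v)" by (simp add: poly_line_def)
  obtain c where c: "c \<noteq> 0" "line_poly L = Polynomial.smult c (vpoly v)"
    unfolding L by (rule line_poly_poly_line)
  show "line_poly L \<noteq> 0" "degree (line_poly L) \<le> m" "poly_line (line_poly L) = L"
    using c v(2,3) L by (auto simp: coord_space_iff poly_line_smult)
qed

lemma hratio_line_poly:
  assumes "L \<in> proj_space m"
  shows "hratio j i L = coeff (line_poly L) j / coeff (line_poly L) i"
  using hratio_cline[of j i "pvec (line_poly L)"] line_poly(3)[OF assms] by (simp add: poly_line_def)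

lemma hratio_poly_line: "hratio j i (poly_line p) = coeff p j / coeff p i"
  by (simp add: poly_line_def hratio_cline)

lemma proj_chart_iff: "L \<in> proj_chart (coord_space m) i \<longleftrightarrow> L \<in> proj_space m \<and> coeff (line_poly L) i \<noteq> 0"
proof (cases "L \<in> proj_space m")
  case True
  from line_poly(3)[OF True] show ?thesis
    using proj_chart_cline[of "pvec (line_poly L)" "coord_space m" i] by (simp add: poly_line_def)
qed simp

section \<open>Multiplication of linear forms\<close>

definition roots_prod :: "(nat \<Rightarrow>\<^sub>0 complex) set list \<Rightarrow> complex poly"
  where "roots_prod xs = (\<Prod>L\<leftarrow>xs. line_poly L)"

lemma roots_prod_mset: "roots_prod xs = prod_mset (image_mset line_poly (mset xs))"
  by (simp add: roots_prod_def flip: prod_mset_prod_list)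

lemma roots_prod_nth: "roots_prod xs = (\<Prod>k<length xs. line_poly (xs ! k))"
  by (simp add: roots_prod_def prod.list_conv_set_nth atLeast0LessThan)

lemma roots_prod_nonzero: "set xs \<subseteq> proj_space 1 \<Longrightarrow> roots_prod xs \<noteq> 0"
  using line_poly(1) by (induction xs) (auto simp: roots_prod_def)

lemma degree_roots_prod: "set xs \<subseteq> proj_space 1 \<Longrightarrow> degree (roots_prod xs) \<le> length xs"
proof (induction xs)
  case (Cons L xs)
  have "degree (roots_prod (L # xs)) \<le> degree (line_poly L) + degree (roots_prod xs)"
    by (simp add: roots_prod_def degree_mult_le)
  also have "\<dots> \<le> 1 + length xs"
    using Cons line_poly(2)[of L 1] by (intro add_mono) auto
  finally show ?case by simp
qed (simp add: roots_prod_def)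

lemma degree_roots_prod_eq:
  assumes "set xs \<subseteq> proj_space 1" "\<And>L. L \<in> set xs \<Longrightarrow> degree (line_poly L) = 1"
  shows "degree (roots_prod xs) = length xs"
  using assms
proof (induction xs)
  case (Cons L xs)
  then show ?case
    using line_poly(1)[of L 1] roots_prod_nonzero[of xs]
    by (simp add: roots_prod_def degree_mult_eq)
qed (simp add: roots_prod_def)

lemma linear_poly_eq:
  assumes "degree p \<le> 1"
  shows "p = [:coeff p 0, coeff p 1:]"
proof (rule poly_eqI)
  show "coeff p n = coeff [:coeff p 0, coeff p 1:] n" for n
    using assms by (cases n; cases "n - 1") (auto simp: coeff_pCons coeff_eq_0 split: nat.splits)
qed

text \<open>Induction on \<open>m\<close>: a polynomial of full degree has a root to split off; one
  of lower degree has a root at infinity and splits off the constant factor 1.\<close>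

lemma roots_prod_surj:
  assumes "q \<noteq> 0" "degree q \<le> m"
  obtains xs where "length xs = m" "set xs \<subseteq> proj_space 1" "poly_line (roots_prod xs) = poly_line q"
proof -
  have "\<exists>xs c. length xs = m \<and> set xs \<subseteq> proj_space 1 \<and> c \<noteq> 0 \<and> roots_prod xs = Polynomial.smult c q"
    using assms
  proof (induction m arbitrary: q)
    case 0
    then obtain a where "q = [:a:]" by (auto elim: degree_eq_zeroE)
    with 0 show ?case by (intro exI[of _ "[]"] exI[of _ "inverse a"]) (auto simp: roots_prod_def one_pCons)
  next
    case (Suc m)
    have ext: ?case if q: "q = l * q'" "q' \<noteq> 0" "degree q' \<le> m" "l \<noteq> 0" "degree l \<le> 1" for l q'
    proof -
      obtain xs c where xs: "length xs = m" "set xs \<subseteq> proj_space 1" "c \<noteq> 0" "roots_prod xs = Polynomial.smult c q'"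
        using Suc.IH[OF q(2,3)] by blast
      obtain b where b: "b \<noteq> 0" "line_poly (poly_line l) = Polynomial.smult b l"
        by (rule line_poly_poly_line)
      show ?case
        by (rule exI[of _ "poly_line l # xs"], rule exI[of _ "b * c"])
          (use xs b q poly_line_in_proj[OF q(4,5)] in \<open>auto simp: roots_prod_def mult.commute\<close>)
    qed
    show ?case
    proof (cases "degree q \<le> m")
      case True
      show ?thesis by (rule ext[of 1 q]) (use True Suc in auto)
    next
      case False
      then have "\<not> constant (poly q)" by (auto simp: constant_degree)
      then obtain z where "poly q z = 0" using fundamental_theorem_of_algebra by blast
      then obtain q' where q': "q = [:- z, 1:] * q'" by (auto simp: poly_eq_0_iff_dvd dvd_def)
      have "q' \<noteq> 0" using q' Suc.prems by auto
      moreover have "degree q' \<le> m"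
        using Suc.prems(2) degree_mult_eq[of "[:- z, 1:]" q'] \<open>q' \<noteq> 0\<close> unfolding q' by simp
      ultimately have "q' \<noteq> 0" "degree q' \<le> m" by auto
      then show ?thesis by (intro ext[OF q']) auto
    qed
  qed
  then obtain xs c where "length xs = m" "set xs \<subseteq> proj_space 1" "c \<noteq> 0" "roots_prod xs = Polynomial.smult c q"
    by blast
  then show thesis using that poly_line_smult by metis
qed

text \<open>Two nonzero vectors of C^2 with vanishing determinant are proportional.\<close>

lemma line_eq_of_common_root:
  assumes "L \<in> proj_space 1" "L' \<in> proj_space 1"
    "coeff (line_poly L) 0 * coeff (line_poly L') 1 = coeff (line_poly L) 1 * coeff (line_poly L') 0"
  shows "L = L'"
proof -
  obtain a b where ab: "line_poly L = [:a, b:]"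
    using linear_poly_eq[OF line_poly(2)[OF assms(1)]] by blast
  obtain a' b' where ab': "line_poly L' = [:a', b':]"
    using linear_poly_eq[OF line_poly(2)[OF assms(2)]] by blast
  have nz: "a \<noteq> 0 \<or> b \<noteq> 0" "a' \<noteq> 0 \<or> b' \<noteq> 0"
    using line_poly(1)[OF assms(1)] line_poly(1)[OF assms(2)] ab ab' by auto
  have e: "a * b' = b * a'" using assms(3) ab ab' by simp
  define c where "c = (if a = 0 then b' / b else a' / a)"
  have "c \<noteq> 0" "line_poly L' = Polynomial.smult c (line_poly L)"
    using nz e unfolding ab ab' c_def by (auto simp: field_simps)
  then show ?thesis
    using line_poly(3)[OF assms(1)] line_poly(3)[OF assms(2)] poly_line_smult by metis
qed

text \<open>The first point of \<open>xs\<close> recurs in \<open>ys\<close>: a point at infinity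
  shows up as a defect of the degree, a finite one as a root of the product. Then its factor
  cancels.\<close>

lemma roots_prod_inj:
  assumes "length xs = length ys" "set xs \<subseteq> proj_space 1" "set ys \<subseteq> proj_space 1"
    "c \<noteq> 0" "roots_prod xs = Polynomial.smult c (roots_prod ys)"
  shows "mset xs = mset ys"
  using assms
proof (induction xs arbitrary: ys)
  case (Cons L xs)
  have L: "L \<in> proj_space 1" and ys: "set ys \<subseteq> proj_space 1" using Cons.prems by auto
  have "L \<in> set ys"
  proof (cases "degree (line_poly L) = 0")
    case True
    have "degree (roots_prod (L # xs)) \<le> degree (line_poly L) + degree (roots_prod xs)"
      by (simp add: roots_prod_def degree_mult_le)
    then have "degree (roots_prod ys) \<noteq> length ys"
      using Cons.prems degree_roots_prod[of xs] True by auto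
    then obtain L' where L': "L' \<in> set ys" "degree (line_poly L') \<noteq> 1"
      using degree_roots_prod_eq[OF ys] by blast
    then have "degree (line_poly L') = 0" using line_poly(2)[of L' 1] ys by fastforce
    then have "L = L'"
      using True L L' ys by (intro line_eq_of_common_root) (auto simp: coeff_eq_0)
    with L' show ?thesis by simp
  next
    case False
    then have "degree (line_poly L) = 1" using line_poly(2)[OF L] by simp
    then have b: "coeff (line_poly L) 1 \<noteq> 0" by (metis leading_coeff_0_iff degree_0 zero_neq_one)
    define z where "z = - coeff (line_poly L) 0 / coeff (line_poly L) 1"
    have p: "poly (line_poly M) x = coeff (line_poly M) 0 + coeff (line_poly M) 1 * x"
      if "M \<in> proj_space 1" for M x
      by (subst linear_poly_eq[OF line_poly(2)[OF that]]) simp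
    have "poly (line_poly L) z = 0" using b by (simp add: p[OF L] z_def)
    then have "poly (roots_prod (L # xs)) z = 0" by (simp add: roots_prod_def)
    then have "poly (roots_prod ys) z = 0" using Cons.prems by simp
    then obtain k where "k < length ys" "poly (line_poly (ys ! k)) z = 0"
      unfolding roots_prod_nth poly_prod by auto
    then obtain L' where L': "L' \<in> set ys" "poly (line_poly L') z = 0" using nth_mem by blast
    then have "L' \<in> proj_space 1" using ys by blast
    then have "L = L'"
      using L' b L by (intro line_eq_of_common_root) (auto simp: p z_def field_simps)
    with L' show ?thesis by simp
  qed
  then have m: "mset ys = add_mset L (mset (remove1 L ys))" by simp
  have eq: "roots_prod ys = line_poly L * roots_prod (remove1 L ys)"
    unfolding roots_prod_mset by (subst m) (simp only: image_mset_add_mset prod_mset.add_mset)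
  have "mset xs = mset (remove1 L ys)"
  proof (rule Cons.IH)
    show "length xs = length (remove1 L ys)"
      using Cons.prems(1) \<open>L \<in> set ys\<close> by (simp add: length_remove1)
    show "set (remove1 L ys) \<subseteq> proj_space 1" using ys set_remove1_subset by fast
    have "line_poly L * roots_prod xs = line_poly L * Polynomial.smult c (roots_prod (remove1 L ys))"
      using Cons.prems(5) unfolding eq by (simp add: roots_prod_def)
    then show "roots_prod xs = Polynomial.smult c (roots_prod (remove1 L ys))"
      using line_poly(1)[OF L] by (simp only: mult_cancel_left) simp
  qed (use Cons.prems in auto)
  then have "mset (L # xs) = add_mset L (mset (remove1 L ys))" by (simp only: mset.simps)
  also have "\<dots> = mset ys" by (rule m[symmetric])
  finally show ?case .
qed auto

definition mult_map :: "(nat \<Rightarrow>\<^sub>0 complex) set list \<Rightarrow> (nat \<Rightarrow>\<^sub>0 complex) set"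
  where "mult_map xs = poly_line (roots_prod xs)"

definition P1_lists :: "nat \<Rightarrow> (nat \<Rightarrow>\<^sub>0 complex) set list set"
  where "P1_lists m = {xs. length xs = m \<and> set xs \<subseteq> proj_space 1}"

lemma mult_map_in_proj: "xs \<in> P1_lists m \<Longrightarrow> mult_map xs \<in> proj_space m"
  unfolding mult_map_def P1_lists_def
  using degree_roots_prod roots_prod_nonzero by (intro poly_line_in_proj) auto

lemma mult_map_eq_iff:
  assumes "xs \<in> P1_lists m" "ys \<in> P1_lists m"
  shows "mult_map xs = mult_map ys \<longleftrightarrow> mset xs = mset ys"
proof
  assume "mult_map xs = mult_map ys"
  then obtain c where "c \<noteq> 0" "roots_prod ys = Polynomial.smult c (roots_prod xs)"
    unfolding mult_map_def by (rule poly_line_eqE)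
  then show "mset xs = mset ys"
    using roots_prod_inj[of ys xs c] assms unfolding P1_lists_def by simp
qed (simp add: mult_map_def roots_prod_mset)

text \<open>A set-theoretic section of \<open>mult_map\<close> without any regularity; only data
  independent of the order of the list will matter.\<close>

definition some_roots :: "nat \<Rightarrow> (nat \<Rightarrow>\<^sub>0 complex) set \<Rightarrow> (nat \<Rightarrow>\<^sub>0 complex) set list"
  where "some_roots m L = (SOME xs. xs \<in> P1_lists m \<and> mult_map xs = L)"

lemma some_roots:
  assumes "L \<in> proj_space m"
  shows "some_roots m L \<in> P1_lists m" "mult_map (some_roots m L) = L"
proof -
  obtain xs where "length xs = m" "set xs \<subseteq> proj_space 1"
    "poly_line (roots_prod xs) = poly_line (line_poly L)"
    using roots_prod_surj[OF line_poly(1,2)[OF assms]] by blast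
  then have "\<exists>xs. xs \<in> P1_lists m \<and> mult_map xs = L"
    using line_poly(3)[OF assms] unfolding P1_lists_def mult_map_def by auto
  from someI_ex[OF this] show "some_roots m L \<in> P1_lists m" "mult_map (some_roots m L) = L"
    unfolding some_roots_def by auto
qed

section \<open>Charts of powers of the projective line\<close>

abbreviation P1_power :: "nat \<Rightarrow> (nat \<Rightarrow>\<^sub>0 complex) set list atlas"
  where "P1_power m \<equiv> power_atlas m (proj_atlas (coord_space 1))"

definition power_chart :: "nat \<Rightarrow> (nat \<Rightarrow> nat) \<Rightarrow> (nat \<Rightarrow>\<^sub>0 complex) set list set"
  where "power_chart m I = {xs. length xs = m \<and> (\<forall>k<m. xs ! k \<in> proj_chart (coord_space 1) (I k))}"

definition power_coords :: "nat \<Rightarrow> (nat \<Rightarrow> nat) \<Rightarrow> ((nat \<Rightarrow>\<^sub>0 complex) set list \<Rightarrow> complex) set"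
  where "power_coords m I = {\<lambda>xs. hratio j (I k) (xs ! k) | j k. k < m}"

lemma P1_power_iff: "(D, A) \<in> P1_power m \<longleftrightarrow> (\<exists>I. D = power_chart m I \<and> A = power_coords m I)"
proof
  assume "(D, A) \<in> P1_power m"
  then obtain cs where cs: "length cs = m" "set cs \<subseteq> proj_atlas (coord_space 1)"
    "D = {xs. length xs = m \<and> (\<forall>i<m. xs ! i \<in> fst (cs ! i))}"
    "A = {\<lambda>xs. a (xs ! i) | a i. i < m \<and> a \<in> snd (cs ! i)}"
    unfolding power_atlas_def by blast
  have "\<forall>k. \<exists>i. k < m \<longrightarrow> cs ! k = (proj_chart (coord_space 1) i, proj_coords i)"
    using cs(1,2) nth_mem unfolding proj_atlas_def by blast
  from choice[OF this] obtain I
    where I: "\<And>k. k < m \<Longrightarrow> cs ! k = (proj_chart (coord_space 1) (I k), proj_coords (I k))" by blast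
  have "D = power_chart m I" unfolding cs(3) power_chart_def using I by auto
  moreover have "A = power_coords m I" unfolding cs(4) power_coords_def using I by fastforce
  ultimately show "\<exists>I. D = power_chart m I \<and> A = power_coords m I" by blast
next
  assume "\<exists>I. D = power_chart m I \<and> A = power_coords m I"
  then obtain I where I: "D = power_chart m I" "A = power_coords m I" by blast
  let ?cs = "map (\<lambda>k. (proj_chart (coord_space 1) (I k), proj_coords (I k))) [0..<m]"
  have "set ?cs \<subseteq> proj_atlas (coord_space 1)" using proj_chart_in_atlas by auto
  moreover have "D = {xs. length xs = m \<and> (\<forall>i<m. xs ! i \<in> fst (?cs ! i))}"
    unfolding I power_chart_def by auto
  moreover have "A = {\<lambda>xs. a (xs ! i) | a i. i < m \<and> a \<in> snd (?cs ! i)}"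
    unfolding I power_coords_def by fastforce
  ultimately show "(D, A) \<in> P1_power m"
    unfolding power_atlas_def by (intro CollectI exI[of _ ?cs]) auto
qed

lemma power_chart_subset: "power_chart m I \<subseteq> P1_lists m"
  unfolding power_chart_def P1_lists_def by (auto simp: in_set_conv_nth)

lemma topspace_P1_power: "topspace (zariski_of (P1_power m)) = P1_lists m"
proof
  show "topspace (zariski_of (P1_power m)) \<subseteq> P1_lists m"
    unfolding topspace_zariski_of
  proof clarify
    fix xs D A assume "(D, A) \<in> P1_power m" "xs \<in> D"
    then show "xs \<in> P1_lists m" unfolding P1_power_iff using power_chart_subset by auto
  qed
  show "P1_lists m \<subseteq> topspace (zariski_of (P1_power m))"
  proof
    fix xs assume xs: "xs \<in> P1_lists m"
    have "\<forall>k. \<exists>i. k < m \<longrightarrow> xs ! k \<in> proj_chart (coord_space 1) i"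
    proof
      fix k
      show "\<exists>i. k < m \<longrightarrow> xs ! k \<in> proj_chart (coord_space 1) i"
      proof (cases "k < m")
      case True
      then have "xs ! k \<in> proj_space 1" using xs unfolding P1_lists_def by auto
      then show ?thesis by (rule proj_points_chart) blast
      qed simp
    qed
    from choice[OF this] obtain I where "\<And>k. k < m \<Longrightarrow> xs ! k \<in> proj_chart (coord_space 1) (I k)" by blast
    then have "xs \<in> power_chart m I" using xs unfolding power_chart_def P1_lists_def by auto
    then show "xs \<in> topspace (zariski_of (P1_power m))"
      unfolding topspace_zariski_of using P1_power_iff by blast
  qed
qed

lemma poly_funs_coeff_prod_linear:
  assumes "\<And>k. k \<in> K \<Longrightarrow> f k \<in> poly_funs A" "\<And>k. k \<in> K \<Longrightarrow> g k \<in> poly_funs A"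
  shows "(\<lambda>x. coeff (\<Prod>k\<in>K. [:f k x, g k x:]) j) \<in> poly_funs A"
  using assms
proof (induction K arbitrary: j rule: infinite_finite_induct)
  case (insert k K)
  have "coeff (\<Prod>k\<in>insert k K. [:f k x, g k x:]) j = f k x * coeff (\<Prod>k\<in>K. [:f k x, g k x:]) j +
      (case j of 0 \<Rightarrow> 0 | Suc j' \<Rightarrow> g k x * coeff (\<Prod>k\<in>K. [:f k x, g k x:]) j')" for x
    using insert.hyps by (simp add: coeff_pCons split: nat.splits)
  then show ?case
    using insert by (cases j) (auto intro!: poly_funs.mult poly_funs.add)
qed (simp_all add: poly_funs.const)

lemma morphism_mult_map: "morphism (P1_power m) (proj_atlas (coord_space m)) mult_map"
  unfolding morphism_def topspace_P1_power topspace_proj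
proof (intro conjI ballI allI impI mult_map_in_proj)
  fix xs D' A'
  assume xs: "xs \<in> P1_lists m" and DA': "(D', A') \<in> proj_atlas (coord_space m)" "mult_map xs \<in> D'"
  obtain i where i: "D' = proj_chart (coord_space m) i" "A' = proj_coords i"
    using DA'(1) unfolding proj_atlas_def by blast
  obtain I where I: "xs \<in> power_chart m I"
    using xs P1_power_iff unfolding topspace_P1_power[symmetric] topspace_zariski_of by blast
  let ?D = "power_chart m I" and ?A = "power_coords m I"
  have DA: "(?D, ?A) \<in> P1_power m" using P1_power_iff by blast
  \<comment> \<open>Each factor is divided by its coordinate \<open>I k\<close>, which changes the
    product by a nonzero scalar and makes its coefficients polynomials in the chart
    coordinates.\<close>
  define N where "N ys = (\<Prod>k<m. [:hratio 0 (I k) (ys ! k), hratio 1 (I k) (ys ! k):])" for ys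
  have N: "roots_prod ys = Polynomial.smult (\<Prod>k<m. coeff (line_poly (ys ! k)) (I k)) (N ys)"
    and nz: "(\<Prod>k<m. coeff (line_poly (ys ! k)) (I k)) \<noteq> 0" if "ys \<in> ?D" for ys
  proof -
    have *: "ys ! k \<in> proj_space 1" "coeff (line_poly (ys ! k)) (I k) \<noteq> 0" if "k < m" for k
      using \<open>ys \<in> ?D\<close> that unfolding power_chart_def proj_chart_iff by auto
    have "line_poly (ys ! k) = Polynomial.smult (coeff (line_poly (ys ! k)) (I k))
        [:hratio 0 (I k) (ys ! k), hratio 1 (I k) (ys ! k):]" if "k < m" for k
      by (subst linear_poly_eq[OF line_poly(2)[OF *(1)[OF that]]])
        (use * that in \<open>simp add: hratio_line_poly[of _ "Suc 0"]\<close>)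
    then have "(\<Prod>k<m. line_poly (ys ! k)) = (\<Prod>k<m. Polynomial.smult (coeff (line_poly (ys ! k)) (I k))
        [:hratio 0 (I k) (ys ! k), hratio 1 (I k) (ys ! k):])"
      by (intro prod.cong) auto
    then show "roots_prod ys = Polynomial.smult (\<Prod>k<m. coeff (line_poly (ys ! k)) (I k)) (N ys)"
      using \<open>ys \<in> ?D\<close> by (simp only: roots_prod_nth N_def power_chart_def prod_smult mem_Collect_eq)
    show "(\<Prod>k<m. coeff (line_poly (ys ! k)) (I k)) \<noteq> 0" using * by simp
  qed
  have mm: "mult_map ys = poly_line (N ys)" if "ys \<in> ?D" for ys
    unfolding mult_map_def N[OF that] by (rule poly_line_smult[OF nz[OF that]])
  have chart: "mult_map ys \<in> D' \<longleftrightarrow> coeff (N ys) i \<noteq> 0" if "ys \<in> ?D" for ys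
    using mult_map_in_proj[of ys m] power_chart_subset that
      proj_chart_cline[of "pvec (N ys)" "coord_space m" i]
    unfolding i mm[OF that] poly_line_def by auto
  have poly: "(\<lambda>ys. coeff (N ys) j) \<in> poly_funs ?A" for j
    unfolding N_def
    by (rule poly_funs_coeff_prod_linear; rule poly_funs.coord) (auto simp: power_coords_def)
  show "\<exists>D A W. (D, A) \<in> P1_power m \<and> xs \<in> D \<and> openin (zariski_of (P1_power m)) W \<and> xs \<in> W \<and>
      mult_map ` W \<subseteq> D' \<and> (\<forall>a\<in>A'. rat (P1_power m) D A xs (\<lambda>y. a (mult_map y)))"
  proof (rule exI[of _ ?D], rule exI[of _ ?A], rule exI[of _ "{ys \<in> ?D. coeff (N ys) i \<noteq> 0}"],
      intro conjI ballI DA I openin_zariski_basic[OF DA poly])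
    show "xs \<in> {ys \<in> ?D. coeff (N ys) i \<noteq> 0}" using I chart DA'(2) by auto
    show "mult_map ` {ys \<in> ?D. coeff (N ys) i \<noteq> 0} \<subseteq> D'" using chart by auto
    fix a assume "a \<in> A'"
    then obtain j where j: "a = hratio j i" unfolding i by blast
    have "rat (P1_power m) ?D ?A xs (\<lambda>ys. coeff (N ys) j / coeff (N ys) i)"
      using chart[OF I] DA'(2) by (intro rat_divide[OF DA] rat_poly[OF DA I] poly) auto
    then show "rat (P1_power m) ?D ?A xs (\<lambda>y. a (mult_map y))"
      by (rule rat_cong[OF _ openin_zariski_chart[OF DA] I]) (simp add: j mm hratio_poly_line)
  qed
qed

text \<open>The affine chart of \<open>(\<P>\<^sup>1)\<^sup>m\<close> of the points where the linear form \<open>v\<^sub>0 + \<beta> v\<^sub>1\<close> does not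
  vanish. For given points, some \<open>\<beta>\<close> works for all of them.\<close>

definition aff_coord :: "complex \<Rightarrow> nat \<Rightarrow> (nat \<Rightarrow>\<^sub>0 complex) set \<Rightarrow> complex"
  where "aff_coord \<beta> i L = coeff (line_poly L) i / poly (line_poly L) \<beta>"

definition aff_chart :: "nat \<Rightarrow> complex \<Rightarrow> (nat \<Rightarrow>\<^sub>0 complex) set list set"
  where "aff_chart m \<beta> = {xs \<in> P1_lists m. \<forall>k<m. poly (line_poly (xs ! k)) \<beta> \<noteq> 0}"

definition aff_coords :: "nat \<Rightarrow> complex \<Rightarrow> ((nat \<Rightarrow>\<^sub>0 complex) set list \<Rightarrow> complex) set"
  where "aff_coords m \<beta> = {\<lambda>xs. aff_coord \<beta> 1 (xs ! k) | k. k < m}"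

lemma poly_line_poly_P1:
  "L \<in> proj_space 1 \<Longrightarrow> poly (line_poly L) x = coeff (line_poly L) 0 + coeff (line_poly L) 1 * x"
  by (subst linear_poly_eq[OF line_poly(2)]) auto

text \<open>The two coordinates satisfy a_0 + \<beta> a_1 = 1, and those of higher index
  vanish.\<close>

lemma aff_coord_poly:
  obtains p where "p \<in> poly_funs (aff_coords m \<beta>)"
    "\<And>xs. xs \<in> aff_chart m \<beta> \<Longrightarrow> k < m \<Longrightarrow> p xs = aff_coord \<beta> i (xs ! k)"
proof (cases "k < m")
  case True
  have c1: "(\<lambda>xs. aff_coord \<beta> 1 (xs ! k)) \<in> poly_funs (aff_coords m \<beta>)"
    using True by (intro poly_funs.coord) (auto simp: aff_coords_def)
  have P1: "xs ! k \<in> proj_space 1" "poly (line_poly (xs ! k)) \<beta> \<noteq> 0" if "xs \<in> aff_chart m \<beta>" for xs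
    using that True unfolding aff_chart_def P1_lists_def by (auto simp: subset_iff)
  consider "i = 0" | "i = 1" | "i > 1" by linarith
  then show thesis
  proof cases
    case 1
    show thesis
    proof (rule that)
      show "(\<lambda>xs. 1 - \<beta> * aff_coord \<beta> 1 (xs ! k)) \<in> poly_funs (aff_coords m \<beta>)"
        by (intro poly_funs_diff poly_funs.const poly_funs_cmult c1)
      show "1 - \<beta> * aff_coord \<beta> 1 (xs ! k) = aff_coord \<beta> i (xs ! k)" if "xs \<in> aff_chart m \<beta>" for xs
        using P1[OF that] unfolding 1 aff_coord_def by (simp add: field_simps poly_line_poly_P1)
    qed
  next
    case 2
    with c1 show thesis by (intro that) auto
  next
    case 3
    have "coeff (line_poly (xs ! k)) i = 0" if "xs \<in> aff_chart m \<beta>" for xs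
      using line_poly(2)[OF P1(1)[OF that]] 3 by (simp add: coeff_eq_0)
    then show thesis by (intro that[of "\<lambda>_. 0"]) (auto simp: aff_coord_def poly_funs.const)
  qed
next
  case False
  then show thesis by (intro that[of "\<lambda>_. 0"]) (auto intro: poly_funs.const)
qed

text \<open>This product is what has to be inverted to pass from the affine chart to
  \<open>power_chart m I\<close>; the next lemma identifies its nonvanishing locus.\<close>

lemma aff_denominator:
  obtains \<Delta> where "\<Delta> \<in> poly_funs (aff_coords m \<beta>)"
    "\<And>xs. xs \<in> aff_chart m \<beta> \<Longrightarrow> \<Delta> xs = (\<Prod>k<m. aff_coord \<beta> (I k) (xs ! k))"
proof -
  have "\<forall>k. \<exists>p. p \<in> poly_funs (aff_coords m \<beta>) \<and>
      (\<forall>xs\<in>aff_chart m \<beta>. k < m \<longrightarrow> p xs = aff_coord \<beta> (I k) (xs ! k))"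
  proof
    fix k
    obtain p where "p \<in> poly_funs (aff_coords m \<beta>)"
      "\<And>xs. xs \<in> aff_chart m \<beta> \<Longrightarrow> k < m \<Longrightarrow> p xs = aff_coord \<beta> (I k) (xs ! k)"
      using aff_coord_poly[of m \<beta> k "I k"] by blast
    then show "\<exists>p. p \<in> poly_funs (aff_coords m \<beta>) \<and>
      (\<forall>xs\<in>aff_chart m \<beta>. k < m \<longrightarrow> p xs = aff_coord \<beta> (I k) (xs ! k))" by blast
  qed
  from choice[OF this] obtain p where p: "\<And>k. p k \<in> poly_funs (aff_coords m \<beta>)"
    "\<And>k xs. xs \<in> aff_chart m \<beta> \<Longrightarrow> k < m \<Longrightarrow> p k xs = aff_coord \<beta> (I k) (xs ! k)" by blast
  show thesis
    by (rule that[of "\<lambda>xs. \<Prod>k<m. p k xs"]) (use p in \<open>auto intro: poly_funs_prod\<close>)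
qed

lemma aff_denominator_nonzero:
  assumes "xs \<in> aff_chart m \<beta>"
  shows "(\<Prod>k<m. aff_coord \<beta> (I k) (xs ! k)) \<noteq> 0 \<longleftrightarrow> xs \<in> power_chart m I"
  using assms unfolding aff_chart_def power_chart_def proj_chart_iff P1_lists_def
  by (auto simp: aff_coord_def subset_iff)

text \<open>Multiplying a ratio of coordinates of the k-th point by the product of the
  \<open>aff_coord \<beta> (I k)\<close> only replaces the k-th factor by another coordinate. Sums
  are brought to a common exponent.\<close>

lemma clear_denominators:
  assumes "p \<in> poly_funs (power_coords m I)"
  obtains P N where "P \<in> poly_funs (aff_coords m \<beta>)"
    "\<And>xs. xs \<in> aff_chart m \<beta> \<Longrightarrow> xs \<in> power_chart m I \<Longrightarrow>
      P xs = p xs * (\<Prod>k<m. aff_coord \<beta> (I k) (xs ! k)) ^ N"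
proof -
  let ?\<delta> = "\<lambda>xs. \<Prod>k<m. aff_coord \<beta> (I k) (xs ! k)"
  obtain \<Delta> where \<Delta>: "\<Delta> \<in> poly_funs (aff_coords m \<beta>)"
    "\<And>xs. xs \<in> aff_chart m \<beta> \<Longrightarrow> \<Delta> xs = ?\<delta> xs" using aff_denominator[of m \<beta> I] by blast
  have "\<exists>P\<in>poly_funs (aff_coords m \<beta>). \<exists>N. \<forall>xs\<in>aff_chart m \<beta> \<inter> power_chart m I. P xs = p xs * ?\<delta> xs ^ N"
    using assms
  proof (induction p rule: poly_funs.induct)
    case (const c)
    show ?case by (rule bexI[of _ "\<lambda>_. c"], rule exI[of _ 0]) (auto intro: poly_funs.const)
  next
    case (coord a)
    then obtain j k where a: "a = (\<lambda>xs. hratio j (I k) (xs ! k))" "k < m"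
      unfolding power_coords_def by blast
    obtain p where p: "p \<in> poly_funs (aff_coords m \<beta>)"
      "\<And>xs. xs \<in> aff_chart m \<beta> \<Longrightarrow> p xs = (\<Prod>k'<m. aff_coord \<beta> ((I(k := j)) k') (xs ! k'))"
      using aff_denominator[of m \<beta> "I(k := j)"] by blast
    have "p xs = a xs * ?\<delta> xs ^ 1" if xs: "xs \<in> aff_chart m \<beta> \<inter> power_chart m I" for xs
    proof -
      have "xs ! k \<in> proj_space 1" "coeff (line_poly (xs ! k)) (I k) \<noteq> 0"
        using xs a(2) unfolding power_chart_def proj_chart_iff by auto
      then have "a xs * aff_coord \<beta> (I k) (xs ! k) = aff_coord \<beta> j (xs ! k)"
        unfolding a(1) by (simp add: aff_coord_def hratio_line_poly)
      then show ?thesis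
        using xs a(2) by (simp add: p prod.remove[of "{..<m}" k] mult.assoc[symmetric])
    qed
    with p(1) show ?case by blast
  next
    case (add p q)
    from add.IH(1) obtain P N where P: "P \<in> poly_funs (aff_coords m \<beta>)"
      "\<forall>xs\<in>aff_chart m \<beta> \<inter> power_chart m I. P xs = p xs * ?\<delta> xs ^ N" by blast
    from add.IH(2) obtain Q M where Q: "Q \<in> poly_funs (aff_coords m \<beta>)"
      "\<forall>xs\<in>aff_chart m \<beta> \<inter> power_chart m I. Q xs = q xs * ?\<delta> xs ^ M" by blast
    show ?case
    proof (rule bexI[of _ "\<lambda>xs. P xs * \<Delta> xs ^ M + Q xs * \<Delta> xs ^ N"], rule exI[of _ "N + M"], intro ballI)
      show "P xs * \<Delta> xs ^ M + Q xs * \<Delta> xs ^ N = (p xs + q xs) * ?\<delta> xs ^ (N + M)"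
        if "xs \<in> aff_chart m \<beta> \<inter> power_chart m I" for xs
        using P(2) Q(2) that \<Delta>(2) by (simp add: power_add distrib_right mult_ac)
    qed (intro poly_funs.add poly_funs.mult poly_funs_power P(1) Q(1) \<Delta>)
  next
    case (mult p q)
    from mult.IH(1) obtain P N where P: "P \<in> poly_funs (aff_coords m \<beta>)"
      "\<forall>xs\<in>aff_chart m \<beta> \<inter> power_chart m I. P xs = p xs * ?\<delta> xs ^ N" by blast
    from mult.IH(2) obtain Q M where Q: "Q \<in> poly_funs (aff_coords m \<beta>)"
      "\<forall>xs\<in>aff_chart m \<beta> \<inter> power_chart m I. Q xs = q xs * ?\<delta> xs ^ M" by blast
    show ?case
    proof (rule bexI[of _ "\<lambda>xs. P xs * Q xs"], rule exI[of _ "N + M"], intro ballI)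
      show "P xs * Q xs = p xs * q xs * ?\<delta> xs ^ (N + M)"
        if "xs \<in> aff_chart m \<beta> \<inter> power_chart m I" for xs
        using P(2) Q(2) that by (simp add: power_add mult_ac)
    qed (intro poly_funs.mult P(1) Q(1))
  qed
  then show thesis using that by blast
qed

text \<open>In the affine chart a single nonvanishing function cuts out a neighbourhood:
  intersections correspond to products, and a basic open set of another chart is handled by clearing
  denominators and multiplying by the function that cuts out that chart.\<close>

lemma aff_basic_nbhd:
  assumes "openin (zariski_of (P1_power m)) W" "xs \<in> W" "xs \<in> aff_chart m \<beta>"
  obtains H where "H \<in> poly_funs (aff_coords m \<beta>)" "H xs \<noteq> 0"
    "\<And>ys. ys \<in> aff_chart m \<beta> \<Longrightarrow> H ys \<noteq> 0 \<Longrightarrow> ys \<in> W"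
proof -
  have "generate_topology_on {{x \<in> D. q x \<noteq> 0} | D A q. (D, A) \<in> P1_power m \<and> q \<in> poly_funs A} W"
    using assms(1) unfolding zariski_of_def by (rule openin_topology_generated_by)
  then have "\<exists>H\<in>poly_funs (aff_coords m \<beta>). H xs \<noteq> 0 \<and>
      (\<forall>ys\<in>aff_chart m \<beta>. H ys \<noteq> 0 \<longrightarrow> ys \<in> W)"
    using assms(2)
  proof induction
    case (Int U V)
    obtain G H where "G \<in> poly_funs (aff_coords m \<beta>)" "G xs \<noteq> 0"
      "\<forall>ys\<in>aff_chart m \<beta>. G ys \<noteq> 0 \<longrightarrow> ys \<in> U"
      "H \<in> poly_funs (aff_coords m \<beta>)" "H xs \<noteq> 0" "\<forall>ys\<in>aff_chart m \<beta>. H ys \<noteq> 0 \<longrightarrow> ys \<in> V"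
      using Int by blast
    then show ?case
      by (intro bexI[of _ "\<lambda>ys. G ys * H ys"]) (auto intro: poly_funs.mult)
  next
    case (UN K)
    then show ?case by (meson UnionE UnionI)
  next
    case (Basis U)
    then obtain I q where U: "U = {x \<in> power_chart m I. q x \<noteq> 0}" "q \<in> poly_funs (power_coords m I)"
      unfolding P1_power_iff by blast
    let ?\<delta> = "\<lambda>xs. \<Prod>k<m. aff_coord \<beta> (I k) (xs ! k)"
    obtain \<Delta> where \<Delta>: "\<Delta> \<in> poly_funs (aff_coords m \<beta>)"
      "\<And>xs. xs \<in> aff_chart m \<beta> \<Longrightarrow> \<Delta> xs = ?\<delta> xs" using aff_denominator[of m \<beta> I] by blast
    obtain Q N where Q: "Q \<in> poly_funs (aff_coords m \<beta>)"
      "\<And>xs. xs \<in> aff_chart m \<beta> \<Longrightarrow> xs \<in> power_chart m I \<Longrightarrow> Q xs = q xs * ?\<delta> xs ^ N"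
      using clear_denominators[OF U(2), of \<beta>] by metis
    show ?case
    proof (rule bexI[of _ "\<lambda>ys. Q ys * \<Delta> ys"], intro conjI ballI impI)
      have "?\<delta> xs \<noteq> 0" "xs \<in> power_chart m I" "q xs \<noteq> 0"
        using Basis.prems U(1) aff_denominator_nonzero[OF assms(3)] by auto
      then show "Q xs * \<Delta> xs \<noteq> 0" using Q(2)[OF assms(3)] \<Delta>(2)[OF assms(3)] by simp
      fix ys assume ys: "ys \<in> aff_chart m \<beta>" "Q ys * \<Delta> ys \<noteq> 0"
      then have "ys \<in> power_chart m I" using \<Delta>(2) aff_denominator_nonzero by (metis mult_zero_right)
      then show "ys \<in> U" using ys Q(2) U(1) by auto
    qed (intro poly_funs.mult Q \<Delta>)
  qed auto
  then show thesis using that by blast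
qed

text \<open>The factor \<open>H\<close> makes both sides vanish outside the locus where the fraction
  is known, so the identity holds on the whole affine chart. This matters because it will be applied
  to all permutations of a list, and these need not stay where the fraction was given.\<close>

lemma aff_fraction:
  assumes "openin (zariski_of (P1_power m)) W" "F \<in> regular (variety_of (P1_power m)) W"
    "xs \<in> W" "xs \<in> aff_chart m \<beta>"
  obtains a b where "a \<in> poly_funs (aff_coords m \<beta>)" "b \<in> poly_funs (aff_coords m \<beta>)" "a xs \<noteq> 0"
    "\<And>ys. ys \<in> aff_chart m \<beta> \<Longrightarrow> F ys * a ys = b ys"
    "\<And>ys. ys \<in> aff_chart m \<beta> \<Longrightarrow> a ys \<noteq> 0 \<Longrightarrow> ys \<in> W"
proof -
  obtain I where "rat (P1_power m) (power_chart m I) (power_coords m I) xs F"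
    using assms(2,3) unfolding regular_variety_of_iff[OF assms(1)] P1_power_iff by blast
  then obtain V p q where V: "openin (zariski_of (P1_power m)) V" "xs \<in> V" "V \<subseteq> power_chart m I"
    "p \<in> poly_funs (power_coords m I)" "q \<in> poly_funs (power_coords m I)"
    "\<And>y. y \<in> V \<Longrightarrow> q y \<noteq> 0" "\<And>y. y \<in> V \<Longrightarrow> F y = p y / q y"
    by (rule ratE) metis
  let ?\<delta> = "\<lambda>xs. \<Prod>k<m. aff_coord \<beta> (I k) (xs ! k)"
  obtain \<Delta> where \<Delta>: "\<Delta> \<in> poly_funs (aff_coords m \<beta>)"
    "\<And>xs. xs \<in> aff_chart m \<beta> \<Longrightarrow> \<Delta> xs = ?\<delta> xs" using aff_denominator[of m \<beta> I] by blast
  obtain P N where P: "P \<in> poly_funs (aff_coords m \<beta>)"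
    "\<And>xs. xs \<in> aff_chart m \<beta> \<Longrightarrow> xs \<in> power_chart m I \<Longrightarrow> P xs = p xs * ?\<delta> xs ^ N"
    using clear_denominators[OF V(4), of \<beta>] by metis
  obtain Q M where Q: "Q \<in> poly_funs (aff_coords m \<beta>)"
    "\<And>xs. xs \<in> aff_chart m \<beta> \<Longrightarrow> xs \<in> power_chart m I \<Longrightarrow> Q xs = q xs * ?\<delta> xs ^ M"
    using clear_denominators[OF V(5), of \<beta>] by metis
  have WV: "openin (zariski_of (P1_power m)) (W \<inter> V)" "xs \<in> W \<inter> V" using assms V by auto
  obtain H where H: "H \<in> poly_funs (aff_coords m \<beta>)" "H xs \<noteq> 0"
    "\<And>ys. ys \<in> aff_chart m \<beta> \<Longrightarrow> H ys \<noteq> 0 \<Longrightarrow> ys \<in> W \<inter> V"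
    using aff_basic_nbhd[OF WV assms(4)] by metis
  show thesis
  proof (rule that[of "\<lambda>ys. H ys * (Q ys * \<Delta> ys ^ N)" "\<lambda>ys. H ys * (P ys * \<Delta> ys ^ M)"])
    have "?\<delta> xs \<noteq> 0" using aff_denominator_nonzero[OF assms(4)] V(2,3) by blast
    then show "H xs * (Q xs * \<Delta> xs ^ N) \<noteq> 0"
      using H(2) Q(2)[OF assms(4)] \<Delta>(2)[OF assms(4)] V(2,3,6) by auto
    fix ys assume ys: "ys \<in> aff_chart m \<beta>"
    show "F ys * (H ys * (Q ys * \<Delta> ys ^ N)) = H ys * (P ys * \<Delta> ys ^ M)"
    proof (cases "H ys = 0")
      case False
      then have "ys \<in> V" using H(3) ys by blast
      then have "F ys = p ys / q ys" "q ys \<noteq> 0" "ys \<in> power_chart m I" using V by auto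
      then show ?thesis by (simp add: P(2)[OF ys] Q(2)[OF ys] \<Delta>(2)[OF ys])
    qed simp
    show "ys \<in> W" if "H ys * (Q ys * \<Delta> ys ^ N) \<noteq> 0" using H(3)[OF ys] that by auto
  qed (intro poly_funs.mult poly_funs_power H P Q \<Delta>)+
qed

section \<open>Descent of functions to the symmetric quotient\<close>

abbreviation root_coords :: "complex \<Rightarrow> (nat \<Rightarrow>\<^sub>0 complex) set list \<Rightarrow> complex list"
  where "root_coords \<beta> \<equiv> map (aff_coord \<beta> 1)"

lemma aff_coords_to_list:
  assumes "g \<in> poly_funs (aff_coords m \<beta>)"
  obtains h where "h \<in> poly_funs (coord_funs m)"
    "\<And>xs. length xs = m \<Longrightarrow> g xs = h (root_coords \<beta> xs)"
proof -
  have "\<exists>h\<in>poly_funs (coord_funs m). \<forall>xs. length xs = m \<longrightarrow> g xs = h (root_coords \<beta> xs)"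
    using assms
  proof (induction g rule: poly_funs.induct)
    case (const c)
    show ?case by (rule bexI[of _ "\<lambda>_. c"]) (auto intro: poly_funs.const)
  next
    case (coord a)
    then obtain k where "a = (\<lambda>xs. aff_coord \<beta> 1 (xs ! k))" "k < m" unfolding aff_coords_def by blast
    then show ?case
      by (intro bexI[of _ "\<lambda>ts. ts ! k"]) (auto intro!: poly_funs.coord simp: coord_funs_def)
  next
    case (add p q)
    then obtain f g where "f \<in> poly_funs (coord_funs m)" "g \<in> poly_funs (coord_funs m)"
      "\<forall>xs. length xs = m \<longrightarrow> p xs = f (root_coords \<beta> xs)"
      "\<forall>xs. length xs = m \<longrightarrow> q xs = g (root_coords \<beta> xs)" by blast
    then show ?case
      by (intro bexI[of _ "\<lambda>ts. f ts + g ts"]) (auto intro: poly_funs.add)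
  next
    case (mult p q)
    then obtain f g where "f \<in> poly_funs (coord_funs m)" "g \<in> poly_funs (coord_funs m)"
      "\<forall>xs. length xs = m \<longrightarrow> p xs = f (root_coords \<beta> xs)"
      "\<forall>xs. length xs = m \<longrightarrow> q xs = g (root_coords \<beta> xs)" by blast
    then show ?case
      by (intro bexI[of _ "\<lambda>ts. f ts * g ts"]) (auto intro: poly_funs.mult)
  qed
  then show thesis using that by blast
qed

definition shuffle :: "nat list \<Rightarrow> 'a list \<Rightarrow> 'a list"
  where "shuffle is xs = map ((!) xs) is"

lemma mset_shuffle:
  assumes "is \<in> dlists (length xs) (length xs)"
  shows "mset (shuffle is xs) = mset xs"
proof -
  have "set is = {..<length xs}"
    using assms card_subset_eq[of "{..<length xs}" "set is"] distinct_card[of "is"]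
    by (auto simp: dlists_def)
  then have "mset is = mset [0..<length xs]"
    using assms by (intro set_eq_iff_mset_eq_distinct[THEN iffD1]) (auto simp: dlists_def atLeast0LessThan)
  then have "mset (shuffle is xs) = image_mset ((!) xs) (mset [0..<length xs])"
    unfolding shuffle_def mset_map by simp
  also have "\<dots> = mset (map ((!) xs) [0..<length xs])" by simp
  finally show ?thesis by (simp only: map_nth)
qed

lemma shuffle_P1_lists:
  assumes "xs \<in> P1_lists m" "is \<in> dlists m m"
  shows "shuffle is xs \<in> P1_lists m" "mult_map (shuffle is xs) = mult_map xs"
proof -
  have m: "mset (shuffle is xs) = mset xs"
    using assms by (intro mset_shuffle) (auto simp: P1_lists_def)
  then have "set (shuffle is xs) = set xs" "length (shuffle is xs) = length xs"
    using mset_eq_setD mset_eq_length by blast+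
  then show "shuffle is xs \<in> P1_lists m" using assms by (simp add: P1_lists_def)
  show "mult_map (shuffle is xs) = mult_map xs" unfolding mult_map_def roots_prod_mset m ..
qed

lemma shuffle_aff_chart:
  assumes "xs \<in> aff_chart m \<beta>" "is \<in> dlists m m"
  shows "shuffle is xs \<in> aff_chart m \<beta>"
proof -
  have "\<forall>k<m. shuffle is xs ! k = xs ! (is ! k) \<and> is ! k < m"
    using assms(2) nth_mem by (fastforce simp: dlists_def shuffle_def)
  then show ?thesis
    using assms shuffle_P1_lists[of xs m "is"] by (auto simp: aff_chart_def)
qed

lemma aff_chart_iff: "xs \<in> P1_lists m \<Longrightarrow> xs \<in> aff_chart m \<beta> \<longleftrightarrow> poly (roots_prod xs) \<beta> \<noteq> 0"
  unfolding aff_chart_def roots_prod_nth poly_prod P1_lists_def by auto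

lemma line_poly_shift:
  assumes "L \<in> proj_space 1" "poly (line_poly L) \<beta> \<noteq> 0"
  shows "pcompose (line_poly L) [:\<beta>, 1:] = Polynomial.smult (poly (line_poly L) \<beta>) [:1, aff_coord \<beta> 1 L:]"
proof -
  have "poly (line_poly L) \<beta> * aff_coord \<beta> 1 L = coeff (line_poly L) 1"
    using assms(2) by (simp add: aff_coord_def)
  then have "Polynomial.smult (poly (line_poly L) \<beta>) [:1, aff_coord \<beta> 1 L:] =
      pcompose [:coeff (line_poly L) 0, coeff (line_poly L) 1:] [:\<beta>, 1:]"
    by (simp add: poly_line_poly_P1[OF assms(1)] pcompose_pCons mult.commute)
  then show ?thesis using linear_poly_eq[OF line_poly(2)[OF assms(1)]] by simp
qed

text \<open>Expanding around \<beta> gives each linear factor a nonzero constant term; after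
  dividing by it, the coefficients of the product are the elementary symmetric functions of the
  affine coordinates.\<close>

lemma roots_prod_shift:
  assumes "xs \<in> aff_chart m \<beta>"
  shows "pcompose (roots_prod xs) [:\<beta>, 1:] =
    Polynomial.smult (poly (roots_prod xs) \<beta>) (elem_poly (root_coords \<beta> xs))"
proof -
  have "L \<in> proj_space 1 \<and> poly (line_poly L) \<beta> \<noteq> 0" if L: "L \<in> set xs" for L
  proof -
    obtain k where "k < length xs" "xs ! k = L" using L unfolding in_set_conv_nth by blast
    then show ?thesis using assms L unfolding aff_chart_def P1_lists_def by auto
  qed
  then show ?thesis
  proof (induction xs)
    case (Cons L xs)
    have r: "roots_prod (L # xs) = line_poly L * roots_prod xs" by (simp add: roots_prod_def)
    have e: "elem_poly (root_coords \<beta> (L # xs)) =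
        [:1, aff_coord \<beta> 1 L:] * elem_poly (root_coords \<beta> xs)" by (simp add: elem_poly_def)
    have "pcompose (roots_prod (L # xs)) [:\<beta>, 1:] =
        pcompose (line_poly L) [:\<beta>, 1:] * pcompose (roots_prod xs) [:\<beta>, 1:]"
      unfolding r by (rule pcompose_mult)
    also have "\<dots> = Polynomial.smult (poly (line_poly L) \<beta>) [:1, aff_coord \<beta> 1 L:] *
        Polynomial.smult (poly (roots_prod xs) \<beta>) (elem_poly (root_coords \<beta> xs))"
    proof -
      have "pcompose (roots_prod xs) [:\<beta>, 1:] =
          Polynomial.smult (poly (roots_prod xs) \<beta>) (elem_poly (root_coords \<beta> xs))"
        by (rule Cons.IH) (use Cons.prems in simp)
      moreover have "pcompose (line_poly L) [:\<beta>, 1:] =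
          Polynomial.smult (poly (line_poly L) \<beta>) [:1, aff_coord \<beta> 1 L:]"
        by (rule line_poly_shift) (use Cons.prems[of L] in simp_all)
      ultimately show ?thesis by (simp only:)
    qed
    also have "\<dots> = Polynomial.smult (poly (roots_prod (L # xs)) \<beta>)
        (elem_poly (root_coords \<beta> (L # xs)))"
      unfolding r e by (simp only: mult_smult_left mult_smult_right smult_smult poly_mult mult_ac)
    finally show ?case .
  qed (simp add: roots_prod_def elem_poly_def pcompose_1)
qed

text \<open>By \<open>roots_prod_shift\<close> these quotients are the elementary symmetric
  functions of the roots. Numerator and denominator are linear in the coefficients of the
  form.\<close>

lemma rat_elem:
  assumes "L \<in> proj_chart (coord_space m) i" "poly (line_poly L) \<beta> \<noteq> 0"
  shows "rat (proj_atlas (coord_space m)) (proj_chart (coord_space m) i) (proj_coords i) L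
    (\<lambda>L. coeff (pcompose (line_poly L) [:\<beta>, 1:]) j / poly (line_poly L) \<beta>)"
    and "openin (zariski_of (proj_atlas (coord_space m)))
      {L \<in> proj_chart (coord_space m) i. poly (line_poly L) \<beta> \<noteq> 0}"
proof -
  let ?D = "proj_chart (coord_space m) i"
  let ?num = "\<lambda>L. \<Sum>k\<le>m. hratio k i L * coeff ([:\<beta>, 1:] ^ k) j"
  let ?den = "\<lambda>L. \<Sum>k\<le>m. hratio k i L * \<beta> ^ k"
  note in_atlas = proj_chart_in_atlas[of "coord_space m" i]
  have h: "hratio k i \<in> poly_funs (proj_coords i)" for k by (rule poly_funs.coord) blast
  have p: "?num \<in> poly_funs (proj_coords i)" "?den \<in> poly_funs (proj_coords i)"
    by (intro poly_funs_sum poly_funs.mult h poly_funs.const)+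
  have eq: "coeff (pcompose (line_poly L) [:\<beta>, 1:]) j = coeff (line_poly L) i * ?num L"
    "poly (line_poly L) \<beta> = coeff (line_poly L) i * ?den L" "coeff (line_poly L) i \<noteq> 0"
    if "L \<in> ?D" for L
  proof -
    have L: "L \<in> proj_space m" "coeff (line_poly L) i \<noteq> 0"
      using that unfolding proj_chart_iff by auto
    then show "coeff (line_poly L) i \<noteq> 0" by simp
    have d: "poly (line_poly L) x = (\<Sum>k\<le>m. coeff (line_poly L) k * x ^ k)" for x
      unfolding poly_altdef
      by (rule sum.mono_neutral_left) (use line_poly(2)[OF L(1)] in \<open>auto simp: coeff_eq_0\<close>)
    then show "poly (line_poly L) \<beta> = coeff (line_poly L) i * ?den L"
      unfolding sum_distrib_left d using L by (intro sum.cong) (auto simp: hratio_line_poly)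
    have mon: "pcompose (Polynomial.monom a k) r = Polynomial.smult a (r ^ k)" for a r and k :: nat
      by (induction k) (simp_all add: monom_0 monom_Suc pcompose_pCons)
    have "pcompose (line_poly L) r = (\<Sum>k\<le>m. Polynomial.smult (coeff (line_poly L) k) (r ^ k))" for r
      by (subst poly_as_sum_of_monoms'[OF line_poly(2)[OF L(1)], symmetric]) (simp add: pcompose_sum mon)
    then show "coeff (pcompose (line_poly L) [:\<beta>, 1:]) j = coeff (line_poly L) i * ?num L"
      unfolding sum_distrib_left using L
      by (auto simp: coeff_sum hratio_line_poly intro!: sum.cong)
  qed
  have "rat (proj_atlas (coord_space m)) ?D (proj_coords i) L (\<lambda>L. ?num L / ?den L)"
    using eq(2,3)[OF assms(1)] assms(2) by (intro rat_divide[OF in_atlas] rat_poly[OF in_atlas assms(1)] p) auto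
  then show "rat (proj_atlas (coord_space m)) ?D (proj_coords i) L
      (\<lambda>L. coeff (pcompose (line_poly L) [:\<beta>, 1:]) j / poly (line_poly L) \<beta>)"
    by (rule rat_cong[OF _ openin_zariski_chart[OF in_atlas] assms(1)]) (simp add: eq)
  have "{L \<in> ?D. poly (line_poly L) \<beta> \<noteq> 0} = {L \<in> ?D. ?den L \<noteq> 0}" using eq(2,3) by auto
  then show "openin (zariski_of (proj_atlas (coord_space m))) {L \<in> ?D. poly (line_poly L) \<beta> \<noteq> 0}"
    using openin_zariski_basic[OF in_atlas p(2)] by simp
qed

text \<open>The fraction \<open>b / a\<close> representing the pullback near one list of roots is symmetrized into
  \<open>(\<Sum>\<sigma>. b\<^sub>\<sigma> a\<^sub>\<sigma>\<^sup>k) / (\<Sum>\<sigma>. a\<^sub>\<sigma>\<^sup>k\<^sup>+\<^sup>1)\<close>, which is a rational function on the quotient.\<close>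

lemma descend_along_mult_map:
  assumes W: "openin (zariski_of (P1_power m)) {xs \<in> P1_lists m. mult_map xs \<in> V}"
    and f: "f \<circ> mult_map \<in> regular (variety_of (P1_power m)) {xs \<in> P1_lists m. mult_map xs \<in> V}"
    and L: "L \<in> V" "L \<in> proj_chart (coord_space m) i"
  obtains W where "openin (zariski_of (proj_atlas (coord_space m))) W" "L \<in> W" "W \<subseteq> V"
    "rat (proj_atlas (coord_space m)) (proj_chart (coord_space m) i) (proj_coords i) L f"
proof -
  let ?D = "proj_chart (coord_space m) i" and ?At = "proj_atlas (coord_space m)"
  note in_atlas = proj_chart_in_atlas[of "coord_space m" i]
  have Lp: "L' \<in> proj_space m" if "L' \<in> ?D" for L' using that by simp
  define xs where "xs = some_roots m L"
  have xs: "xs \<in> P1_lists m" "mult_map xs = L" using some_roots[OF Lp[OF L(2)]] by (auto simp: xs_def)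
  have "finite {x. poly (roots_prod xs) x = 0}"
    using roots_prod_nonzero xs by (intro poly_roots_finite) (auto simp: P1_lists_def)
  then obtain \<beta> where \<beta>: "poly (roots_prod xs) \<beta> \<noteq> 0"
    using ex_new_if_finite[OF infinite_UNIV_char_0] by blast
  have U: "xs \<in> aff_chart m \<beta>" using aff_chart_iff[OF xs(1)] \<beta> by simp
  obtain a b where ab: "a \<in> poly_funs (aff_coords m \<beta>)" "b \<in> poly_funs (aff_coords m \<beta>)" "a xs \<noteq> 0"
    "\<And>ys. ys \<in> aff_chart m \<beta> \<Longrightarrow> (f \<circ> mult_map) ys * a ys = b ys"
    "\<And>ys. ys \<in> aff_chart m \<beta> \<Longrightarrow> a ys \<noteq> 0 \<Longrightarrow> ys \<in> {xs \<in> P1_lists m. mult_map xs \<in> V}"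
    using aff_fraction[OF W f _ U] xs L(1) by auto
  have id: "[0..<m] \<in> dlists m m" "shuffle [0..<m] xs = xs"
    using xs(1) by (auto simp: dlists_def P1_lists_def shuffle_def map_nth)
  \<comment> \<open>The sum of \<open>a\<close> over all permutations may cancel although
    \<open>a xs\<close> is nonzero; some power sum does not.\<close>
  obtain k where k: "(\<Sum>is\<in>dlists m m. a (shuffle is xs) ^ Suc k) \<noteq> 0"
    using power_sums_separate[OF finite_dlists id(1), of "\<lambda>is. a (shuffle is xs)"] ab(3) id(2) by auto
  let ?a = "\<lambda>ys. \<Sum>is\<in>dlists m m. a (shuffle is ys) ^ Suc k"
  let ?b = "\<lambda>ys. \<Sum>is\<in>dlists m m. b (shuffle is ys) * a (shuffle is ys) ^ k"
  have frac: "f (mult_map ys) * ?a ys = ?b ys" if ys: "ys \<in> aff_chart m \<beta>" for ys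
    unfolding sum_distrib_left
  proof (rule sum.cong[OF refl])
    fix "is" assume "is": "is \<in> dlists m m"
    have "f (mult_map ys) * a (shuffle is ys) = b (shuffle is ys)"
      using ab(4)[OF shuffle_aff_chart[OF ys "is"]] shuffle_P1_lists(2)[OF _ "is", of ys] ys
      by (simp add: aff_chart_def)
    then show "f (mult_map ys) * a (shuffle is ys) ^ Suc k = b (shuffle is ys) * a (shuffle is ys) ^ k"
      by (simp flip: mult.assoc)
  qed
  \<comment> \<open>A nonzero sum has a nonzero term, which places some permutation of
    \<open>ys\<close> in the preimage of \<open>V\<close>; and \<open>mult_map\<close> does not see
    permutations.\<close>
  have inV: "mult_map ys \<in> V" if ys: "ys \<in> aff_chart m \<beta>" "?a ys \<noteq> 0" for ys
  proof -
    obtain "is" where "is": "is \<in> dlists m m" "a (shuffle is ys) \<noteq> 0"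
      using ys(2) by (metis (mono_tags, lifting) power_eq_0_iff sum.neutral zero_less_Suc)
    then show ?thesis
      using ab(5)[OF shuffle_aff_chart[OF ys(1) "is"(1)]] shuffle_P1_lists(2)[OF _ "is"(1), of ys] ys(1)
      by (simp add: aff_chart_def)
  qed
  define V\<beta> where "V\<beta> = {L \<in> ?D. poly (line_poly L) \<beta> \<noteq> 0}"
  have roots: "some_roots m L' \<in> aff_chart m \<beta>" "mult_map (some_roots m L') = L'"
    "coeff (elem_poly (root_coords \<beta> (some_roots m L'))) j =
      coeff (pcompose (line_poly L') [:\<beta>, 1:]) j / poly (line_poly L') \<beta>" if L': "L' \<in> V\<beta>" for L' j
  proof -
    have L'p: "L' \<in> proj_space m" "poly (line_poly L') \<beta> \<noteq> 0" using L' unfolding V\<beta>_def by auto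
    note r = some_roots[OF L'p(1)]
    obtain c where c: "c \<noteq> 0" "line_poly L' = Polynomial.smult c (roots_prod (some_roots m L'))"
      using line_poly_poly_line[of "roots_prod (some_roots m L')"] r(2) unfolding mult_map_def by metis
    show s: "some_roots m L' \<in> aff_chart m \<beta>" using L'p(2) c by (simp add: aff_chart_iff[OF r(1)])
    show "coeff (elem_poly (root_coords \<beta> (some_roots m L'))) j =
        coeff (pcompose (line_poly L') [:\<beta>, 1:]) j / poly (line_poly L') \<beta>"
      using c L'p(2) by (simp add: pcompose_smult roots_prod_shift[OF s])
  qed (rule some_roots, use L' V\<beta>_def in simp)
  have LV: "L \<in> V\<beta>"
  proof -
    obtain c where "c \<noteq> 0" "line_poly L = Polynomial.smult c (roots_prod xs)"
      using line_poly_poly_line[of "roots_prod xs"] xs(2) unfolding mult_map_def by metis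
    then show ?thesis using \<beta> L(2) unfolding V\<beta>_def by simp
  qed
  have V\<beta>: "openin (zariski_of ?At) V\<beta>" unfolding V\<beta>_def
    using rat_elem(2)[OF L(2)] LV unfolding V\<beta>_def by blast
  \<comment> \<open>A symmetrized polynomial in the roots is a polynomial in their elementary
    symmetric functions, hence rational at \<open>L\<close> although \<open>some_roots\<close> is a
    mere choice.\<close>
  have sym: "rat ?At ?D (proj_coords i) L (\<lambda>L. \<Sum>is\<in>dlists m m. g (shuffle is (some_roots m L)))"
    if g: "g \<in> poly_funs (aff_coords m \<beta>)" for g
  proof -
    obtain h where h: "h \<in> poly_funs (coord_funs m)"
      "\<And>xs. length xs = m \<Longrightarrow> g xs = h (root_coords \<beta> xs)" using aff_coords_to_list[OF g] by blast
    obtain R where R: "R \<in> poly_funs elem_funs"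
      "\<And>ts. length ts = m \<Longrightarrow> (\<Sum>is\<in>dlists m m. h (map ((!) ts) is)) = R ts"
      using elem_rep_symmetrization[OF h(1)] unfolding elem_rep_def by blast
    have "rat ?At ?D (proj_coords i) L (\<lambda>L. R (root_coords \<beta> (some_roots m L)))"
    proof (rule rat_poly_funs[OF in_atlas L(2) R(1)])
      fix e assume "e \<in> elem_funs"
      then obtain j where j: "e = (\<lambda>ts. coeff (elem_poly ts) j)" unfolding elem_funs_def by blast
      have "poly (line_poly L) \<beta> \<noteq> 0" using LV unfolding V\<beta>_def by blast
      then show "rat ?At ?D (proj_coords i) L (\<lambda>y. e (root_coords \<beta> (some_roots m y)))"
        unfolding j by (intro rat_cong[OF rat_elem(1)[OF L(2), of \<beta> j] V\<beta> LV]) (auto simp only: roots(3))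
    qed
    then show ?thesis
    proof (rule rat_cong[OF _ V\<beta> LV])
      fix L' assume "L' \<in> V\<beta>"
      then have len: "length (some_roots m L') = m"
        using roots(1) by (auto simp: aff_chart_def P1_lists_def)
      have "R (root_coords \<beta> (some_roots m L')) =
          (\<Sum>is\<in>dlists m m. h (map ((!) (root_coords \<beta> (some_roots m L'))) is))"
        using R(2) len by simp
      also have "\<dots> = (\<Sum>is\<in>dlists m m. g (shuffle is (some_roots m L')))"
      proof (rule sum.cong[OF refl])
        fix "is" assume "is": "is \<in> dlists m m"
        have "map ((!) (root_coords \<beta> (some_roots m L'))) is =
            root_coords \<beta> (shuffle is (some_roots m L'))"
          using "is" len by (auto simp: shuffle_def dlists_def subset_iff)
        moreover have "length (shuffle is (some_roots m L')) = m"
          using "is" by (simp add: shuffle_def dlists_def)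
        ultimately show "h (map ((!) (root_coords \<beta> (some_roots m L'))) is) = g (shuffle is (some_roots m L'))"
          by (simp only: h(2))
      qed
      finally show "R (root_coords \<beta> (some_roots m L')) =
        (\<Sum>is\<in>dlists m m. g (shuffle is (some_roots m L')))" .
    qed
  qed
  have ra: "rat ?At ?D (proj_coords i) L (\<lambda>L. ?a (some_roots m L))"
    by (rule sym) (intro poly_funs_power ab)
  have rb: "rat ?At ?D (proj_coords i) L (\<lambda>L. ?b (some_roots m L))"
    by (rule sym) (intro poly_funs.mult poly_funs_power ab)
  obtain W0 where W0: "openin (zariski_of ?At) W0" "L \<in> W0" "\<And>y. y \<in> W0 \<Longrightarrow> ?a (some_roots m y) \<noteq> 0"
  proof (rule rat_nonzero[OF in_atlas ra])
    show "?a (some_roots m L) \<noteq> 0" using k unfolding xs_def .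
  qed blast
  have WV: "openin (zariski_of ?At) (W0 \<inter> V\<beta>)" "L \<in> W0 \<inter> V\<beta>" using W0 V\<beta> LV by auto
  show thesis
  proof (rule that[OF WV])
    show "W0 \<inter> V\<beta> \<subseteq> V" using inV[OF roots(1)] roots(2) W0(3) by fastforce
    have "rat ?At ?D (proj_coords i) L (\<lambda>L. ?b (some_roots m L) / ?a (some_roots m L))"
      using k unfolding xs_def by (intro rat_divide[OF in_atlas rb ra])
    then show "rat ?At ?D (proj_coords i) L f"
    proof (rule rat_cong[OF _ WV])
      fix L' assume "L' \<in> W0 \<inter> V\<beta>"
      then show "?b (some_roots m L') / ?a (some_roots m L') = f L'"
        using frac[OF roots(1), of L'] roots(2)[of L'] W0(3)[of L'] by (simp add: field_simps)
    qed
  qed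
qed

lemma open_iff_mult_map:
  assumes "V \<subseteq> proj_space m"
  shows "openin (zariski_of (proj_atlas (coord_space m))) V \<longleftrightarrow>
    openin (zariski_of (P1_power m)) {xs \<in> P1_lists m. mult_map xs \<in> V}"
proof
  show "openin (zariski_of (proj_atlas (coord_space m))) V \<Longrightarrow>
    openin (zariski_of (P1_power m)) {xs \<in> P1_lists m. mult_map xs \<in> V}"
    using openin_continuous_map_preimage[OF morphism_continuous[OF morphism_mult_map]]
    unfolding topspace_P1_power .
next
  assume W: "openin (zariski_of (P1_power m)) {xs \<in> P1_lists m. mult_map xs \<in> V}"
  \<comment> \<open>The descent lemma also produces an open neighbourhood inside \<open>V\<close>;
    the zero function suffices for that.\<close>
  have z: "(\<lambda>_. 0) \<circ> mult_map \<in> regular (variety_of (P1_power m)) {xs \<in> P1_lists m. mult_map xs \<in> V}"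
    unfolding regular_variety_of_iff[OF W]
  proof
    fix xs assume "xs \<in> {xs \<in> P1_lists m. mult_map xs \<in> V}"
    then obtain D A where "(D, A) \<in> P1_power m" "xs \<in> D"
      unfolding topspace_P1_power[symmetric] topspace_zariski_of by blast
    then show "\<exists>D A. (D, A) \<in> P1_power m \<and> rat (P1_power m) D A xs ((\<lambda>_. 0) \<circ> mult_map)"
      unfolding comp_def by (intro exI conjI rat_poly[OF _ _ poly_funs.const])
  qed
  show "openin (zariski_of (proj_atlas (coord_space m))) V"
  proof (subst openin_subopen, intro ballI)
    fix L assume L: "L \<in> V"
    then obtain i where i: "L \<in> proj_chart (coord_space m) i" using assms proj_points_chart by blast
    show "\<exists>T. openin (zariski_of (proj_atlas (coord_space m))) T \<and> L \<in> T \<and> T \<subseteq> V"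
      by (rule descend_along_mult_map[OF W z L i]) blast
  qed
qed

lemma regular_iff_mult_map:
  assumes V: "openin (zariski_of (proj_atlas (coord_space m))) V"
  shows "f \<in> regular (PP m) V \<longleftrightarrow>
    f \<circ> mult_map \<in> regular (variety_of (P1_power m)) {xs \<in> P1_lists m. mult_map xs \<in> V}"
proof
  show "f \<in> regular (PP m) V \<Longrightarrow>
    f \<circ> mult_map \<in> regular (variety_of (P1_power m)) {xs \<in> P1_lists m. mult_map xs \<in> V}"
    using morphism_regular[OF morphism_mult_map V] unfolding topspace_P1_power PP_def .
  assume f: "f \<circ> mult_map \<in> regular (variety_of (P1_power m)) {xs \<in> P1_lists m. mult_map xs \<in> V}"
  have sub: "V \<subseteq> proj_space m" using openin_subset[OF V] topspace_proj by blast
  note W = V[unfolded open_iff_mult_map[OF sub]]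
  show "f \<in> regular (PP m) V"
    unfolding PP_def regular_variety_of_iff[OF V]
  proof
    fix L assume L: "L \<in> V"
    then obtain i where i: "L \<in> proj_chart (coord_space m) i" using sub proj_points_chart by blast
    have "rat (proj_atlas (coord_space m)) (proj_chart (coord_space m) i) (proj_coords i) L f"
      by (rule descend_along_mult_map[OF W f L i])
    then show "\<exists>D A. (D, A) \<in> proj_atlas (coord_space m) \<and> rat (proj_atlas (coord_space m)) D A L f"
      using proj_chart_in_atlas[of "coord_space m" i] by blast
  qed
qed

text \<open>\<open>mult_map\<close> and \<open>mset\<close> have the same fibres, and the topology
  and the functions on both targets are determined by their pullbacks to the power of P^1.\<close>

theorem iso_PP_sym_P1: "iso_space_fun (PP m) (sym_P1 m)"
proof -
  let ?\<phi> = "\<lambda>L. mset (some_roots m L)" and ?S = "sym_P1 m"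
  have S_open: "openin (zariski ?S) U \<longleftrightarrow>
      U \<subseteq> mset ` P1_lists m \<and> openin (zariski_of (P1_power m)) {xs \<in> P1_lists m. mset xs \<in> U}" for U
    unfolding sym_P1_def sym_product_def openin_quotient_space
    by (simp add: topspace_P1_power del: One_nat_def)
  have \<phi>: "?\<phi> (mult_map xs) = mset xs" if "xs \<in> P1_lists m" for xs
    using some_roots[OF mult_map_in_proj[OF that]] that mult_map_eq_iff by blast
  have top_S: "topspace (zariski ?S) = mset ` P1_lists m"
  proof -
    have "{xs \<in> P1_lists m. mset xs \<in> mset ` P1_lists m} = P1_lists m" by auto
    then have "openin (zariski ?S) (mset ` P1_lists m)"
      unfolding S_open using openin_topspace[of "zariski_of (P1_power m)"]
      unfolding topspace_P1_power by simp
    moreover have "topspace (zariski ?S) \<subseteq> mset ` P1_lists m"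
      using S_open[THEN iffD1, OF openin_topspace] by (rule conjunct1)
    ultimately show ?thesis by (intro subset_antisym openin_subset)
  qed
  have top_P: "topspace (zariski (PP m)) = proj_space m" by (simp add: PP_def topspace_proj)
  have pre: "{xs \<in> P1_lists m. mult_map xs \<in> {L \<in> proj_space m. ?\<phi> L \<in> U}} =
      {xs \<in> P1_lists m. mset xs \<in> U}" for U
    using \<phi> mult_map_in_proj by auto
  have op: "openin (zariski (PP m)) {L \<in> proj_space m. ?\<phi> L \<in> U} \<longleftrightarrow> openin (zariski ?S) U"
    if "U \<subseteq> mset ` P1_lists m" for U
    using open_iff_mult_map[of "{L \<in> proj_space m. ?\<phi> L \<in> U}" m] that
    unfolding pre S_open by (simp add: PP_def)
  have "homeomorphic_map (zariski (PP m)) (zariski ?S) ?\<phi>"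
    unfolding homeomorphic_map_def quotient_map_def top_P top_S
  proof (intro conjI allI impI)
    show "?\<phi> ` proj_space m = mset ` P1_lists m"
    proof
      show "?\<phi> ` proj_space m \<subseteq> mset ` P1_lists m" using some_roots by blast
      show "mset ` P1_lists m \<subseteq> ?\<phi> ` proj_space m"
      proof
        fix M assume "M \<in> mset ` P1_lists m"
        then obtain xs where xs: "xs \<in> P1_lists m" "M = mset xs" by blast
        then have "M = ?\<phi> (mult_map xs)" using \<phi> by simp
        then show "M \<in> ?\<phi> ` proj_space m" using mult_map_in_proj[OF xs(1)] by (rule image_eqI)
      qed
    qed
    show "inj_on ?\<phi> (proj_space m)" 
    proof (rule inj_onI)
      fix L L' assume L: "L \<in> proj_space m" "L' \<in> proj_space m" "?\<phi> L = ?\<phi> L'"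
      then have "mult_map (some_roots m L) = mult_map (some_roots m L')"
        using mult_map_eq_iff some_roots(1) by blast
      then show "L = L'" using some_roots(2) L by simp
    qed
  qed (rule op)
  moreover have "f \<in> regular ?S U \<longleftrightarrow> f \<circ> ?\<phi> \<in> regular (PP m) {L \<in> proj_space m. ?\<phi> L \<in> U}"
    if U: "openin (zariski ?S) U" for U f
  proof -
    have U': "U \<subseteq> mset ` P1_lists m" using U S_open by blast
    have "f \<in> regular ?S U \<longleftrightarrow> f \<circ> mset \<in> regular (variety_of (P1_power m)) {xs \<in> P1_lists m. mset xs \<in> U}"
      by (simp add: sym_P1_def sym_product_def quotient_space_def topspace_P1_power del: One_nat_def)
    also have "\<dots> \<longleftrightarrow> f \<circ> ?\<phi> \<circ> mult_map \<in> regular (variety_of (P1_power m)) {xs \<in> P1_lists m. mset xs \<in> U}"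
      using U S_open by (intro regular_variety_of_cong) (auto simp: \<phi>)
    also have "\<dots> \<longleftrightarrow> f \<circ> ?\<phi> \<in> regular (PP m) {L \<in> proj_space m. ?\<phi> L \<in> U}"
      using regular_iff_mult_map[of m "{L \<in> proj_space m. ?\<phi> L \<in> U}" "f \<circ> ?\<phi>"] op[OF U'] U
      unfolding pre by (simp add: PP_def)
    finally show ?thesis .
  qed
  ultimately show ?thesis
    unfolding iso_space_fun_def top_P by blast
qed

section \<open>Ideals, forms and Hilbert functions\<close>

lemma poly_mapping_sum_single:
  fixes f :: "'a \<Rightarrow>\<^sub>0 'b::comm_monoid_add"
  assumes "finite S" "keys f \<subseteq> S"
  shows "f = (\<Sum>m\<in>S. single m (lookup f m))"
proof (rule poly_mapping_eqI)
  fix k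
  have "(\<Sum>m\<in>S. lookup f m when m = k) = (\<Sum>m\<in>S. if m = k then lookup f k else 0)"
    by (rule sum.cong) (auto simp: when_def)
  also have "\<dots> = lookup f k"
    using assms by (auto simp: in_keys_iff)
  finally show "lookup f k = lookup (\<Sum>m\<in>S. single m (lookup f m)) k"
    by (simp add: lookup_sum lookup_single)
qed

lemma single_times:
  fixes f :: cpoly
  shows "single a c * f = (\<Sum>m\<in>keys f. single (a + m) (c * lookup f m))"
  by (subst poly_mapping_sum_single[of "keys f" f]) (simp_all add: sum_distrib_left mult_single)

lemma lookup_single_times [simp]:
  fixes f :: cpoly
  shows "lookup (single a c * f) (a + b) = c * lookup f b"
proof -
  have "(\<Sum>m\<in>keys f. c * lookup f m when a + m = a + b) = (\<Sum>m\<in>keys f. if m = b then c * lookup f b else 0)"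
    by (rule sum.cong) (auto simp: when_def)
  then show ?thesis unfolding single_times lookup_sum lookup_single by (simp add: in_keys_iff)
qed

lemma lookup_single_times_0:
  fixes f :: cpoly
  assumes "\<And>b. m \<noteq> a + b"
  shows "lookup (single a c * f) m = 0"
  unfolding single_times lookup_sum lookup_single by (rule sum.neutral) (use assms in \<open>auto simp: when_def\<close>)

lemma monom_minus_single:
  "lookup m i \<noteq> 0 \<Longrightarrow> m = single i 1 + (m - single i (1::nat))" for m :: monom
  by (rule poly_mapping_eqI) (auto simp: lookup_add lookup_minus lookup_single when_def)

lemma lookup_Var_times:
  "lookup (Var i * f) m = (if lookup m i = 0 then 0 else lookup f (m - single i 1))"
proof (cases "lookup m i = 0")
  case True
  then have "m \<noteq> single i 1 + b" for b by (auto simp: lookup_add)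
  then show ?thesis using True unfolding Var_def by (simp add: lookup_single_times_0)
next
  case False
  show ?thesis
    using False lookup_single_times[of "single i 1" 1 f "m - single i 1"]
    unfolding monom_minus_single[OF False, symmetric] Var_def by simp
qed

lemma cscale_eq_times: "cscale c f = single 0 c * f" for f :: cpoly
  using lookup_single_times[of 0 c f] by (intro poly_mapping_eqI) simp

lemma cscale_add: "cscale c (f + g) = cscale c f + cscale c g"
  and cscale_diff: "cscale c (f - g) = cscale c f - cscale c g"
  and cscale_minus1: "cscale (- 1) f = - f"
  and cscale_single: "cscale c (single m a) = single m (c * a)"
  by (auto intro!: poly_mapping_eqI simp: lookup_add lookup_minus algebra_simps lookup_single when_def)

section \<open>Ideals as subspaces closed under the variables\<close>

lemma polys_Var: "i \<le> n \<Longrightarrow> Var i \<in> polys n"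
  by (auto simp: polys_def Var_def)

lemma polys_single: "keys m \<subseteq> {..n} \<Longrightarrow> single m c \<in> polys n"
  by (auto simp: polys_def)

lemma polys_cscale: "f \<in> polys n \<Longrightarrow> cscale c f \<in> polys n"
  by (auto simp: polys_def keys_cscale split: if_splits)

lemma forms_polys: "f \<in> forms n e \<Longrightarrow> f \<in> polys n"
  by (auto simp: forms_def polys_def monoms_def)

lemma cvec_subspaceI:
  "0 \<in> S \<Longrightarrow> (\<And>f g. f \<in> S \<Longrightarrow> g \<in> S \<Longrightarrow> f + g \<in> S) \<Longrightarrow> (\<And>c f. f \<in> S \<Longrightarrow> cscale c f \<in> S) \<Longrightarrow> cvec.subspace S"
  by (simp add: cvec.subspace_def)

lemma subspace_forms: "cvec.subspace (forms n e)"
proof (rule cvec_subspaceI)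
  show "f + g \<in> forms n e" if "f \<in> forms n e" "g \<in> forms n e" for f g
    using that Poly_Mapping.keys_add[of f g] by (auto simp: forms_def)
qed (auto simp: forms_def keys_cscale)

text \<open>Monomials are reached from the variables by induction on the degree, polynomials as
  linear combinations of monomials.\<close>

lemma ideal_poly_ringI:
  assumes "S \<subseteq> polys n" "cvec.subspace S" "\<And>i f. i \<le> n \<Longrightarrow> f \<in> S \<Longrightarrow> Var i * f \<in> S"
  shows "ideal S (poly_ring n)"
proof -
  interpret R: cring "poly_ring n" by (rule cring_poly_ring)
  have c: "carrier (poly_ring n) = polys n" by (simp add: poly_ring_def)
  have add: "f + g \<in> S" if "f \<in> S" "g \<in> S" for f g using assms(2) that by (rule cvec.subspace_add)
  have sc: "cscale c f \<in> S" if "f \<in> S" for c f using assms(2) that by (rule cvec.subspace_scale)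
  have mon: "single m a * f \<in> S" if "keys m \<subseteq> {..n}" "f \<in> S" for m a f
    using that
  proof (induction "mdeg m" arbitrary: m)
    case 0
    then have "m = 0" by (auto simp: mdeg_def in_keys_iff intro: poly_mapping_eqI)
    then show ?case using sc[OF 0(3), of a] by (simp add: cscale_eq_times)
  next
    case (Suc k)
    then obtain i where i: "lookup m i \<noteq> 0" by (metis mdeg_zero old.nat.distinct(2) poly_mapping_eqI lookup_zero)
    define m' where "m' = m - single i 1"
    have m: "m = single i 1 + m'" unfolding m'_def by (rule monom_minus_single[OF i])
    have "keys m' \<subseteq> keys m" unfolding m'_def by (auto simp: in_keys_iff lookup_minus)
    moreover have "k = mdeg m'" using Suc(2) unfolding m by simp
    ultimately have "single m' a * f \<in> S" using Suc by blast
    then have "Var i * (single m' a * f) \<in> S"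
      using i subsetD[OF Suc.prems(1), of i] by (intro assms(3)) (auto simp: in_keys_iff)
    then show ?case unfolding m Var_def by (simp add: mult_single flip: mult.assoc)
  qed
  have mult: "h * f \<in> S" if h: "h \<in> polys n" and f: "f \<in> S" for h f
  proof -
    have "h * f = (\<Sum>m\<in>keys h. single m (lookup h m) * f)"
      by (subst poly_mapping_sum_single[of "keys h" h]) (simp_all add: sum_distrib_right)
    moreover have "(\<Sum>m\<in>keys h. single m (lookup h m) * f) \<in> S"
      using assms(2) by (rule cvec.subspace_sum) (use h f in \<open>auto simp: polys_def intro: mon\<close>)
    ultimately show ?thesis by simp
  qed
  show ?thesis
  proof (rule idealI)
    show "ring (poly_ring n)" by (rule R.ring_axioms)
    show "subgroup S (add_monoid (poly_ring n))"
    proof (rule group.subgroupI[OF R.a_group])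
      show "S \<subseteq> carrier (add_monoid (poly_ring n))" using assms(1) c by simp
      show "S \<noteq> {}" using cvec.subspace_0[OF assms(2)] by blast
      fix f assume f: "f \<in> S"
      have "\<ominus>\<^bsub>poly_ring n\<^esub> f = - f"
        using assms(1) f by (intro R.minus_equality) (auto simp: poly_ring_def polys_uminus)
      then show "inv\<^bsub>add_monoid (poly_ring n)\<^esub> f \<in> S"
        unfolding a_inv_def using sc[OF f, of "-1"] by (simp add: cscale_minus1)
      fix g assume "g \<in> S"
      with f show "f \<otimes>\<^bsub>add_monoid (poly_ring n)\<^esub> g \<in> S" using add by (simp add: poly_ring_def)
    qed
    fix a x assume "a \<in> S" "x \<in> carrier (poly_ring n)"
    then show "x \<otimes>\<^bsub>poly_ring n\<^esub> a \<in> S" "a \<otimes>\<^bsub>poly_ring n\<^esub> x \<in> S"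
      using mult[of x a] by (auto simp: poly_ring_def mult.commute[of a x])
  qed
qed

lemma ideal_poly_ringD:
  assumes "ideal J (poly_ring n)"
  shows "J \<subseteq> polys n" "\<And>h f. h \<in> polys n \<Longrightarrow> f \<in> J \<Longrightarrow> h * f \<in> J" "cvec.subspace J"
proof -
  interpret ideal J "poly_ring n" by (rule assms)
  show "J \<subseteq> polys n" using a_subset by (simp add: poly_ring_def)
  show *: "h * f \<in> J" if "h \<in> polys n" "f \<in> J" for h f
    using I_l_closed[OF that(2), of h] that(1) by (simp add: poly_ring_def)
  show "cvec.subspace J"
  proof (rule cvec_subspaceI)
    show "0 \<in> J" using additive_subgroup.zero_closed[OF is_additive_subgroup] by (simp add: poly_ring_def)
    show "f + g \<in> J" if "f \<in> J" "g \<in> J" for f g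
      using additive_subgroup.a_closed[OF is_additive_subgroup that] by (simp add: poly_ring_def)
    show "cscale c f \<in> J" if "f \<in> J" for c f
      unfolding cscale_eq_times using that by (intro * polys_single) auto
  qed
qed

section \<open>Homogeneous components\<close>

lemma lookup_hcomp: "lookup (hcomp e f) m = (if mdeg m = e then lookup f m else 0)"
proof -
  have "(\<Sum>k | k \<in> keys f \<and> mdeg k = e. lookup f k when k = m) =
      (\<Sum>k | k \<in> keys f \<and> mdeg k = e. if k = m then lookup f m else 0)"
    by (rule sum.cong) (auto simp: when_def)
  then show ?thesis unfolding hcomp_def lookup_sum lookup_single by (simp add: in_keys_iff)
qed

lemma hcomp_forms: "f \<in> polys n \<Longrightarrow> hcomp e f \<in> forms n e"
  by (auto simp: forms_def monoms_def polys_def in_keys_iff lookup_hcomp split: if_splits)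

lemma hcomp_id: "f \<in> forms n e \<Longrightarrow> hcomp e f = f"
  by (rule poly_mapping_eqI) (auto simp: forms_def monoms_def in_keys_iff lookup_hcomp subset_iff)

lemma sum_hcomp: "(\<Sum>e\<in>mdeg ` keys f. hcomp e f) = f"
proof (rule poly_mapping_eqI)
  fix m
  have "(\<Sum>e\<in>mdeg ` keys f. lookup (hcomp e f) m) =
      (\<Sum>e\<in>mdeg ` keys f. if e = mdeg m then lookup f m else 0)"
    by (rule sum.cong) (auto simp: lookup_hcomp)
  then show "lookup (\<Sum>e\<in>mdeg ` keys f. hcomp e f) m = lookup f m"
    by (auto simp: lookup_sum in_keys_iff)
qed

lemma homogeneous_idealD:
  assumes "homogeneous_ideal n J"
  shows "ideal J (poly_ring n)" "\<And>f e. f \<in> J \<Longrightarrow> hcomp e f \<in> J"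
  using assms unfolding homogeneous_ideal_def by auto

text \<open>Each element is the sum of its homogeneous components, and these stay in the
  ideal.\<close>

lemma homogeneous_ideal_subset:
  assumes "homogeneous_ideal n J" "cvec.subspace J'" "\<And>e. J \<inter> forms n e \<subseteq> J'"
  shows "J \<subseteq> J'"
proof
  fix f assume f: "f \<in> J"
  note J = homogeneous_idealD[OF assms(1)]
  have "hcomp e f \<in> J'" for e
    using J(2)[OF f] hcomp_forms[of f n e] ideal_poly_ringD(1)[OF J(1)] f assms(3)[of e] by blast
  then have "(\<Sum>e\<in>mdeg ` keys f. hcomp e f) \<in> J'"
    by (intro cvec.subspace_sum[OF assms(2)])
  then show "f \<in> J'" by (simp add: sum_hcomp)
qed

section \<open>Monomial bases of quotients and normal forms\<close>

lemma finite_monoms: "finite (monoms n e)"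
proof (rule finite_subset)
  let ?m = "\<lambda>g. \<Sum>i\<le>n. single i (g i) :: monom"
  show "monoms n e \<subseteq> ?m ` PiE {..n} (\<lambda>_. {..e})"
  proof
    fix m assume m: "m \<in> monoms n e"
    have "lookup m i \<le> e" if "i \<le> n" for i
    proof -
      have "lookup m i \<le> (\<Sum>i\<le>n. lookup m i)" using that by (intro member_le_sum) auto
      then show ?thesis using m mdeg_superset[of "{..n}" m] by (simp add: monoms_def)
    qed
    then have "restrict (lookup m) {..n} \<in> PiE {..n} (\<lambda>_. {..e})" by auto
    moreover have "m = ?m (restrict (lookup m) {..n})"
      using m by (subst poly_mapping_sum_single[of "{..n}" m]) (auto simp: monoms_def)
    ultimately show "m \<in> ?m ` PiE {..n} (\<lambda>_. {..e})" by blast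
  qed
qed (auto intro: finite_PiE)

lemma single_in_forms: "m \<in> monoms n e \<Longrightarrow> single m c \<in> forms n e"
  by (auto simp: forms_def)

lemma forms_subset_keys: "B \<subseteq> monoms n e \<Longrightarrow> keys p \<subseteq> B \<Longrightarrow> p \<in> forms n e"
  by (auto simp: forms_def)

lemma forms_diff: "f \<in> forms n e \<Longrightarrow> g \<in> forms n e \<Longrightarrow> f - g \<in> forms n e"
  by (rule cvec.subspace_diff[OF subspace_forms])

lemma keys_subset_add: "keys p \<subseteq> B \<Longrightarrow> keys q \<subseteq> B \<Longrightarrow> keys (p + q) \<subseteq> B"
  using Poly_Mapping.keys_add[of p q] by blast

lemma keys_subset_diff: "keys p \<subseteq> B \<Longrightarrow> keys q \<subseteq> B \<Longrightarrow> keys (p - q) \<subseteq> B"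
  for p q :: cpoly by (auto simp: in_keys_iff lookup_minus subset_iff) metis

lemma keys_subset_sum: "(\<And>i. i \<in> I \<Longrightarrow> keys (f i) \<subseteq> B) \<Longrightarrow> keys (\<Sum>i\<in>I. f i) \<subseteq> B"
  by (induction I rule: infinite_finite_induct) (simp_all add: keys_subset_add)

text \<open>Reading off the entry at \<open>m\<close> isolates one coefficient of a linear relation;
  entries outside \<open>M\<close> are arbitrary.\<close>

lemma independent_unitriangular:
  fixes w :: "'i \<Rightarrow> 'i \<Rightarrow>\<^sub>0 complex"
  assumes "finite M" "\<And>m m'. m \<in> M \<Longrightarrow> m' \<in> M \<Longrightarrow> lookup (w m) m' = (if m = m' then 1 else 0)"
  shows "cvec.independent (w ` M)" "card (w ` M) = card M"
proof -
  have inj: "inj_on w M"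
    by (rule inj_onI) (metis assms(2) zero_neq_one)
  then show "card (w ` M) = card M" by (rule card_image)
  show "cvec.independent (w ` M)"
  proof (rule cvec.independent_if_scalars_zero)
    fix f x assume f: "(\<Sum>x\<in>w ` M. cscale (f x) x) = 0" and "x \<in> w ` M"
    then obtain m where m: "m \<in> M" "x = w m" by blast
    have "0 = lookup (\<Sum>k\<in>M. cscale (f (w k)) (w k)) m"
      using f by (simp add: sum.reindex[OF inj] lookup_zero)
    also have "\<dots> = (\<Sum>k\<in>M. if k = m then f (w m) else 0)"
      unfolding lookup_sum by (rule sum.cong) (use assms(2) m in auto)
    finally show "f x = 0" using m assms(1) by simp
  qed (use assms in auto)
qed

lemma forms_span: "forms n e \<subseteq> cvec.span ((\<lambda>m. single m 1) ` monoms n e)"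
proof
  fix f assume "f \<in> forms n e"
  then have "f = (\<Sum>m\<in>monoms n e. cscale (lookup f m) (single m 1))"
    using poly_mapping_sum_single[OF finite_monoms, of f n e] by (simp add: forms_def cscale_single)
  also have "\<dots> \<in> cvec.span ((\<lambda>m. single m 1) ` monoms n e)"
    by (intro cvec.span_sum cvec.span_scale cvec.span_base imageI)
  finally show "f \<in> cvec.span ((\<lambda>m. single m 1) ` monoms n e)" .
qed

lemma dim_forms: "cvec.dim (forms n e) = card (monoms n e)"
proof (rule cvec.dim_unique[OF _ forms_span])
  show "(\<lambda>m. single m 1) ` monoms n e \<subseteq> forms n e" by (auto intro: single_in_forms)
qed (use independent_unitriangular[OF finite_monoms, of n e "\<lambda>m. single m 1"] in
  \<open>auto simp: lookup_single when_def\<close>)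

lemma quot_basisD:
  assumes "quot_basis n J e B"
  shows "B \<subseteq> monoms n e" "\<And>f. f \<in> forms n e \<Longrightarrow> \<exists>!p. keys p \<subseteq> B \<and> f - p \<in> J"
  using assms unfolding quot_basis_def by auto

lemma quot_basis_zero:
  assumes "quot_basis n J e B" "cvec.subspace J" "keys p \<subseteq> B" "p \<in> J"
  shows "p = 0"
proof -
  have "\<exists>!p. keys p \<subseteq> B \<and> 0 - p \<in> J"
    using quot_basisD(2)[OF assms(1), of 0] cvec.subspace_0[OF subspace_forms] by blast
  moreover have "keys p \<subseteq> B \<and> 0 - p \<in> J" "keys 0 \<subseteq> B \<and> 0 - 0 \<in> J"
    using assms cvec.subspace_neg[OF assms(2)] cvec.subspace_0[OF assms(2)] by auto
  ultimately show ?thesis by blast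
qed

lemma quot_basisI:
  assumes "cvec.subspace J" "B \<subseteq> monoms n e"
    "\<And>f. f \<in> forms n e \<Longrightarrow> \<exists>p. keys p \<subseteq> B \<and> f - p \<in> J"
    "\<And>p. keys p \<subseteq> B \<Longrightarrow> p \<in> J \<Longrightarrow> p = 0"
  shows "quot_basis n J e B"
  unfolding quot_basis_def
proof (intro conjI ballI ex_ex1I)
  fix f p q assume "keys p \<subseteq> B \<and> f - p \<in> J" "keys q \<subseteq> B \<and> f - q \<in> J"
  then have "keys (p - q) \<subseteq> B" "(f - q) - (f - p) \<in> J"
    using keys_subset_diff cvec.subspace_diff[OF assms(1)] by blast+
  then show "p = q" using assms(4)[of "p - q"] by simp
qed (use assms in auto)

definition nform :: "cpoly set \<Rightarrow> monom set \<Rightarrow> cpoly \<Rightarrow> cpoly"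
  where "nform J B f = (THE p. keys p \<subseteq> B \<and> f - p \<in> J)"

lemma nform:
  assumes "quot_basis n J e B" "f \<in> forms n e"
  shows "keys (nform J B f) \<subseteq> B" "f - nform J B f \<in> J"
  using theI'[OF quot_basisD(2)[OF assms]] unfolding nform_def by auto

lemma nform_eqI:
  assumes "quot_basis n J e B" "f \<in> forms n e" "keys p \<subseteq> B" "f - p \<in> J"
  shows "nform J B f = p"
  unfolding nform_def using the1_equality[OF quot_basisD(2)[OF assms(1,2)]] assms(3,4) by blast

lemma nf_coeff_nform: "nf_coeff B m b J = lookup (nform J B (single m 1)) b"
  unfolding nf_coeff_def nform_def ..

text \<open>The monomials outside \<open>B\<close>, each minus its normal form, are a basis of
  \<open>J\<close> in degree \<open>e\<close>.\<close>

lemma hilbert_fun_quot_basis: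
  assumes "cvec.subspace J" "quot_basis n J e B"
  shows "hilbert_fun n J e = card B"
proof -
  note B = quot_basisD[OF assms(2)]
  let ?M = "monoms n e - B"
  define w where "w m = single m 1 - nform J B (single m 1)" for m
  have fin: "finite ?M" "finite B" using finite_monoms finite_subset[OF B(1)] by auto
  have wJ: "w m \<in> J" "w m \<in> forms n e" and wl: "lookup (w m) m' = (if m = m' then 1 else 0)"
    if "m \<in> monoms n e" "m' \<notin> B" for m m'
  proof -
    note nf = nform[OF assms(2) single_in_forms[OF that(1), of 1]]
    show "w m \<in> J" using nf(2) by (simp add: w_def)
    show "w m \<in> forms n e" unfolding w_def
      by (intro forms_diff single_in_forms forms_subset_keys[OF B(1) nf(1)] that)
    have "lookup (nform J B (single m 1)) m' = 0" using nf(1) that(2) by (metis in_keys_iff subsetD)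
    then show "lookup (w m) m' = (if m = m' then 1 else 0)"
      by (simp add: w_def lookup_minus lookup_single when_def)
  qed
  have "cvec.dim (J \<inter> forms n e) = card ?M"
  proof (rule cvec.dim_unique)
    show "w ` ?M \<subseteq> J \<inter> forms n e" using wJ by blast
    show "cvec.independent (w ` ?M)" "card (w ` ?M) = card ?M"
      using independent_unitriangular[OF fin(1), of w] wl by auto
    show "J \<inter> forms n e \<subseteq> cvec.span (w ` ?M)"
    proof
      fix f assume f: "f \<in> J \<inter> forms n e"
      define g where "g = (\<Sum>m\<in>?M. cscale (lookup f m) (w m))"
      have gJ: "g \<in> J" "g \<in> forms n e" unfolding g_def
        by (intro cvec.subspace_sum cvec.subspace_scale assms(1) subspace_forms wJ[of _ undefined] wJ; blast)+
      have "lookup (f - g) m' = 0" if "m' \<notin> B" for m'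
      proof (cases "m' \<in> monoms n e")
        case True
        have "lookup g m' = (\<Sum>m\<in>?M. if m = m' then lookup f m' else 0)"
          unfolding g_def lookup_sum by (rule sum.cong) (use wl that in auto)
        then show ?thesis using True that fin by (simp add: lookup_minus)
      next
        case False
        have "f - g \<in> forms n e" using f gJ by (intro forms_diff) auto
        then show ?thesis using False by (auto simp: forms_def in_keys_iff subset_iff)
      qed
      then have "keys (f - g) \<subseteq> B" by (auto simp: in_keys_iff)
      moreover have "f - g \<in> J" using f gJ cvec.subspace_diff[OF assms(1)] by blast
      ultimately have "f = g" using quot_basis_zero[OF assms(2,1)] by fastforce
      then show "f \<in> cvec.span (w ` ?M)" unfolding g_def
        by (metis (no_types, lifting) cvec.span_base cvec.span_scale cvec.span_sum imageI)
    qed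
  qed
  moreover have "card ?M = card (monoms n e) - card B" "card B \<le> card (monoms n e)"
    using B(1) finite_monoms fin by (auto simp: card_Diff_subset card_mono)
  ultimately show ?thesis unfolding hilbert_fun_def dim_forms by simp
qed

lemma quot_basis_of_spanning:
  assumes "cvec.subspace J" "B \<subseteq> monoms n e"
    "\<And>f. f \<in> forms n e \<Longrightarrow> \<exists>p. keys p \<subseteq> B \<and> f - p \<in> J" "card B \<le> hilbert_fun n J e"
  shows "quot_basis n J e B"
proof -
  have ex: "\<exists>B'\<subseteq>B. quot_basis n J e B'"
    if "B \<subseteq> monoms n e" "\<And>f. f \<in> forms n e \<Longrightarrow> \<exists>p. keys p \<subseteq> B \<and> f - p \<in> J" for B
    using that
  proof (induction "card B" arbitrary: B rule: less_induct)
    case less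
    show ?case
    proof (cases "\<forall>p. keys p \<subseteq> B \<longrightarrow> p \<in> J \<longrightarrow> p = 0")
      case True
      then show ?thesis using quot_basisI[OF assms(1) less.prems] by blast
    next
      case False
      then obtain p where p: "keys p \<subseteq> B" "p \<in> J" "p \<noteq> 0" by blast
      then obtain b where b: "lookup p b \<noteq> 0" by (metis poly_mapping_eqI lookup_zero)
      then have bB: "b \<in> B" using p(1) by (metis in_keys_iff subsetD)
      have "finite B" using less.prems(1) finite_monoms finite_subset by blast
      then have "card (B - {b}) < card B" using bB by (intro psubset_card_mono) auto
      moreover have "\<exists>q. keys q \<subseteq> B - {b} \<and> f - q \<in> J" if f: "f \<in> forms n e" for f
      proof -
        obtain r where r: "keys r \<subseteq> B" "f - r \<in> J" using less.prems(2)[OF f] by blast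
        \<comment> \<open>The relation \<open>p\<close> eliminates \<open>b\<close> from the
          representative \<open>r\<close>.\<close>
        define q where "q = r - cscale (lookup r b / lookup p b) p"
        have "keys q \<subseteq> B" unfolding q_def
          using r(1) p(1) by (intro keys_subset_diff) (auto simp: keys_cscale)
        moreover have "lookup q b = 0" using b by (simp add: q_def lookup_minus)
        ultimately have "keys q \<subseteq> B - {b}" by (auto simp: in_keys_iff)
        moreover have "f - q = (f - r) + cscale (lookup r b / lookup p b) p" by (simp add: q_def)
        then have "f - q \<in> J"
          using cvec.subspace_add[OF assms(1) r(2) cvec.subspace_scale[OF assms(1) p(2)]] by (simp only:)
        ultimately show ?thesis by blast
      qed
      ultimately obtain B' where "B' \<subseteq> B - {b}" "quot_basis n J e B'"
        using less.hyps[of "B - {b}"] less.prems(1) by blast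
      then show ?thesis by blast
    qed
  qed
  obtain B' where B': "B' \<subseteq> B" "quot_basis n J e B'" using ex[OF assms(2,3)] by blast
  have "finite B" using assms(2) finite_monoms finite_subset by blast
  moreover have "card B \<le> card B'" using assms(4) hilbert_fun_quot_basis[OF assms(1) B'(2)] by simp
  ultimately have "B' = B" using B'(1) by (intro card_seteq)
  with B'(2) show ?thesis by simp
qed

text \<open>A basis of the smaller space extends to one of the larger; equal finite sizes make the
  two bases equal.\<close>

lemma hilbert_fun_eq_imp_subset:
  assumes "cvec.subspace J" "cvec.subspace J'" "J \<inter> forms n e \<subseteq> J'"
    "hilbert_fun n J e = hilbert_fun n J' e"
  shows "J' \<inter> forms n e \<subseteq> J"
proof -
  let ?S = "(\<lambda>m. single m (1::complex)) ` monoms n e"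
  have sub: "cvec.subspace (K \<inter> forms n e)" if "cvec.subspace K" for K
    using cvec.subspace_Int[of "{K, forms n e}" id] that subspace_forms
    by (intro cvec.subspace_inter) auto
  have ind: "finite B \<and> card B \<le> card (monoms n e)" if "cvec.independent B" "B \<subseteq> forms n e" for B
  proof -
    have "finite B \<and> card B \<le> card ?S"
      using that forms_span finite_monoms by (intro cvec.independent_span_bound) (auto intro: subset_trans)
    then show ?thesis using card_image_le[OF finite_monoms, of "\<lambda>m. single m (1::complex)" n e] by auto
  qed
  obtain B where B: "B \<subseteq> J \<inter> forms n e" "cvec.independent B" "J \<inter> forms n e \<subseteq> cvec.span B"
    using cvec.maximal_independent_subset[of "J \<inter> forms n e"] by blast
  obtain C where C: "B \<subseteq> C" "C \<subseteq> J' \<inter> forms n e" "cvec.independent C" "J' \<inter> forms n e \<subseteq> cvec.span C"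
    using cvec.maximal_independent_subset_extend[of B "J' \<inter> forms n e"] B assms(3) by blast
  have dims: "cvec.dim (J \<inter> forms n e) = card B" "cvec.dim (J' \<inter> forms n e) = card C"
    by (rule cvec.dim_unique[OF B(1,3,2) refl], rule cvec.dim_unique[OF C(2,4,3) refl])
  \<comment> \<open>Both dimensions are at most the number of monomials, so the truncated
    subtraction in \<open>hilbert_fun\<close> loses nothing.\<close>
  have fin: "finite C" "card B \<le> card (monoms n e)" "card C \<le> card (monoms n e)"
    using ind[of B] ind[of C] B C by auto
  have "card B = card C"
    using assms(4) fin unfolding hilbert_fun_def dim_forms dims by linarith
  then have "B = C" using C(1) fin(1) by (simp add: card_subset_eq)
  have "cvec.span B \<subseteq> J" using B(1) assms(1) by (intro cvec.span_minimal) auto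
  then show ?thesis using C(4) \<open>B = C\<close> by blast
qed

lemma HilbD:
  assumes "J \<in> Hilb n h"
  shows "homogeneous_ideal n J" "ideal J (poly_ring n)" "cvec.subspace J" "hilbert_fun n J e = h e"
proof -
  show hom: "homogeneous_ideal n J" and "hilbert_fun n J e = h e" using assms unfolding Hilb_def by auto
  show J: "ideal J (poly_ring n)" using hom by (rule homogeneous_idealD)
  show "cvec.subspace J" using J by (rule ideal_poly_ringD)
qed

lemma Hilb_eqI:
  assumes "J \<in> Hilb n h" "J' \<in> Hilb n h" "J \<subseteq> J'"
  shows "J = J'"
proof
  show "J' \<subseteq> J"
  proof (rule homogeneous_ideal_subset[OF HilbD(1)[OF assms(2)] HilbD(3)[OF assms(1)]])
    show "J' \<inter> forms n e \<subseteq> J" for e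
      by (rule hilbert_fun_eq_imp_subset[OF HilbD(3)[OF assms(1)] HilbD(3)[OF assms(2)]])
        (use assms(3) HilbD(4)[OF assms(1)] HilbD(4)[OF assms(2)] in auto)
  qed
qed (rule assms)

section \<open>The ideals \<open>I + (q)\<close>\<close>

locale G_form =
  fixes d :: nat
  assumes d_ge_3: "d \<ge> 3"
begin

definition ymon :: "nat \<Rightarrow> nat \<Rightarrow> monom"
  where "ymon a b = single d a + single (d + 1) b"

definition xmon :: "nat \<Rightarrow> nat \<Rightarrow> nat \<Rightarrow> monom"
  where "xmon i a b = single i 1 + ymon a b"

text \<open>Differentiating u_0^i u_1^(d-1-i) a times by u_0 and b times by u_1 gives the factor i!
  (d-1-i)! over (i-a)! (d-1-i-b)!. The numerator is (d-1)! divided by this binomial, and the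
  denominator depends on i - a and a + b only.\<close>

definition bin :: "nat \<Rightarrow> complex"
  where "bin i = of_nat ((d - 1) choose i)"

definition XM :: "nat \<Rightarrow> nat \<Rightarrow> nat \<Rightarrow> cpoly"
  where "XM i a b = single (xmon i a b) (bin i)"

text \<open>In terms of the rescaled variables \<open>X\<^sub>i = bin i \<cdot> x\<^sub>i\<close>, the annihilator of \<open>G\<close> identifies the
  monomials \<open>X\<^sub>i y\<^sub>0\<^sup>a y\<^sub>1\<^sup>b\<close> with equal \<open>N = a + b\<close> and \<open>c = i - a\<close>; \<open>Lam N c\<close> reads off the coefficient
  of this class.\<close>

definition Lam :: "nat \<Rightarrow> nat \<Rightarrow> cpoly \<Rightarrow> complex"
  where "Lam N c f = (\<Sum>a\<le>N. lookup f (xmon (c + a) a (N - a)) / bin (c + a))"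

definition Yp :: "nat \<Rightarrow> cpoly \<Rightarrow> complex poly"
  where "Yp e f = (\<Sum>a\<le>e. Polynomial.monom (lookup f (ymon a (e - a))) a)"

definition yform :: "nat \<Rightarrow> complex poly \<Rightarrow> cpoly"
  where "yform e p = (\<Sum>a\<le>e. single (ymon a (e - a)) (coeff p a))"

text \<open>A binary form of degree \<open>e\<close> is represented by its dehomogenization, so the multiples of the
  form \<open>q\<close> of degree \<open>d + 2\<close> among the forms of degree \<open>e\<close> are the products with polynomials of degree
  at most \<open>e - (d + 2)\<close>.\<close>

definition form_multiple :: "complex poly \<Rightarrow> nat \<Rightarrow> complex poly \<Rightarrow> bool"
  where "form_multiple q e p \<longleftrightarrow> (\<exists>g. p = q * g \<and> (g = 0 \<or> degree g + (d + 2) \<le> e))"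

text \<open>The remaining monomials are unrestricted: those of degree at least 2 in the x_i, and X_i
  y_0^a y_1^b with \<open>a > i\<close> or \<open>i + b \<ge> d\<close>.\<close>

definition JJ :: "complex poly \<Rightarrow> cpoly set"
  where "JJ q = {f \<in> polys (d + 1). (\<forall>N c. c + N < d \<longrightarrow> Lam N c f = 0) \<and>
    (\<forall>e. form_multiple q e (Yp e f))}"

lemma lookup_ymon: "lookup (ymon a b) k = (if k = d then a else if k = d + 1 then b else 0)"
  by (auto simp: ymon_def lookup_add lookup_single when_def)

lemma lookup_xmon: "lookup (xmon i a b) k = (if k = i then 1 else 0) + lookup (ymon a b) k"
  by (auto simp: xmon_def lookup_add lookup_single when_def)

lemma ymon_eq_iff [simp]: "ymon a b = ymon a' b' \<longleftrightarrow> a = a' \<and> b = b'"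
proof
  assume "ymon a b = ymon a' b'"
  then have "lookup (ymon a b) k = lookup (ymon a' b') k" for k by simp
  from this[of d] this[of "d + 1"] show "a = a' \<and> b = b'" by (simp add: lookup_ymon)
qed simp

lemma xmon_neq_ymon [simp]: "i < d \<Longrightarrow> xmon i a b \<noteq> ymon a' b'" "i < d \<Longrightarrow> ymon a' b' \<noteq> xmon i a b"
  by (auto simp: lookup_xmon lookup_ymon dest!: arg_cong[where f = "\<lambda>m. lookup m i"])

lemma xmon_eq_iff:
  assumes "i < d" "i' < d"
  shows "xmon i a b = xmon i' a' b' \<longleftrightarrow> i = i' \<and> a = a' \<and> b = b'"
proof
  assume "xmon i a b = xmon i' a' b'"
  then have *: "lookup (xmon i a b) k = lookup (xmon i' a' b') k" for k by simp
  from *[of d] *[of "d + 1"] *[of i] show "i = i' \<and> a = a' \<and> b = b'"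
    using assms by (simp add: lookup_xmon lookup_ymon split: if_splits)
qed simp

lemma mdeg_ymon [simp]: "mdeg (ymon a b) = a + b" and mdeg_xmon [simp]: "mdeg (xmon i a b) = Suc (a + b)"
  by (simp_all add: ymon_def xmon_def)

lemma keys_ymon: "keys (ymon a b) \<subseteq> {..d + 1}" and keys_xmon: "i < d \<Longrightarrow> keys (xmon i a b) \<subseteq> {..d + 1}"
  by (auto simp: in_keys_iff lookup_ymon lookup_xmon split: if_splits)

lemma ymon_in_monoms: "a + b = e \<Longrightarrow> ymon a b \<in> monoms (d + 1) e"
  using keys_ymon by (auto simp: monoms_def)

lemma xmon_in_monoms: "i < d \<Longrightarrow> Suc (a + b) = e \<Longrightarrow> xmon i a b \<in> monoms (d + 1) e"
  using keys_xmon by (auto simp: monoms_def)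

lemma ymonI:
  assumes "keys m \<subseteq> {..d + 1}" "\<And>i. i < d \<Longrightarrow> lookup m i = 0"
  shows "m = ymon (lookup m d) (lookup m (d + 1))"
proof (rule poly_mapping_eqI)
  fix k
  have "k \<le> d + 1 \<or> lookup m k = 0" using assms(1) subsetD[of "keys m" "{..d + 1}" k] by (auto simp: in_keys_iff)
  then show "lookup m k = lookup (ymon (lookup m d) (lookup m (d + 1))) k"
    using assms(2)[of k] by (auto simp: lookup_ymon)
qed

lemma bin_nonzero [simp]: "i < d \<Longrightarrow> bin i \<noteq> 0"
  by (simp add: bin_def)

lemma coeff_Yp: "coeff (Yp e f) a = (if a \<le> e then lookup f (ymon a (e - a)) else 0)"
  by (simp add: Yp_def coeff_sum)

lemma degree_Yp: "degree (Yp e f) \<le> e"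
  by (rule degree_le) (simp add: coeff_Yp)

lemma lookup_yform_ymon: "lookup (yform e p) (ymon a b) = (if a + b = e then coeff p a else 0)"
proof -
  have "(\<Sum>k\<le>e. coeff p k when ymon k (e - k) = ymon a b) =
      (\<Sum>k\<le>e. if k = a then (if a + b = e then coeff p a else 0) else 0)"
    by (rule sum.cong) (auto simp: when_def)
  then show ?thesis by (simp add: yform_def lookup_sum lookup_single)
qed

lemma lookup_yform_xmon: "i < d \<Longrightarrow> lookup (yform e p) (xmon i a b) = 0"
  by (simp add: yform_def lookup_sum lookup_single)

lemma yform_in_forms: "yform e p \<in> forms (d + 1) e"
  unfolding yform_def
  by (intro cvec.subspace_sum[OF subspace_forms] single_in_forms ymon_in_monoms) auto

lemma Yp_yform: "degree p \<le> e \<Longrightarrow> Yp e' (yform e p) = (if e' = e then p else 0)"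
  by (rule poly_eqI) (auto simp: coeff_Yp lookup_yform_ymon coeff_eq_0)

lemma Lam_yform: "c + N < d \<Longrightarrow> Lam N c (yform e p) = 0"
  unfolding Lam_def by (rule sum.neutral) (auto simp: lookup_yform_xmon)

lemma Yp_add: "Yp e (f + g) = Yp e f + Yp e g" and Yp_cscale: "Yp e (cscale c f) = Polynomial.smult c (Yp e f)"
  and Yp_diff: "Yp e (f - g) = Yp e f - Yp e g" and Yp_0 [simp]: "Yp e 0 = 0"
  by (auto intro!: poly_eqI simp: coeff_Yp lookup_add lookup_minus)

lemma Lam_add: "Lam N c (f + g) = Lam N c f + Lam N c g"
  and Lam_cscale: "Lam N c (cscale a f) = a * Lam N c f"
  and Lam_0 [simp]: "Lam N c 0 = 0"
  by (auto simp: Lam_def lookup_add add_divide_distrib sum.distrib sum_distrib_left)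

lemma Lam_diff: "Lam N c (f - g) = Lam N c f - Lam N c g"
  by (auto simp: Lam_def lookup_minus diff_divide_distrib sum_subtractf)

lemma form_multiple_0 [simp]: "form_multiple q e 0"
  unfolding form_multiple_def by (intro exI[of _ 0]) simp

lemma form_multiple_small: "e < d + 2 \<Longrightarrow> form_multiple q e p \<longleftrightarrow> p = 0"
  unfolding form_multiple_def by auto

lemma form_multiple_self: "form_multiple q (d + 2) q"
  unfolding form_multiple_def by (intro exI[of _ 1]) simp

lemma form_multiple_add:
  assumes "form_multiple q e p" "form_multiple q e p'"
  shows "form_multiple q e (p + p')"
proof -
  obtain g g' where g: "p = q * g" "g = 0 \<or> degree g + (d + 2) \<le> e"
    "p' = q * g'" "g' = 0 \<or> degree g' + (d + 2) \<le> e"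
    using assms unfolding form_multiple_def by auto
  have "g + g' = 0 \<or> degree (g + g') + (d + 2) \<le> e"
    using g(2,4) degree_add_le_max[of g g'] by auto
  then show ?thesis unfolding form_multiple_def using g by (intro exI[of _ "g + g'"]) (auto simp: distrib_left)
qed

lemma form_multiple_smult:
  assumes "form_multiple q e p"
  shows "form_multiple q e (Polynomial.smult c p)"
proof -
  obtain g where g: "p = q * g" "g = 0 \<or> degree g + (d + 2) \<le> e"
    using assms unfolding form_multiple_def by auto
  then show ?thesis unfolding form_multiple_def by (intro exI[of _ "Polynomial.smult c g"]) auto
qed

lemma form_multiple_pCons:
  assumes "form_multiple q e p"
  shows "form_multiple q (Suc e) (pCons 0 p)" "form_multiple q (Suc e) p"
proof -
  obtain g where g: "p = q * g" "g = 0 \<or> degree g + (d + 2) \<le> e"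
    using assms unfolding form_multiple_def by auto
  show "form_multiple q (Suc e) (pCons 0 p)" unfolding form_multiple_def
    using g degree_pCons_le[of 0 g] by (intro exI[of _ "pCons 0 g"]) auto
  show "form_multiple q (Suc e) p" unfolding form_multiple_def using g by (intro exI[of _ g]) auto
qed

lemma JJ_D:
  assumes "f \<in> JJ q"
  shows "f \<in> polys (d + 1)" "\<And>N c. c + N < d \<Longrightarrow> Lam N c f = 0" "\<And>e. form_multiple q e (Yp e f)"
  using assms by (auto simp: JJ_def)

lemma JJ_lookup_ymon: "f \<in> JJ q \<Longrightarrow> a + b < d + 2 \<Longrightarrow> lookup f (ymon a b) = 0"
  using JJ_D(3)[of f q "a + b"] coeff_Yp[of "a + b" f a] by (simp add: form_multiple_small)

lemma subspace_JJ: "cvec.subspace (JJ q)"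
  by (rule cvec_subspaceI)
    (auto simp: JJ_def polys_0 polys_add polys_cscale Lam_add Lam_cscale Yp_add Yp_cscale
      form_multiple_add form_multiple_smult)

lemma lookup_Var_ymon:
  "i < d \<Longrightarrow> lookup (Var i * f) (ymon a b) = 0"
  "lookup (Var d * f) (ymon a b) = (if a = 0 then 0 else lookup f (ymon (a - 1) b))"
  "lookup (Var (d + 1) * f) (ymon a b) = (if b = 0 then 0 else lookup f (ymon a (b - 1)))"
proof -
  have "ymon a b - single d 1 = ymon (a - 1) b" "ymon a b - single (d + 1) 1 = ymon a (b - 1)"
    by (auto intro!: poly_mapping_eqI simp: lookup_minus lookup_ymon lookup_single when_def)
  then show "i < d \<Longrightarrow> lookup (Var i * f) (ymon a b) = 0"
    "lookup (Var d * f) (ymon a b) = (if a = 0 then 0 else lookup f (ymon (a - 1) b))"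
    "lookup (Var (d + 1) * f) (ymon a b) = (if b = 0 then 0 else lookup f (ymon a (b - 1)))"
    unfolding lookup_Var_times by (auto simp: lookup_ymon)
qed

lemma lookup_Var_xmon:
  assumes "j < d"
  shows "i < d \<Longrightarrow> lookup (Var i * f) (xmon j a b) = (if i = j then lookup f (ymon a b) else 0)"
    "lookup (Var d * f) (xmon j a b) = (if a = 0 then 0 else lookup f (xmon j (a - 1) b))"
    "lookup (Var (d + 1) * f) (xmon j a b) = (if b = 0 then 0 else lookup f (xmon j a (b - 1)))"
proof -
  note simps = lookup_minus lookup_xmon lookup_ymon lookup_single when_def
  have 1: "xmon j a b - single j 1 = ymon a b"
    using assms by (auto intro!: poly_mapping_eqI simp: simps)
  have 2: "xmon j a b - single d 1 = xmon j (a - 1) b" if "a > 0"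
    using that assms by (auto intro!: poly_mapping_eqI simp: simps)
  have 3: "xmon j a b - single (d + 1) 1 = xmon j a (b - 1)" if "b > 0"
    using that assms by (auto intro!: poly_mapping_eqI simp: simps)
  show "i < d \<Longrightarrow> lookup (Var i * f) (xmon j a b) = (if i = j then lookup f (ymon a b) else 0)"
    "lookup (Var d * f) (xmon j a b) = (if a = 0 then 0 else lookup f (xmon j (a - 1) b))"
    "lookup (Var (d + 1) * f) (xmon j a b) = (if b = 0 then 0 else lookup f (xmon j a (b - 1)))"
    unfolding lookup_Var_times using assms 1 2 3 by (auto simp: lookup_xmon lookup_ymon)
qed

text \<open>On the functionals, y_0 shifts (N, c) to (N - 1, c + 1) and y_1 shifts it to (N - 1, c);
  x_i makes them read binary coefficients of degree below d, which vanish. On binary parts, y_0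
  multiplies by X and y_1 raises the degree allowed for the cofactor.\<close>

lemma Var_times_JJ:
  assumes "i \<le> d + 1" "f \<in> JJ q"
  shows "Var i * f \<in> JJ q"
proof -
  note f = JJ_D[OF assms(2)]
  have pol: "Var i * f \<in> polys (d + 1)" using polys_mult[OF polys_Var f(1)] assms(1) .
  consider "i < d" | "i = d" | "i = d + 1" using assms(1) by linarith
  then have "(\<forall>N c. c + N < d \<longrightarrow> Lam N c (Var i * f) = 0) \<and> (\<forall>e. form_multiple q e (Yp e (Var i * f)))"
  proof cases
    case 1
    have "Lam N c (Var i * f) = 0" if "c + N < d" for N c
      unfolding Lam_def using that 1
      by (intro sum.neutral) (auto simp: lookup_Var_xmon JJ_lookup_ymon[OF assms(2)])
    moreover have "Yp e (Var i * f) = 0" for e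
      by (rule poly_eqI) (simp add: coeff_Yp lookup_Var_ymon 1)
    ultimately show ?thesis by simp
  next
    case 2
    have "Lam N c (Var d * f) = 0" if cN: "c + N < d" for N c
    proof (cases N)
      case 0
      then show ?thesis using cN by (simp add: Lam_def lookup_Var_xmon)
    next
      case (Suc N')
      have "Lam N c (Var d * f) = Lam N' (Suc c) f"
        unfolding Lam_def Suc sum.atMost_Suc_shift using cN Suc
        by (auto simp: lookup_Var_xmon intro!: sum.cong)
      then show ?thesis using f(2)[of "Suc c" N'] cN Suc by simp
    qed
    moreover have "form_multiple q e (Yp e (Var d * f))" for e
    proof (cases e)
      case 0
      have "Yp e (Var d * f) = 0" by (rule poly_eqI) (simp add: coeff_Yp lookup_Var_ymon 0)
      then show ?thesis by simp
    next
      case (Suc e')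
      have "Yp e (Var d * f) = pCons 0 (Yp e' f)"
        by (rule poly_eqI) (auto simp: coeff_Yp lookup_Var_ymon Suc coeff_pCons split: nat.splits)
      then show ?thesis using form_multiple_pCons(1)[OF f(3)[of e']] Suc by simp
    qed
    ultimately show ?thesis using 2 by simp
  next
    case 3
    have "Lam N c (Var (d + 1) * f) = 0" if cN: "c + N < d" for N c
    proof (cases N)
      case 0
      then show ?thesis using cN by (simp add: Lam_def lookup_Var_xmon(3)[unfolded Suc_eq_plus1[symmetric]])
    next
      case (Suc N')
      have "Lam N c (Var (d + 1) * f) = Lam N' c f"
        unfolding Lam_def Suc sum.atMost_Suc using cN Suc lookup_Var_xmon(3)[of "Suc (c + N')" f "Suc N'" 0]
        by (auto simp: lookup_Var_xmon(3)[unfolded Suc_eq_plus1[symmetric]] Suc_diff_le intro!: sum.cong)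
      then show ?thesis using f(2)[of c N'] cN Suc by simp
    qed
    moreover have "form_multiple q e (Yp e (Var (d + 1) * f))" for e
    proof (cases e)
      case 0
      have "Yp e (Var (d + 1) * f) = 0"
        by (rule poly_eqI) (simp add: coeff_Yp lookup_Var_ymon(3)[unfolded Suc_eq_plus1[symmetric]] 0)
      then show ?thesis by simp
    next
      case (Suc e')
      have "Yp e (Var (d + 1) * f) = Yp e' f"
        by (rule poly_eqI)
          (auto simp: coeff_Yp lookup_Var_ymon(3)[unfolded Suc_eq_plus1[symmetric]] Suc Suc_diff_le not_less_eq_eq)
      then show ?thesis using form_multiple_pCons(2)[OF f(3)[of e']] Suc by simp
    qed
    ultimately show ?thesis using 3 by simp
  qed
  with pol show ?thesis by (simp add: JJ_def)
qed

lemma ideal_JJ: "ideal (JJ q) (poly_ring (d + 1))"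
  by (rule ideal_poly_ringI[OF _ subspace_JJ Var_times_JJ]) (auto simp: JJ_def)

lemma Yp_hcomp: "Yp e' (hcomp e f) = (if e' = e then Yp e f else 0)"
  by (rule poly_eqI) (auto simp: coeff_Yp lookup_hcomp)

lemma Lam_hcomp: "Lam N c (hcomp e f) = (if Suc N = e then Lam N c f else 0)"
  by (auto simp: Lam_def lookup_hcomp)

lemma Yp_forms: "f \<in> forms (d + 1) e \<Longrightarrow> e' \<noteq> e \<Longrightarrow> Yp e' f = 0"
  using Yp_hcomp[of e' e f] hcomp_id[of f "d + 1" e] by simp

lemma Lam_forms: "f \<in> forms (d + 1) e \<Longrightarrow> Suc N \<noteq> e \<Longrightarrow> Lam N c f = 0"
  using Lam_hcomp[of N c e f] hcomp_id[of f "d + 1" e] by simp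

lemma homogeneous_JJ: "homogeneous_ideal (d + 1) (JJ q)"
  unfolding homogeneous_ideal_def
proof (intro conjI ideal_JJ ballI allI)
  fix f e assume f: "f \<in> JJ q"
  have "hcomp e f \<in> polys (d + 1)" using hcomp_forms[OF JJ_D(1)[OF f]] by (rule forms_polys)
  then show "hcomp e f \<in> JJ q" using JJ_D[OF f] by (auto simp: JJ_def Yp_hcomp Lam_hcomp)
qed

lemma JJ_forms_iff:
  assumes "f \<in> forms (d + 1) e"
  shows "f \<in> JJ q \<longleftrightarrow> (\<forall>N c. Suc N = e \<longrightarrow> c + N < d \<longrightarrow> Lam N c f = 0) \<and> form_multiple q e (Yp e f)"
proof
  assume R: "(\<forall>N c. Suc N = e \<longrightarrow> c + N < d \<longrightarrow> Lam N c f = 0) \<and> form_multiple q e (Yp e f)"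
  have "Lam N c f = 0" if "c + N < d" for N c
    using R Lam_forms[OF assms] that by (cases "Suc N = e") auto
  moreover have "form_multiple q e' (Yp e' f)" for e'
    using R Yp_forms[OF assms] by (cases "e' = e") auto
  ultimately show "f \<in> JJ q" using forms_polys[OF assms] by (simp add: JJ_def)
qed (use JJ_D in blast)

lemma forms_eq_0I:
  assumes "keys f \<subseteq> (\<lambda>a. ymon a (e - a)) ` {..e} \<union> K" "Yp e f = 0" "\<And>m. m \<in> K \<Longrightarrow> lookup f m = 0"
  shows "f = 0"
proof (rule poly_mapping_eqI)
  fix m
  show "lookup f m = lookup 0 m"
  proof (rule ccontr)
    assume "lookup f m \<noteq> lookup 0 m"
    then have "m \<in> keys f" by (simp add: in_keys_iff)
    then consider a where "a \<le> e" "m = ymon a (e - a)" | "m \<in> K" using assms(1) by auto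
    then show False
    proof cases
      case 1
      then have "lookup f m = coeff (Yp e f) a" by (simp add: coeff_Yp)
      then show False using assms(2) \<open>m \<in> keys f\<close> by (simp add: in_keys_iff)
    next
      case 2
      then show False using assms(3) \<open>m \<in> keys f\<close> by (simp add: in_keys_iff)
    qed
  qed
qed

subsection \<open>Their Hilbert function\<close>

lemma Lam_XM:
  assumes "c' + N < d" "c + N' < d"
  shows "Lam N' c (XM c' 0 N) = (if N' = N \<and> c = c' then 1 else 0)"
proof -
  have "Lam N' c (XM c' 0 N) = (\<Sum>a\<le>N'. if a = 0 then (if N' = N \<and> c = c' then 1 else 0) else 0)"
    unfolding Lam_def XM_def lookup_single
    by (rule sum.cong) (use assms in \<open>auto simp: when_def xmon_eq_iff\<close>)
  then show ?thesis by simp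
qed

lemma Lam_sum: "Lam N c (\<Sum>i\<in>I. f i) = (\<Sum>i\<in>I. Lam N c (f i))"
  by (induction I rule: infinite_finite_induct) (auto simp: Lam_add)

lemma Yp_sum: "Yp e (\<Sum>i\<in>I. f i) = (\<Sum>i\<in>I. Yp e (f i))"
  by (induction I rule: infinite_finite_induct) (auto simp: Yp_add)

lemma Yp_XM: "i < d \<Longrightarrow> Yp e (XM i a b) = 0"
  by (rule poly_eqI) (simp add: coeff_Yp XM_def lookup_single)

text \<open>Below degree d + 2 the condition on q just says that the binary part vanishes, so the
  binary monomials stay independent; each class of monomials linear in the x_i is represented by its
  member X_c y_1^(e-1).\<close>

lemma quot_basis_JJ_small:
  assumes "e < d + 2"
  shows "quot_basis (d + 1) (JJ q) e
    ((\<lambda>a. ymon a (e - a)) ` {..e} \<union> (\<lambda>c. xmon c 0 (e - 1)) ` {c. 1 \<le> e \<and> c + e \<le> d})"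
proof (rule quot_basisI[OF subspace_JJ])
  let ?K = "(\<lambda>c. xmon c 0 (e - 1)) ` {c. 1 \<le> e \<and> c + e \<le> d}"
  let ?B = "(\<lambda>a. ymon a (e - a)) ` {..e} \<union> ?K"
  show "?B \<subseteq> monoms (d + 1) e"
    by (auto intro!: ymon_in_monoms[simplified] xmon_in_monoms[simplified])
  show "\<exists>p. keys p \<subseteq> ?B \<and> f - p \<in> JJ q" if f: "f \<in> forms (d + 1) e" for f
  proof (intro exI conjI)
    let ?C = "{c. 1 \<le> e \<and> c + e \<le> d}"
    have fin: "finite ?C" by (rule finite_subset[of _ "{..d}"]) auto
    let ?p = "yform e (Yp e f) + (\<Sum>c\<in>?C. cscale (Lam (e - 1) c f) (XM c 0 (e - 1)))"
    have "keys (yform e (Yp e f)) \<subseteq> ?B"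
      unfolding yform_def by (intro keys_subset_sum) auto
    moreover have "keys (\<Sum>c\<in>?C. cscale (Lam (e - 1) c f) (XM c 0 (e - 1))) \<subseteq> ?B"
      by (intro keys_subset_sum) (auto simp: keys_cscale XM_def)
    ultimately show k: "keys ?p \<subseteq> ?B" by (rule keys_subset_add)
    then have "?p \<in> forms (d + 1) e"
      by (intro forms_subset_keys[OF \<open>?B \<subseteq> monoms (d + 1) e\<close>])
    then have fp: "f - ?p \<in> forms (d + 1) e" using f by (rule forms_diff[rotated])
    show "f - ?p \<in> JJ q"
      unfolding JJ_forms_iff[OF fp]
    proof (intro conjI allI impI)
      fix N c assume N: "Suc N = e" "c + N < d"
      have "(\<Sum>c'\<in>?C. Lam (e - 1) c' f * Lam N c (XM c' 0 (e - 1))) =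
          (\<Sum>c'\<in>?C. if c' = c then Lam N c f else 0)"
        by (rule sum.cong) (use N in \<open>auto simp: Lam_XM\<close>)
      also have "\<dots> = Lam N c f" using N fin by auto
      finally show "Lam N c (f - ?p) = 0"
        using N by (simp add: Lam_diff Lam_add Lam_yform Lam_sum Lam_cscale)
      next
      have "Yp e (f - ?p) = 0"
        by (auto simp: Yp_diff Yp_add Yp_yform degree_Yp Yp_sum Yp_cscale Yp_XM intro!: sum.neutral)
      then show "form_multiple q e (Yp e (f - ?p))" by simp
    qed
  qed
  show "p = 0" if p: "keys p \<subseteq> ?B" "p \<in> JJ q" for p
  proof (rule forms_eq_0I[OF p(1)])
    show "Yp e p = 0" using JJ_D(3)[OF p(2), of e] assms form_multiple_small by blast
    fix m assume "m \<in> ?K"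
    then obtain c where c: "m = xmon c 0 (e - 1)" "1 \<le> e" "c + e \<le> d" by auto
    have "Lam (e - 1) c p = (\<Sum>a\<le>e - 1. if a = 0 then lookup p m / bin c else 0)"
      unfolding Lam_def
    proof (rule sum.cong[OF refl])
      fix a assume a: "a \<in> {..e - 1}"
      show "lookup p (xmon (c + a) a (e - 1 - a)) / bin (c + a) = (if a = 0 then lookup p m / bin c else 0)"
      proof (cases "a = 0")
        case False
        then have "xmon (c + a) a (e - 1 - a) \<notin> ?B" using a c by (auto simp: xmon_eq_iff)
        then have "xmon (c + a) a (e - 1 - a) \<notin> keys p" using p(1) by blast
        then show ?thesis using False by (simp add: in_keys_iff)
      qed (simp add: c)
    qed
    then have "Lam (e - 1) c p = lookup p m / bin c" by simp
    then show "lookup p m = 0" using JJ_D(2)[OF p(2), of c "e - 1"] c by simp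
  qed
qed

text \<open>The multiples of q have leading exponents from \<open>degree q\<close> to
  \<open>e + degree q - (d + 2)\<close>; the other exponents give a basis. The upper range is
  nonempty exactly if q has a root at infinity, that is, \<open>degree q < d + 2\<close>.\<close>

lemma quot_basis_JJ_large:
  assumes "q \<noteq> 0" "degree q \<le> d + 2" "e \<ge> d + 2"
  shows "quot_basis (d + 1) (JJ q) e
    ((\<lambda>a. ymon a (e - a)) ` ({..<degree q} \<union> {e + degree q - (d + 2)<..e}))"
proof (rule quot_basisI[OF subspace_JJ])
  let ?i = "degree q" and ?D = "e + degree q - (d + 2)"
  let ?B = "(\<lambda>a. ymon a (e - a)) ` ({..<?i} \<union> {?D<..e})"
  show B: "?B \<subseteq> monoms (d + 1) e"
    using assms by (auto intro!: ymon_in_monoms[simplified])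
  have JJ_iff: "f \<in> JJ q \<longleftrightarrow> form_multiple q e (Yp e f)" if "f \<in> forms (d + 1) e" for f
    unfolding JJ_forms_iff[OF that] using assms(3) by auto
  show "\<exists>p. keys p \<subseteq> ?B \<and> f - p \<in> JJ q" if f: "f \<in> forms (d + 1) e" for f
  proof -
    \<comment> \<open>Terms of exponent above \<open>?D\<close> are already reduced; only the rest
      is divided by \<open>q\<close>, which keeps the quotient within the allowed degree.\<close>
    define F where "F = (\<Sum>a\<le>?D. Polynomial.monom (coeff (Yp e f) a) a)"
    have cF: "coeff F a = (if a \<le> ?D then coeff (Yp e f) a else 0)" for a
      by (simp add: F_def coeff_sum)
    have dF: "degree F \<le> ?D" by (rule degree_le) (simp add: cF)
    define g where "g = F div q"
    have "degree g \<le> ?D - ?i"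
    proof (cases "g = 0")
      case False
      have qg: "q * g = F - F mod q" unfolding g_def by (simp add: minus_mod_eq_mult_div)
      have "degree q + degree g = degree (q * g)" using False assms(1) by (simp add: degree_mult_eq)
      also have "\<dots> \<le> ?D"
        unfolding qg using dF degree_mod_less[OF assms(1), of F] assms(3)
        by (intro degree_diff_le) auto
      finally show ?thesis by simp
    qed simp
    then have fm: "form_multiple q e (q * g)"
      using assms unfolding form_multiple_def by (intro exI[of _ g]) auto
    have qg: "degree (q * g) \<le> e" using fm degree_mult_le[of q g] assms
      \<open>degree g \<le> ?D - ?i\<close> by linarith
    define p where "p = f - yform e (q * g) - (f - yform e (Yp e f))"
    have Ypf: "p = yform e (Yp e f - q * g)"
      unfolding p_def yform_def by (simp add: single_diff sum_subtractf)
    have c0: "coeff (Yp e f - q * g) a = 0" if a: "a \<le> e" "a \<notin> {..<?i} \<union> {?D<..e}" for a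
    proof -
      have "coeff (Yp e f - q * g) a = coeff (F - q * g) a" using a by (simp add: cF)
      also have "F - q * g = F mod q" unfolding g_def by (simp add: minus_mult_div_eq_mod)
      also have "coeff (F mod q) a = 0"
        using degree_mod_less[OF assms(1), of F] a by (auto intro: coeff_eq_0)
      finally show ?thesis .
    qed
    have "keys p \<subseteq> ?B" unfolding Ypf yform_def
    proof (rule keys_subset_sum)
      fix a assume "a \<in> {..e}"
      then show "keys (single (ymon a (e - a)) (coeff (Yp e f - q * g) a)) \<subseteq> ?B"
        using c0[of a] by (cases "a \<in> {..<?i} \<union> {?D<..e}") auto
    qed
    moreover have "f - p \<in> JJ q"
    proof -
      have fp: "f - p \<in> forms (d + 1) e" unfolding Ypf by (intro forms_diff f yform_in_forms)
      have "degree (Yp e f - q * g) \<le> e" using degree_Yp qg by (rule degree_diff_le)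
      then have "Yp e (f - p) = q * g" unfolding Yp_diff Ypf by (simp add: Yp_yform)
      then show ?thesis unfolding JJ_iff[OF fp] using fm by simp
    qed
    ultimately show ?thesis by blast
  qed
  show "p = 0" if p: "keys p \<subseteq> ?B" "p \<in> JJ q" for p
  proof (rule forms_eq_0I[of p e "{}"])
    show "keys p \<subseteq> (\<lambda>a. ymon a (e - a)) ` {..e} \<union> {}" using p(1) assms by auto
    obtain g where g: "Yp e p = q * g" "g = 0 \<or> degree g + (d + 2) \<le> e"
      using JJ_D(3)[OF p(2)] unfolding form_multiple_def by blast
    show "Yp e p = 0"
    proof (rule ccontr)
      assume "Yp e p \<noteq> 0"
      then have nz: "g \<noteq> 0" using g(1) by auto
      define a where "a = degree q + degree g"
      have a: "?i \<le> a" "a \<le> ?D" "a \<le> e" using g(2) nz assms unfolding a_def by auto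
      have "coeff (Yp e p) a = lead_coeff q * lead_coeff g"
        unfolding g(1) a_def by (rule coeff_mult_degree_sum)
      then have "lookup p (ymon a (e - a)) \<noteq> 0" using nz assms(1) a by (simp add: coeff_Yp)
      then have "ymon a (e - a) \<in> ?B" using p(1) by (auto simp: in_keys_iff)
      then show False using a by auto
    qed
  qed auto
qed

lemma JJ_in_Hilb:
  assumes "q \<noteq> 0" "degree q \<le> d + 2"
  shows "JJ q \<in> Hilb (d + 1) (h_gen (d + 1) (d + 2))"
proof -
  have "hilbert_fun (d + 1) (JJ q) e = h_gen (d + 1) (d + 2) e" for e
  proof -
    \<comment> \<open>A quotient basis of d + 2 monomials also shows that there are that many
      monomials, so the minimum in \<open>h_gen\<close> is d + 2.\<close>
    have key: ?thesis if B: "quot_basis (d + 1) (JJ q) e B" "card B = d + 2" for B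
      using hilbert_fun_quot_basis[OF subspace_JJ B(1)] B(2)
        card_mono[OF finite_monoms quot_basisD(1)[OF B(1)]]
      by (simp add: h_gen_def dim_forms)
    have inj: "inj_on (\<lambda>a. ymon a (e - a)) A" for A by (rule inj_onI) simp
    consider "e = 0" | "1 \<le> e" "e < d + 2" | "e \<ge> d + 2" by linarith
    then show ?thesis
    proof cases
      case 1
      have "monoms (d + 1) 0 = {0}"
        by (auto simp: monoms_def mdeg_def in_keys_iff intro!: poly_mapping_eqI)
      then have "h_gen (d + 1) (d + 2) e = 1" using 1 by (simp add: h_gen_def dim_forms)
      moreover have "hilbert_fun (d + 1) (JJ q) e = 1"
        using hilbert_fun_quot_basis[OF subspace_JJ quot_basis_JJ_small[of 0 q]] 1 by simp
      ultimately show ?thesis by simp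
    next
      case 2
      show ?thesis
      proof (rule key[OF quot_basis_JJ_small[OF 2(2)]])
        have C: "{c. 1 \<le> e \<and> c + e \<le> d} = {..<d + 1 - e}" using 2 by auto
        have inj_x: "inj_on (\<lambda>c. xmon c 0 (e - 1)) {c. 1 \<le> e \<and> c + e \<le> d}"
          using 2 by (auto intro!: inj_onI simp: xmon_eq_iff)
        have "card ((\<lambda>c. xmon c 0 (e - 1)) ` {c. 1 \<le> e \<and> c + e \<le> d}) = d + 1 - e"
          using card_image[OF inj_x] unfolding C by simp
        moreover have "card ((\<lambda>a. ymon a (e - a)) ` {..e}) = e + 1" by (simp add: card_image[OF inj])
        moreover have disj: "(\<lambda>a. ymon a (e - a)) ` {..e} \<inter> (\<lambda>c. xmon c 0 (e - 1)) ` {c. 1 \<le> e \<and> c + e \<le> d} = {}"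
          using 2 by auto
        have fin: "finite ((\<lambda>c. xmon c 0 (e - 1)) ` {c. 1 \<le> e \<and> c + e \<le> d})" unfolding C by simp
        ultimately show "card ((\<lambda>a. ymon a (e - a)) ` {..e} \<union>
            (\<lambda>c. xmon c 0 (e - 1)) ` {c. 1 \<le> e \<and> c + e \<le> d}) = d + 2"
          using 2(2) unfolding card_Un_disjoint[OF finite_imageI[OF finite_atMost] fin disj] by linarith
      qed
    next
      case 3
      show ?thesis
      proof (rule key[OF quot_basis_JJ_large[OF assms 3]])
        have "card ({..<degree q} \<union> {e + degree q - (d + 2)<..e}) = d + 2"
          using assms(2) 3 by (subst card_Un_disjoint) auto
        then show "card ((\<lambda>a. ymon a (e - a)) ` ({..<degree q} \<union> {e + degree q - (d + 2)<..e})) = d + 2"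
          by (simp add: card_image[OF inj])
      qed
    qed
  qed
  then show ?thesis unfolding Hilb_def using homogeneous_JJ by blast
qed

end

section \<open>The annihilator of \<open>G\<close>\<close>

lemma lookup_pd: "lookup (pd i F) k = of_nat (lookup k i + 1) * lookup F (k + single i 1)"
proof -
  have "(of_nat (lookup m i) * lookup F m when m - single i 1 = k) =
      (if m = k + single i 1 then of_nat (lookup k i + 1) * lookup F (k + single i 1) else 0)" for m
  proof (cases "lookup m i = 0")
    case True
    then have "m \<noteq> k + single i 1" by (auto simp: lookup_add)
    then show ?thesis using True by (simp add: when_def)
  next
    case False
    then have "m - single i 1 = k \<longleftrightarrow> m = k + single i 1"
      using monom_minus_single[OF False] by (metis add.commute add_diff_cancel_right')
    then show ?thesis by (auto simp: when_def lookup_add)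
  qed
  then show ?thesis unfolding pd_def lookup_sum lookup_single by (simp add: in_keys_iff)
qed

lemma lookup_pd_power:
  "lookup ((pd i ^^ a) F) k = fact (lookup k i + a) / fact (lookup k i) * lookup F (k + single i a)"
proof (induction a arbitrary: k)
  case (Suc a)
  have "lookup ((pd i ^^ Suc a) F) k = of_nat (lookup k i + 1) * lookup ((pd i ^^ a) F) (k + single i 1)"
    by (simp add: lookup_pd)
  also have "\<dots> = of_nat (lookup k i + 1) * (fact (lookup k i + 1 + a) / fact (lookup k i + 1) *
      lookup F (k + single i 1 + single i a))"
    unfolding Suc.IH by (simp add: lookup_add)
  also have "k + single i 1 + single i a = k + single i (Suc a)"
    by (rule poly_mapping_eqI) (simp add: lookup_add lookup_single when_def)
  also have "of_nat (lookup k i + 1) * (fact (lookup k i + 1 + a) / fact (lookup k i + 1) *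
      lookup F (k + single i (Suc a))) =
      fact (lookup k i + Suc a) / fact (lookup k i) * lookup F (k + single i (Suc a))"
  proof -
    have "(of_nat (lookup k i + 1) :: complex) \<noteq> 0" using of_nat_neq_0[of "lookup k i"] by simp
    moreover have "fact (lookup k i + 1) = (of_nat (lookup k i + 1) :: complex) * fact (lookup k i)"
      by simp
    moreover have "x * (A / (x * B) * C) = A / B * C" if "x \<noteq> 0" for x A B C :: complex
      using that by simp
    ultimately show ?thesis by (metis add.assoc plus_1_eq_Suc)
  qed
  finally show ?case .
qed simp

definition diff_weight :: "monom \<Rightarrow> monom \<Rightarrow> complex"
  where "diff_weight k a = (\<Prod>i\<in>keys a. fact (lookup k i + lookup a i) / fact (lookup k i))"

lemma diff_weight_superset:
  assumes "finite S" "keys a \<subseteq> S"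
  shows "diff_weight k a = (\<Prod>i\<in>S. fact (lookup k i + lookup a i) / fact (lookup k i))"
  unfolding diff_weight_def by (rule prod.mono_neutral_left) (use assms in \<open>auto simp: in_keys_iff\<close>)

lemma lookup_pd_monom: "lookup (pd_monom a F) k = diff_weight k a * lookup F (k + a)"
proof -
  have "lookup (fold (\<lambda>i. pd i ^^ lookup a i) xs F) k =
      (\<Prod>i\<in>set xs. fact (lookup k i + lookup a i) / fact (lookup k i)) *
      lookup F (k + (\<Sum>i\<in>set xs. single i (lookup a i)))" if "distinct xs" for xs
    using that
  proof (induction xs arbitrary: F)
    case (Cons x xs)
    let ?S = "\<Sum>i\<in>set xs. single i (lookup a i)"
    \<comment> \<open>No variable occurs twice, so the weight of \<open>x\<close> is not affected by
      the other derivatives.\<close>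
    have "lookup ?S x = 0"
      unfolding lookup_sum lookup_single using Cons.prems by (intro sum.neutral) (auto simp: when_def)
    then have "lookup (k + ?S) x = lookup k x" by (simp add: lookup_add)
    moreover have "k + ?S + single x (lookup a x) = k + (\<Sum>i\<in>set (x # xs). single i (lookup a i))"
      using Cons.prems by (simp add: add_ac)
    ultimately show ?case using Cons by (simp add: lookup_pd_power)
  qed simp
  from this[of "sorted_list_of_set (keys a)"] show ?thesis
    by (simp add: pd_monom_def diff_weight_def flip: poly_mapping_sum_single)
qed

lemma lookup_diff_act:
  "lookup (diff_act h F) k = (\<Sum>a\<in>keys h. lookup h a * (diff_weight k a * lookup F (k + a)))"
  unfolding diff_act_def by (simp add: lookup_sum lookup_pd_monom)

lemma sum_keys_eq:
  fixes h :: cpoly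
  assumes "finite T" "\<And>a. a \<in> keys h \<Longrightarrow> a \<notin> T \<Longrightarrow> v a = 0"
  shows "(\<Sum>a\<in>keys h. lookup h a * v a) = (\<Sum>a\<in>T. lookup h a * v a)"
proof -
  have "(\<Sum>a\<in>keys h. lookup h a * v a) = (\<Sum>a\<in>keys h \<inter> T. lookup h a * v a)"
    by (rule sum.mono_neutral_right) (use assms in auto)
  also have "\<dots> = (\<Sum>a\<in>T. lookup h a * v a)"
    by (rule sum.mono_neutral_left) (use assms in \<open>auto simp: in_keys_iff\<close>)
  finally show ?thesis .
qed

context G_form
begin

lemma form_G_eq: "form_G d = (\<Sum>i<d. single (xmon i i (d - 1 - i)) 1)"
proof -
  have pow: "Var j ^ k = single (single j k) 1" for j k
    by (induction k) (simp_all add: Var_def mult_single flip: single_add)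
  have "form_G d = (\<Sum>i<d. Var i * single (single d i) 1 * single (single (d + 1) (d - 1 - i)) 1)"
    by (simp only: form_G_def pow)
  then show ?thesis by (simp add: Var_def mult_single xmon_def ymon_def add.assoc)
qed

lemma lookup_form_G: "lookup (form_G d) m = (if \<exists>i<d. m = xmon i i (d - 1 - i) then 1 else 0)"
proof (cases "\<exists>i<d. m = xmon i i (d - 1 - i)")
  case True
  then obtain i where i: "i < d" "m = xmon i i (d - 1 - i)" by blast
  have "lookup (form_G d) m = (\<Sum>j<d. if j = i then 1 else 0)"
    unfolding form_G_eq lookup_sum lookup_single i(2)
    by (rule sum.cong) (use i in \<open>auto simp: when_def xmon_eq_iff\<close>)
  then show ?thesis using i by auto
next
  case False
  then show ?thesis unfolding form_G_eq lookup_sum lookup_single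
    by (auto simp: when_def intro!: sum.neutral)
qed

lemma diff_weight_xmon:
  assumes "i < d"
  shows "diff_weight (ymon c c') (xmon i a b) = fact (c + a) / fact c * (fact (c' + b) / fact c')"
  by (subst diff_weight_superset[of "{i, d, Suc d}"])
    (use assms in \<open>auto simp: in_keys_iff lookup_xmon lookup_ymon split: if_splits\<close>)

lemma diff_weight_ymon:
  assumes "i < d"
  shows "diff_weight (xmon i c c') (ymon a b) = fact (c + a) / fact c * (fact (c' + b) / fact c')"
  by (subst diff_weight_superset[of "{d, Suc d}"])
    (use assms in \<open>auto simp: in_keys_iff lookup_xmon lookup_ymon split: if_splits\<close>)

lemma ymon_add_eq_xmonD:
  assumes "ymon c c' + a = xmon i p r" "i < d"
  shows "a = xmon i (p - c) (r - c') \<and> c \<le> p \<and> c' \<le> r"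
proof -
  have *: "lookup (ymon c c') k + lookup a k = lookup (xmon i p r) k" for k
    using arg_cong[OF assms(1), of "\<lambda>m. lookup m k"] by (simp add: lookup_add)
  have c: "c + lookup a d = p" "c' + lookup a (Suc d) = r"
    using *[of d] *[of "Suc d"] assms(2) by (auto simp: lookup_xmon lookup_ymon)
  have "lookup a k = lookup (xmon i (p - c) (r - c')) k" for k
    using *[of k] c assms(2) by (auto simp: lookup_xmon lookup_ymon split: if_splits)
  then have "a = xmon i (p - c) (r - c')" by (rule poly_mapping_eqI)
  then show ?thesis using c by auto
qed

lemma xmon_add_eq_xmonD:
  assumes "xmon j c c' + a = xmon i p r" "i < d" "j < d"
  shows "j = i \<and> a = ymon (p - c) (r - c') \<and> c \<le> p \<and> c' \<le> r"
proof -
  have *: "lookup (xmon j c c') k + lookup a k = lookup (xmon i p r) k" for k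
    using arg_cong[OF assms(1), of "\<lambda>m. lookup m k"] by (simp add: lookup_add)
  have ji: "j = i" using *[of j] assms(2,3) by (auto simp: lookup_xmon lookup_ymon split: if_splits)
  have c: "c + lookup a d = p" "c' + lookup a (Suc d) = r"
    using *[of d] *[of "Suc d"] assms(2,3) by (auto simp: lookup_xmon lookup_ymon)
  have "lookup a k = lookup (ymon (p - c) (r - c')) k" for k
    using *[of k] c assms(2) ji by (auto simp: lookup_xmon lookup_ymon split: if_splits)
  then have "a = ymon (p - c) (r - c')" by (rule poly_mapping_eqI)
  then show ?thesis using c ji by auto
qed

text \<open>Only the operators x_i y_0^t y_1^(N-t) with i = c + t reach the monomial u_0^c
  u_1^(d-1-c-N), and the factorials from differentiation turn into the weights 1 / bin.\<close>

lemma lookup_diff_act_ymon: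
  assumes "c + N < d"
  shows "lookup (diff_act h (form_G d)) (ymon c (d - 1 - c - N)) =
    fact (d - 1) / (fact c * fact (d - 1 - c - N)) * Lam N c h"
proof -
  let ?c' = "d - 1 - c - N" and ?T = "(\<lambda>t. xmon (c + t) t (N - t)) ` {..N}"
  let ?v = "\<lambda>a. diff_weight (ymon c ?c') a * lookup (form_G d) (ymon c ?c' + a)"
  have inj: "inj_on (\<lambda>t. xmon (c + t) t (N - t)) {..N}"
    using assms by (auto intro!: inj_onI simp: xmon_eq_iff)
  have "?v a = 0" if "a \<notin> ?T" for a
  proof -
    have "\<not> (\<exists>i<d. ymon c ?c' + a = xmon i i (d - 1 - i))"
    proof
      assume "\<exists>i<d. ymon c ?c' + a = xmon i i (d - 1 - i)"
      then obtain i where "i < d" "a = xmon i (i - c) (d - 1 - i - ?c')" "c \<le> i" "?c' \<le> d - 1 - i"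
        using ymon_add_eq_xmonD by blast
      then have "a = xmon (c + (i - c)) (i - c) (N - (i - c))" "i - c \<le> N"
        using assms by (auto simp: add.commute)
      then show False using that by blast
    qed
    then show ?thesis by (simp only: lookup_form_G if_False mult_zero_right)
  qed
  then have "lookup (diff_act h (form_G d)) (ymon c ?c') = (\<Sum>a\<in>?T. lookup h a * ?v a)"
    unfolding lookup_diff_act by (intro sum_keys_eq) auto
  also have "\<dots> = (\<Sum>t\<le>N. lookup h (xmon (c + t) t (N - t)) * ?v (xmon (c + t) t (N - t)))"
    by (rule sum.reindex[OF inj, unfolded comp_def])
  also have "\<dots> = (\<Sum>t\<le>N. fact (d - 1) / (fact c * fact ?c') *
      (lookup h (xmon (c + t) t (N - t)) / bin (c + t)))"
  proof (rule sum.cong[OF refl])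
    fix t assume t: "t \<in> {..N}"
    have "ymon c ?c' + xmon (c + t) t (N - t) = xmon (c + t) (c + t) (d - 1 - (c + t))"
      by (rule poly_mapping_eqI) (use t assms in \<open>auto simp: lookup_add lookup_xmon lookup_ymon\<close>)
    then have "lookup (form_G d) (ymon c ?c' + xmon (c + t) t (N - t)) = 1"
      using t assms by (auto simp: lookup_form_G intro!: exI[of _ "c + t"])
    moreover have "?c' + (N - t) = d - 1 - (c + t)" using t assms by auto
    moreover have "bin (c + t) = fact (d - 1) / (fact (c + t) * fact (d - 1 - (c + t)))"
      using t assms unfolding bin_def by (intro binomial_fact) auto
    ultimately show "lookup h (xmon (c + t) t (N - t)) * ?v (xmon (c + t) t (N - t)) =
        fact (d - 1) / (fact c * fact ?c') * (lookup h (xmon (c + t) t (N - t)) / bin (c + t))"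
      using t assms by (simp add: diff_weight_xmon)
  qed
  also have "\<dots> = fact (d - 1) / (fact c * fact ?c') * Lam N c h"
    unfolding Lam_def by (simp add: sum_distrib_left)
  finally show ?thesis .
qed

text \<open>A monomial containing v_i arises from one monomial of G only, hence from a single binary
  operator.\<close>

lemma lookup_diff_act_xmon:
  assumes "i < d" "c \<le> i" "c' \<le> d - 1 - i"
  shows "lookup (diff_act h (form_G d)) (xmon i c c') =
    fact i / fact c * (fact (d - 1 - i) / fact c') * lookup h (ymon (i - c) (d - 1 - i - c'))"
proof -
  let ?m = "ymon (i - c) (d - 1 - i - c')"
  let ?v = "\<lambda>a. diff_weight (xmon i c c') a * lookup (form_G d) (xmon i c c' + a)"
  have "?v a = 0" if "a \<notin> {?m}" for a
  proof -
    have "\<not> (\<exists>j<d. xmon i c c' + a = xmon j j (d - 1 - j))"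
      using that xmon_add_eq_xmonD assms(1) by blast
    then show ?thesis by (simp only: lookup_form_G if_False mult_zero_right)
  qed
  then have "lookup (diff_act h (form_G d)) (xmon i c c') = (\<Sum>a\<in>{?m}. lookup h a * ?v a)"
    unfolding lookup_diff_act by (intro sum_keys_eq) auto
  moreover have "xmon i c c' + ?m = xmon i i (d - 1 - i)"
    by (rule poly_mapping_eqI) (use assms in \<open>auto simp: lookup_add lookup_xmon lookup_ymon\<close>)
  then have "lookup (form_G d) (xmon i c c' + ?m) = 1" using assms by (auto simp: lookup_form_G)
  ultimately show ?thesis using assms by (simp add: diff_weight_ymon)
qed

text \<open>The conditions are the coefficients of \<open>diff_act h (form_G d)\<close>: monomials
  free of the v_i give the \<open>Lam N c h\<close>, those containing a v_i give the binary
  coefficients of degree below d.\<close>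

lemma Ann_iff:
  assumes "h \<in> polys (d + 1)"
  shows "h \<in> Ann (d + 1) (form_G d) \<longleftrightarrow>
    (\<forall>N c. c + N < d \<longrightarrow> Lam N c h = 0) \<and> (\<forall>a b. a + b < d \<longrightarrow> lookup h (ymon a b) = 0)"
proof
  assume "h \<in> Ann (d + 1) (form_G d)"
  then have 0: "lookup (diff_act h (form_G d)) k = 0" for k by (simp add: Ann_def)
  have "Lam N c h = 0" if "c + N < d" for N c
    using lookup_diff_act_ymon[OF that, of h] 0 by simp
  moreover have "lookup h (ymon a b) = 0" if "a + b < d" for a b
  proof -
    \<comment> \<open>The coefficient of v_a u_1^(d-1-a-b) isolates y_0^a y_1^b.\<close>
    have "d - 1 - a - (d - 1 - a - b) = b" using that by simp
    then show ?thesis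
      using lookup_diff_act_xmon[of a 0 "d - 1 - a - b" h] 0 that by simp
  qed
  ultimately show "(\<forall>N c. c + N < d \<longrightarrow> Lam N c h = 0) \<and> (\<forall>a b. a + b < d \<longrightarrow> lookup h (ymon a b) = 0)"
    by blast
next
  assume R: "(\<forall>N c. c + N < d \<longrightarrow> Lam N c h = 0) \<and> (\<forall>a b. a + b < d \<longrightarrow> lookup h (ymon a b) = 0)"
  \<comment> \<open>Only divisors of the monomials of G can occur; such a divisor either contains
    its v_i or is binary.\<close>
  have "lookup (diff_act h (form_G d)) k = 0" for k
  proof (cases "\<exists>a i. i < d \<and> k + a = xmon i i (d - 1 - i)")
    case True
    then obtain a i where ai: "i < d" "k + a = xmon i i (d - 1 - i)" by blast
    have *: "lookup k j + lookup a j = lookup (xmon i i (d - 1 - i)) j" for j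
      using arg_cong[OF ai(2), of "\<lambda>m. lookup m j"] by (simp add: lookup_add)
    have le: "lookup k d \<le> i" "lookup k (Suc d) \<le> d - 1 - i"
      using *[of d] *[of "Suc d"] ai(1) by (auto simp: lookup_xmon lookup_ymon)
    show ?thesis
    proof (cases "lookup k i = 0")
      case True
      have k: "k = ymon (lookup k d) (lookup k (Suc d))"
      proof (rule poly_mapping_eqI)
        fix j show "lookup k j = lookup (ymon (lookup k d) (lookup k (Suc d))) j"
          using *[of j] True by (auto simp: lookup_xmon lookup_ymon split: if_splits)
      qed
      define N where "N = d - 1 - lookup k d - lookup k (Suc d)"
      have N: "lookup k d + N < d" "lookup k (Suc d) = d - 1 - lookup k d - N"
        using le ai(1) unfolding N_def by auto
      have "lookup (diff_act h (form_G d)) (ymon (lookup k d) (lookup k (Suc d))) = 0"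
        using lookup_diff_act_ymon[OF N(1), of h] R N by simp
      then show ?thesis using k by simp
    next
      case False
      have k: "k = xmon i (lookup k d) (lookup k (Suc d))"
      proof (rule poly_mapping_eqI)
        fix j show "lookup k j = lookup (xmon i (lookup k d) (lookup k (Suc d))) j"
          using *[of j] *[of i] False ai(1) by (auto simp: lookup_xmon lookup_ymon split: if_splits)
      qed
      have "i - lookup k d + (d - 1 - i - lookup k (Suc d)) < d" using ai(1) by auto
      then have "lookup (diff_act h (form_G d)) (xmon i (lookup k d) (lookup k (Suc d))) = 0"
        using lookup_diff_act_xmon[OF ai(1) le, of h] R by simp
      then show ?thesis using k by simp
    qed
  next
    case False
    then show ?thesis unfolding lookup_diff_act by (intro sum.neutral) (auto simp: lookup_form_G)
  qed
  then show "h \<in> Ann (d + 1) (form_G d)"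
    using assms by (auto simp: Ann_def intro!: poly_mapping_eqI)
qed

lemma JJ_subset_Ann: "JJ q \<subseteq> Ann (d + 1) (form_G d)"
proof
  fix h assume h: "h \<in> JJ q"
  have "lookup h (ymon a b) = 0" if "a + b < d" for a b
    using JJ_lookup_ymon[OF h] that by simp
  then show "h \<in> Ann (d + 1) (form_G d)"
    using JJ_D(2)[OF h] Ann_iff[OF JJ_D(1)[OF h]] by blast
qed

section \<open>Generators of \<open>I + (q)\<close>\<close>

text \<open>These quadrics are a basis of Ann(G) in degree 2: there are d(d + 1)/2 + d + 1 of them,
  which is d + 2 less than the number of quadratic monomials. With X_(-1) = X_d = 0, those linear in
  the X_i are, up to sign, all of the form X_(i+1) y_0 - X_i y_1.\<close>

definition contains_gens :: "cpoly set \<Rightarrow> bool"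
  where "contains_gens J \<longleftrightarrow> (\<forall>i<d. \<forall>j<d. Var i * Var j \<in> J) \<and>
    (\<forall>i. Suc i < d \<longrightarrow> XM (Suc i) 1 0 - XM i 0 1 \<in> J) \<and> XM 0 1 0 \<in> J \<and> XM (d - 1) 0 1 \<in> J"

lemma Lam_XM_general:
  assumes "c + N < d" "i < d"
  shows "Lam N c (XM i a b) = (if N = a + b \<and> i = c + a then 1 else 0)"
proof -
  have "Lam N c (XM i a b) = (\<Sum>t\<le>N. if t = a then (if N = a + b \<and> i = c + a then 1 else 0) else 0)"
    unfolding Lam_def XM_def lookup_single
    by (rule sum.cong) (use assms in \<open>auto simp: when_def xmon_eq_iff\<close>)
  then show ?thesis by simp
qed

lemma Var_Var: "Var i * Var j = single (single i 1 + single j 1) 1"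
  by (simp add: Var_def mult_single)

lemma Lam_eq_0_of_lookup: "(\<And>a. a \<le> N \<Longrightarrow> lookup f (xmon (c + a) a (N - a)) = 0) \<Longrightarrow> Lam N c f = 0"
  unfolding Lam_def by (rule sum.neutral) auto

lemma two_x_neq_xmon:
  assumes "i < d" "j < d" "k < d"
  shows "single i 1 + single j 1 + m \<noteq> xmon k a b" "single i 1 + single j 1 + m \<noteq> ymon a b"
proof -
  show "single i 1 + single j 1 + m \<noteq> xmon k a b"
  proof
    assume eq: "single i 1 + single j 1 + m = xmon k a b"
    have *: "lookup (single i 1 + single j 1 + m) l = lookup (xmon k a b) l" for l by (simp only: eq)
    show False using *[of i] *[of j] assms
      by (auto simp: lookup_add lookup_single when_def lookup_xmon lookup_ymon split: if_splits)
  qed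
  show "single i 1 + single j 1 + m \<noteq> ymon a b"
    using assms by (auto simp: lookup_add lookup_single lookup_ymon dest!: arg_cong[where f = "\<lambda>m. lookup m i"])
qed

lemma contains_gens_JJ: "contains_gens (JJ q)"
proof -
  have I: "f \<in> JJ q" if "f \<in> forms (d + 1) 2" "\<And>c. Suc c < d \<Longrightarrow> Lam 1 c f = 0" "Yp 2 f = 0" for f
    unfolding JJ_forms_iff[OF that(1)] using that(2,3) by simp
  have forms: "XM i a b \<in> forms (d + 1) 2" if "i < d" "a + b = 1" for i a b
    unfolding XM_def using that by (intro single_in_forms xmon_in_monoms) auto
  have "Var i * Var j \<in> JJ q" if ij: "i < d" "j < d" for i j
  proof (rule I)
    have "single i 1 + single j 1 \<in> monoms (d + 1) 2"
      using that Poly_Mapping.keys_add[of "single i (1::nat)" "single j 1"] by (auto simp: monoms_def)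
    then show "Var i * Var j \<in> forms (d + 1) 2" unfolding Var_Var by (rule single_in_forms)
    show "Lam 1 c (Var i * Var j) = 0" if "Suc c < d" for c
      using that two_x_neq_xmon(1)[OF ij, of "c + _" 0]
      by (intro Lam_eq_0_of_lookup) (simp add: Var_Var lookup_single)
    show "Yp 2 (Var i * Var j) = 0"
      using two_x_neq_xmon(2)[OF ij ij(1), of 0]
      by (intro poly_eqI) (simp add: coeff_Yp Var_Var lookup_single)
  qed
  moreover have "XM (Suc i) 1 0 - XM i 0 1 \<in> JJ q" if "Suc i < d" for i
    using that by (intro I forms_diff forms) (auto simp: Lam_diff Lam_XM_general Yp_diff Yp_XM)
  moreover have "XM 0 1 0 \<in> JJ q" "XM (d - 1) 0 1 \<in> JJ q"
    using d_ge_3 by (auto intro!: I forms[simplified] simp: Lam_XM_general Yp_XM)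
  ultimately show ?thesis by (simp add: contains_gens_def)
qed

section \<open>Reduction modulo the quadrics\<close>

definition ypart :: "cpoly \<Rightarrow> cpoly"
  where "ypart f = (\<Sum>m | m \<in> keys f \<and> (\<forall>i<d. lookup m i = 0). single m (lookup f m))"

lemma lookup_ypart: "lookup (ypart f) m = (if \<forall>i<d. lookup m i = 0 then lookup f m else 0)"
proof -
  have "(\<Sum>k | k \<in> keys f \<and> (\<forall>i<d. lookup k i = 0). lookup f k when k = m) =
      (\<Sum>k | k \<in> keys f \<and> (\<forall>i<d. lookup k i = 0). if k = m then lookup f m else 0)"
    by (rule sum.cong) (auto simp: when_def)
  then show ?thesis unfolding ypart_def lookup_sum lookup_single by (simp add: in_keys_iff)
qed

lemma lookup_yform_other: "(\<And>a b. m \<noteq> ymon a b) \<Longrightarrow> lookup (yform e p) m = 0"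
  unfolding yform_def lookup_sum lookup_single by (intro sum.neutral) (metis when_simps(2))

lemma ypart_eq:
  assumes "f \<in> polys (d + 1)"
  shows "ypart f = (\<Sum>e\<in>mdeg ` keys f. yform e (Yp e f))"
proof (rule poly_mapping_eqI)
  fix m
  show "lookup (ypart f) m = lookup (\<Sum>e\<in>mdeg ` keys f. yform e (Yp e f)) m"
  proof (cases "\<exists>a b. m = ymon a b")
    case True
    then obtain a b where m: "m = ymon a b" by blast
    have "(\<Sum>e\<in>mdeg ` keys f. lookup (yform e (Yp e f)) m) =
        (\<Sum>e\<in>mdeg ` keys f. if e = a + b then lookup f m else 0)"
      unfolding m by (rule sum.cong) (auto simp: lookup_yform_ymon coeff_Yp)
    also have "\<dots> = lookup f m"
    proof (cases "lookup f m = 0")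
      case False
      then have "a + b \<in> mdeg ` keys f" using m by (auto simp: in_keys_iff intro!: image_eqI[of _ _ m])
      then show ?thesis by simp
    qed simp
    finally show ?thesis unfolding lookup_sum by (simp add: lookup_ypart m lookup_ymon)
  next
    case False
    have "lookup (yform e p) m = 0" for e p
      using False by (intro lookup_yform_other) auto
    moreover have "lookup f m = 0" if "\<forall>i<d. lookup m i = 0"
    proof (rule ccontr)
      assume "lookup f m \<noteq> 0"
      then have "keys m \<subseteq> {..d + 1}" using assms by (auto simp: polys_def in_keys_iff)
      then show False using ymonI that False by blast
    qed
    ultimately show ?thesis by (simp add: lookup_ypart lookup_sum)
  qed
qed

lemma ymon_times_XM: "single (ymon a b) 1 * XM i a' b' = XM i (a + a') (b + b')"
proof -
  have "ymon a b + xmon i a' b' = xmon i (a + a') (b + b')"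
    by (rule poly_mapping_eqI) (auto simp: lookup_add lookup_xmon lookup_ymon)
  then show ?thesis by (simp add: XM_def mult_single)
qed

text \<open>Dehomogenization turns y_0^k y_1^l into X^k. The degree bound matters:
  \<open>yform e\<close> cuts off coefficients beyond \<open>e\<close> that the right-hand side
  could still contain.\<close>

lemma ymon_times_yform:
  assumes "degree p \<le> e"
  shows "single (ymon k l) c * yform e p = yform (e + k + l) (Polynomial.monom c k * p)"
proof (rule poly_mapping_eqI)
  fix m
  show "lookup (single (ymon k l) c * yform e p) m = lookup (yform (e + k + l) (Polynomial.monom c k * p)) m"
  proof (cases "\<exists>b. m = ymon k l + b")
    case True
    then obtain b where m: "m = ymon k l + b" by blast
    show ?thesis
    proof (cases "\<exists>s t. b = ymon s t")
      case True
      then obtain s t where b: "b = ymon s t" by blast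
      have "ymon k l + b = ymon (k + s) (l + t)"
        unfolding b by (rule poly_mapping_eqI) (auto simp: lookup_add lookup_ymon)
      then have "lookup (yform (e + k + l) (Polynomial.monom c k * p)) m = (if s + t = e then c * coeff p s else 0)"
        unfolding m by (simp add: lookup_yform_ymon coeff_monom_mult)
      then show ?thesis unfolding m lookup_single_times by (simp add: b lookup_yform_ymon)
    next
      case False
      have "m \<noteq> ymon s t" for s t
      proof
        assume eq: "m = ymon s t"
        have *: "lookup (ymon k l) j + lookup b j = lookup (ymon s t) j" for j
          using arg_cong[OF eq, of "\<lambda>m. lookup m j"] by (simp add: m lookup_add)
        have "b = ymon (lookup b d) (lookup b (Suc d))"
        proof (rule poly_mapping_eqI)
          fix j show "lookup b j = lookup (ymon (lookup b d) (lookup b (Suc d))) j"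
            using *[of j] by (auto simp: lookup_ymon split: if_splits)
        qed
        then show False using False by blast
      qed
      then have "lookup (yform e' p') m = 0" for e' p' by (rule lookup_yform_other)
      moreover have "lookup (yform e p) b = 0"
        using False by (intro lookup_yform_other) auto
      ultimately show ?thesis unfolding m by simp
    qed
  next
    case False
    have "lookup (yform (e + k + l) (Polynomial.monom c k * p)) m = 0"
    proof (cases "\<exists>s t. m = ymon s t")
      case True
      then obtain s t where m: "m = ymon s t" by blast
      have "\<not> (k \<le> s \<and> l \<le> t)"
      proof
        assume "k \<le> s \<and> l \<le> t"
        then have "m = ymon k l + ymon (s - k) (t - l)"
          unfolding m by (intro poly_mapping_eqI) (auto simp: lookup_add lookup_ymon)
        then show False using False by blast
      qed
      moreover have "coeff p (s - k) = 0" if "k \<le> s" "t < l" "s + t = e + k + l"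
        using that assms by (intro coeff_eq_0) linarith
      ultimately show ?thesis by (auto simp: m lookup_yform_ymon coeff_monom_mult)
    next
      case False
      then show ?thesis by (intro lookup_yform_other) auto
    qed
    then show ?thesis using False by (simp add: lookup_single_times_0)
  qed
qed

lemma yform_sum: "yform e (\<Sum>i\<in>I. p i) = (\<Sum>i\<in>I. yform e (p i))"
  by (induction I rule: infinite_finite_induct)
    (simp_all add: yform_def single_add sum.distrib)

lemma yform_multiple_in_ideal:
  assumes J: "ideal J (poly_ring (d + 1))" and q: "yform (d + 2) q \<in> J" "degree q \<le> d + 2"
    and p: "form_multiple q e p"
  shows "yform e p \<in> J"
proof -
  note J' = ideal_poly_ringD[OF J]
  obtain g where g: "p = q * g" "g = 0 \<or> degree g + (d + 2) \<le> e" using p unfolding form_multiple_def by blast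
  show ?thesis
  proof (cases "g = 0")
    case True
    then show ?thesis using cvec.subspace_0[OF J'(3)] by (simp add: g yform_def)
  next
    case False
    then have e: "degree g + (d + 2) \<le> e" using g(2) by simp
    have "p = (\<Sum>k\<le>degree g. Polynomial.monom (coeff g k) k * q)"
      unfolding g(1) by (subst poly_as_sum_of_monoms[of g, symmetric]) (simp add: sum_distrib_left mult.commute)
    then have "yform e p = (\<Sum>k\<le>degree g. yform e (Polynomial.monom (coeff g k) k * q))"
      by (simp add: yform_sum)
    also have "\<dots> = (\<Sum>k\<le>degree g. single (ymon k (e - (d + 2) - k)) (coeff g k) * yform (d + 2) q)"
    proof (rule sum.cong[OF refl])
      fix k assume "k \<in> {..degree g}"
      then have eq: "d + 2 + k + (e - (d + 2) - k) = e" using e by auto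
      then show "yform e (Polynomial.monom (coeff g k) k * q) =
          single (ymon k (e - (d + 2) - k)) (coeff g k) * yform (d + 2) q"
        by (simp only: ymon_times_yform[OF q(2)] eq)
    qed
    also have "\<dots> \<in> J"
      by (intro cvec.subspace_sum[OF J'(3)] J'(2) q(1) polys_single keys_ymon)
    finally show ?thesis .
  qed
qed

text \<open>Each relation X_(i+1) y_0 = X_i y_1 lowers the index by one and trades y_0 for y_1.
  Going down, the factors y_0 are used up or X_0 y_0 = 0 is reached; a monomial with enough factors
  y_1 can be moved up to X_(d-1) y_1 = 0.\<close>

lemma gens_XM_reduce:
  assumes J: "ideal J (poly_ring (d + 1))" and gens: "contains_gens J" and i: "i < d"
  shows "XM i a b - (if a \<le> i \<and> i + b < d then XM (i - a) 0 (a + b) else 0) \<in> J"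
proof -
  note J' = ideal_poly_ringD[OF J]
  have mult: "single (ymon s t) 1 * f \<in> J" if "f \<in> J" for f s t
    using that by (intro J'(2) polys_single keys_ymon)
  have trans: "f - h \<in> J" if "f - g \<in> J" "g - h \<in> J" for f g h
    using cvec.subspace_add[OF J'(3) that] by simp
  have sym: "g - f \<in> J" if "f - g \<in> J" for f g
    using cvec.subspace_neg[OF J'(3) that] by simp
  have step: "XM (Suc i) (Suc a) b - XM i a (Suc b) \<in> J" if "Suc i < d" for i a b
  proof -
    have "single (ymon a b) 1 * (XM (Suc i) 1 0 - XM i 0 1) \<in> J"
      using gens that by (intro mult) (simp add: contains_gens_def)
    then show ?thesis by (simp add: right_diff_distrib ymon_times_XM)
  qed
  have down: "XM (i + k) (a + k) b - XM i a (b + k) \<in> J" if "i + k < d" for i a b k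
    using that
  proof (induction k arbitrary: b)
    case (Suc k)
    have "XM (i + Suc k) (a + Suc k) b - XM (i + k) (a + k) (Suc b) \<in> J"
      using step[of "i + k" "a + k" b] Suc.prems by simp
    from trans[OF this Suc.IH[of "Suc b"]] show ?case using Suc.prems by simp
  qed (simp add: cvec.subspace_0[OF J'(3)])
  show ?thesis
  proof (cases "a \<le> i")
    case True
    have d1: "XM i a b - XM (i - a) 0 (a + b) \<in> J"
      using down[of "i - a" a 0 b] True i by (simp add: add.commute)
    show ?thesis
    proof (cases "i + b < d")
      case False
      \<comment> \<open>\<open>k\<close> steps lead from index \<open>i - a\<close> up to
        \<open>d - 1\<close>; since \<open>k < a + b\<close>, a factor y_1 is left and the last
        quadric applies.\<close>
      define k where "k = d - 1 - (i - a)"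
      have k: "i - a + k = d - 1" "k < a + b" using False True i unfolding k_def by auto
      have "XM (i - a + k) (0 + k) (a + b - k) - XM (i - a) 0 (a + b - k + k) \<in> J"
        using k i by (intro down) auto
      then have "XM (d - 1) k (a + b - k) - XM (i - a) 0 (a + b) \<in> J" using k by simp
      then have d2: "XM i a b - XM (d - 1) k (a + b - k) \<in> J" using trans[OF d1 sym] by blast
      have "single (ymon k (a + b - k - 1)) 1 * XM (d - 1) 0 1 \<in> J"
        using gens by (intro mult) (simp add: contains_gens_def)
      then have "XM (d - 1) k (a + b - k) \<in> J" using k(2) by (simp add: ymon_times_XM Suc_diff_Suc)
      then have "XM (d - 1) k (a + b - k) - 0 \<in> J" by simp
      from trans[OF d2 this] show ?thesis using False by simp
    qed (use True d1 in simp)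
  next
    case False
    have d1: "XM i a b - XM 0 (a - i) (b + i) \<in> J" using down[of 0 i "a - i" b] False i by simp
    have "single (ymon (a - i - 1) (b + i)) 1 * XM 0 1 0 \<in> J"
      using gens by (intro mult) (simp add: contains_gens_def)
    then have "XM 0 (a - i) (b + i) - 0 \<in> J" using False by (simp add: ymon_times_XM Suc_diff_Suc)
    from trans[OF d1 this] show ?thesis using False by simp
  qed
qed

lemma keys_minus_subset: "keys (m - m') \<subseteq> keys m" for m :: monom
  by (auto simp: in_keys_iff lookup_minus)

lemma monom_cases:
  assumes "keys m \<subseteq> {..d + 1}"
  obtains a b where "m = ymon a b"
    | i a b where "i < d" "m = xmon i a b"
    | i j m' where "i < d" "j < d" "m = single i 1 + single j 1 + m'" "keys m' \<subseteq> {..d + 1}"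
proof (cases "\<forall>i<d. lookup m i = 0")
  case True
  then show thesis using ymonI[OF assms] that(1) by blast
next
  case False
  then obtain i where i: "i < d" "lookup m i \<noteq> 0" by blast
  define m1 where "m1 = m - single i 1"
  have m: "m = single i 1 + m1" unfolding m1_def by (rule monom_minus_single[OF i(2)])
  have k1: "keys m1 \<subseteq> {..d + 1}" using assms keys_minus_subset unfolding m1_def by blast
  show thesis
  proof (cases "\<forall>j<d. lookup m1 j = 0")
    case True
    then have "m = xmon i (lookup m1 d) (lookup m1 (d + 1))"
      using ymonI[OF k1] m unfolding xmon_def by simp
    then show thesis using that(2) i by blast
  next
    case False
    then obtain j where j: "j < d" "lookup m1 j \<noteq> 0" by blast
    define m2 where "m2 = m1 - single j 1"
    have "m1 = single j 1 + m2" unfolding m2_def by (rule monom_minus_single[OF j(2)])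
    then have "m = single i 1 + single j 1 + m2" using m by (simp add: add.assoc)
    moreover have "keys m2 \<subseteq> {..d + 1}" using k1 keys_minus_subset unfolding m2_def by blast
    ultimately show thesis using that(3) i j by blast
  qed
qed

lemma ypart_add: "ypart (f + g) = ypart f + ypart g" and ypart_cscale: "ypart (cscale c f) = cscale c (ypart f)"
  by (auto intro!: poly_mapping_eqI simp: lookup_ypart lookup_add)

text \<open>Modulo the quadrics every polynomial is congruent to its part in \<open>y\<^sub>0, y\<^sub>1\<close> plus the
  combination of the monomials \<open>X\<^sub>c y\<^sub>1\<^sup>N\<close> with coefficients \<open>Lam N c\<close>; by linearity this is checked
  on monomials.\<close>

lemma gens_reduce:
  assumes J: "ideal J (poly_ring (d + 1))" and gens: "contains_gens J"
    and f: "f \<in> polys (d + 1)" "\<And>N c. c + N < d \<Longrightarrow> Lam N c f = 0"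
  shows "f - ypart f \<in> J"
proof -
  note J' = ideal_poly_ringD[OF J]
  let ?P = "{(N, c). c + N < d}"
  have finP: "finite ?P" by (rule finite_subset[of _ "{..d} \<times> {..d}"]) auto
  define red where "red f = f - (ypart f + (\<Sum>(N, c)\<in>?P. cscale (Lam N c f) (XM c 0 N)))" for f
  have "cvec.subspace {f. red f \<in> J}"
  proof (rule cvec_subspaceI)
    have "red 0 = 0"
      by (rule poly_mapping_eqI) (simp add: red_def lookup_minus lookup_add lookup_ypart lookup_sum split_def)
    then show "0 \<in> {f. red f \<in> J}" using cvec.subspace_0[OF J'(3)] by simp
    have "red (f + g) = red f + red g" for f g
      unfolding red_def ypart_add Lam_add
      by (rule poly_mapping_eqI)
        (simp add: lookup_minus lookup_add lookup_sum split_def distrib_right sum.distrib)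
    then show "f + g \<in> {f. red f \<in> J}" if "f \<in> {f. red f \<in> J}" "g \<in> {f. red f \<in> J}" for f g
      using that cvec.subspace_add[OF J'(3)] by simp
    have "red (cscale a f) = cscale a (red f)" for a f
      unfolding red_def ypart_cscale Lam_cscale
      by (rule poly_mapping_eqI)
        (simp add: lookup_minus lookup_add lookup_sum split_def right_diff_distrib distrib_left sum_distrib_left mult.assoc)
    then show "cscale a f \<in> {f. red f \<in> J}" if "f \<in> {f. red f \<in> J}" for a f
      using that cvec.subspace_scale[OF J'(3)] by simp
  qed
  moreover have "single m (lookup f m) \<in> {f. red f \<in> J}" if m: "m \<in> keys f" for m
  proof -
    have k: "keys m \<subseteq> {..d + 1}" using f(1) m by (auto simp: polys_def)
    have "red (single m 1) \<in> J"
      using k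
    proof (cases rule: monom_cases)
      case (1 a b)
      have "ypart (single m 1) = single m 1"
        by (rule poly_mapping_eqI) (auto simp: lookup_ypart lookup_single when_def 1 lookup_ymon)
      moreover have "Lam N c (single m 1) = 0" if "c + N < d" for N c
        using that by (intro Lam_eq_0_of_lookup) (simp add: lookup_single 1)
      ultimately have "red (single m 1) = 0" unfolding red_def by (auto intro!: sum.neutral)
      then show ?thesis using cvec.subspace_0[OF J'(3)] by simp
    next
      case (2 i a b)
      have yp: "ypart (single m 1) = 0"
        by (rule poly_mapping_eqI) (use 2 in \<open>auto simp: lookup_ypart lookup_single when_def lookup_xmon\<close>)
      have m: "single m 1 = cscale (1 / bin i) (XM i a b)"
        using 2 by (simp add: XM_def cscale_single)
      let ?t = "if a \<le> i \<and> i + b < d then XM (i - a) 0 (a + b) else 0"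
      \<comment> \<open>Only the class of the monomial itself can contribute. If
        \<open>a > i\<close>, the truncated difference \<open>i - a\<close> names a wrong class, but
        then \<open>?t\<close> is 0.\<close>
      have "(\<Sum>(N, c)\<in>?P. cscale (Lam N c (single m 1)) (XM c 0 N)) =
          (\<Sum>x\<in>?P. if x = (a + b, i - a) then cscale (1 / bin i) ?t else 0)"
        by (rule sum.cong) (use 2(1) in \<open>auto simp: m Lam_cscale Lam_XM_general split: if_splits\<close>)
      also have "\<dots> = cscale (1 / bin i) ?t"
        using finP 2(1) by (auto simp: not_less)
      finally have "red (single m 1) = cscale (1 / bin i) (XM i a b - ?t)"
        unfolding red_def yp by (simp add: m cscale_diff)
      then show ?thesis
        using cvec.subspace_scale[OF J'(3) gens_XM_reduce[OF J gens 2(1), of a b]] by simp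
    next
      case (3 i j m')
      have yp: "ypart (single m 1) = 0"
        by (rule poly_mapping_eqI)
          (use 3 in \<open>auto simp: lookup_ypart lookup_single when_def lookup_add\<close>)
      have "Lam N c (single m 1) = 0" if "c + N < d" for N c
        using that two_x_neq_xmon(1)[OF 3(1,2)]
        by (intro Lam_eq_0_of_lookup) (simp add: lookup_single 3(3))
      then have "red (single m 1) = single m 1" unfolding red_def yp by (auto intro!: sum.neutral)
      also have "\<dots> = single m' 1 * (Var i * Var j)"
        by (simp add: Var_Var mult_single 3(3) add.commute)
      also have "\<dots> \<in> J"
      proof (rule J'(2))
        show "single m' 1 \<in> polys (d + 1)" using 3(4) by (rule polys_single)
        show "Var i * Var j \<in> J" using gens 3(1,2) by (simp add: contains_gens_def)
      qed
      finally show ?thesis .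
    qed
    then have "single m 1 \<in> {f. red f \<in> J}" by simp
    from cvec.subspace_scale[OF \<open>cvec.subspace {f. red f \<in> J}\<close> this, of "lookup f m"]
    show ?thesis by (simp add: cscale_single)
  qed
  ultimately have "(\<Sum>m\<in>keys f. single m (lookup f m)) \<in> {f. red f \<in> J}"
    by (rule cvec.subspace_sum)
  then have "red f \<in> J" by (simp flip: poly_mapping_sum_single)
  moreover have "red f = f - ypart f" unfolding red_def using f(2) by (auto intro!: sum.neutral)
  ultimately show ?thesis by simp
qed

text \<open>\<open>gens_reduce\<close> leaves the binary part, which consists of multiples of q. The
  lemma serves for three kinds of ideals: those contained in the annihilator, limits of ideals of
  points, and limits of ideals \<open>JJ q\<close>.\<close>

lemma JJ_subset_ideal:
  assumes J: "ideal J (poly_ring (d + 1))" and gens: "contains_gens J"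
    and q: "yform (d + 2) q \<in> J" "degree q \<le> d + 2"
  shows "JJ q \<subseteq> J"
proof
  fix f assume f: "f \<in> JJ q"
  note J' = ideal_poly_ringD[OF J]
  have "ypart f \<in> J"
    unfolding ypart_eq[OF JJ_D(1)[OF f]]
    by (intro cvec.subspace_sum[OF J'(3)] yform_multiple_in_ideal[OF J q] JJ_D(3)[OF f])
  then show "f \<in> J"
    using cvec.subspace_add[OF J'(3) gens_reduce[OF J gens JJ_D(1,2)[OF f]], of "ypart f"] by simp
qed

lemma yform_in_JJ: "degree q \<le> d + 2 \<Longrightarrow> yform (d + 2) q \<in> JJ q"
  unfolding JJ_forms_iff[OF yform_in_forms] by (auto simp: Lam_yform Yp_yform form_multiple_self[simplified])

theorem Hilb_Ann_eq_JJ: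
  assumes J: "J \<in> Hilb (d + 1) (h_gen (d + 1) (d + 2))" and Ann: "J \<subseteq> Ann (d + 1) (form_G d)"
  obtains q where "q \<noteq> 0" "degree q \<le> d + 2" "J = JJ q"
proof -
  note JD = HilbD[OF J]
  \<comment> \<open>With equal Hilbert functions, an inclusion in one degree is an equality.\<close>
  have sub: "JJ q \<inter> forms (d + 1) e \<subseteq> J"
    if "q \<noteq> 0" "degree q \<le> d + 2" "J \<inter> forms (d + 1) e \<subseteq> JJ q" for q e
    using hilbert_fun_eq_imp_subset[OF JD(3) subspace_JJ that(3)] JD(4)[of e]
      HilbD(4)[OF JJ_in_Hilb[OF that(1,2)], of e] by simp
  have Lam0: "Lam N c f = 0" if "f \<in> J" "c + N < d" for f N c
    using that Ann Ann_iff[of f] ideal_poly_ringD(1)[OF JD(2)] by blast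
  \<comment> \<open>In degree 2 all \<open>JJ q\<close> agree, so \<open>q = 1\<close> can stand for
    any of them. Binary quadrics are kept out of \<open>J\<close> by
    \<open>d \<ge> 3\<close>.\<close>
  have "J \<inter> forms (d + 1) 2 \<subseteq> JJ 1"
  proof
    fix f assume f: "f \<in> J \<inter> forms (d + 1) 2"
    have "lookup f (ymon a b) = 0" if "a + b < d" for a b
      using f that Ann Ann_iff[of f] ideal_poly_ringD(1)[OF JD(2)] by blast
    then have "Yp 2 f = 0" using d_ge_3 by (intro poly_eqI) (simp add: coeff_Yp)
    then show "f \<in> JJ 1" using f Lam0 by (subst JJ_forms_iff[of f 2]) auto
  qed
  then have sub2: "JJ 1 \<inter> forms (d + 1) 2 \<subseteq> J" by (intro sub) auto
  have gens: "contains_gens J"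
  proof -
    have XMf: "XM i a b \<in> forms (d + 1) 2" if "i < d" "a + b = 1" for i a b
      unfolding XM_def using that by (intro single_in_forms xmon_in_monoms) auto
    have Varf: "Var i * Var j \<in> forms (d + 1) 2" if "i < d" "j < d" for i j
      unfolding Var_Var using that Poly_Mapping.keys_add[of "single i (1::nat)" "single j 1"]
      by (intro single_in_forms) (auto simp: monoms_def)
    note g = contains_gens_JJ[of 1, unfolded contains_gens_def]
    show ?thesis
      unfolding contains_gens_def
    proof (intro conjI allI impI)
      show "Var i * Var j \<in> J" if "i < d" "j < d" for i j using that g Varf sub2 by blast
      show "XM (Suc i) 1 0 - XM i 0 1 \<in> J" if "Suc i < d" for i
        using that g sub2 forms_diff[OF XMf XMf, of "Suc i" 1 0 i 0 1] by auto
      show "XM 0 1 0 \<in> J" using g sub2 XMf[of 0 1 0] d_ge_3 by auto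
      show "XM (d - 1) 0 1 \<in> J" using g sub2 XMf[of "d - 1" 0 1] d_ge_3 by auto
    qed
  qed
  \<comment> \<open>Otherwise degree d + 2 of \<open>J\<close> lies in, and hence equals, that of
    every \<open>JJ q\<close>; but \<open>JJ 1\<close> contains the binary form y_1^(d+2).\<close>
  have "\<exists>f\<in>J \<inter> forms (d + 1) (d + 2). Yp (d + 2) f \<noteq> 0"
  proof (rule ccontr)
    assume *: "\<not> (\<exists>f\<in>J \<inter> forms (d + 1) (d + 2). Yp (d + 2) f \<noteq> 0)"
    have "J \<inter> forms (d + 1) (d + 2) \<subseteq> JJ q" for q
    proof
      fix f assume f: "f \<in> J \<inter> forms (d + 1) (d + 2)"
      then show "f \<in> JJ q" using * Lam0 by (subst JJ_forms_iff[of f "d + 2"]) auto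
    qed
    then have "JJ 1 \<inter> forms (d + 1) (d + 2) \<subseteq> J" by (intro sub) auto
    then have "yform (d + 2) 1 \<in> J" using yform_in_JJ[of 1] yform_in_forms by auto
    then show False using * yform_in_forms[of "d + 2" 1] Yp_yform[of 1 "d + 2" "d + 2"] by auto
  qed
  then obtain f where f: "f \<in> J" "f \<in> forms (d + 1) (d + 2)" "Yp (d + 2) f \<noteq> 0" by blast
  define q where "q = Yp (d + 2) f"
  have q: "q \<noteq> 0" "degree q \<le> d + 2" using f(3) degree_Yp unfolding q_def by auto
  \<comment> \<open>\<open>f\<close> is homogeneous, so only one degree contributes to its binary
    part.\<close>
  have fy: "ypart f = yform (d + 2) q"
  proof -
    have "Yp (d + 2) f \<noteq> 0 \<Longrightarrow> mdeg ` keys f = {d + 2}"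
      using f(2) by (auto simp: forms_def monoms_def poly_eq_iff coeff_Yp in_keys_iff subset_iff
          intro!: image_eqI split: if_splits)
    then show ?thesis using f(3) ypart_eq[OF forms_polys[OF f(2)]] by (simp add: q_def)
  qed
  have "f - ypart f \<in> J" using gens_reduce[OF JD(2) gens forms_polys[OF f(2)]] Lam0[OF f(1)] by blast
  then have "yform (d + 2) q \<in> J"
    using cvec.subspace_diff[OF JD(3) f(1), of "f - ypart f"] fy by simp
  then have "JJ q \<subseteq> J" using JJ_subset_ideal[OF JD(2) gens _ q(2)] by blast
  then have "J = JJ q" using Hilb_eqI[OF JJ_in_Hilb[OF q] J] by blast
  with q show thesis by (rule that)
qed

end

section \<open>The family of the ideals \<open>I + (q)\<close> is a projective space\<close>

lemma poly_funs_det: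
  assumes "\<And>r c. r < N \<Longrightarrow> c < N \<Longrightarrow> (\<lambda>x. f r c x) \<in> poly_funs A"
  shows "(\<lambda>x. det (mat N N (\<lambda>(r, c). f r c x))) \<in> poly_funs A"
proof -
  have "det (mat N N (\<lambda>(r, c). f r c x)) =
      (\<Sum>p | p permutes {0..<N}. signof p * (\<Prod>i = 0..<N. f i (p i) x))" for x
    by (subst det_def'[of _ N])
      (auto intro!: sum.cong prod.cong arg_cong2[of _ _ _ _ "(*)"] dest: permutes_in_image)
  moreover have "(\<lambda>x. \<Sum>p | p permutes {0..<N}. signof p * (\<Prod>i = 0..<N. f i (p i) x)) \<in> poly_funs A"
    by (intro poly_funs_sum poly_funs_cmult poly_funs_prod assms) (auto dest: permutes_in_image)
  ultimately show ?thesis by simp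
qed

lemma poly_funs_adj_mat:
  assumes "\<And>r c. r < N \<Longrightarrow> c < N \<Longrightarrow> (\<lambda>x. f r c x) \<in> poly_funs A" "i < N" "j < N"
  shows "(\<lambda>x. adj_mat (mat N N (\<lambda>(r, c). f r c x)) $$ (i, j)) \<in> poly_funs A"
proof -
  let ?s = "\<lambda>k l. if l < k then l else Suc l"
  have "adj_mat (mat N N (\<lambda>(r, c). f r c x)) $$ (i, j) =
      (- 1) ^ (j + i) * det (mat (N - 1) (N - 1) (\<lambda>(r, c). f (?s j r) (?s i c) x))" for x
  proof -
    have "mat_delete (mat N N (\<lambda>(r, c). f r c x)) j i =
        mat (N - 1) (N - 1) (\<lambda>(r, c). f (?s j r) (?s i c) x)"
      by (rule eq_matI) (use assms(2,3) in \<open>auto simp: mat_delete_def\<close>)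
    then show ?thesis using assms(2,3) by (simp add: adj_mat_def cofactor_def)
  qed
  moreover have "(\<lambda>x. (- 1) ^ (j + i) * det (mat (N - 1) (N - 1) (\<lambda>(r, c). f (?s j r) (?s i c) x))) \<in> poly_funs A"
    by (intro poly_funs_cmult poly_funs_det assms(1)) (use assms(2,3) in auto)
  ultimately show ?thesis by simp
qed

lemma smult_one_mult_vec:
  fixes v :: "'a::comm_ring_1 vec"
  assumes "v \<in> carrier_vec n"
  shows "(c \<cdot>\<^sub>m 1\<^sub>m n) *\<^sub>v v = c \<cdot>\<^sub>v v"
proof (rule eq_vecI)
  fix i assume i: "i < dim_vec (c \<cdot>\<^sub>v v)"
  have "(\<Sum>j = 0..<n. c * (if j = i then 1 else 0) * v $ j) = (\<Sum>j = 0..<n. if j = i then c * v $ i else 0)"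
    by (rule sum.cong) auto
  then show "((c \<cdot>\<^sub>m 1\<^sub>m n) *\<^sub>v v) $ i = (c \<cdot>\<^sub>v v) $ i" using i assms by (simp add: scalar_prod_def)
qed (use assms in auto)

lemma quot_basis_cong:
  assumes "\<And>f. f \<in> forms n e \<Longrightarrow> f \<in> J \<longleftrightarrow> f \<in> J'"
  shows "quot_basis n J e B \<longleftrightarrow> quot_basis n J' e B"
    and "B \<subseteq> monoms n e \<Longrightarrow> m \<in> monoms n e \<Longrightarrow> nf_coeff B m b J = nf_coeff B m b J'"
proof -
  have *: "(keys p \<subseteq> B \<and> f - p \<in> J) \<longleftrightarrow> (keys p \<subseteq> B \<and> f - p \<in> J')"
    if "B \<subseteq> monoms n e" "f \<in> forms n e" for f p
    using assms[of "f - p"] forms_diff[OF that(2)] forms_subset_keys[OF that(1)] by blast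
  show "quot_basis n J e B \<longleftrightarrow> quot_basis n J' e B"
    unfolding quot_basis_def by (intro conj_cong ball_cong refl) (simp only: *)
  show "B \<subseteq> monoms n e \<Longrightarrow> m \<in> monoms n e \<Longrightarrow> nf_coeff B m b J = nf_coeff B m b J'"
    unfolding nf_coeff_def using *[OF _ single_in_forms] by simp
qed

lemma sum_lessThan_add:
  fixes f :: "nat \<Rightarrow> 'b::comm_monoid_add"
  shows "(\<Sum>k<a + b. f k) = (\<Sum>k<a. f k) + (\<Sum>s<b. f (a + s))"
  by (induction b) (simp_all add: add.assoc)

context G_form
begin

abbreviation h_G :: "nat \<Rightarrow> nat"
  where "h_G \<equiv> h_gen (d + 1) (d + 2)"

definition SS :: "cpoly set set"
  where "SS = JJ ` {q. q \<noteq> 0 \<and> degree q \<le> d + 2}"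

lemma SS_Hilb: "SS \<subseteq> Hilb (d + 1) h_G"
  unfolding SS_def using JJ_in_Hilb by auto

lemma form_multiple_smult_left: "c \<noteq> 0 \<Longrightarrow> form_multiple (Polynomial.smult c q) e p \<longleftrightarrow> form_multiple q e p"
proof
  assume c: "c \<noteq> 0"
  show "form_multiple (Polynomial.smult c q) e p" if "form_multiple q e p"
  proof -
    obtain g where "p = q * g" "g = 0 \<or> degree g + (d + 2) \<le> e" using \<open>form_multiple q e p\<close> unfolding form_multiple_def by blast
    then show ?thesis using c unfolding form_multiple_def
      by (intro exI[of _ "Polynomial.smult (inverse c) g"]) auto
  qed
  show "form_multiple q e p" if "form_multiple (Polynomial.smult c q) e p"
  proof -
    obtain g where "p = Polynomial.smult c q * g" "g = 0 \<or> degree g + (d + 2) \<le> e"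
      using \<open>form_multiple (Polynomial.smult c q) e p\<close> unfolding form_multiple_def by blast
    then show ?thesis using c unfolding form_multiple_def
      by (intro exI[of _ "Polynomial.smult c g"]) auto
  qed
qed

lemma JJ_smult: "c \<noteq> 0 \<Longrightarrow> JJ (Polynomial.smult c q) = JJ q"
  unfolding JJ_def by (simp add: form_multiple_smult_left)

text \<open>The binary forms of degree d + 2 in \<open>JJ q\<close> are just the scalar multiples of
  q.\<close>

lemma JJ_eq_imp_poly_line_eq:
  assumes "JJ q = JJ q'" "q' \<noteq> 0" "degree q' \<le> d + 2"
  shows "poly_line q = poly_line q'"
proof -
  have "yform (d + 2) q' \<in> JJ q" using yform_in_JJ[OF assms(3)] assms(1) by simp
  then have "form_multiple q (d + 2) q'"
    using JJ_D(3)[of "yform (d + 2) q'" q "d + 2"] Yp_yform[OF assms(3)] by simp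
  then obtain g where g: "q' = q * g" "g = 0 \<or> degree g + (d + 2) \<le> d + 2"
    unfolding form_multiple_def by blast
  with assms(2) have "degree g = 0" by auto
  then obtain c where "g = [:c:]" by (rule degree_eq_zeroE)
  then have "q' = Polynomial.smult c q" "c \<noteq> 0" using g(1) assms(2) by auto
  then show ?thesis by (simp add: poly_line_smult)
qed

definition ideal_line :: "cpoly set \<Rightarrow> (nat \<Rightarrow>\<^sub>0 complex) set"
  where "ideal_line J = poly_line (SOME q. q \<noteq> 0 \<and> degree q \<le> d + 2 \<and> JJ q = J)"

lemma ideal_line_JJ:
  assumes "q \<noteq> 0" "degree q \<le> d + 2"
  shows "ideal_line (JJ q) = poly_line q"
proof -
  let ?q = "SOME q'. q' \<noteq> 0 \<and> degree q' \<le> d + 2 \<and> JJ q' = JJ q"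
  have "?q \<noteq> 0 \<and> degree ?q \<le> d + 2 \<and> JJ ?q = JJ q"
    by (rule someI[of _ q]) (use assms in simp)
  then show ?thesis unfolding ideal_line_def using JJ_eq_imp_poly_line_eq[of ?q q] assms by simp
qed

lemma restrict_Hilb_iff:
  "(D, A) \<in> restrict_atlas (Hilb_atlas (d + 1) h_G) SS \<longleftrightarrow>
    (\<exists>E B. finite E \<and> D = {J \<in> SS. \<forall>e\<in>E. quot_basis (d + 1) J e (B e)} \<and>
      A = {nf_coeff (B e) m b | e m b. e \<in> E \<and> m \<in> monoms (d + 1) e \<and> b \<in> B e})"
proof -
  let ?A = "\<lambda>E B. {nf_coeff (B e) m b | e m b. e \<in> E \<and> m \<in> monoms (d + 1) e \<and> b \<in> B e}"
  have eq: "{J \<in> Hilb (d + 1) h_G. P J} \<inter> SS = {J \<in> SS. P J}" for P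
    using SS_Hilb by blast
  show ?thesis
  proof
    assume "(D, A) \<in> restrict_atlas (Hilb_atlas (d + 1) h_G) SS"
    then obtain D' where D': "D = D' \<inter> SS" "(D', A) \<in> Hilb_atlas (d + 1) h_G"
      unfolding restrict_atlas_def by blast
    obtain E B where E: "D' = {J \<in> Hilb (d + 1) h_G. \<forall>e\<in>E. quot_basis (d + 1) J e (B e)}"
      "A = ?A E B" "finite E"
      using D'(2) unfolding Hilb_atlas_def by blast
    show "\<exists>E B. finite E \<and> D = {J \<in> SS. \<forall>e\<in>E. quot_basis (d + 1) J e (B e)} \<and> A = ?A E B"
      unfolding D'(1) E(1,2) eq by (rule exI[of _ E], rule exI[of _ B]) (use E(3) in blast)
  next
    assume "\<exists>E B. finite E \<and> D = {J \<in> SS. \<forall>e\<in>E. quot_basis (d + 1) J e (B e)} \<and> A = ?A E B"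
    then obtain E B where E: "finite E" "D = {J \<in> SS. \<forall>e\<in>E. quot_basis (d + 1) J e (B e)}" "A = ?A E B"
      by (elim exE conjE) rule
    have "({J \<in> Hilb (d + 1) h_G. \<forall>e\<in>E. quot_basis (d + 1) J e (B e)}, A) \<in> Hilb_atlas (d + 1) h_G"
      unfolding Hilb_atlas_def E(3) using E(1) by blast
    then show "(D, A) \<in> restrict_atlas (Hilb_atlas (d + 1) h_G) SS"
      unfolding restrict_atlas_def E(2) eq[symmetric] by blast
  qed
qed

lemma topspace_SS: "topspace (zariski_of (restrict_atlas (Hilb_atlas (d + 1) h_G) SS)) = SS"
proof
  show "topspace (zariski_of (restrict_atlas (Hilb_atlas (d + 1) h_G) SS)) \<subseteq> SS"
    unfolding topspace_zariski_of by (auto simp: restrict_atlas_def)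
  have "(SS, {}) \<in> restrict_atlas (Hilb_atlas (d + 1) h_G) SS"
    unfolding restrict_Hilb_iff by (rule exI[of _ "{}"]) simp
  then show "SS \<subseteq> topspace (zariski_of (restrict_atlas (Hilb_atlas (d + 1) h_G) SS))"
    unfolding topspace_zariski_of by blast
qed

subsection \<open>From ideals to points\<close>

text \<open>The quotient basis of degree d + 2 that corresponds to the i-th standard chart of
  P^(d+2): for \<open>i \<le> d + 2\<close> it is a basis exactly if the i-th coefficient of q is
  nonzero.\<close>

abbreviation omit_basis :: "nat \<Rightarrow> monom set"
  where "omit_basis i \<equiv> (\<lambda>a. ymon a (d + 2 - a)) ` ({..d + 2} - {i})"

lemma omit_basis_monoms: "omit_basis i \<subseteq> monoms (d + 1) (d + 2)"
proof
  fix m assume "m \<in> omit_basis i"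
  then obtain a where "m = ymon a (d + 2 - a)" "a \<le> d + 2" by auto
  then show "m \<in> monoms (d + 1) (d + 2)" using ymon_in_monoms[of a "d + 2 - a" "d + 2"] by simp
qed

lemma JJ_forms_large_iff:
  "f \<in> forms (d + 1) e \<Longrightarrow> e \<ge> d + 2 \<Longrightarrow> f \<in> JJ q \<longleftrightarrow> form_multiple q e (Yp e f)"
  by (auto simp: JJ_forms_iff)

lemma keys_yform: "keys (yform e p) \<subseteq> (\<lambda>a. ymon a (e - a)) ` {a. a \<le> e \<and> coeff p a \<noteq> 0}"
  unfolding yform_def by (intro keys_subset_sum) auto

lemma quot_basis_omitI:
  assumes "coeff q i \<noteq> 0" "degree q \<le> d + 2"
  shows "quot_basis (d + 1) (JJ q) (d + 2) (omit_basis i)"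
proof (rule quot_basisI[OF subspace_JJ omit_basis_monoms])
  fix f assume f: "f \<in> forms (d + 1) (d + 2)"
  define c where "c = coeff (Yp (d + 2) f) i / coeff q i"
  let ?p = "yform (d + 2) (Yp (d + 2) f - Polynomial.smult c q)"
  have "{a. a \<le> d + 2 \<and> coeff (Yp (d + 2) f - Polynomial.smult c q) a \<noteq> 0} \<subseteq> {..d + 2} - {i}"
    using assms(1) by (auto simp: c_def)
  from image_mono[OF this] keys_yform have "keys ?p \<subseteq> omit_basis i" by (rule subset_trans[rotated])
  moreover have "f - ?p \<in> JJ q"
  proof -
    have "degree (Yp (d + 2) f - Polynomial.smult c q) \<le> d + 2"
      using degree_Yp assms(2) by (intro degree_diff_le) auto
    then have "Yp (d + 2) (f - ?p) = Polynomial.smult c q" unfolding Yp_diff by (simp add: Yp_yform)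
    then show ?thesis
      using f yform_in_forms form_multiple_smult[OF form_multiple_self]
      by (subst JJ_forms_large_iff[of _ "d + 2"]) (auto intro!: forms_diff)
  qed
  ultimately show "\<exists>p. keys p \<subseteq> omit_basis i \<and> f - p \<in> JJ q" by blast
next
  fix p assume p: "keys p \<subseteq> omit_basis i" "p \<in> JJ q"
  obtain g where g: "Yp (d + 2) p = q * g" "g = 0 \<or> degree g + (d + 2) \<le> d + 2"
    using JJ_D(3)[OF p(2)] unfolding form_multiple_def by blast
  then have "degree g = 0" by auto
  then obtain c where c: "g = [:c:]" by (rule degree_eq_zeroE)
  have "ymon i (d + 2 - i) \<notin> omit_basis i" by auto
  then have "coeff (Yp (d + 2) p) i = 0" using p(1) by (auto simp: coeff_Yp in_keys_iff)
  then have "c = 0" using g(1) c assms(1) by simp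
  show "p = 0"
    by (rule forms_eq_0I[of p "d + 2" "{}"]) (use p(1) g(1) c \<open>c = 0\<close> in auto)
qed

lemma quot_basis_omitD:
  assumes "quot_basis (d + 1) (JJ q) (d + 2) (omit_basis i)" "q \<noteq> 0" "degree q \<le> d + 2"
  shows "coeff q i \<noteq> 0"
proof
  assume "coeff q i = 0"
  then have "keys (yform (d + 2) q) \<subseteq> omit_basis i" using keys_yform[of "d + 2" q] by auto
  then have "yform (d + 2) q = 0"
    using quot_basis_zero[OF assms(1) subspace_JJ] yform_in_JJ[OF assms(3)] by blast
  then show False using Yp_yform[OF assms(3), of "d + 2"] assms(2) by simp
qed

text \<open>Modulo q divided by its i-th coefficient, the omitted monomial is minus the sum of the
  other terms; so its normal form coefficients are, up to sign, the affine coordinates of q.\<close>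

lemma nf_coeff_omit:
  assumes "coeff q i \<noteq> 0" "degree q \<le> d + 2" "j \<noteq> i" "j \<le> d + 2"
  shows "nf_coeff (omit_basis i) (ymon i (d + 2 - i)) (ymon j (d + 2 - j)) (JJ q) = - (coeff q j / coeff q i)"
proof -
  have i: "i \<le> d + 2" using assms(1,2) le_degree[of q i] by linarith
  let ?m = "single (ymon i (d + 2 - i)) (1::complex)"
  let ?y = "yform (d + 2) (Polynomial.smult (1 / coeff q i) q)"
  have m: "?m \<in> forms (d + 1) (d + 2)" using i by (intro single_in_forms ymon_in_monoms) auto
  have "nform (JJ q) (omit_basis i) ?m = ?m - ?y"
  proof (rule nform_eqI[OF quot_basis_omitI[OF assms(1,2)] m])
    have "lookup (?m - ?y) k = 0" if k: "k \<notin> omit_basis i" for k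
    proof (cases "k = ymon i (d + 2 - i)")
      case True
      then show ?thesis using assms(1) i by (simp add: lookup_minus lookup_yform_ymon)
    next
      case False
      then have "k \<notin> (\<lambda>a. ymon a (d + 2 - a)) ` {..d + 2}" using k by auto
      then have "lookup ?y k = 0" using keys_yform[of "d + 2" "Polynomial.smult (1 / coeff q i) q"]
        by (auto simp: in_keys_iff subset_iff image_iff)
      then show ?thesis using False by (simp add: lookup_minus lookup_single)
    qed
    then show "keys (?m - ?y) \<subseteq> omit_basis i" by (auto simp: in_keys_iff)
    have "?y \<in> JJ q"
      using assms(2) form_multiple_smult[OF form_multiple_self]
      by (subst JJ_forms_large_iff[OF yform_in_forms]) (auto simp: Yp_yform)
    then show "?m - (?m - ?y) \<in> JJ q" by simp
  qed
  then show ?thesis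
    unfolding nf_coeff_nform using assms(3,4)
    by (simp add: lookup_minus lookup_single lookup_yform_ymon)
qed

lemma morphism_ideal_line:
  "morphism (restrict_atlas (Hilb_atlas (d + 1) h_G) SS) (proj_atlas (coord_space (d + 2))) ideal_line"
  unfolding morphism_def topspace_SS topspace_proj
proof (intro conjI ballI allI impI)
  let ?At = "restrict_atlas (Hilb_atlas (d + 1) h_G) SS"
  fix J assume "J \<in> SS"
  then obtain q where q: "J = JJ q" "q \<noteq> 0" "degree q \<le> d + 2" unfolding SS_def by blast
  have img: "ideal_line (JJ q') = poly_line q'" "poly_line q' \<in> proj_space (d + 2)"
    if "q' \<noteq> 0" "degree q' \<le> d + 2" for q'
    using ideal_line_JJ[OF that] poly_line_in_proj[OF that] by auto
  show "ideal_line J \<in> proj_space (d + 2)" using img[OF q(2,3)] q(1) by simp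
  fix D' A' assume DA': "(D', A') \<in> proj_atlas (coord_space (d + 2))" "ideal_line J \<in> D'"
  then obtain i where i: "D' = proj_chart (coord_space (d + 2)) i" "A' = proj_coords i"
    unfolding proj_atlas_def by blast
  have chart: "poly_line q' \<in> D' \<longleftrightarrow> coeff q' i \<noteq> 0" if "q' \<noteq> 0" "degree q' \<le> d + 2" for q'
    using img(2)[OF that] proj_chart_cline[of "pvec q'" "coord_space (d + 2)" i]
    unfolding i poly_line_def by simp
  have qi: "coeff q i \<noteq> 0" using DA'(2) chart[OF q(2,3)] img(1)[OF q(2,3)] q(1) by simp
  then have i_le: "i \<le> d + 2" using q(3) le_degree[of q i] by linarith
  define D where "D = {J \<in> SS. quot_basis (d + 1) J (d + 2) (omit_basis i)}"
  define A where "A = {nf_coeff (omit_basis i) m b | m b. m \<in> monoms (d + 1) (d + 2) \<and> b \<in> omit_basis i}"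
  have DA: "(D, A) \<in> ?At" unfolding restrict_Hilb_iff D_def A_def
    by (rule exI[of _ "{d + 2}"], rule exI[of _ "\<lambda>_. omit_basis i"]) auto
  have JD: "J \<in> D" unfolding D_def using quot_basis_omitI[OF qi q(3)] q \<open>J \<in> SS\<close> by simp
  have D_E: "\<exists>q'. J' = JJ q' \<and> q' \<noteq> 0 \<and> degree q' \<le> d + 2 \<and> coeff q' i \<noteq> 0" if "J' \<in> D" for J'
    using that quot_basis_omitD unfolding D_def SS_def by blast
  show "\<exists>D A W. (D, A) \<in> ?At \<and> J \<in> D \<and> openin (zariski_of ?At) W \<and> J \<in> W \<and> ideal_line ` W \<subseteq> D' \<and>
      (\<forall>a\<in>A'. rat ?At D A J (\<lambda>J. a (ideal_line J)))"
  proof (rule exI[of _ D], rule exI[of _ A], rule exI[of _ D], intro conjI ballI DA JD openin_zariski_chart[OF DA])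
    show "ideal_line ` D \<subseteq> D'"
    proof clarify
      fix J' assume "J' \<in> D"
      then obtain q' where "J' = JJ q'" "q' \<noteq> 0" "degree q' \<le> d + 2" "coeff q' i \<noteq> 0" using D_E by blast
      then show "ideal_line J' \<in> D'" using chart img(1) by simp
    qed
    fix a assume "a \<in> A'"
    then obtain j where j: "a = hratio j i" unfolding i by blast
    \<comment> \<open>The ratio of index \<open>i\<close> is 1, and indices above
      \<open>d + 2\<close> give 0; only the remaining ones are coordinates of the ideal.\<close>
    define g where "g = (if j = i then (\<lambda>_. 1) else if j \<le> d + 2
      then (\<lambda>J. - nf_coeff (omit_basis i) (ymon i (d + 2 - i)) (ymon j (d + 2 - j)) J) else (\<lambda>_. 0))"
    have "g \<in> poly_funs A"
    proof -
      have "ymon i (d + 2 - i) \<in> monoms (d + 1) (d + 2)" using i_le by (intro ymon_in_monoms) auto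
      then have "j \<noteq> i \<Longrightarrow> j \<le> d + 2 \<Longrightarrow>
          nf_coeff (omit_basis i) (ymon i (d + 2 - i)) (ymon j (d + 2 - j)) \<in> poly_funs A"
        by (intro poly_funs.coord) (auto simp: A_def)
      then show ?thesis unfolding g_def by (auto intro: poly_funs.const poly_funs_uminus)
    qed
    then have "rat ?At D A J g" by (rule rat_poly[OF DA JD])
    then show "rat ?At D A J (\<lambda>J. a (ideal_line J))"
    proof (rule rat_cong[OF _ openin_zariski_chart[OF DA] JD])
      fix J' assume "J' \<in> D"
      then obtain q' where q': "J' = JJ q'" "q' \<noteq> 0" "degree q' \<le> d + 2" "coeff q' i \<noteq> 0" using D_E by blast
      have "coeff q' j = 0" if "\<not> j \<le> d + 2" using that q'(3) by (intro coeff_eq_0) simp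
      then show "g J' = a (ideal_line J')"
        unfolding q'(1) img(1)[OF q'(2,3)] j hratio_poly_line g_def
        using nf_coeff_omit[OF q'(4,3), of j] q'(4) by auto
    qed
  qed
qed

subsection \<open>From points to ideals\<close>

text \<open>The columns of \<open>norm_mat\<close> are the prospective basis monomials, with exponents \<open>\<alpha> k\<close>, and the
  multiples of \<open>q\<close>: by Cramer's rule the normal forms depend rationally on \<open>q\<close>.\<close>

definition norm_entry :: "(nat \<Rightarrow> nat) \<Rightarrow> (nat \<Rightarrow> complex) \<Rightarrow> nat \<Rightarrow> nat \<Rightarrow> complex"
  where "norm_entry \<alpha> c r k = (if k < d + 2 then (if r = \<alpha> k then 1 else 0)
    else if k - (d + 2) \<le> r then c (r - (k - (d + 2))) else 0)"

definition norm_mat :: "nat \<Rightarrow> (nat \<Rightarrow> nat) \<Rightarrow> (nat \<Rightarrow> complex) \<Rightarrow> complex mat"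
  where "norm_mat e \<alpha> c = mat (e + 1) (e + 1) (\<lambda>(r, k). norm_entry \<alpha> c r k)"

definition basis_poly :: "(nat \<Rightarrow> nat) \<Rightarrow> complex vec \<Rightarrow> complex poly"
  where "basis_poly \<alpha> v = (\<Sum>k<d + 2. Polynomial.monom (v $ k) (\<alpha> k))"

definition cofactor_poly :: "nat \<Rightarrow> complex vec \<Rightarrow> complex poly"
  where "cofactor_poly e v = (\<Sum>s<e + 1 - (d + 2). Polynomial.monom (v $ (d + 2 + s)) s)"

text \<open>The vector collects a candidate normal form and a cofactor g of degree at most e - (d +
  2); the matrix sends it to the coefficients of their combination, the candidate plus q g.\<close>

lemma norm_mat_mult_vec:
  assumes "v \<in> carrier_vec (e + 1)" "e \<ge> d + 2" "r \<le> e"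
  shows "(norm_mat e \<alpha> (coeff q) *\<^sub>v v) $ r = coeff (basis_poly \<alpha> v + q * cofactor_poly e v) r"
proof -
  have split: "e + 1 = (d + 2) + (e + 1 - (d + 2))" using assms(2) by simp
  have "(norm_mat e \<alpha> (coeff q) *\<^sub>v v) $ r = (\<Sum>k<e + 1. norm_entry \<alpha> (coeff q) r k * v $ k)"
    using assms by (simp add: norm_mat_def scalar_prod_def row_def atLeast0LessThan)
  also have "\<dots> = (\<Sum>k<d + 2. norm_entry \<alpha> (coeff q) r k * v $ k) +
      (\<Sum>s<e + 1 - (d + 2). norm_entry \<alpha> (coeff q) r (d + 2 + s) * v $ (d + 2 + s))"
    by (subst split, rule sum_lessThan_add)
  also have "(\<Sum>k<d + 2. norm_entry \<alpha> (coeff q) r k * v $ k) = coeff (basis_poly \<alpha> v) r"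
    unfolding basis_poly_def coeff_sum by (rule sum.cong) (auto simp: norm_entry_def)
  also have "(\<Sum>s<e + 1 - (d + 2). norm_entry \<alpha> (coeff q) r (d + 2 + s) * v $ (d + 2 + s)) =
      coeff (q * cofactor_poly e v) r"
    unfolding cofactor_poly_def sum_distrib_left coeff_sum
    by (rule sum.cong) (auto simp: norm_entry_def mult.commute[of q] coeff_monom_mult)
  finally show ?thesis by simp
qed

lemma cofactor_poly_degree: "e \<ge> d + 2 \<Longrightarrow> degree (cofactor_poly e v) + (d + 2) \<le> e"
proof -
  assume e: "e \<ge> d + 2"
  have "degree (cofactor_poly e v) \<le> e - (d + 2)"
    by (rule degree_le) (auto simp: cofactor_poly_def coeff_sum intro!: sum.neutral)
  then show ?thesis using e by simp
qed

lemma coeff_basis_poly: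
  assumes "inj_on \<alpha> {..<d + 2}" "k < d + 2"
  shows "coeff (basis_poly \<alpha> v) (\<alpha> k) = v $ k"
proof -
  have "coeff (basis_poly \<alpha> v) (\<alpha> k) = (\<Sum>l<d + 2. if l = k then v $ k else 0)"
    unfolding basis_poly_def coeff_sum by (rule sum.cong) (use assms in \<open>auto simp: inj_on_def\<close>)
  then show ?thesis using assms(2) by simp
qed

lemma coeff_basis_poly_0: "a \<notin> \<alpha> ` {..<d + 2} \<Longrightarrow> coeff (basis_poly \<alpha> v) a = 0"
  unfolding basis_poly_def coeff_sum by (rule sum.neutral) auto

lemma h_G_eq: "e \<ge> d + 2 \<Longrightarrow> h_G e = d + 2"
proof -
  assume e: "e \<ge> d + 2"
  have "(\<lambda>a. ymon a (e - a)) ` {..<d + 2} \<subseteq> monoms (d + 1) e"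
  proof clarify
    show "ymon a (e - a) \<in> monoms (d + 1) e" if "a < d + 2" for a
      using that e by (intro ymon_in_monoms) simp
  qed
  then have "card ((\<lambda>a. ymon a (e - a)) ` {..<d + 2}) \<le> card (monoms (d + 1) e)"
    by (rule card_mono[OF finite_monoms])
  moreover have "inj_on (\<lambda>a. ymon a (e - a)) {..<d + 2}" by (rule inj_onI) simp
  ultimately show ?thesis by (simp add: card_image h_gen_def dim_forms)
qed

context
  fixes e :: nat and \<alpha> :: "nat \<Rightarrow> nat"
  assumes e: "e \<ge> d + 2" and inj: "inj_on \<alpha> {..<d + 2}" and le: "\<alpha> ` {..<d + 2} \<subseteq> {..e}"
begin

abbreviation "norm_basis \<equiv> (\<lambda>k. ymon (\<alpha> k) (e - \<alpha> k)) ` {..<d + 2}"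

lemma degree_basis_poly: "degree (basis_poly \<alpha> v) \<le> e"
  by (rule degree_le) (use le coeff_basis_poly_0[of _ \<alpha> v] in force)

lemma keys_yform_basis_poly: "keys (yform e (basis_poly \<alpha> v)) \<subseteq> norm_basis"
  using keys_yform[of e "basis_poly \<alpha> v"] coeff_basis_poly_0[of _ \<alpha> v] by fastforce

lemma basis_relation_eqI:
  assumes "\<And>r. r \<le> e \<Longrightarrow> coeff (basis_poly \<alpha> v + q * cofactor_poly e v) r = coeff F r"
    "degree F \<le> e" "degree q \<le> d + 2"
  shows "basis_poly \<alpha> v + q * cofactor_poly e v = F"
proof (rule poly_eqI)
  fix r
  have "degree (q * cofactor_poly e v) \<le> e"
    using degree_mult_le[of q "cofactor_poly e v"] cofactor_poly_degree[OF e, of v] assms(3) by linarith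
  then have "degree (basis_poly \<alpha> v + q * cofactor_poly e v) \<le> e"
    using degree_basis_poly by (rule degree_add_le[rotated])
  then show "coeff (basis_poly \<alpha> v + q * cofactor_poly e v) r = coeff F r"
    using assms(1)[of r] assms(2) coeff_eq_0[of F r]
      coeff_eq_0[of "basis_poly \<alpha> v + q * cofactor_poly e v" r] by (cases "r \<le> e") auto
qed

text \<open>A kernel vector gives a combination of the basis monomials that is a multiple of q; it
  lies in the ideal, so it vanishes, and then so does the cofactor.\<close>

lemma det_norm_mat_nonzero:
  assumes q: "q \<noteq> 0" "degree q \<le> d + 2" and qb: "quot_basis (d + 1) (JJ q) e norm_basis"
  shows "det (norm_mat e \<alpha> (coeff q)) \<noteq> 0"
proof
  let ?M = "norm_mat e \<alpha> (coeff q)"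
  assume "det ?M = 0"
  moreover have "?M \<in> carrier_mat (e + 1) (e + 1)" by (simp add: norm_mat_def)
  ultimately obtain v where v: "v \<in> carrier_vec (e + 1)" "v \<noteq> 0\<^sub>v (e + 1)" "?M *\<^sub>v v = 0\<^sub>v (e + 1)"
    using det_0_iff_vec_prod_zero_field by metis
  have rel: "basis_poly \<alpha> v + q * cofactor_poly e v = 0"
  proof (rule basis_relation_eqI)
    show "coeff (basis_poly \<alpha> v + q * cofactor_poly e v) r = coeff 0 r" if "r \<le> e" for r
      using norm_mat_mult_vec[OF v(1) e that, of \<alpha> q] v(3) that by simp
  qed (use q in auto)
  then have b: "basis_poly \<alpha> v = q * - cofactor_poly e v" by (simp add: eq_neg_iff_add_eq_0)
  have "form_multiple q e (basis_poly \<alpha> v)"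
    unfolding form_multiple_def
    by (rule exI[of _ "- cofactor_poly e v"]) (use b cofactor_poly_degree[OF e, of v] in simp)
  then have "yform e (basis_poly \<alpha> v) \<in> JJ q"
    by (simp add: JJ_forms_large_iff[OF yform_in_forms e] Yp_yform[OF degree_basis_poly])
  then have "yform e (basis_poly \<alpha> v) = 0"
    using quot_basis_zero[OF qb subspace_JJ keys_yform_basis_poly] by blast
  then have b0: "basis_poly \<alpha> v = 0" using Yp_yform[OF degree_basis_poly, of e v] by simp
  then have c0: "cofactor_poly e v = 0" using rel q(1) by simp
  have "v $ k = 0" if "k < e + 1" for k
  proof (cases "k < d + 2")
    case True
    then show ?thesis using coeff_basis_poly[OF inj True, of v] b0 by simp
  next
    case False
    define s where "s = k - (d + 2)"
    have s: "k = d + 2 + s" "s < e + 1 - (d + 2)" using False that unfolding s_def by auto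
    have "coeff (cofactor_poly e v) s = v $ k"
      using s by (simp add: cofactor_poly_def coeff_sum)
    then show ?thesis using c0 by simp
  qed
  then have "v = 0\<^sub>v (e + 1)" using v(1) by (intro eq_vecI) auto
  then show False using v(2) by simp
qed

text \<open>The converse: an invertible matrix yields a normal form of every form, so the monomials
  span; there are d + 2 of them, hence they are a basis. The adjugate makes the denominators
  explicit.\<close>

lemma norm_mat_solution:
  assumes q: "q \<noteq> 0" "degree q \<le> d + 2" and det: "det (norm_mat e \<alpha> (coeff q)) \<noteq> 0"
  shows "quot_basis (d + 1) (JJ q) e norm_basis"
    and "m \<in> monoms (d + 1) e \<Longrightarrow> k < d + 2 \<Longrightarrow> nf_coeff norm_basis m (ymon (\<alpha> k) (e - \<alpha> k)) (JJ q) =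
      (\<Sum>r<e + 1. adj_mat (norm_mat e \<alpha> (coeff q)) $$ (k, r) * coeff (Yp e (single m 1)) r) /
        det (norm_mat e \<alpha> (coeff q))"
proof -
  let ?M = "norm_mat e \<alpha> (coeff q)"
  have M: "?M \<in> carrier_mat (e + 1) (e + 1)" by (simp add: norm_mat_def)
  note adj = adj_mat[OF M]
  define F where "F f = vec (e + 1) (coeff (Yp e f))" for f
  define x where "x f = (1 / det ?M) \<cdot>\<^sub>v (adj_mat ?M *\<^sub>v F f)" for f
  have xc: "x f \<in> carrier_vec (e + 1)" for f unfolding x_def F_def using adj(1) by simp
  have xk: "x f $ k = (\<Sum>r<e + 1. adj_mat ?M $$ (k, r) * coeff (Yp e f) r) / det ?M" if "k < e + 1" for f k
    using that adj(1) unfolding x_def F_def by (simp add: scalar_prod_def row_def atLeast0LessThan)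
  have Mx: "?M *\<^sub>v x f = F f" for f
  proof -
    have Fc: "F f \<in> carrier_vec (e + 1)" by (simp add: F_def)
    have "?M *\<^sub>v x f = (1 / det ?M) \<cdot>\<^sub>v ((?M * adj_mat ?M) *\<^sub>v F f)"
      unfolding x_def using M adj(1) Fc by (simp add: mult_mat_vec assoc_mult_mat_vec[OF M adj(1) Fc])
    also have "(?M * adj_mat ?M) *\<^sub>v F f = det ?M \<cdot>\<^sub>v F f"
      unfolding adj(2) using Fc by (rule smult_one_mult_vec)
    finally show ?thesis using det Fc by (simp add: smult_smult_assoc)
  qed
  have rel: "basis_poly \<alpha> (x f) + q * cofactor_poly e (x f) = Yp e f" for f
  proof (rule basis_relation_eqI[OF _ degree_Yp q(2)])
    show "coeff (basis_poly \<alpha> (x f) + q * cofactor_poly e (x f)) r = coeff (Yp e f) r" if "r \<le> e" for r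
      using norm_mat_mult_vec[OF xc e that, of \<alpha> q f] Mx[of f] that by (simp add: F_def)
  qed
  have nf: "keys (yform e (basis_poly \<alpha> (x f))) \<subseteq> norm_basis" "f - yform e (basis_poly \<alpha> (x f)) \<in> JJ q"
    if f: "f \<in> forms (d + 1) e" for f
  proof -
    show "keys (yform e (basis_poly \<alpha> (x f))) \<subseteq> norm_basis" by (rule keys_yform_basis_poly)
    have "Yp e (f - yform e (basis_poly \<alpha> (x f))) = q * cofactor_poly e (x f)"
      using rel[of f] by (simp add: Yp_diff Yp_yform[OF degree_basis_poly] algebra_simps)
    then have "form_multiple q e (Yp e (f - yform e (basis_poly \<alpha> (x f))))"
      unfolding form_multiple_def using cofactor_poly_degree[OF e] by blast
    then show "f - yform e (basis_poly \<alpha> (x f)) \<in> JJ q"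
      using JJ_forms_large_iff[OF forms_diff[OF f yform_in_forms] e] by blast
  qed
  have inj': "inj_on (\<lambda>k. ymon (\<alpha> k) (e - \<alpha> k)) {..<d + 2}"
    using inj by (auto simp: inj_on_def)
  show qb: "quot_basis (d + 1) (JJ q) e norm_basis"
  proof (rule quot_basis_of_spanning[OF subspace_JJ])
    show "norm_basis \<subseteq> monoms (d + 1) e"
    proof clarify
      show "ymon (\<alpha> k) (e - \<alpha> k) \<in> monoms (d + 1) e" if "k < d + 2" for k
        using that le by (intro ymon_in_monoms) auto
    qed
    show "card norm_basis \<le> hilbert_fun (d + 1) (JJ q) e"
      unfolding card_image[OF inj'] using HilbD(4)[OF JJ_in_Hilb[OF q], of e] h_G_eq[OF e] by simp
  qed (use nf in blast)
  assume m: "m \<in> monoms (d + 1) e" and k: "k < d + 2"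
  have "nform (JJ q) norm_basis (single m 1) = yform e (basis_poly \<alpha> (x (single m 1)))"
    using nform_eqI[OF qb single_in_forms[OF m]] nf[OF single_in_forms[OF m]] by blast
  moreover have "\<alpha> k \<le> e" using le k by auto
  ultimately have "nf_coeff norm_basis m (ymon (\<alpha> k) (e - \<alpha> k)) (JJ q) = x (single m 1) $ k"
    unfolding nf_coeff_nform by (simp add: lookup_yform_ymon coeff_basis_poly[OF inj k])
  then show "nf_coeff norm_basis m (ymon (\<alpha> k) (e - \<alpha> k)) (JJ q) =
      (\<Sum>r<e + 1. adj_mat ?M $$ (k, r) * coeff (Yp e (single m 1)) r) / det ?M"
    using xk[of k] k e by simp
qed

end

text \<open>From degree d + 2 on, every monomial containing an x_i lies in the ideal, so quotient
  bases are binary.\<close>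

lemma quot_basis_large_E:
  assumes q: "q \<noteq> 0" "degree q \<le> d + 2" and e: "e \<ge> d + 2" and qb: "quot_basis (d + 1) (JJ q) e B"
  obtains \<alpha> where "inj_on \<alpha> {..<d + 2}" "\<alpha> ` {..<d + 2} \<subseteq> {..e}"
    "B = (\<lambda>k. ymon (\<alpha> k) (e - \<alpha> k)) ` {..<d + 2}"
proof -
  let ?A = "{a. a \<le> e \<and> ymon a (e - a) \<in> B}"
  have BA: "B = (\<lambda>a. ymon a (e - a)) ` ?A"
  proof
    show "B \<subseteq> (\<lambda>a. ymon a (e - a)) ` ?A"
    proof
      fix m assume m: "m \<in> B"
      then have mm: "m \<in> monoms (d + 1) e" using quot_basisD(1)[OF qb] by blast
      show "m \<in> (\<lambda>a. ymon a (e - a)) ` ?A"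
      proof (cases "\<forall>i<d. lookup m i = 0")
        case True
        then have y: "m = ymon (lookup m d) (lookup m (d + 1))" using mm ymonI by (simp add: monoms_def)
        moreover have "lookup m d + lookup m (d + 1) = e"
          using mm arg_cong[OF y, of mdeg] by (simp add: monoms_def)
        ultimately have "m = ymon (lookup m d) (e - lookup m d)" "lookup m d \<le> e" by auto
        then show ?thesis using m by (intro image_eqI[of _ _ "lookup m d"]) auto
      next
        case False
        then have "m \<noteq> ymon a b" for a b by (auto simp: lookup_ymon)
        then have "Yp e (single m 1) = 0" by (intro poly_eqI) (simp add: coeff_Yp lookup_single)
        then have "single m 1 \<in> JJ q" by (simp add: JJ_forms_large_iff[OF single_in_forms[OF mm] e])
        then have "single m (1::complex) = 0" using quot_basis_zero[OF qb subspace_JJ] m by simp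
        then have False using lookup_single_eq[of m "1::complex"] by simp
        then show ?thesis ..
      qed
    qed
  qed auto
  have inj: "inj_on (\<lambda>a. ymon a (e - a)) ?A" by (rule inj_onI) simp
  have "card B = d + 2"
    using hilbert_fun_quot_basis[OF subspace_JJ qb] HilbD(4)[OF JJ_in_Hilb[OF q], of e] h_G_eq[OF e] by simp
  then have "card ?A = d + 2" using card_image[OF inj] BA by simp
  moreover have "finite ?A" by (rule finite_subset[of _ "{..e}"]) auto
  ultimately obtain \<alpha> where \<alpha>: "bij_betw \<alpha> {..<d + 2} ?A"
    using ex_bij_betw_nat_finite[of ?A] by (auto simp: atLeast0LessThan)
  then have img: "\<alpha> ` {..<d + 2} = ?A" by (rule bij_betw_imp_surj_on)
  have "B = (\<lambda>a. ymon a (e - a)) ` (\<alpha> ` {..<d + 2})" unfolding img by (rule BA)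
  then have "B = (\<lambda>k. ymon (\<alpha> k) (e - \<alpha> k)) ` {..<d + 2}" unfolding image_image .
  moreover have "inj_on \<alpha> {..<d + 2}" "\<alpha> ` {..<d + 2} \<subseteq> {..e}" using \<alpha> by (auto simp: bij_betw_def)
  ultimately show thesis using that by blast
qed

definition point_ideal :: "(nat \<Rightarrow>\<^sub>0 complex) set \<Rightarrow> cpoly set"
  where "point_ideal L = JJ (line_poly L)"

lemma JJ_small_forms: "e < d + 2 \<Longrightarrow> f \<in> forms (d + 1) e \<Longrightarrow> f \<in> JJ q \<longleftrightarrow> f \<in> JJ q'"
  by (simp add: JJ_forms_iff form_multiple_small)

text \<open>Below degree d + 2 the ideal does not depend on q, so everything is constant; from there
  on the determinant of \<open>norm_mat\<close> cuts out the neighbourhood and Cramer's rule gives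
  the coefficients.\<close>

lemma normal_forms_rational:
  assumes L: "L \<in> proj_chart (coord_space (d + 2)) i" and qb: "quot_basis (d + 1) (point_ideal L) e B"
  shows "\<exists>W. openin (zariski_of (proj_atlas (coord_space (d + 2)))) W \<and> L \<in> W \<and>
      (\<forall>L'\<in>W. L' \<in> proj_space (d + 2) \<and> quot_basis (d + 1) (point_ideal L') e B)"
    and "m \<in> monoms (d + 1) e \<Longrightarrow> b \<in> B \<Longrightarrow> rat (proj_atlas (coord_space (d + 2)))
      (proj_chart (coord_space (d + 2)) i) (proj_coords i) L (\<lambda>L. nf_coeff B m b (point_ideal L))"
proof -
  let ?At = "proj_atlas (coord_space (d + 2))" and ?D = "proj_chart (coord_space (d + 2)) i"
  note in_atlas = proj_chart_in_atlas[of "coord_space (d + 2)" i]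
  have Lq: "line_poly L' \<noteq> 0" "degree (line_poly L') \<le> d + 2" if "L' \<in> proj_space (d + 2)" for L'
    using line_poly[OF that] by auto
  have "(\<exists>W. openin (zariski_of ?At) W \<and> L \<in> W \<and>
      (\<forall>L'\<in>W. L' \<in> proj_space (d + 2) \<and> quot_basis (d + 1) (point_ideal L') e B)) \<and>
    (m \<in> monoms (d + 1) e \<longrightarrow> b \<in> B \<longrightarrow> rat ?At ?D (proj_coords i) L (\<lambda>L. nf_coeff B m b (point_ideal L)))"
  proof (cases "e < d + 2")
    case True
    have "quot_basis (d + 1) (point_ideal L') e B" for L'
      using quot_basis_cong(1)[OF JJ_small_forms[OF True]] qb unfolding point_ideal_def by blast
    moreover have eq: "nf_coeff B m b (point_ideal L') = nf_coeff B m b (point_ideal L)" if "m \<in> monoms (d + 1) e" for L'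
      using quot_basis_cong(2)[OF JJ_small_forms[OF True] quot_basisD(1)[OF qb] that] unfolding point_ideal_def .
    have "rat ?At ?D (proj_coords i) L (\<lambda>L. nf_coeff B m b (point_ideal L))" if m: "m \<in> monoms (d + 1) e"
      by (rule rat_cong[OF rat_poly[OF in_atlas L poly_funs.const[of "nf_coeff B m b (point_ideal L)"]]
          openin_zariski_chart[OF in_atlas] L]) (rule eq[OF m, symmetric])
    moreover have "\<forall>L'\<in>?D. L' \<in> proj_space (d + 2)" by simp
    ultimately show ?thesis using openin_zariski_chart[OF in_atlas] L by blast
  next
    case False
    then have e: "e \<ge> d + 2" by simp
    obtain \<alpha> where \<alpha>: "inj_on \<alpha> {..<d + 2}" "\<alpha> ` {..<d + 2} \<subseteq> {..e}"
      "B = (\<lambda>k. ymon (\<alpha> k) (e - \<alpha> k)) ` {..<d + 2}"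
      using quot_basis_large_E[OF Lq e qb[unfolded point_ideal_def]] L by blast
    define c where "c L' = (\<lambda>j. hratio j i L')" for L'
    \<comment> \<open>The representative with i-th coefficient 1: its coefficients are the chart
      coordinates themselves.\<close>
    define q where "q L' = Polynomial.smult (1 / coeff (line_poly L') i) (line_poly L')" for L'
    have q: "q L' \<noteq> 0" "degree (q L') \<le> d + 2" "coeff (q L') = c L'" "point_ideal L' = JJ (q L')"
      if L': "L' \<in> ?D" for L'
    proof -
      have *: "L' \<in> proj_space (d + 2)" "coeff (line_poly L') i \<noteq> 0" using L' unfolding proj_chart_iff by auto
      show "q L' \<noteq> 0" "degree (q L') \<le> d + 2" using Lq[OF *(1)] *(2) by (auto simp: q_def)
      show "coeff (q L') = c L'" by (rule ext) (simp add: q_def c_def hratio_line_poly[OF *(1)])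
      show "point_ideal L' = JJ (q L')" unfolding point_ideal_def q_def using *(2) by (simp add: JJ_smult)
    qed
    have entry: "(\<lambda>L'. norm_entry \<alpha> (c L') r k) \<in> poly_funs (proj_coords i)" for r k
      unfolding norm_entry_def c_def
      by (cases "k < d + 2"; cases "k - (d + 2) \<le> r") (auto intro: poly_funs.const poly_funs.coord)
    have detp: "(\<lambda>L'. det (norm_mat e \<alpha> (c L'))) \<in> poly_funs (proj_coords i)"
      unfolding norm_mat_def by (rule poly_funs_det) (rule entry)
    have det: "det (norm_mat e \<alpha> (c L)) \<noteq> 0"
      using det_norm_mat_nonzero[OF e \<alpha>(1,2) q(1,2)[OF L]] qb q(3,4)[OF L] \<alpha>(3) by simp
    define W where "W = {L' \<in> ?D. det (norm_mat e \<alpha> (c L')) \<noteq> 0}"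
    have W: "openin (zariski_of ?At) W" "L \<in> W" "W \<subseteq> ?D"
      unfolding W_def using openin_zariski_basic[OF in_atlas detp] L det by auto
    have sol: "quot_basis (d + 1) (point_ideal L') e B"
      "m \<in> monoms (d + 1) e \<Longrightarrow> k < d + 2 \<Longrightarrow> nf_coeff B m (ymon (\<alpha> k) (e - \<alpha> k)) (point_ideal L') =
        (\<Sum>r<e + 1. adj_mat (norm_mat e \<alpha> (c L')) $$ (k, r) * coeff (Yp e (single m 1)) r) /
          det (norm_mat e \<alpha> (c L'))" if L': "L' \<in> W" for L' k
    proof -
      have D: "L' \<in> ?D" and "det (norm_mat e \<alpha> (coeff (q L'))) \<noteq> 0" using L' q(3) unfolding W_def by auto
      note s = norm_mat_solution[OF e \<alpha>(1,2) q(1,2)[OF D] this(2)]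
      show "quot_basis (d + 1) (point_ideal L') e B" unfolding q(4)[OF D] \<alpha>(3) by (rule s(1))
      show "m \<in> monoms (d + 1) e \<Longrightarrow> k < d + 2 \<Longrightarrow> nf_coeff B m (ymon (\<alpha> k) (e - \<alpha> k)) (point_ideal L') =
        (\<Sum>r<e + 1. adj_mat (norm_mat e \<alpha> (c L')) $$ (k, r) * coeff (Yp e (single m 1)) r) /
          det (norm_mat e \<alpha> (c L'))"
        unfolding q(4)[OF D] \<alpha>(3) q(3)[OF D, symmetric] by (rule s(2))
    qed
    have "rat ?At ?D (proj_coords i) L (\<lambda>L. nf_coeff B m b (point_ideal L))"
      if m: "m \<in> monoms (d + 1) e" and b: "b \<in> B"
    proof -
      obtain k where k: "b = ymon (\<alpha> k) (e - \<alpha> k)" "k < d + 2" using b \<alpha>(3) by blast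
      have "(\<lambda>L'. \<Sum>r<e + 1. adj_mat (norm_mat e \<alpha> (c L')) $$ (k, r) * coeff (Yp e (single m 1)) r)
          \<in> poly_funs (proj_coords i)"
        unfolding norm_mat_def
        by (intro poly_funs_sum poly_funs.mult poly_funs.const poly_funs_adj_mat entry) (use k e in auto)
      then have "rat ?At ?D (proj_coords i) L (\<lambda>L'. (\<Sum>r<e + 1. adj_mat (norm_mat e \<alpha> (c L')) $$ (k, r) *
          coeff (Yp e (single m 1)) r) / det (norm_mat e \<alpha> (c L')))"
        by (rule rat_divide[OF in_atlas rat_poly[OF in_atlas L] rat_poly[OF in_atlas L detp] det])
      then show ?thesis
        by (rule rat_cong[OF _ W(1,2)]) (simp only: k(1) sol(2)[OF _ m k(2)])
    qed
    moreover have "\<forall>L'\<in>W. L' \<in> proj_space (d + 2) \<and> quot_basis (d + 1) (point_ideal L') e B"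
      using W(3) sol(1) by blast
    ultimately show ?thesis using W by blast
  qed
  then show "\<exists>W. openin (zariski_of ?At) W \<and> L \<in> W \<and>
      (\<forall>L'\<in>W. L' \<in> proj_space (d + 2) \<and> quot_basis (d + 1) (point_ideal L') e B)"
    and "m \<in> monoms (d + 1) e \<Longrightarrow> b \<in> B \<Longrightarrow>
      rat ?At ?D (proj_coords i) L (\<lambda>L. nf_coeff B m b (point_ideal L))" by blast+
qed

lemma point_ideal_SS: "L \<in> proj_space (d + 2) \<Longrightarrow> point_ideal L \<in> SS"
  unfolding point_ideal_def SS_def using line_poly(1,2) by blast

lemma morphism_point_ideal:
  "morphism (proj_atlas (coord_space (d + 2))) (restrict_atlas (Hilb_atlas (d + 1) h_G) SS) point_ideal"
  unfolding morphism_def topspace_SS topspace_proj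
proof (intro conjI ballI allI impI point_ideal_SS)
  let ?At = "proj_atlas (coord_space (d + 2))"
  fix L D' A'
  assume L: "L \<in> proj_space (d + 2)" and DA': "(D', A') \<in> restrict_atlas (Hilb_atlas (d + 1) h_G) SS"
    "point_ideal L \<in> D'"
  obtain E B where E: "finite E" "D' = {J \<in> SS. \<forall>e\<in>E. quot_basis (d + 1) J e (B e)}"
    "A' = {nf_coeff (B e) m b | e m b. e \<in> E \<and> m \<in> monoms (d + 1) e \<and> b \<in> B e}"
    using DA'(1) unfolding restrict_Hilb_iff by (elim exE conjE) rule
  obtain i where i: "L \<in> proj_chart (coord_space (d + 2)) i" using proj_points_chart[OF L] by blast
  have qb: "quot_basis (d + 1) (point_ideal L) e (B e)" if "e \<in> E" for e
    using DA'(2) that unfolding E(2) by blast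
  \<comment> \<open>A chart involves finitely many degrees, so the neighbourhoods found degree by
    degree can be intersected.\<close>
  have "\<exists>W. openin (zariski_of ?At) W \<and> L \<in> W \<and>
      (\<forall>L'\<in>W. L' \<in> proj_space (d + 2) \<and> (\<forall>e\<in>E'. quot_basis (d + 1) (point_ideal L') e (B e)))"
    if "finite E'" "E' \<subseteq> E" for E'
    using that
  proof (induction E' rule: finite_induct)
    case empty
    show ?case
      by (rule exI[of _ "proj_chart (coord_space (d + 2)) i"])
        (use i openin_zariski_chart[OF proj_chart_in_atlas] in auto)
  next
    case (insert e E')
    obtain V where V: "openin (zariski_of ?At) V" "L \<in> V"
      "\<forall>L'\<in>V. L' \<in> proj_space (d + 2) \<and> quot_basis (d + 1) (point_ideal L') e (B e)"
      using normal_forms_rational(1)[OF i qb] insert.prems by blast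
    obtain W where W: "openin (zariski_of ?At) W" "L \<in> W"
      "\<forall>L'\<in>W. L' \<in> proj_space (d + 2) \<and> (\<forall>e\<in>E'. quot_basis (d + 1) (point_ideal L') e (B e))"
      using insert by blast
    show ?case by (rule exI[of _ "V \<inter> W"]) (use V W in auto)
  qed
  from this[OF E(1) subset_refl] obtain W where W: "openin (zariski_of ?At) W" "L \<in> W"
    "\<forall>L'\<in>W. L' \<in> proj_space (d + 2) \<and> (\<forall>e\<in>E. quot_basis (d + 1) (point_ideal L') e (B e))" by blast
  show "\<exists>D A W. (D, A) \<in> ?At \<and> L \<in> D \<and> openin (zariski_of ?At) W \<and> L \<in> W \<and> point_ideal ` W \<subseteq> D' \<and>
      (\<forall>a\<in>A'. rat ?At D A L (\<lambda>L. a (point_ideal L)))"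
  proof (rule exI[of _ "proj_chart (coord_space (d + 2)) i"], rule exI[of _ "proj_coords i"],
      rule exI[of _ W], intro conjI ballI proj_chart_in_atlas i W(1,2))
    show "point_ideal ` W \<subseteq> D'" using W(3) point_ideal_SS unfolding E(2) by blast
    fix a assume "a \<in> A'"
    then obtain e m b where "a = nf_coeff (B e) m b" "e \<in> E" "m \<in> monoms (d + 1) e" "b \<in> B e"
      unfolding E(3) by blast
    then show "rat ?At (proj_chart (coord_space (d + 2)) i) (proj_coords i) L (\<lambda>L. a (point_ideal L))"
      using normal_forms_rational(2)[OF i qb] by simp
  qed
qed

theorem iso_SS_PP:
  "iso_space_fun (variety_of (restrict_atlas (Hilb_atlas (d + 1) h_G) SS)) (PP (d + 2))"
  unfolding PP_def
proof (rule iso_space_fun_variety[OF morphism_ideal_line morphism_point_ideal])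
  fix J assume "J \<in> topspace (zariski_of (restrict_atlas (Hilb_atlas (d + 1) h_G) SS))"
  then have "J \<in> SS" unfolding topspace_SS .
  then obtain q where q: "J = JJ q" "q \<noteq> 0" "degree q \<le> d + 2" unfolding SS_def by blast
  obtain c where "c \<noteq> 0" "line_poly (poly_line q) = Polynomial.smult c q" by (rule line_poly_poly_line)
  then show "point_ideal (ideal_line J) = J"
    unfolding q(1) ideal_line_JJ[OF q(2,3)] point_ideal_def by (simp add: JJ_smult)
next
  fix L assume "L \<in> topspace (zariski_of (proj_atlas (coord_space (d + 2))))"
  then have "L \<in> proj_space (d + 2)" unfolding topspace_proj .
  then show "ideal_line (point_ideal L) = L"
    unfolding point_ideal_def using ideal_line_JJ line_poly by simp
qed

end

section \<open>Limits of ideals\<close>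

text \<open>Coefficientwise limits in the Euclidean sense. The degrees of the \<open>fs k\<close>
  may be unbounded; passing to homogeneous components makes the problem finite-dimensional
  later.\<close>

definition lim_set :: "nat \<Rightarrow> (nat \<Rightarrow> cpoly set) \<Rightarrow> cpoly set"
  where "lim_set n Js = {f \<in> polys n. \<exists>fs. (\<forall>k. fs k \<in> Js k) \<and>
    (\<forall>m. (\<lambda>k. lookup (fs k) m) \<longlonglongrightarrow> lookup f m)}"

lemma lim_setI:
  "f \<in> polys n \<Longrightarrow> (\<And>k. fs k \<in> Js k) \<Longrightarrow> (\<And>m. (\<lambda>k. lookup (fs k) m) \<longlonglongrightarrow> lookup f m) \<Longrightarrow> f \<in> lim_set n Js"
  unfolding lim_set_def by blast

lemma lim_setE:
  assumes "f \<in> lim_set n Js"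
  obtains fs where "\<And>k. fs k \<in> Js k" "\<And>m. (\<lambda>k. lookup (fs k) m) \<longlonglongrightarrow> lookup f m"
  using assms unfolding lim_set_def by blast

lemma ideal_lim_set:
  assumes J: "\<And>k. ideal (Js k) (poly_ring n)"
  shows "ideal (lim_set n Js) (poly_ring n)"
proof (rule ideal_poly_ringI)
  note JD = ideal_poly_ringD[OF J]
  show "lim_set n Js \<subseteq> polys n" unfolding lim_set_def by blast
  show "cvec.subspace (lim_set n Js)"
  proof (rule cvec_subspaceI)
    show "0 \<in> lim_set n Js"
      by (rule lim_setI[where fs = "\<lambda>_. 0"]) (auto intro: polys_0 cvec.subspace_0[OF JD(3)])
    fix f assume f: "f \<in> lim_set n Js"
    then obtain fs where fs: "\<And>k. fs k \<in> Js k" "\<And>m. (\<lambda>k. lookup (fs k) m) \<longlonglongrightarrow> lookup f m"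
      by (rule lim_setE) blast
    have fp: "f \<in> polys n" using f unfolding lim_set_def by blast
    show "cscale c f \<in> lim_set n Js" for c
      by (rule lim_setI[where fs = "\<lambda>k. cscale c (fs k)"])
        (auto intro!: polys_cscale fp cvec.subspace_scale[OF JD(3)] tendsto_mult fs)
    fix g assume g: "g \<in> lim_set n Js"
    then obtain gs where gs: "\<And>k. gs k \<in> Js k" "\<And>m. (\<lambda>k. lookup (gs k) m) \<longlonglongrightarrow> lookup g m"
      by (rule lim_setE) blast
    have gp: "g \<in> polys n" using g unfolding lim_set_def by blast
    show "f + g \<in> lim_set n Js"
      by (rule lim_setI[where fs = "\<lambda>k. fs k + gs k"])
        (auto intro!: polys_add fp gp cvec.subspace_add[OF JD(3)] tendsto_add fs gs simp: lookup_add)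
  qed
  fix i f assume i: "i \<le> n" and f: "f \<in> lim_set n Js"
  then obtain fs where fs: "\<And>k. fs k \<in> Js k" "\<And>m. (\<lambda>k. lookup (fs k) m) \<longlonglongrightarrow> lookup f m"
    by (elim lim_setE) blast
  have fp: "f \<in> polys n" using f unfolding lim_set_def by blast
  show "Var i * f \<in> lim_set n Js"
    by (rule lim_setI[where fs = "\<lambda>k. Var i * fs k"])
      (auto intro!: polys_mult polys_Var i fp JD(2) fs simp: lookup_Var_times)
qed

text \<open>If every element of \<open>J\<^sub>0\<close> is a limit of elements of the \<open>J\<^sub>k\<close>, then the elements
  \<open>m - nform m\<close> of \<open>J\<^sub>0\<close> lift to elements of \<open>J\<^sub>k\<close> with errors \<open>\<eta> m k\<close> tending to \<open>0\<close>. Modulo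
  \<open>J\<^sub>k\<close> this is a system of linear equations close to the identity for the normal forms.\<close>

locale ideal_limit =
  fixes n :: nat and h :: "nat \<Rightarrow> nat" and J\<^sub>0 :: "cpoly set" and Js :: "nat \<Rightarrow> cpoly set"
  assumes J0: "J\<^sub>0 \<in> Hilb n h" and Js: "\<And>k. Js k \<in> Hilb n h" and lim: "J\<^sub>0 \<subseteq> lim_set n Js"
begin

lemma normal_form_limit:
  assumes qb: "quot_basis n J\<^sub>0 e B"
  shows "\<forall>\<^sub>F k in sequentially. quot_basis n (Js k) e B"
    and "m \<in> monoms n e \<Longrightarrow> (\<lambda>k. nf_coeff B m b (Js k)) \<longlonglongrightarrow> nf_coeff B m b J\<^sub>0"
proof -
  note J0D = HilbD[OF J0] and JsD = HilbD[OF Js]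
  let ?M = "monoms n e"
  let ?x = "\<lambda>m. single m (1::complex)"
  define w where "w m = ?x m - nform J\<^sub>0 B (?x m)" for m
  have nf0: "keys (nform J\<^sub>0 B (?x m)) \<subseteq> B" "w m \<in> J\<^sub>0" "w m \<in> forms n e" if "m \<in> ?M" for m
  proof -
    note nf = nform[OF qb single_in_forms[OF that, of 1]]
    show "keys (nform J\<^sub>0 B (?x m)) \<subseteq> B" "w m \<in> J\<^sub>0" using nf by (auto simp: w_def)
    show "w m \<in> forms n e" unfolding w_def
      by (intro forms_diff single_in_forms that forms_subset_keys[OF quot_basisD(1)[OF qb] nf(1)])
  qed
  have "\<exists>ws. (\<forall>k. ws k \<in> Js k \<and> ws k \<in> forms n e) \<and> (\<forall>m'. (\<lambda>k. lookup (ws k) m') \<longlonglongrightarrow> lookup (w m) m')"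
    if m: "m \<in> ?M" for m
  proof -
    have "w m \<in> lim_set n Js" using lim nf0(2)[OF m] by blast
    then obtain ws where ws: "\<And>k. ws k \<in> Js k" "\<And>m'. (\<lambda>k. lookup (ws k) m') \<longlonglongrightarrow> lookup (w m) m'"
      by (rule lim_setE) blast
    \<comment> \<open>The approximating polynomials are cut down to degree \<open>e\<close>, which
      keeps them in the ideal and does not change the limit.\<close>
    have "hcomp e (ws k) \<in> Js k" for k using homogeneous_idealD(2)[OF JsD(1) ws(1)] .
    moreover have "hcomp e (ws k) \<in> forms n e" for k
      using hcomp_forms ideal_poly_ringD(1)[OF JsD(2)] ws(1) by blast
    moreover have "(\<lambda>k. lookup (hcomp e (ws k)) m') \<longlonglongrightarrow> lookup (w m) m'" for m'
    proof (cases "mdeg m' = e")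
      case True
      then show ?thesis using ws(2) by (simp add: lookup_hcomp)
    next
      case False
      then have "lookup (w m) m' = 0"
        using nf0(3)[OF m] by (auto simp: forms_def monoms_def in_keys_iff subset_iff)
      then show ?thesis using False by (simp add: lookup_hcomp)
    qed
    ultimately show ?thesis by (intro exI[of _ "\<lambda>k. hcomp e (ws k)"]) blast
  qed
  then have "\<forall>m. \<exists>ws. m \<in> ?M \<longrightarrow> (\<forall>k. ws k \<in> Js k \<and> ws k \<in> forms n e) \<and>
      (\<forall>m'. (\<lambda>k. lookup (ws k) m') \<longlonglongrightarrow> lookup (w m) m')" by blast
  from choice[OF this] obtain ws where ws: "\<And>m k. m \<in> ?M \<Longrightarrow> ws m k \<in> Js k"
    "\<And>m k. m \<in> ?M \<Longrightarrow> ws m k \<in> forms n e"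
    "\<And>m m'. m \<in> ?M \<Longrightarrow> (\<lambda>k. lookup (ws m k) m') \<longlonglongrightarrow> lookup (w m) m'" by blast
  define \<eta> where "\<eta> m k = ws m k - w m" for m k
  have \<eta>: "\<eta> m k \<in> forms n e" "\<eta> m k = (\<Sum>m'\<in>?M. cscale (lookup (\<eta> m k) m') (?x m'))" if "m \<in> ?M" for m k
  proof -
    show "\<eta> m k \<in> forms n e" unfolding \<eta>_def by (intro forms_diff ws nf0 that)
    then show "\<eta> m k = (\<Sum>m'\<in>?M. cscale (lookup (\<eta> m k) m') (?x m'))"
      using poly_mapping_sum_single[OF finite_monoms, of "\<eta> m k" n e]
      by (simp add: forms_def cscale_single)
  qed
  \<comment> \<open>A norm of the error matrix. Once it is below 1/2, a solution of x = y - \<eta> x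
    is bounded by twice the norm of y, and y = 0 forces x = 0.\<close>
  define \<kappa> where "\<kappa> k = (\<Sum>m\<in>?M. \<Sum>m'\<in>?M. norm (lookup (\<eta> m k) m'))" for k
  have "\<kappa> \<longlonglongrightarrow> 0"
    unfolding \<kappa>_def
  proof (intro tendsto_null_sum tendsto_norm_zero)
    fix m m' assume "m \<in> ?M"
    then show "(\<lambda>k. lookup (\<eta> m k) m') \<longlonglongrightarrow> 0"
      using LIM_zero[OF ws(3)] by (simp add: \<eta>_def lookup_minus)
  qed
  then have ev: "\<forall>\<^sub>F k in sequentially. \<kappa> k < 1 / 2" by (rule order_tendstoD) simp
  have contract: "(\<Sum>m\<in>?M. norm (\<Sum>m'\<in>?M. lookup (\<eta> m k) m' * g m')) \<le> \<kappa> k * (\<Sum>m\<in>?M. norm (g m))"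
    for g :: "monom \<Rightarrow> complex" and k
    unfolding \<kappa>_def sum_distrib_right
  proof (rule sum_mono)
    fix m assume "m \<in> ?M"
    have "norm (\<Sum>m'\<in>?M. lookup (\<eta> m k) m' * g m') \<le> (\<Sum>m'\<in>?M. norm (lookup (\<eta> m k) m') * norm (g m'))"
      by (rule order_trans[OF norm_sum]) (simp add: norm_mult)
    also have "\<dots> \<le> (\<Sum>m'\<in>?M. norm (lookup (\<eta> m k) m') * (\<Sum>m\<in>?M. norm (g m)))"
      by (intro sum_mono mult_left_mono member_le_sum finite_monoms) auto
    finally show "norm (\<Sum>m'\<in>?M. lookup (\<eta> m k) m' * g m') \<le>
        (\<Sum>m'\<in>?M. norm (lookup (\<eta> m k) m') * (\<Sum>m\<in>?M. norm (g m)))" .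
  qed
  have qbk: "quot_basis n (Js k) e B" if k: "\<kappa> k < 1 / 2" for k
  proof (rule quot_basis_of_spanning[OF JsD(3) quot_basisD(1)[OF qb]])
    show "card B \<le> hilbert_fun n (Js k) e"
      using hilbert_fun_quot_basis[OF J0D(3) qb] J0D(4) JsD(4) by simp
    define U where "U = {f \<in> forms n e. \<exists>p. keys p \<subseteq> B \<and> f - p \<in> Js k}"
    have U: "cvec.subspace U"
    proof (rule cvec_subspaceI)
      show "0 \<in> U" unfolding U_def
        using cvec.subspace_0[OF subspace_forms] cvec.subspace_0[OF JsD(3)]
        by (auto intro!: exI[of _ 0])
      fix f assume "f \<in> U"
      then obtain p where p: "f \<in> forms n e" "keys p \<subseteq> B" "f - p \<in> Js k" unfolding U_def by blast
      have "cscale c f - cscale c p \<in> Js k" for c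
        using cvec.subspace_scale[OF JsD(3) p(3), of c] by (simp add: cscale_diff)
      moreover have "keys (cscale c p) \<subseteq> B" for c using p(2) by (auto simp: keys_cscale)
      ultimately show "cscale c f \<in> U" for c
        unfolding U_def using cvec.subspace_scale[OF subspace_forms p(1)] by blast
      fix g assume "g \<in> U"
      then obtain r where r: "g \<in> forms n e" "keys r \<subseteq> B" "g - r \<in> Js k" unfolding U_def by blast
      have "(f + g) - (p + r) \<in> Js k"
        using cvec.subspace_add[OF JsD(3) p(3) r(3)] by (simp add: algebra_simps)
      then show "f + g \<in> U"
        unfolding U_def using cvec.subspace_add[OF subspace_forms p(1) r(1)] keys_subset_add[OF p(2) r(2)] by blast
    qed
    have xU: "?x m + \<eta> m k \<in> U" if m: "m \<in> ?M" for m
    proof -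
      have "?x m + \<eta> m k - nform J\<^sub>0 B (?x m) = ws m k" by (simp add: \<eta>_def w_def)
      then have "?x m + \<eta> m k - nform J\<^sub>0 B (?x m) \<in> Js k" using ws(1)[OF m] by simp
      then show ?thesis
        unfolding U_def using cvec.subspace_add[OF subspace_forms single_in_forms[OF m] \<eta>(1)[OF m]] nf0(1)[OF m] by blast
    qed
    have "f \<in> U" if f: "f \<in> forms n e" for f
    proof (rule ccontr)
      \<comment> \<open>If some form had no normal form, a linear functional \<open>g\<close> would
        kill \<open>U\<close> without killing \<open>f\<close>. Its values on the monomials then
        satisfy g = - \<eta> g, and the contraction forces all of them to be 0.\<close>
      assume fU: "f \<notin> U"
      interpret P: vector_space_pair "cscale :: complex \<Rightarrow> cpoly \<Rightarrow> cpoly" "(*) :: complex \<Rightarrow> complex \<Rightarrow> complex"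
        by unfold_locales (auto simp: algebra_simps)
      obtain C where C: "C \<subseteq> U" "cvec.independent C" "U \<subseteq> cvec.span C"
        using cvec.maximal_independent_subset[of U] by blast
      have "cvec.span C \<subseteq> U" using C(1) U by (rule cvec.span_minimal)
      then have "cvec.independent (insert f C)"
        using C(2) fU by (intro cvec.independent_insertI) auto
      then obtain g where g: "Vector_Spaces.linear cscale (*) g"
        "\<And>x. x \<in> insert f C \<Longrightarrow> g x = (if x = f then 1 else 0)"
        using P.linear_independent_extend[of "insert f C" "\<lambda>x. if x = f then 1 else 0"] by blast
      interpret g: Vector_Spaces.linear "cscale :: complex \<Rightarrow> cpoly \<Rightarrow> cpoly" "(*)" g by (rule g(1))
      have gU: "g u = 0" if "u \<in> U" for u
      proof (rule g.eq_0_on_span[of C])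
        show "u \<in> cvec.span C" using C(3) that by blast
        show "g x = 0" if "x \<in> C" for x using g(2)[of x] that C(1) fU by auto
      qed
      have gsum: "g (\<Sum>i\<in>I. cscale (c i) (v i)) = (\<Sum>i\<in>I. c i * g (v i))"
        for I :: "monom set" and c v by (simp add: g.sum g.scale)
      have "g (?x m) = - (\<Sum>m'\<in>?M. lookup (\<eta> m k) m' * g (?x m'))" if m: "m \<in> ?M" for m
      proof -
        have "0 = g (?x m) + g (\<eta> m k)" using gU[OF xU[OF m]] g.add by simp
        also have "g (\<eta> m k) = (\<Sum>m'\<in>?M. lookup (\<eta> m k) m' * g (?x m'))"
          by (subst \<eta>(2)[OF m], rule gsum)
        finally show ?thesis by (simp add: eq_neg_iff_add_eq_0)
      qed
      then have "(\<Sum>m\<in>?M. norm (g (?x m))) = (\<Sum>m\<in>?M. norm (\<Sum>m'\<in>?M. lookup (\<eta> m k) m' * g (?x m')))"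
        by (intro sum.cong) (auto simp: norm_minus_cancel)
      also have "\<dots> \<le> \<kappa> k * (\<Sum>m\<in>?M. norm (g (?x m)))" by (rule contract)
      also have "\<dots> \<le> 1 / 2 * (\<Sum>m\<in>?M. norm (g (?x m)))"
        using k by (intro mult_right_mono sum_nonneg) auto
      finally have "(\<Sum>m\<in>?M. norm (g (?x m))) \<le> 0" by simp
      then have "(\<Sum>m\<in>?M. norm (g (?x m))) = 0" by (intro antisym sum_nonneg) auto
      then have g0: "g (?x m) = 0" if "m \<in> ?M" for m
        using that sum_nonneg_eq_0_iff[OF finite_monoms, of n e "\<lambda>m. norm (g (?x m))"] by simp
      have "f = (\<Sum>m\<in>?M. cscale (lookup f m) (?x m))"
        using poly_mapping_sum_single[OF finite_monoms, of f n e] f by (simp add: forms_def cscale_single)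
      then have "g f = (\<Sum>m\<in>?M. lookup f m * g (?x m))" using gsum by metis
      then have "g f = 0" using g0 by simp
      then show False using g(2)[of f] by simp
    qed
    then show "\<exists>p. keys p \<subseteq> B \<and> f - p \<in> Js k" if "f \<in> forms n e" for f
      using that unfolding U_def by blast
  qed
  show "\<forall>\<^sub>F k in sequentially. quot_basis n (Js k) e B"
    using ev by eventually_elim (rule qbk)
  assume m: "m \<in> ?M"
  define \<Psi> where "\<Psi> = (\<Sum>m\<in>?M. norm (nf_coeff B m b J\<^sub>0))"
  have bound: "norm (nf_coeff B m b (Js k) - nf_coeff B m b J\<^sub>0) \<le> \<kappa> k * (2 * \<Psi>)" if k: "\<kappa> k < 1 / 2" for k
  proof -
    let ?N = "\<lambda>m. nform (Js k) B (?x m)"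
    \<comment> \<open>Modulo \<open>Js k\<close> the element \<open>ws m k\<close> rewrites a
      monomial as its old normal form minus the error \<open>\<eta> m k\<close>; the error is then
      replaced by its own normal form.\<close>
    have rec: "nf_coeff B m b (Js k) - nf_coeff B m b J\<^sub>0 =
        - (\<Sum>m'\<in>?M. lookup (\<eta> m k) m' * nf_coeff B m' b (Js k))" if m: "m \<in> ?M" for m
    proof -
      define s where "s = (\<Sum>m'\<in>?M. cscale (lookup (\<eta> m k) m') (?N m'))"
      define t where "t = (\<Sum>m'\<in>?M. cscale (lookup (\<eta> m k) m') (?x m' - ?N m'))"
      have N: "keys (?N m') \<subseteq> B" "?x m' - ?N m' \<in> Js k" if "m' \<in> ?M" for m'
        using nform[OF qbk[OF k] single_in_forms[OF that]] by auto
      have "?N m = nform J\<^sub>0 B (?x m) - s"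
      proof (rule nform_eqI[OF qbk[OF k] single_in_forms[OF m]])
        have "keys s \<subseteq> B" unfolding s_def
          by (intro keys_subset_sum) (use N(1) in \<open>auto simp: keys_cscale\<close>)
        then show "keys (nform J\<^sub>0 B (?x m) - s) \<subseteq> B" by (rule keys_subset_diff[OF nf0(1)[OF m]])
        have "\<eta> m k = s + t" unfolding s_def t_def
          by (subst \<eta>(2)[OF m]) (simp add: cscale_diff sum_subtractf)
        then have "?x m - (nform J\<^sub>0 B (?x m) - s) = ws m k - t"
          by (simp add: \<eta>_def w_def algebra_simps)
        moreover have "t \<in> Js k" unfolding t_def
          by (intro cvec.subspace_sum[OF JsD(3)] cvec.subspace_scale[OF JsD(3)] N(2))
        ultimately show "?x m - (nform J\<^sub>0 B (?x m) - s) \<in> Js k"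
          using cvec.subspace_diff[OF JsD(3) ws(1)[OF m]] by simp
      qed
      then show ?thesis unfolding nf_coeff_nform s_def by (simp add: lookup_minus lookup_sum)
    qed
    let ?S = "\<Sum>m\<in>?M. norm (nf_coeff B m b (Js k))"
    have diff: "(\<Sum>m\<in>?M. norm (nf_coeff B m b (Js k) - nf_coeff B m b J\<^sub>0)) \<le> \<kappa> k * ?S"
      using contract[of k "\<lambda>m. nf_coeff B m b (Js k)"] rec by (simp add: norm_minus_cancel)
    have S0: "0 \<le> ?S" by (intro sum_nonneg) auto
    have \<kappa>0: "0 \<le> \<kappa> k" unfolding \<kappa>_def by (intro sum_nonneg) auto
    \<comment> \<open>Absorbing half of \<open>?S\<close> into the left-hand side bounds it by
      \<open>2 * \<Psi>\<close>, independently of \<open>k\<close>.\<close>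
    have "?S \<le> (\<Sum>m\<in>?M. norm (nf_coeff B m b J\<^sub>0) + norm (nf_coeff B m b (Js k) - nf_coeff B m b J\<^sub>0))"
      by (intro sum_mono norm_triangle_sub)
    also have "\<dots> \<le> \<Psi> + \<kappa> k * ?S" using diff unfolding \<Psi>_def sum.distrib by simp
    also have "\<dots> \<le> \<Psi> + 1 / 2 * ?S" using k S0 by (intro add_left_mono mult_right_mono) auto
    finally have "?S \<le> 2 * \<Psi>" by simp
    moreover have "norm (nf_coeff B m b (Js k) - nf_coeff B m b J\<^sub>0) \<le>
        (\<Sum>m\<in>?M. norm (nf_coeff B m b (Js k) - nf_coeff B m b J\<^sub>0))"
      using m by (intro member_le_sum finite_monoms) auto
    ultimately show ?thesis using diff mult_left_mono[of ?S "2 * \<Psi>" "\<kappa> k"] \<kappa>0 by linarith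
  qed
  have "(\<lambda>k. nf_coeff B m b (Js k) - nf_coeff B m b J\<^sub>0) \<longlonglongrightarrow> 0"
  proof (rule tendsto_0_le[OF \<open>\<kappa> \<longlonglongrightarrow> 0\<close>])
    have \<kappa>n: "norm (\<kappa> k) = \<kappa> k" for k unfolding \<kappa>_def by (simp add: sum_nonneg)
    show "\<forall>\<^sub>F k in sequentially. norm (nf_coeff B m b (Js k) - nf_coeff B m b J\<^sub>0) \<le> norm (\<kappa> k) * (2 * \<Psi>)"
      unfolding \<kappa>n using ev by eventually_elim (rule bound)
  qed
  then show "(\<lambda>k. nf_coeff B m b (Js k)) \<longlonglongrightarrow> nf_coeff B m b J\<^sub>0" by (rule LIM_zero_cancel)
qed

text \<open>A basic Zariski neighbourhood is given by finitely many quotient bases and the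
  nonvanishing of a polynomial in the normal form coefficients. The bases persist and the
  coefficients converge, so the sequence eventually stays in the neighbourhood.\<close>

lemma in_closure:
  assumes "\<And>k. Js k \<in> S"
  shows "J\<^sub>0 \<in> zariski_of (Hilb_atlas n h) closure_of S"
  unfolding in_closure_of
proof (intro conjI allI impI)
  have "(Hilb n h, {}) \<in> Hilb_atlas n h"
    unfolding Hilb_atlas_def by (intro CollectI exI[of _ "{}"]) auto
  then show "J\<^sub>0 \<in> topspace (zariski_of (Hilb_atlas n h))"
    using J0 unfolding topspace_zariski_of by blast
  fix T assume T: "J\<^sub>0 \<in> T \<and> openin (zariski_of (Hilb_atlas n h)) T"
  have "generate_topology_on {{x \<in> D. q x \<noteq> 0} | D A q. (D, A) \<in> Hilb_atlas n h \<and> q \<in> poly_funs A} T"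
    using T unfolding zariski_of_def by (blast dest: openin_topology_generated_by)
  then have "J\<^sub>0 \<in> T \<Longrightarrow> \<forall>\<^sub>F k in sequentially. Js k \<in> T"
  proof induction
    case (Int U V)
    then show ?case by (auto elim: eventually_elim2)
  next
    case (UN K)
    then obtain U where U: "U \<in> K" "J\<^sub>0 \<in> U" by blast
    with UN have "\<forall>\<^sub>F k in sequentially. Js k \<in> U" by blast
    then show ?case by eventually_elim (use U in blast)
  next
    case (Basis U)
    then obtain D A q where U: "U = {x \<in> D. q x \<noteq> 0}" "(D, A) \<in> Hilb_atlas n h" "q \<in> poly_funs A" by blast
    then obtain E B where E: "finite E" "D = {J \<in> Hilb n h. \<forall>e\<in>E. quot_basis n J e (B e)}"
      "A = {nf_coeff (B e) m b | e m b. e \<in> E \<and> m \<in> monoms n e \<and> b \<in> B e}"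
      unfolding Hilb_atlas_def by blast
    have qb: "quot_basis n J\<^sub>0 e (B e)" if "e \<in> E" for e using Basis.prems that unfolding U(1) E(2) by blast
    have "\<forall>\<^sub>F k in sequentially. \<forall>e\<in>E. quot_basis n (Js k) e (B e)"
      using E(1) normal_form_limit(1)[OF qb] by (simp add: eventually_ball_finite_distrib)
    then have evD: "\<forall>\<^sub>F k in sequentially. Js k \<in> D"
      by eventually_elim (use Js E(2) in blast)
    have "(\<lambda>k. p (Js k)) \<longlonglongrightarrow> p J\<^sub>0" if "p \<in> poly_funs A" for p
      using that
    proof (induction p rule: poly_funs.induct)
      case (coord a)
      then show ?case unfolding E(3) using normal_form_limit(2)[OF qb] by blast
    qed (auto intro: tendsto_add tendsto_mult)
    then have "(\<lambda>k. q (Js k)) \<longlonglongrightarrow> q J\<^sub>0" using U(3) by blast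
    moreover have "q J\<^sub>0 \<noteq> 0" using Basis.prems unfolding U(1) by blast
    ultimately have "\<forall>\<^sub>F k in sequentially. q (Js k) \<noteq> 0" by (rule tendsto_imp_eventually_ne)
    with evD show ?case unfolding U(1) by eventually_elim blast
  qed auto
  with T have "\<forall>\<^sub>F k in sequentially. Js k \<in> T" by blast
  then obtain k where "Js k \<in> T" by (metis eventually_happens sequentially_bot)
  then show "\<exists>y. y \<in> S \<and> y \<in> T" using assms by blast
qed

end

section \<open>Vanishing ideals of points\<close>

definition mval :: "monom \<Rightarrow> (nat \<Rightarrow>\<^sub>0 complex) \<Rightarrow> complex"
  where "mval m v = (\<Prod>i\<in>keys m. lookup v i ^ lookup m i)"

lemma mval_superset: "finite S \<Longrightarrow> keys m \<subseteq> S \<Longrightarrow> mval m v = (\<Prod>i\<in>S. lookup v i ^ lookup m i)"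
  unfolding mval_def by (rule prod.mono_neutral_left) (auto simp: in_keys_iff)

lemma mval_add: "mval (a + b) v = mval a v * mval b v"
proof -
  let ?S = "keys a \<union> keys b"
  have "mval (a + b) v = (\<Prod>i\<in>?S. lookup v i ^ lookup (a + b) i)"
    by (rule mval_superset) (use Poly_Mapping.keys_add[of a b] in auto)
  then show ?thesis
    by (simp add: mval_superset[of ?S a] mval_superset[of ?S b] lookup_add power_add prod.distrib)
qed

lemma mval_single [simp]: "mval (single i k) v = lookup v i ^ k"
  by (simp add: mval_def)

lemma mval_cscale: "mval m (cscale c v) = c ^ mdeg m * mval m v"
  by (simp add: mval_def mdeg_def power_mult_distrib prod.distrib power_sum)

lemma peval_superset:
  assumes "finite S" "keys f \<subseteq> S"
  shows "peval f v = (\<Sum>m\<in>S. lookup f m * mval m v)"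
  unfolding peval_def mval_def by (rule sum.mono_neutral_left) (use assms in \<open>auto simp: in_keys_iff\<close>)

lemma peval_mval: "peval f v = (\<Sum>m\<in>keys f. lookup f m * mval m v)"
  by (rule peval_superset) auto

lemma peval_0 [simp]: "peval 0 v = 0"
  by (simp add: peval_def)

lemma peval_single [simp]: "peval (single m c) v = c * mval m v"
  by (simp add: peval_mval)

lemma peval_add: "peval (f + g) v = peval f v + peval g v"
proof -
  let ?S = "keys f \<union> keys g"
  have "peval (f + g) v = (\<Sum>m\<in>?S. lookup (f + g) m * mval m v)"
    by (rule peval_superset) (use Poly_Mapping.keys_add[of f g] in auto)
  then show ?thesis
    by (simp add: peval_superset[of ?S f] peval_superset[of ?S g] lookup_add distrib_right sum.distrib)
qed

lemma peval_cscale: "peval (cscale c f) v = c * peval f v"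
  using peval_superset[of "keys f" "cscale c f" v]
  by (simp add: keys_cscale peval_mval sum_distrib_left mult.assoc)

lemma peval_diff: "peval (f - g) v = peval f v - peval g v"
  using peval_add[of f "- g" v] peval_cscale[of "- 1" g v] by (simp add: cscale_minus1)

lemma peval_sum: "peval (\<Sum>i\<in>I. f i) v = (\<Sum>i\<in>I. peval (f i) v)"
  by (induction I rule: infinite_finite_induct) (auto simp: peval_add)

lemma peval_Var_times: "peval (Var i * f) v = lookup v i * peval f v"
  unfolding Var_def single_times peval_sum
  by (simp add: mval_add peval_mval[of f] sum_distrib_left mult_ac)

lemma peval_hcomp_scale: "peval f (cscale c v) = (\<Sum>e\<in>mdeg ` keys f. c ^ e * peval (hcomp e f) v)"
proof -
  have "peval (hcomp e f) (cscale c v) = c ^ e * peval (hcomp e f) v" for e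
  proof -
    have eq: "lookup (hcomp e f) m * mval m (cscale c v) = c ^ e * (lookup (hcomp e f) m * mval m v)" for m
      by (simp add: lookup_hcomp mval_cscale)
    show ?thesis unfolding peval_mval sum_distrib_left by (intro sum.cong refl eq)
  qed
  moreover have "peval f (cscale c v) = peval (\<Sum>e\<in>mdeg ` keys f. hcomp e f) (cscale c v)"
    by (simp add: sum_hcomp)
  ultimately show ?thesis unfolding peval_sum by simp
qed

text \<open>On the multiples c v, \<open>f\<close> is the polynomial in c with coefficients
  \<open>peval (hcomp e f) v\<close>; vanishing for all nonzero c makes it the zero
  polynomial.\<close>

lemma vanishing_ideal_lines:
  "vanishing_ideal n (cline ` P) = {f \<in> polys n. \<forall>v\<in>P. \<forall>e. peval (hcomp e f) v = 0}"
proof -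
  have "(\<forall>w\<in>cline v. peval f w = 0) \<longleftrightarrow> (\<forall>e. peval (hcomp e f) v = 0)" for v f
  proof
    assume *: "\<forall>w\<in>cline v. peval f w = 0"
    define p where "p = (\<Sum>e\<in>mdeg ` keys f. Polynomial.monom (peval (hcomp e f) v) e)"
    have "poly p c = 0" if "c \<noteq> 0" for c
    proof -
      have "poly p c = peval f (cscale c v)"
        by (simp add: p_def poly_sum poly_monom peval_hcomp_scale mult.commute)
      moreover have "cscale c v \<in> cline v" using that unfolding cline_def by blast
      ultimately show ?thesis using * by simp
    qed
    then have "UNIV - {0} \<subseteq> {c. poly p c = 0}" by auto
    then have "infinite {c. poly p c = 0}"
      by (metis infinite_UNIV_char_0 infinite_remove infinite_super)
    then have "p = 0" using poly_roots_finite by blast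
    show "\<forall>e. peval (hcomp e f) v = 0"
    proof
      fix e
      show "peval (hcomp e f) v = 0"
      proof (cases "e \<in> mdeg ` keys f")
        case True
        have "coeff p e = (\<Sum>e'\<in>mdeg ` keys f. if e' = e then peval (hcomp e f) v else 0)"
          unfolding p_def coeff_sum by (rule sum.cong) auto
        then show ?thesis using True \<open>p = 0\<close> by simp
      next
        case False
        then have "hcomp e f = 0" by (intro poly_mapping_eqI) (auto simp: lookup_hcomp in_keys_iff)
        then show ?thesis by simp
      qed
    qed
  next
    assume "\<forall>e. peval (hcomp e f) v = 0"
    then show "\<forall>w\<in>cline v. peval f w = 0" unfolding cline_def by (auto simp: peval_hcomp_scale)
  qed
  then show ?thesis unfolding vanishing_ideal_def by auto
qed

lemma hcomp_add: "hcomp e (f + g) = hcomp e f + hcomp e g"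
  and hcomp_cscale: "hcomp e (cscale c f) = cscale c (hcomp e f)"
  and hcomp_hcomp: "hcomp e' (hcomp e f) = (if e' = e then hcomp e f else 0)"
  by (auto intro!: poly_mapping_eqI simp: lookup_hcomp lookup_add)

lemma hcomp_Var_times: "hcomp e (Var i * f) = (case e of 0 \<Rightarrow> 0 | Suc e' \<Rightarrow> Var i * hcomp e' f)"
proof (rule poly_mapping_eqI)
  fix m
  show "lookup (hcomp e (Var i * f)) m = lookup (case e of 0 \<Rightarrow> 0 | Suc e' \<Rightarrow> Var i * hcomp e' f) m"
  proof (cases "lookup m i = 0")
    case True
    then show ?thesis by (simp add: lookup_hcomp lookup_Var_times split: nat.split)
  next
    case False
    then have "mdeg m = Suc (mdeg (m - single i 1))"
      using arg_cong[OF monom_minus_single[OF False], of mdeg] by simp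
    then show ?thesis using False by (simp add: lookup_hcomp lookup_Var_times split: nat.split)
  qed
qed

lemma homogeneous_vanishing_ideal: "homogeneous_ideal n (vanishing_ideal n (cline ` P))"
  unfolding homogeneous_ideal_def
proof (intro conjI ballI allI)
  show "ideal (vanishing_ideal n (cline ` P)) (poly_ring n)"
    unfolding vanishing_ideal_lines
  proof (rule ideal_poly_ringI)
    show "cvec.subspace {f \<in> polys n. \<forall>v\<in>P. \<forall>e. peval (hcomp e f) v = 0}"
    proof (rule cvec_subspaceI)
      have "hcomp e 0 = 0" for e by (rule poly_mapping_eqI) (simp add: lookup_hcomp)
      then show "0 \<in> {f \<in> polys n. \<forall>v\<in>P. \<forall>e. peval (hcomp e f) v = 0}" by (simp add: polys_0)
    qed (auto simp: polys_add polys_cscale hcomp_add hcomp_cscale peval_add peval_cscale)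
    fix i f assume "i \<le> n" "f \<in> {f \<in> polys n. \<forall>v\<in>P. \<forall>e. peval (hcomp e f) v = 0}"
    then show "Var i * f \<in> {f \<in> polys n. \<forall>v\<in>P. \<forall>e. peval (hcomp e f) v = 0}"
      by (auto simp: hcomp_Var_times peval_Var_times intro: polys_mult polys_Var split: nat.split)
  qed auto
  fix f e assume "f \<in> vanishing_ideal n (cline ` P)"
  then show "hcomp e f \<in> vanishing_ideal n (cline ` P)"
    unfolding vanishing_ideal_lines by (auto simp: hcomp_hcomp intro: forms_polys hcomp_forms)
qed

lemma vanishing_ideal_forms_iff:
  assumes "f \<in> forms n e"
  shows "f \<in> vanishing_ideal n (cline ` P) \<longleftrightarrow> (\<forall>v\<in>P. peval f v = 0)"
proof
  assume "f \<in> vanishing_ideal n (cline ` P)"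
  then show "\<forall>v\<in>P. peval f v = 0"
    unfolding vanishing_ideal_lines using hcomp_id[OF assms] by (metis (mono_tags, lifting) mem_Collect_eq)
next
  assume "\<forall>v\<in>P. peval f v = 0"
  moreover have "hcomp e' f = (if e' = e then f else 0)" for e'
    using hcomp_hcomp[of e' e f] hcomp_id[OF assms] by simp
  ultimately show "f \<in> vanishing_ideal n (cline ` P)"
    unfolding vanishing_ideal_lines using forms_polys[OF assms] by auto
qed

text \<open>Newton interpolation: the correction term vanishes at the old nodes.\<close>

lemma interpolation:
  fixes T :: "'a::field set"
  assumes "finite T" "T \<noteq> {}"
  obtains p where "degree p < card T" "\<And>t. t \<in> T \<Longrightarrow> poly p t = \<phi> t"
proof -
  have "\<exists>p. degree p < card T \<and> (\<forall>t\<in>T. poly p t = \<phi> t)"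
    using assms
  proof (induction T rule: finite_ne_induct)
    case (singleton t)
    show ?case by (rule exI[of _ "[:\<phi> t:]"]) simp
  next
    case (insert t T)
    then obtain p where p: "degree p < card T" "\<forall>t\<in>T. poly p t = \<phi> t" by blast
    define R where "R = (\<Prod>s\<in>T. [:- s, 1:])"
    have dR: "degree R = card T" unfolding R_def by (subst degree_prod_eq_sum_degree) auto
    have R0: "poly R s = 0" if "s \<in> T" for s
      using that insert.hyps by (auto simp: R_def poly_prod prod_zero_iff)
    have Rt: "poly R t \<noteq> 0" using insert.hyps by (auto simp: R_def poly_prod prod_zero_iff)
    let ?p = "p + Polynomial.smult ((\<phi> t - poly p t) / poly R t) R"
    have "degree ?p \<le> card T" using p(1) dR degree_smult_le[of "(\<phi> t - poly p t) / poly R t" R]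
      by (intro degree_add_le) auto
    then have "degree ?p < card (insert t T)" using insert.hyps by simp
    moreover have "\<forall>s\<in>insert t T. poly ?p s = \<phi> s" using p(2) R0 Rt by simp
    ultimately show ?case by blast
  qed
  with that show thesis by blast
qed

context G_form
begin

text \<open>Points of \<open>\<P>\<^sup>d\<^sup>+\<^sup>1\<close> over the roots \<open>t\<close> of a monic polynomial \<open>q\<close> of degree \<open>d + 2\<close> with distinct
  roots. Their coordinates \<open>X\<^sub>i = \<epsilon> h\<^sub>i(t)\<close> are the Horner polynomials of \<open>q\<close>, which satisfy
  \<open>h\<^sub>i = q\<^sub>i\<^sub>+\<^sub>1 + t h\<^sub>i\<^sub>+\<^sub>1\<close>; so the quadrics in \<open>I\<close> vanish on them up to terms of order \<open>\<epsilon>\<close>.\<close>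

definition pc :: "complex poly \<Rightarrow> complex \<Rightarrow> complex \<Rightarrow> nat \<Rightarrow> complex"
  where "pc q \<epsilon> t i =
    (if i < d then \<epsilon> * poly (poly_shift (Suc i) q) t / bin i else if i = d then t else 1)"

definition pt :: "complex poly \<Rightarrow> complex \<Rightarrow> complex \<Rightarrow> nat \<Rightarrow>\<^sub>0 complex"
  where "pt q \<epsilon> t = (\<Sum>i\<le>d + 1. single i (pc q \<epsilon> t i))"

lemma lookup_pt: "i \<le> d + 1 \<Longrightarrow> lookup (pt q \<epsilon> t) i = pc q \<epsilon> t i"
proof -
  assume i: "i \<le> d + 1"
  have "lookup (pt q \<epsilon> t) i = (\<Sum>j\<le>d + 1. if j = i then pc q \<epsilon> t i else 0)"
    unfolding pt_def lookup_sum lookup_single by (rule sum.cong) (auto simp: when_def)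
  then show ?thesis using i by simp
qed

lemma mval_ymon: "mval (ymon a b) (pt q \<epsilon> t) = t ^ a"
  unfolding ymon_def mval_add mval_single using lookup_pt[of d q \<epsilon> t] lookup_pt[of "d + 1" q \<epsilon> t]
  by (simp add: pc_def)

lemma mval_xmon: "i < d \<Longrightarrow> mval (xmon i a b) (pt q \<epsilon> t) = pc q \<epsilon> t i * t ^ a"
  unfolding xmon_def mval_add mval_single mval_ymon using lookup_pt[of i q \<epsilon> t] by simp

lemma peval_XM: "i < d \<Longrightarrow> peval (XM i a b) (pt q \<epsilon> t) = \<epsilon> * poly (poly_shift (Suc i) q) t * t ^ a"
  by (simp add: XM_def mval_xmon pc_def)

lemma poly_shift_rec: "poly (poly_shift i q) t = coeff q i + t * poly (poly_shift (Suc i) q) t"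
proof -
  have "poly_shift i q = pCons (coeff q i) (poly_shift (Suc i) q)"
    by (rule poly_eqI) (auto simp: coeff_poly_shift coeff_pCons split: nat.split)
  then show ?thesis by simp
qed

section \<open>Ideals of the points over the roots of a squarefree form\<close>

context
  fixes q :: "complex poly" and T :: "complex set"
  assumes T: "finite T" "card T = d + 2" and q: "q = (\<Prod>t\<in>T. [:- t, 1:])"
begin

lemma degree_q: "degree q = d + 2"
  unfolding q using T by (subst degree_prod_eq_sum_degree) auto

lemma lead_q: "coeff q (d + 2) = 1"
proof -
  have "lead_coeff q = 1" unfolding q lead_coeff_prod by simp
  then show ?thesis using degree_q by simp
qed

lemma root_q: "t \<in> T \<Longrightarrow> poly q t = 0"
  unfolding q using T by (auto simp: poly_prod prod_zero_iff)

text \<open>The linear form with coefficients c at the point \<open>pt q \<epsilon> t\<close>, as a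
  polynomial in t. Its degree is at most d + 1, so its values at the d + 2 roots determine
  it.\<close>

definition lin_poly :: "complex \<Rightarrow> (nat \<Rightarrow> complex) \<Rightarrow> complex poly"
  where "lin_poly \<epsilon> c = (\<Sum>i<d. Polynomial.smult (c i * \<epsilon> / bin i) (poly_shift (Suc i) q)) + [:c (d + 1), c d:]"

lemma poly_lin_poly: "poly (lin_poly \<epsilon> c) t = (\<Sum>i\<le>d + 1. c i * pc q \<epsilon> t i)"
proof -
  have "{..d + 1} = insert (d + 1) (insert d {..<d})" by auto
  then have "(\<Sum>i\<le>d + 1. c i * pc q \<epsilon> t i) = (\<Sum>i<d. c i * pc q \<epsilon> t i) + c d * t + c (d + 1)"
    by (simp add: pc_def algebra_simps)
  moreover have "(\<Sum>i<d. c i * pc q \<epsilon> t i) = (\<Sum>i<d. c i * \<epsilon> / bin i * poly (poly_shift (Suc i) q) t)"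
    by (rule sum.cong) (auto simp: pc_def)
  ultimately show ?thesis by (simp add: lin_poly_def poly_sum algebra_simps)
qed

lemma degree_shift: "degree (poly_shift (Suc i) q) \<le> d + 1 - i"
  by (rule degree_le) (auto simp: coeff_poly_shift degree_q intro!: coeff_eq_0)

lemma degree_lin_poly: "degree (lin_poly \<epsilon> c) \<le> d + 1"
  unfolding lin_poly_def
proof (intro degree_add_le degree_sum_le)
  show "degree (Polynomial.smult (c i * \<epsilon> / bin i) (poly_shift (Suc i) q)) \<le> d + 1" for i
    using degree_shift[of i] degree_smult_le[of "c i * \<epsilon> / bin i" "poly_shift (Suc i) q"] by linarith
qed auto

text \<open>The i-th Horner polynomial is monic of degree d + 1 - i; together with t and 1 these
  have the degrees d + 1, ..., 0 once each. Hence the system is triangular, and the coefficients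
  vanish one by one from the top degree.\<close>

lemma lin_poly_inj:
  assumes \<epsilon>: "\<epsilon> \<noteq> 0" and z: "\<And>t. t \<in> T \<Longrightarrow> (\<Sum>i\<le>d + 1. c i * pc q \<epsilon> t i) = 0" and i: "i \<le> d + 1"
  shows "c i = 0"
proof -
  have "lin_poly \<epsilon> c = 0"
  proof (rule poly_eqI_degree[of T])
    show "poly (lin_poly \<epsilon> c) t = poly 0 t" if "t \<in> T" for t using z[OF that] by (simp add: poly_lin_poly)
    show "degree (lin_poly \<epsilon> c) < card T" using degree_lin_poly[of \<epsilon> c] T(2) by linarith
  qed (use T in simp)
  then have co: "coeff (lin_poly \<epsilon> c) j = 0" for j by simp
  have x: "c i = 0" if "i < d" for i
    using that
  proof (induction i rule: less_induct)
    case (less i)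
    \<comment> \<open>The coefficient of degree \<open>d + 1 - i\<close>: the terms with
      \<open>k < i\<close> vanish by induction, those with \<open>k > i\<close> have smaller
      degree.\<close>
    have "0 = (\<Sum>k<d. c k * \<epsilon> / bin k * coeff q (d + 1 - i + Suc k)) + coeff [:c (d + 1), c d:] (d + 1 - i)"
      using co[of "d + 1 - i"] unfolding lin_poly_def by (simp add: coeff_sum coeff_poly_shift)
    also have "coeff [:c (d + 1), c d:] (d + 1 - i) = 0"
    proof -
      have "d + 1 - i = Suc (Suc (d - 1 - i))" using less.prems by simp
      then show ?thesis by (simp only: coeff_pCons_Suc) simp
    qed
    also have "(\<Sum>k<d. c k * \<epsilon> / bin k * coeff q (d + 1 - i + Suc k)) =
        (\<Sum>k<d. if k = i then c i * \<epsilon> / bin i else 0)"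
    proof (rule sum.cong[OF refl])
      fix k assume k: "k \<in> {..<d}"
      consider "k < i" | "k = i" | "k > i" by linarith
      then show "c k * \<epsilon> / bin k * coeff q (d + 1 - i + Suc k) = (if k = i then c i * \<epsilon> / bin i else 0)"
      proof cases
        case 1
        then show ?thesis using less.IH less.prems by simp
      next
        case 2
        then have "d + 1 - i + Suc k = d + 2" using less.prems by simp
        then show ?thesis using 2 lead_q by simp
      next
        case 3
        then have "coeff q (d + 1 - i + Suc k) = 0" using less.prems by (intro coeff_eq_0) (simp add: degree_q)
        then show ?thesis using 3 by simp
      qed
    qed
    finally have "c i * \<epsilon> / bin i = 0" using less.prems by simp
    then show "c i = 0" using less.prems \<epsilon> by simp
  qed
  then have "lin_poly \<epsilon> c = [:c (d + 1), c d:]" unfolding lin_poly_def by simp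
  then have "c (d + 1) = 0" "c d = 0" using \<open>lin_poly \<epsilon> c = 0\<close> by (auto split: if_splits)
  moreover have "i < d \<or> i = d \<or> i = d + 1" using i by linarith
  ultimately show ?thesis using x by blast
qed

lemma lin_poly_surj:
  assumes \<epsilon>: "\<epsilon> \<noteq> 0"
  obtains c where "\<And>t. t \<in> T \<Longrightarrow> (\<Sum>i\<le>d + 1. c i * pc q \<epsilon> t i) = \<phi> t"
proof -
  have ex: "\<exists>c. lin_poly \<epsilon> c = p" if "degree p \<le> j" "j \<le> d + 1" for p j
    using that
  proof (induction j arbitrary: p)
    case 0
    then have "p = [:coeff p 0, coeff p 1:]" by (intro linear_poly_eq) simp
    then show ?case
      by (intro exI[of _ "\<lambda>i. if i < d then 0 else if i = d then coeff p 1 else coeff p 0"])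
        (simp add: lin_poly_def)
  next
    case (Suc j)
    show ?case
    proof (cases "j = 0")
      case True
      then have "p = [:coeff p 0, coeff p 1:]" using Suc.prems by (intro linear_poly_eq) simp
      then show ?thesis
        by (intro exI[of _ "\<lambda>i. if i < d then 0 else if i = d then coeff p 1 else coeff p 0"])
          (simp add: lin_poly_def)
    next
      case False
      \<comment> \<open>The shift belonging to \<open>i = d - j\<close> has degree
        \<open>j + 1\<close> and leading coefficient 1, so it removes the top term of
        \<open>p\<close>.\<close>
      define i where "i = d - j"
      have i: "i < d" "Suc j = d + 1 - i" using False Suc.prems by (auto simp: i_def)
      define a where "a = coeff p (Suc j)"
      define r where "r = p - Polynomial.smult a (poly_shift (Suc i) q)"
      have "degree r \<le> j"
      proof (rule degree_le, intro allI impI)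
        fix k assume k: "j < k"
        show "coeff r k = 0"
        proof (cases "k = Suc j")
          case True
          then have "k + Suc i = d + 2" using i by simp
          then have "coeff q (k + Suc i) = 1" using lead_q by simp
          then show ?thesis using True by (simp add: r_def a_def coeff_poly_shift)
        next
          case False
          then have "coeff p k = 0" "coeff q (k + Suc i) = 0"
            using k Suc.prems i by (auto intro!: coeff_eq_0 simp: degree_q)
          then show ?thesis by (simp add: r_def coeff_poly_shift)
        qed
      qed
      then obtain c where c: "lin_poly \<epsilon> c = r" using Suc.IH[of r] Suc.prems by auto
      define c' where "c' = c(i := c i + a * bin i / \<epsilon>)"
      have "c' k * \<epsilon> / bin k = c k * \<epsilon> / bin k + (if k = i then a else 0)" if "k < d" for k
        using that i \<epsilon> by (auto simp: c'_def field_simps)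
      then have "(\<Sum>k<d. Polynomial.smult (c' k * \<epsilon> / bin k) (poly_shift (Suc k) q)) =
          (\<Sum>k<d. Polynomial.smult (c k * \<epsilon> / bin k) (poly_shift (Suc k) q) +
            (if k = i then Polynomial.smult a (poly_shift (Suc i) q) else 0))"
        by (intro sum.cong) (auto simp: smult_add_left)
      also have "\<dots> = (\<Sum>k<d. Polynomial.smult (c k * \<epsilon> / bin k) (poly_shift (Suc k) q)) +
          Polynomial.smult a (poly_shift (Suc i) q)"
        using i by (simp add: sum.distrib)
      finally have "lin_poly \<epsilon> c' = lin_poly \<epsilon> c + Polynomial.smult a (poly_shift (Suc i) q)"
        using i unfolding lin_poly_def by (simp add: c'_def)
      then show ?thesis using c by (auto simp: r_def)
    qed
  qed
  have "T \<noteq> {}" using T by auto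
  then obtain p where p: "degree p < card T" "\<And>t. t \<in> T \<Longrightarrow> poly p t = \<phi> t"
    using interpolation[OF T(1)] by blast
  then obtain c where "lin_poly \<epsilon> c = p" using ex[of p "d + 1"] T(2) by auto
  then show thesis using p(2) that poly_lin_poly by metis
qed

definition points :: "complex \<Rightarrow> (nat \<Rightarrow>\<^sub>0 complex) set"
  where "points \<epsilon> = pt q \<epsilon> ` T"

lemma lin_basis_mval: "i \<le> d + 1 \<Longrightarrow> mval (single i 1 + single (d + 1) b) (pt q \<epsilon> t) = pc q \<epsilon> t i"
  unfolding mval_add mval_single lookup_pt[of "d + 1" q \<epsilon> t, simplified] lookup_pt by (simp add: pc_def lookup_pt[simplified])

text \<open>All points have y_1 = 1, so z y_1^(e-1) and z take the same values there, for each
  variable z. As the linear forms realize every function on the points exactly once, these d + 2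
  monomials form a basis in each positive degree.\<close>

lemma vanishing_in_Hilb:
  assumes \<epsilon>: "\<epsilon> \<noteq> 0"
  shows "vanishing_ideal (d + 1) (cline ` points \<epsilon>) \<in> Hilb (d + 1) h_G"
proof -
  let ?V = "vanishing_ideal (d + 1) (cline ` points \<epsilon>)"
  note hom = homogeneous_vanishing_ideal[of "d + 1" "points \<epsilon>"]
  note VD = ideal_poly_ringD[OF homogeneous_idealD(1)[OF hom]]
  have mem: "f \<in> ?V \<longleftrightarrow> (\<forall>t\<in>T. peval f (pt q \<epsilon> t) = 0)" if "f \<in> forms (d + 1) e" for f e
    using vanishing_ideal_forms_iff[OF that] by (simp add: points_def)
  have "hilbert_fun (d + 1) ?V e = h_G e" for e
  proof (cases "e = 0")
    case True
    have M0: "monoms (d + 1) 0 = {0}"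
      by (auto simp: monoms_def mdeg_def in_keys_iff intro!: poly_mapping_eqI)
    have "quot_basis (d + 1) ?V 0 {0}"
    proof (rule quot_basisI[OF VD(3)])
      show "\<exists>p. keys p \<subseteq> {0} \<and> f - p \<in> ?V" if "f \<in> forms (d + 1) 0" for f
        using that M0 cvec.subspace_0[OF VD(3)] by (intro exI[of _ f]) (auto simp: forms_def)
      fix p assume p: "keys p \<subseteq> {0}" "p \<in> ?V"
      then have p0: "p = single 0 (lookup p 0)" using poly_mapping_sum_single[of "{0}" p] by simp
      obtain t where "t \<in> T" using T by fastforce
      then have "peval p (pt q \<epsilon> t) = 0" using p mem[of p 0] M0 by (auto simp: forms_def)
      then have "lookup p 0 = 0" by (subst (asm) p0) (simp add: mval_def)
      then show "p = 0" using p0 by simp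
    qed (use M0 in simp)
    then show ?thesis
      using hilbert_fun_quot_basis[OF VD(3)] True M0 by (simp add: h_gen_def dim_forms)
  next
    case False
    define b where "b i = single i 1 + single (d + 1) (e - 1)" for i :: nat
    have b_inj: "i = j" if "b i = b j" for i j
    proof -
      have "single i (1::nat) = single j 1" using that unfolding b_def by simp
      then have "lookup (single i (1::nat)) i = lookup (single j 1) i" by simp
      then show ?thesis by (auto simp: lookup_single when_def split: if_splits)
    qed
    have inj: "inj_on b A" for A using b_inj by (auto intro: inj_onI)
    have b_mon: "b ` {..d + 1} \<subseteq> monoms (d + 1) e"
    proof clarify
      fix i :: nat assume "i \<le> d + 1"
      then show "b i \<in> monoms (d + 1) e"
        using False Poly_Mapping.keys_add[of "single i (1::nat)" "single (d + 1) (e - 1)"]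
        unfolding b_def monoms_def by (auto split: if_splits)
    qed
    have ev: "peval (\<Sum>i\<le>d + 1. single (b i) (c i)) (pt q \<epsilon> t) = (\<Sum>i\<le>d + 1. c i * pc q \<epsilon> t i)" for c t
      unfolding peval_sum by (intro sum.cong refl) (simp add: b_def lin_basis_mval[simplified])
    have "quot_basis (d + 1) ?V e (b ` {..d + 1})"
    proof (rule quot_basisI[OF VD(3) b_mon])
      fix f assume f: "f \<in> forms (d + 1) e"
      obtain c where c: "\<And>t. t \<in> T \<Longrightarrow> (\<Sum>i\<le>d + 1. c i * pc q \<epsilon> t i) = peval f (pt q \<epsilon> t)"
        using lin_poly_surj[OF \<epsilon>, of "\<lambda>t. peval f (pt q \<epsilon> t)"] by blast
      let ?p = "\<Sum>i\<le>d + 1. single (b i) (c i)"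
      have k: "keys ?p \<subseteq> b ` {..d + 1}" by (intro keys_subset_sum) auto
      have "peval (f - ?p) (pt q \<epsilon> t) = 0" if t: "t \<in> T" for t
        unfolding peval_diff ev c[OF t] by simp
      then have "f - ?p \<in> ?V"
        using mem[OF forms_diff[OF f forms_subset_keys[OF b_mon k]]] by blast
      with k show "\<exists>p. keys p \<subseteq> b ` {..d + 1} \<and> f - p \<in> ?V" by blast
    next
      fix p assume p: "keys p \<subseteq> b ` {..d + 1}" "p \<in> ?V"
      have "p = (\<Sum>m\<in>b ` {..d + 1}. single m (lookup p m))"
        using p(1) by (intro poly_mapping_sum_single) auto
      then have ps: "p = (\<Sum>i\<le>d + 1. single (b i) (lookup p (b i)))" by (simp add: sum.reindex[OF inj])
      have "(\<Sum>i\<le>d + 1. lookup p (b i) * pc q \<epsilon> t i) = 0" if "t \<in> T" for t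
        using mem[OF forms_subset_keys[OF b_mon p(1)]] p(2) that
        by (subst ev[symmetric], subst ps[symmetric]) simp
      then have "lookup p (b i) = 0" if "i \<le> d + 1" for i
        using lin_poly_inj[OF \<epsilon>, of "\<lambda>i. lookup p (b i)"] that by blast
      then show "p = 0" by (subst ps) simp
    qed
    moreover have "card (b ` {..d + 1}) = d + 2" by (simp add: card_image[OF inj])
    ultimately show ?thesis
      using hilbert_fun_quot_basis[OF VD(3)] card_mono[OF finite_monoms b_mon]
      by (simp add: h_gen_def dim_forms)
  qed
  then show ?thesis using hom unfolding Hilb_def by blast
qed

lemma points_in_proj:
  "cline ` points \<epsilon> \<subseteq> proj_points (coord_space (d + 1))" "finite (cline ` points \<epsilon>)"
  "card (cline ` points \<epsilon>) = d + 2"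
proof -
  have "pt q \<epsilon> t \<in> coord_space (d + 1)" for t
    unfolding coord_space_def pt_def mem_Collect_eq by (intro keys_subset_sum) auto
  moreover have nz: "lookup (pt q \<epsilon> t) (d + 1) = 1" for t using lookup_pt[of "d + 1" q \<epsilon> t] by (simp add: pc_def)
  then have "pt q \<epsilon> t \<noteq> 0" for t by (metis lookup_zero zero_neq_one)
  ultimately show "cline ` points \<epsilon> \<subseteq> proj_points (coord_space (d + 1))"
    unfolding points_def proj_points_def by blast
  show "finite (cline ` points \<epsilon>)" unfolding points_def using T by simp
  have "inj_on (\<lambda>t. cline (pt q \<epsilon> t)) T"
  proof (rule inj_onI)
    fix s t assume "cline (pt q \<epsilon> s) = cline (pt q \<epsilon> t)"
    then obtain c where c: "pt q \<epsilon> t = cscale c (pt q \<epsilon> s)" by (rule cline_eqE)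
    \<comment> \<open>The last coordinate of every point is 1, and the coordinate \<open>d\<close>
      is the root.\<close>
    have "c = 1" using nz[of t] nz[of s] unfolding c by simp
    then have "lookup (pt q \<epsilon> t) d = lookup (pt q \<epsilon> s) d" using c by simp
    then show "s = t" using lookup_pt[of d q \<epsilon>] by (simp add: pc_def)
  qed
  then show "card (cline ` points \<epsilon>) = d + 2"
    unfolding points_def image_image using T(2) by (simp add: card_image)
qed

text \<open>To exhibit \<open>A\<close> as a limit, it is enough to correct it by terms of order
  \<epsilon> and \<epsilon>^2 so that it vanishes at the points.\<close>

lemma lim_set_quadratic:
  assumes "A \<in> forms (d + 1) e" "B \<in> forms (d + 1) e" "C \<in> forms (d + 1) e"
    and s: "s \<longlonglongrightarrow> 0"
    and z: "\<And>k t. t \<in> T \<Longrightarrow> peval A (pt q (s k) t) + s k * peval B (pt q (s k) t) +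
      s k ^ 2 * peval C (pt q (s k) t) = 0"
  shows "A \<in> lim_set (d + 1) (\<lambda>k. vanishing_ideal (d + 1) (cline ` points (s k)))"
proof (rule lim_setI)
  let ?f = "\<lambda>k. A + cscale (s k) B + cscale (s k ^ 2) C"
  show "A \<in> polys (d + 1)" using assms(1) by (rule forms_polys)
  have "?f k \<in> forms (d + 1) e" for k
    by (intro cvec.subspace_add[OF subspace_forms] cvec.subspace_scale[OF subspace_forms] assms)
  then show "?f k \<in> vanishing_ideal (d + 1) (cline ` points (s k))" for k
    using z by (subst vanishing_ideal_forms_iff) (auto simp: points_def peval_add peval_cscale)
  have "(\<lambda>k. lookup A m + s k * lookup B m + s k ^ 2 * lookup C m) \<longlonglongrightarrow> lookup A m + 0 * lookup B m + 0 ^ 2 * lookup C m" for m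
    by (intro tendsto_add tendsto_mult tendsto_power tendsto_const s)
  then show "(\<lambda>k. lookup (?f k) m) \<longlonglongrightarrow> lookup A m" for m by (simp add: lookup_add)
qed

lemma JJ_in_lim_set:
  assumes s: "s \<longlonglongrightarrow> 0"
  shows "JJ q \<subseteq> lim_set (d + 1) (\<lambda>k. vanishing_ideal (d + 1) (cline ` points (s k)))"
proof (rule JJ_subset_ideal)
  let ?L = "lim_set (d + 1) (\<lambda>k. vanishing_ideal (d + 1) (cline ` points (s k)))"
  show "ideal ?L (poly_ring (d + 1))"
    by (rule ideal_lim_set) (rule homogeneous_idealD(1)[OF homogeneous_vanishing_ideal])
  show "degree q \<le> d + 2" by (simp add: degree_q)
  have zf: "0 \<in> forms (d + 1) e" for e by (rule cvec.subspace_0[OF subspace_forms])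
  have yf: "single (ymon a b) 1 \<in> forms (d + 1) 2" if "a + b = 2" for a b
    using that by (intro single_in_forms ymon_in_monoms)
  have xf: "XM i a b \<in> forms (d + 1) 2" if "i < d" "a + b = 1" for i a b
    unfolding XM_def using that by (intro single_in_forms xmon_in_monoms) auto
  have sc: "cscale c f \<in> forms (d + 1) e" if "f \<in> forms (d + 1) e" for c f e
    using that by (rule cvec.subspace_scale[OF subspace_forms])
  have sm: "(\<Sum>i\<in>I. f i) \<in> forms (d + 1) e" if "\<And>i. i \<in> I \<Longrightarrow> f i \<in> forms (d + 1) e" for f e and I :: "nat set"
    using that by (intro cvec.subspace_sum[OF subspace_forms])
  have ad: "f + g \<in> forms (d + 1) e" if "f \<in> forms (d + 1) e" "g \<in> forms (d + 1) e" for f g e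
    using that by (rule cvec.subspace_add[OF subspace_forms])
  show "yform (d + 2) q \<in> ?L"
  proof (rule lim_set_quadratic[OF yform_in_forms zf zf s])
    fix k t assume "t \<in> T"
    have "peval (yform (d + 2) q) (pt q (s k) t) = (\<Sum>a\<le>d + 2. coeff q a * t ^ a)"
      unfolding yform_def peval_sum by (simp add: mval_ymon)
    also have "\<dots> = 0" using root_q[OF \<open>t \<in> T\<close>] unfolding poly_altdef degree_q .
    finally show "peval (yform (d + 2) q) (pt q (s k) t) + s k * peval 0 (pt q (s k) t) +
      s k ^ 2 * peval 0 (pt q (s k) t) = 0" by simp
  qed
  show "contains_gens ?L"
    unfolding contains_gens_def
  proof (intro conjI allI impI)
    \<comment> \<open>The Horner recursion gives X_(i+1) y_0 - X_i y_1 = - \<epsilon> q_(i+1) on the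
      points, where y_1 = 1.\<close>
    show "XM (Suc i) 1 0 - XM i 0 1 \<in> ?L" if i: "Suc i < d" for i
    proof (rule lim_set_quadratic[OF _ _ zf s])
      show "XM (Suc i) 1 0 - XM i 0 1 \<in> forms (d + 1) 2" using i by (intro forms_diff xf) auto
      show "cscale (coeff q (Suc i)) (single (ymon 0 2) 1) \<in> forms (d + 1) 2" by (intro sc yf) simp
      show "peval (XM (Suc i) 1 0 - XM i 0 1) (pt q (s k) t) +
        s k * peval (cscale (coeff q (Suc i)) (single (ymon 0 2) 1)) (pt q (s k) t) +
        s k ^ 2 * peval 0 (pt q (s k) t) = 0" for k t
        using i poly_shift_rec[of "Suc i" q t]
        by (simp add: peval_diff peval_XM peval_cscale mval_ymon algebra_simps)
    qed
    \<comment> \<open>The same recursion at the end, where the Horner polynomial of index -1 is q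
      itself and vanishes at the roots.\<close>
    show "XM 0 1 0 \<in> ?L"
    proof (rule lim_set_quadratic[OF _ _ zf s])
      show "XM 0 1 0 \<in> forms (d + 1) 2" using d_ge_3 by (intro xf) auto
      show "cscale (coeff q 0) (single (ymon 0 2) 1) \<in> forms (d + 1) 2" by (intro sc yf) simp
      fix k t assume t: "t \<in> T"
      have "coeff q 0 + t * poly (poly_shift 1 q) t = 0"
        using poly_shift_rec[of 0 q t] root_q[OF t] by simp
      then have "s k * (coeff q 0 + t * poly (poly_shift 1 q) t) = 0" by simp
      then show "peval (XM 0 1 0) (pt q (s k) t) +
        s k * peval (cscale (coeff q 0) (single (ymon 0 2) 1)) (pt q (s k) t) +
        s k ^ 2 * peval 0 (pt q (s k) t) = 0"
        using d_ge_3 by (simp add: peval_XM peval_cscale mval_ymon algebra_simps)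
    qed
    \<comment> \<open>The last Horner polynomial is the quadric t^2 + q_(d+1) t + q_d, homogenized
      by y_1.\<close>
    show "XM (d - 1) 0 1 \<in> ?L"
    proof (rule lim_set_quadratic[OF _ _ zf s])
      let ?B = "cscale (- 1) (single (ymon 2 0) 1) + cscale (- coeff q (d + 1)) (single (ymon 1 1) 1) +
        cscale (- coeff q d) (single (ymon 0 2) 1)"
      show "XM (d - 1) 0 1 \<in> forms (d + 1) 2" using d_ge_3 by (intro xf) auto
      show "?B \<in> forms (d + 1) 2" by (intro ad sc yf) auto
      fix k t
      have "poly_shift (d + 2) q = [:1:]"
        by (rule poly_eqI) (auto simp: coeff_poly_shift coeff_pCons lead_q[simplified] degree_q intro!: coeff_eq_0 split: nat.split)
      then have "poly (poly_shift d q) t = coeff q d + t * (coeff q (d + 1) + t)"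
        using poly_shift_rec[of d q t] poly_shift_rec[of "Suc d" q t] by simp
      moreover have "peval ?B (pt q (s k) t) = - (t ^ 2) - coeff q (d + 1) * t - coeff q d"
        unfolding peval_add peval_cscale peval_single mval_ymon by simp
      ultimately show "peval (XM (d - 1) 0 1) (pt q (s k) t) + s k * peval ?B (pt q (s k) t) +
        s k ^ 2 * peval 0 (pt q (s k) t) = 0"
        using d_ge_3 by (simp only: peval_XM) (simp add: peval_XM algebra_simps power2_eq_square)
    qed
    show "Var i * Var j \<in> ?L" if ij: "i < d" "j < d" for i j
    proof -
      \<comment> \<open>The product of two x-coordinates is of order \<epsilon>^2. Its values at
        \<epsilon> = 1 are interpolated by a linear form; for general \<epsilon> the x-part of that
        form needs one more factor \<epsilon> and its binary part needs \<epsilon>^2.\<close>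
      obtain c where c: "\<And>t. t \<in> T \<Longrightarrow> (\<Sum>l\<le>d + 1. c l * pc q 1 t l) = pc q 1 t i * pc q 1 t j"
        using lin_poly_surj[of 1 "\<lambda>t. pc q 1 t i * pc q 1 t j"] by auto
      let ?B = "\<Sum>l<d. cscale (- c l / bin l) (XM l 0 1)"
      let ?C = "cscale (- c d) (single (ymon 1 1) 1) + cscale (- c (d + 1)) (single (ymon 0 2) 1)"
      show ?thesis
      proof (rule lim_set_quadratic[OF _ _ _ s])
        have "single i 1 + single j 1 \<in> monoms (d + 1) 2"
          using ij Poly_Mapping.keys_add[of "single i (1::nat)" "single j 1"] by (auto simp: monoms_def)
        then show "Var i * Var j \<in> forms (d + 1) 2" unfolding Var_Var by (rule single_in_forms)
        show "?B \<in> forms (d + 1) 2" by (intro sm sc xf) auto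
        show "?C \<in> forms (d + 1) 2" by (intro ad sc yf) auto
        fix k t assume t: "t \<in> T"
        have pc: "pc q (s k) t l = s k * pc q 1 t l" if "l < d" for l using that by (simp add: pc_def)
        have "{..d + 1} = insert (d + 1) (insert d {..<d})" by auto
        then have c': "pc q 1 t i * pc q 1 t j = (\<Sum>l<d. c l * pc q 1 t l) + c d * t + c (d + 1)"
          using c[OF t] by (simp add: pc_def algebra_simps)
        have A: "peval (Var i * Var j) (pt q (s k) t) = s k ^ 2 * (pc q 1 t i * pc q 1 t j)"
          using ij by (simp add: Var_Var mval_add lookup_pt[simplified] pc power2_eq_square)
        have "peval ?B (pt q (s k) t) = (\<Sum>l<d. - s k * (c l * pc q 1 t l))"
          unfolding peval_sum
        proof (rule sum.cong[OF refl])
          fix l assume "l \<in> {..<d}"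
          then show "peval (cscale (- c l / bin l) (XM l 0 1)) (pt q (s k) t) = - s k * (c l * pc q 1 t l)"
            unfolding peval_cscale by (simp add: peval_XM pc_def)
        qed
        then have B: "peval ?B (pt q (s k) t) = - s k * (\<Sum>l<d. c l * pc q 1 t l)"
          by (simp only: sum_distrib_left)
        have C: "peval ?C (pt q (s k) t) = - c d * t - c (d + 1)"
          unfolding peval_add peval_cscale peval_single mval_ymon by simp
        show "peval (Var i * Var j) (pt q (s k) t) + s k * peval ?B (pt q (s k) t) +
          s k ^ 2 * peval ?C (pt q (s k) t) = 0"
          unfolding A B C c' by (simp add: power2_eq_square algebra_simps)
      qed
    qed
  qed
qed

lemma JJ_in_Slip_squarefree: "JJ q \<in> Slip (d + 1) (d + 2)"
proof -
  define s where "s k = complex_of_real (inverse (real (Suc k)))" for k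
  have s0: "s k \<noteq> 0" for k unfolding s_def by (simp del: of_nat_Suc)
  have "s \<longlonglongrightarrow> 0"
    using tendsto_of_real[OF LIMSEQ_inverse_real_of_nat, where 'a = complex] by (simp add: s_def[abs_def])
  then have "ideal_limit (d + 1) h_G (JJ q) (\<lambda>k. vanishing_ideal (d + 1) (cline ` points (s k)))"
    by (intro ideal_limit.intro JJ_in_Hilb vanishing_in_Hilb s0 JJ_in_lim_set)
      (use degree_q in auto)
  then show ?thesis
    unfolding Slip_def
  proof (rule ideal_limit.in_closure)
    fix k
    show "vanishing_ideal (d + 1) (cline ` points (s k)) \<in> {J \<in> Hilb (d + 1) h_G.
        \<exists>Z. Z \<subseteq> proj_points (coord_space (d + 1)) \<and> finite Z \<and> card Z = d + 2 \<and>
          J = vanishing_ideal (d + 1) Z}"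
      using vanishing_in_Hilb[OF s0, of k] points_in_proj[of "s k"]
      by (intro CollectI conjI exI[of _ "cline ` points (s k)"]) auto
  qed
qed

end

end

section \<open>Arbitrary binary forms as limits\<close>

lemma tendsto_coeff_prod_linear:
  fixes f g :: "'i \<Rightarrow> 'a \<Rightarrow> 'b::{real_normed_field}"
  assumes "\<And>k. k \<in> K \<Longrightarrow> (f k \<longlongrightarrow> a k) F" "\<And>k. k \<in> K \<Longrightarrow> (g k \<longlongrightarrow> b k) F"
  shows "((\<lambda>x. coeff (\<Prod>k\<in>K. [:f k x, g k x:]) j) \<longlongrightarrow> coeff (\<Prod>k\<in>K. [:a k, b k:]) j) F"
  using assms
proof (induction K arbitrary: j rule: infinite_finite_induct)
  case (insert k K)
  have *: "coeff (\<Prod>k\<in>insert k K. [:u k, v k:]) j = u k * coeff (\<Prod>k\<in>K. [:u k, v k:]) j +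
      (case j of 0 \<Rightarrow> 0 | Suc j' \<Rightarrow> v k * coeff (\<Prod>k\<in>K. [:u k, v k:]) j')" for u v :: "'i \<Rightarrow> 'b"
    using insert.hyps by (simp add: coeff_pCons split: nat.splits)
  show ?case
    unfolding *[of "\<lambda>k. f k _" "\<lambda>k. g k _"] *
    using insert by (cases j) (auto intro!: tendsto_add tendsto_mult)
qed simp_all

context G_form
begin

lemma Slip_subset_Hilb: "Slip (d + 1) (d + 2) \<subseteq> Hilb (d + 1) h_G"
proof -
  have "topspace (zariski_of (Hilb_atlas (d + 1) h_G)) \<subseteq> Hilb (d + 1) h_G"
    unfolding topspace_zariski_of Hilb_atlas_def by auto
  then show ?thesis unfolding Slip_def by (rule subset_trans[OF closure_of_subset_topspace])
qed

lemma lookup_yform_sum: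
  "lookup (yform e p) m = (\<Sum>a\<le>e. if ymon a (e - a) = m then coeff p a else 0)"
  by (simp add: yform_def lookup_sum lookup_single when_def)

text \<open>The quadrics lie in every \<open>JJ q\<close>, and the form of degree d + 2 converges
  with its coefficients. The limit lies in the closure of Slip, which is closed.\<close>

lemma JJ_in_Slip_limit:
  assumes q: "q \<noteq> 0" "degree q \<le> d + 2"
    and qs: "\<And>k. JJ (qs k) \<in> Slip (d + 1) (d + 2)" "\<And>k. degree (qs k) \<le> d + 2"
    and conv: "\<And>j. (\<lambda>k. coeff (qs k) j) \<longlonglongrightarrow> coeff q j"
  shows "JJ q \<in> Slip (d + 1) (d + 2)"
proof -
  have "JJ q \<subseteq> lim_set (d + 1) (\<lambda>k. JJ (qs k))"
  proof (rule JJ_subset_ideal[OF ideal_lim_set[OF ideal_JJ] _ _ q(2)])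
    have const: "f \<in> lim_set (d + 1) (\<lambda>k. JJ (qs k))" if "\<And>q. f \<in> JJ q" for f
      by (rule lim_setI[of _ _ "\<lambda>_. f"]) (use that JJ_D(1) in auto)
    show "contains_gens (lim_set (d + 1) (\<lambda>k. JJ (qs k)))"
      unfolding contains_gens_def
      using contains_gens_JJ[unfolded contains_gens_def] by (intro conjI allI impI const) auto
    show "yform (d + 2) q \<in> lim_set (d + 1) (\<lambda>k. JJ (qs k))"
    proof (rule lim_setI[of _ _ "\<lambda>k. yform (d + 2) (qs k)"])
      show "yform (d + 2) q \<in> polys (d + 1)" by (rule forms_polys[OF yform_in_forms])
      show "yform (d + 2) (qs k) \<in> JJ (qs k)" for k by (rule yform_in_JJ[OF qs(2)])
      show "(\<lambda>k. lookup (yform (d + 2) (qs k)) m) \<longlonglongrightarrow> lookup (yform (d + 2) q) m" for m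
        unfolding lookup_yform_sum
      proof (rule tendsto_sum)
        show "(\<lambda>k. if ymon a (d + 2 - a) = m then coeff (qs k) a else 0) \<longlonglongrightarrow>
          (if ymon a (d + 2 - a) = m then coeff q a else 0)" for a
          using conv[of a] by (cases "ymon a (d + 2 - a) = m") auto
      qed
    qed
  qed
  then have "ideal_limit (d + 1) h_G (JJ q) (\<lambda>k. JJ (qs k))"
    using JJ_in_Hilb[OF q] qs(1) Slip_subset_Hilb by (intro ideal_limit.intro) auto
  then have "JJ q \<in> zariski_of (Hilb_atlas (d + 1) h_G) closure_of Slip (d + 1) (d + 2)"
    by (rule ideal_limit.in_closure) (rule qs(1))
  then show ?thesis unfolding Slip_def by simp
qed

text \<open>Moving the roots \<open>- a\<^sub>k / b\<^sub>k\<close> of \<open>q\<close>, where \<open>b\<^sub>k = 0\<close> means the root \<open>\<infinity>\<close>, along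
  \<open>(a\<^sub>k + s k, b\<^sub>k + s)\<close> makes them finite and distinct for almost all \<open>s\<close>: the condition that two
  of them collide is a quadratic equation in \<open>s\<close> with leading coefficient \<open>k - l \<noteq> 0\<close>.\<close>

lemma JJ_in_Slip:
  assumes q: "q \<noteq> 0" "degree q \<le> d + 2"
  shows "JJ q \<in> Slip (d + 1) (d + 2)"
proof -
  obtain xs where xs: "length xs = d + 2" "set xs \<subseteq> proj_space 1" "poly_line (roots_prod xs) = poly_line q"
    using roots_prod_surj[OF q] by blast
  define a where "a k = coeff (line_poly (xs ! k)) 0" for k
  define b where "b k = coeff (line_poly (xs ! k)) 1" for k
  define R where "R s = (\<Prod>k<d + 2. [:a k + s * of_nat k, b k + s:])" for s
  have R0: "R 0 = roots_prod xs"
  proof -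
    have "line_poly (xs ! k) = [:a k, b k:]" if "k < d + 2" for k
      unfolding a_def b_def using xs that by (intro linear_poly_eq line_poly(2)) auto
    then show ?thesis unfolding R_def roots_prod_nth xs(1) by (intro prod.cong) auto
  qed
  \<comment> \<open>The numerator of \<open>t k - t l\<close> below, up to sign, as a polynomial in
    \<open>s\<close>.\<close>
  define coll where "coll k l = [:a k * b l - a l * b k,
      a k + of_nat k * b l - a l - of_nat l * b k, of_nat k - of_nat l:]" for k l
  define bad where "bad = (\<Union>k<d + 2. {- b k}) \<union>
    (\<Union>k<d + 2. \<Union>l\<in>{..<d + 2} - {k}. {s. poly (coll k l) s = 0})"
  have "finite {s. poly (coll k l) s = 0}" if "k \<noteq> l" for k l
    using that by (intro poly_roots_finite) (auto simp: coll_def)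
  then have "finite bad" unfolding bad_def by auto
  have good: "JJ (R s) \<in> Slip (d + 1) (d + 2)" if s: "s \<notin> bad" for s
  proof -
    have bs: "b k + s \<noteq> 0" if "k < d + 2" for k
      using s that unfolding bad_def by (auto simp: eq_neg_iff_add_eq_0 add.commute)
    define t where "t k = - (a k + s * of_nat k) / (b k + s)" for k
    have inj: "inj_on t {..<d + 2}"
    proof (rule inj_onI, rule ccontr)
      fix k l assume kl: "k \<in> {..<d + 2}" "l \<in> {..<d + 2}" "t k = t l" "k \<noteq> l"
      have "(a k + s * of_nat k) * (b l + s) = (a l + s * of_nat l) * (b k + s)"
        using kl(3) bs[of k] bs[of l] kl(1,2)
        unfolding t_def minus_divide_left[symmetric] neg_equal_iff_equal by (simp add: frac_eq_eq)
      then have "poly (coll k l) s = 0" by (simp add: coll_def algebra_simps)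
      then show False using s kl unfolding bad_def by auto
    qed
    \<comment> \<open>Up to a nonzero scalar, \<open>R s\<close> is monic with the distinct roots
      \<open>t k\<close>.\<close>
    have "R s = (\<Prod>k<d + 2. Polynomial.smult (b k + s) [:- t k, 1:])"
      unfolding R_def using bs by (intro prod.cong) (auto simp: t_def)
    also have "\<dots> = Polynomial.smult (\<Prod>k<d + 2. b k + s) (\<Prod>t\<in>t ` {..<d + 2}. [:- t, 1:])"
      unfolding prod_smult prod.reindex[OF inj] comp_def ..
    finally have "JJ (R s) = JJ (\<Prod>t\<in>t ` {..<d + 2}. [:- t, 1:])"
      using bs by (simp add: JJ_smult)
    also have "\<dots> \<in> Slip (d + 1) (d + 2)"
    proof (rule JJ_in_Slip_squarefree)
      show "card (t ` {..<d + 2}) = d + 2" unfolding card_image[OF inj] by simp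
    qed (rule finite_imageI, simp, rule refl)
    finally show ?thesis .
  qed
  define s where "s n = complex_of_real (inverse (real (Suc n)))" for n
  have s0: "s \<longlonglongrightarrow> 0"
    using tendsto_of_real[OF LIMSEQ_inverse_real_of_nat, where 'a = complex] by (simp add: s_def[abs_def])
  \<comment> \<open>An injective sequence meets the finite set \<open>bad\<close> only finitely
    often, so a tail avoids it.\<close>
  have "inj s" by (rule injI) (simp add: s_def del: of_nat_Suc)
  then have "finite (s -` bad)" using \<open>finite bad\<close> by (intro finite_vimageI)
  from finite_nat_bounded[OF this] obtain N where "s -` bad \<subseteq> {..<N}" ..
  then have "s (n + N) \<notin> bad" for n using subsetD[of "s -` bad" "{..<N}" "n + N"] by auto
  then have Slip_n: "JJ (R (s (n + N))) \<in> Slip (d + 1) (d + 2)" for n by (rule good)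
  have s1: "(\<lambda>n. s (n + N)) \<longlonglongrightarrow> 0" using s0 by (rule LIMSEQ_ignore_initial_segment)
  have deg: "degree (R s) \<le> d + 2" for s
  proof -
    have "degree (R s) \<le> (\<Sum>k<d + 2. degree [:a k + s * of_nat k, b k + s:])"
      unfolding R_def by (rule degree_prod_sum_le[unfolded comp_def]) simp
    also have "\<dots> \<le> (\<Sum>k<d + 2. 1)" by (intro sum_mono) simp
    finally show ?thesis by simp
  qed
  have "JJ (R 0) \<in> Slip (d + 1) (d + 2)"
  proof (rule JJ_in_Slip_limit[OF _ _ Slip_n])
    show "R 0 \<noteq> 0" unfolding R0 by (rule roots_prod_nonzero[OF xs(2)])
    show "degree (R 0) \<le> d + 2" "\<And>n. degree (R (s (n + N))) \<le> d + 2" by (rule deg)+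
    show "(\<lambda>n. coeff (R (s (n + N))) j) \<longlonglongrightarrow> coeff (R 0) j" for j
      unfolding R_def
    proof (rule tendsto_coeff_prod_linear)
      show "(\<lambda>n. a k + s (n + N) * of_nat k) \<longlonglongrightarrow> a k + 0 * of_nat k"
        "(\<lambda>n. b k + s (n + N)) \<longlonglongrightarrow> b k + 0" for k
        by (intro tendsto_add tendsto_mult tendsto_const s1)+
    qed
  qed
  moreover obtain c where "c \<noteq> 0" "q = Polynomial.smult c (R 0)"
    using xs(3) unfolding R0 by (rule poly_line_eqE)
  ultimately show ?thesis by (simp add: JJ_smult)
qed

lemma border_VSP_points: "{J \<in> Slip (d + 1) (d + 2). J \<subseteq> Ann (d + 1) (form_G d)} = SS"
proof
  show "{J \<in> Slip (d + 1) (d + 2). J \<subseteq> Ann (d + 1) (form_G d)} \<subseteq> SS"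
  proof clarify
    fix J assume J: "J \<in> Slip (d + 1) (d + 2)" "J \<subseteq> Ann (d + 1) (form_G d)"
    obtain q where "q \<noteq> 0" "degree q \<le> d + 2" "J = JJ q"
      using Hilb_Ann_eq_JJ[OF subsetD[OF Slip_subset_Hilb J(1)] J(2)] by blast
    then show "J \<in> SS" unfolding SS_def by blast
  qed
  show "SS \<subseteq> {J \<in> Slip (d + 1) (d + 2). J \<subseteq> Ann (d + 1) (form_G d)}"
    unfolding SS_def using JJ_in_Slip JJ_subset_Ann by blast
qed

end

theorem theorem6p6:
  fixes d :: nat
  assumes "d \<ge> 3"
  shows "iso_space_fun (border_VSP (d + 1) (form_G d) (d + 2)) (PP (d + 2)) \<and>
    iso_space_fun (PP (d + 2)) (PP_binary_forms (d + 2)) \<and>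
    iso_space_fun (PP_binary_forms (d + 2)) (sym_P1 (d + 2))"
proof (intro conjI)
  interpret G_form d using assms by unfold_locales
  show "iso_space_fun (border_VSP (d + 1) (form_G d) (d + 2)) (PP (d + 2))"
    unfolding border_VSP_def border_VSP_points by (rule iso_SS_PP)
  show "iso_space_fun (PP (d + 2)) (PP_binary_forms (d + 2))"
    by (rule iso_PP_binary_forms)
  show "iso_space_fun (PP_binary_forms (d + 2)) (sym_P1 (d + 2))"
    by (rule iso_space_fun_trans[OF iso_binary_forms_PP iso_PP_sym_P1])
qed

end
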